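(* Let $X$ be a Banach space with finite cotype, let $r\in(0,1)$ and let $T$ be a Ritt$_E$ operator on $X$ with a bounded $H^\infty(E_r)$ functional calculus. Then $T$ admits a quadratic $H^\infty(E_s)$ functional calculus for any $s\in(r,1)$.
   Context: $X$ is a complex Banach space, $B(X)$ the algebra of bounded operators on $X$, $R(z,T)=(z-T)^{-1}$, $\mathbb D$ the open unit disc, $\mathbb T$ the unit circle, $D(0,2)$ the open disc of radius 2. $E=\{\xi_1,\dots,\xi_N\}\subset\mathbb T$ is a fixed finite set of $N\ge1$ distinct points. $T\in B(X)$ is a Ritt$_E$ operator if $\sigma(T)\subset\overline{\mathbb D}$, $\sigma(T)\cap\mathbb T\subset E$ and for every $C>1$ the set $\{\prod_{j=1}^N(1-\overline{\xi_j}z)R(z,T):1<|z|<C\}$ is bounded. For $r\in(0,1)$, $E_r$ is the interior of the convex hull of $E\cup r\mathbb D$; $r$ is $E$-large enough if every segment $[\xi_i,\xi_j]$, $i\neq j$, meets $r\mathbb D$. A Ritt$_E$ operator $T$ is of type $r$ if $r$ is $E$-large enough, $\sigma(T)\subset\overline{E_r}$, and for every $s\in(r,1)$ the set $\{R(z,T)\prod_{j=1}^N(\xi_j-z): z\in D(0,2)\setminus\overline{E_s}\}$ is bounded; it is of type $<s$ if it is of type $r$ for some $r<s$. $H_0^\infty(E_s)$ is the space of bounded holomorphic $\phi:E_s\to\mathbb C$ such that $|\phi(z)|\le C_1\prod_{j=1}^N|\xi_j-z|^{s_j}$ on $E_s$ for some $C_1,s_1,\dots,s_N>0$; $\|\cdot\|_{\infty,E_s}$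 is the sup norm on $E_s$. If $T$ is of type $r<s$ and $\phi\in H_0^\infty(E_s)$, then $\phi(T)=\frac1{2\pi i}\int_{\partial E_u}\phi(z)R(z,T)\,dz$ for any $u\in(r,s)$ (counterclockwise boundary; independent of $u$). A Ritt$_E$ operator $T$ of type $<s$ admits a bounded $H^\infty(E_s)$ functional calculus if there is $K\ge1$ with $\|\phi(T)\|\le K\|\phi\|_{\infty,E_s}$ for all $\phi\in H_0^\infty(E_s)$. It admits a quadratic $H^\infty(E_s)$ functional calculus if there is $K>0$ such that for all $n\ge1$, all $\phi_1,\dots,\phi_n\in H_0^\infty(E_s)$ and all $x\in X$, $$\Big\|\sum_{l=1}^n\varepsilon_l\otimes\phi_l(T)x\Big\|_{\mathrm{Rad}(X)}\le K\|x\|\,\Big\|\Big(\sum_{l=1}^n|\phi_l|^2\Big)^{1/2}\Big\|_{\infty,E_s}.$$ Having one of these calculi includes the requirement that $T$ be of type $<s$. Here $(\varepsilon_k)_{k\ge1}$ are independent Rademacher variables on a probability space $(\Omega,\mathbb P)$ and $\|\sum_k\varepsilon_k\otimes x_k\|_{\mathrm{Rad}(X)}=\big(\int_\Omega\|\sum_k\varepsilon_k(u)x_k\|_X^2\,d\mathbb P(u)\big)^{1/2}$. *)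

theory Defs
  imports "HOL-Probability.Probability"
begin

class complex_vector = real_vector +
  fixes scaleC :: "complex \<Rightarrow> 'a \<Rightarrow> 'a"  (infixr "*\<^sub>C" 75)
  assumes scaleC_add_right: "a *\<^sub>C (x + y) = a *\<^sub>C x + a *\<^sub>C y"
    and scaleC_add_left: "(a + b) *\<^sub>C x = a *\<^sub>C x + b *\<^sub>C x"
    and scaleC_scaleC: "a *\<^sub>C (b *\<^sub>C x) = (a * b) *\<^sub>C x"
    and scaleC_one: "1 *\<^sub>C x = x"
    and scaleC_of_real: "of_real t *\<^sub>C x = t *\<^sub>R x"

class complex_normed_vector = complex_vector + real_normed_vector +
  assumes norm_scaleC: "norm (a *\<^sub>C x) = cmod a * norm x"

class complex_banach = complex_normed_vector + banach

lemma bounded_linear_scaleC: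
  "bounded_linear (\<lambda>x :: 'a :: complex_normed_vector. a *\<^sub>C x)"
proof (rule bounded_linear_intro[where K = "cmod a"])
  fix t :: real and x :: 'a
  show "a *\<^sub>C (t *\<^sub>R x) = t *\<^sub>R (a *\<^sub>C x)"
    by (simp add: scaleC_of_real[symmetric] scaleC_scaleC mult.commute)
qed (simp_all add: scaleC_add_right norm_scaleC mult.commute)

text \<open>The real-linear bounded maps into a complex Banach space form a complex Banach space
  under pointwise operations; it contains the space of complex-linear ones as a closed subspace,
  so operator-valued integrals may be formed in it.\<close>

instantiation blinfun :: (real_normed_vector, complex_normed_vector) complex_normed_vector
begin

lift_definition scaleC_blinfun :: "complex \<Rightarrow> ('a \<Rightarrow>\<^sub>L 'b) \<Rightarrow> ('a \<Rightarrow>\<^sub>L 'b)"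
  is "\<lambda>a f x. a *\<^sub>C f x"
  by (rule bounded_linear_compose[OF bounded_linear_scaleC])

instance
proof
  fix a b :: complex and t :: real and f g :: "'a \<Rightarrow>\<^sub>L 'b"
  show "a *\<^sub>C (f + g) = a *\<^sub>C f + a *\<^sub>C g"
    by transfer (simp add: scaleC_add_right)
  show "(a + b) *\<^sub>C f = a *\<^sub>C f + b *\<^sub>C f"
    by transfer (simp add: scaleC_add_left)
  show "a *\<^sub>C (b *\<^sub>C f) = (a * b) *\<^sub>C f"
    by transfer (simp add: scaleC_scaleC)
  show "1 *\<^sub>C f = f"
    by transfer (simp add: scaleC_one)
  show "of_real t *\<^sub>C f = t *\<^sub>R f"
    by transfer (simp add: scaleC_of_real)
  have le: "norm (c *\<^sub>C h) \<le> cmod c * norm h" for c and h :: "'a \<Rightarrow>\<^sub>L 'b"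
    by (rule norm_blinfun_bound)
      (auto simp: scaleC_blinfun.rep_eq norm_scaleC mult.assoc
        intro!: mult_left_mono norm_blinfun)
  show "norm (a *\<^sub>C f) = cmod a * norm f"
  proof (cases "a = 0")
    case True
    then show ?thesis using le[of a f] by simp
  next
    case False
    have "inverse a *\<^sub>C (a *\<^sub>C f) = f"
      using False by transfer (simp add: scaleC_scaleC scaleC_one)
    with le[of "inverse a" "a *\<^sub>C f"]
    have "norm f \<le> inverse (cmod a) * norm (a *\<^sub>C f)"
      by (simp add: norm_inverse)
    then have "cmod a * norm f \<le> norm (a *\<^sub>C f)"
      using False by (simp add: field_simps)
    with le[of a f] show ?thesis by simp
  qed
qed

end

instance blinfun :: (real_normed_vector, complex_banach) complex_banach ..

definition complex_linear_op :: "('a :: complex_normed_vector \<Rightarrow>\<^sub>L 'a) \<Rightarrow> bool" where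
  "complex_linear_op T \<longleftrightarrow> (\<forall>a x. blinfun_apply T (a *\<^sub>C x) = a *\<^sub>C blinfun_apply T x)"

definition is_inverse_op :: "('a :: complex_normed_vector \<Rightarrow>\<^sub>L 'a) \<Rightarrow> ('a \<Rightarrow>\<^sub>L 'a) \<Rightarrow> bool" where
  "is_inverse_op A B \<longleftrightarrow>
     complex_linear_op B \<and> A o\<^sub>L B = id_blinfun \<and> B o\<^sub>L A = id_blinfun"

definition spectrum_op :: "('a :: complex_normed_vector \<Rightarrow>\<^sub>L 'a) \<Rightarrow> complex set" where
  "spectrum_op T = {z. \<not> (\<exists>B. is_inverse_op (z *\<^sub>C id_blinfun - T) B)}"

definition resolvent :: "complex \<Rightarrow> ('a :: complex_normed_vector \<Rightarrow>\<^sub>L 'a) \<Rightarrow> 'a \<Rightarrow>\<^sub>L 'a" where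
  "resolvent z T = (THE B. is_inverse_op (z *\<^sub>C id_blinfun - T) B)"

definition ritt_op :: "complex set \<Rightarrow> ('a :: complex_normed_vector \<Rightarrow>\<^sub>L 'a) \<Rightarrow> bool" where
  "ritt_op E T \<longleftrightarrow>
     complex_linear_op T \<and>
     spectrum_op T \<subseteq> cball 0 1 \<and>
     spectrum_op T \<inter> sphere 0 1 \<subseteq> E \<and>
     (\<forall>C>1. bounded ((\<lambda>z. (\<Prod>\<xi>\<in>E. 1 - cnj \<xi> * z) *\<^sub>C resolvent z T) `
                      {z. 1 < cmod z \<and> cmod z < C}))"

definition E_dom :: "complex set \<Rightarrow> real \<Rightarrow> complex set" where
  "E_dom E r = interior (convex hull (E \<union> ball 0 r))"

definition E_large_enough :: "complex set \<Rightarrow> real \<Rightarrow> bool" where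
  "E_large_enough E r \<longleftrightarrow>
     (\<forall>\<xi>\<in>E. \<forall>\<eta>\<in>E. \<xi> \<noteq> \<eta> \<longrightarrow> closed_segment \<xi> \<eta> \<inter> ball 0 r \<noteq> {})"

definition ritt_type :: "complex set \<Rightarrow> real \<Rightarrow> ('a :: complex_normed_vector \<Rightarrow>\<^sub>L 'a) \<Rightarrow> bool" where
  "ritt_type E r T \<longleftrightarrow>
     ritt_op E T \<and> 0 < r \<and> r < 1 \<and> E_large_enough E r \<and>
     spectrum_op T \<subseteq> closure (E_dom E r) \<and>
     (\<forall>s\<in>{r<..<1}. bounded ((\<lambda>z. (\<Prod>\<xi>\<in>E. \<xi> - z) *\<^sub>C resolvent z T) `
                      (ball 0 2 - closure (E_dom E s))))"

definition ritt_type_less :: "complex set \<Rightarrow> real \<Rightarrow> ('a :: complex_normed_vector \<Rightarrow>\<^sub>L 'a) \<Rightarrow> bool" where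
  "ritt_type_less E s T \<longleftrightarrow> (\<exists>r<s. ritt_type E r T)"

definition Hinf0 :: "complex set \<Rightarrow> real \<Rightarrow> (complex \<Rightarrow> complex) set" where
  "Hinf0 E s = {\<phi>. \<phi> holomorphic_on E_dom E s \<and> bounded (\<phi> ` E_dom E s) \<and>
     (\<exists>C>0. \<exists>p :: complex \<Rightarrow> real. (\<forall>\<xi>\<in>E. p \<xi> > 0) \<and>
        (\<forall>z\<in>E_dom E s. cmod (\<phi> z) \<le> C * (\<Prod>\<xi>\<in>E. cmod (\<xi> - z) powr p \<xi>)))}"

text \<open>For a bounded convex open set \<open>S\<close> containing 0, every ray from 0 meets the boundary
  exactly once, so the following is the counterclockwise parametrisation of the boundary by the
  polar angle. For \<open>S = E_dom E u\<close> with \<open>0 < u < 1\<close> and \<open>u\<close> being \<open>E\<close>-large enough, the boundary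
  consists of finitely many segments and circular arcs, and the path is piecewise smooth.\<close>

definition polar_boundary :: "complex set \<Rightarrow> real \<Rightarrow> complex" where
  "polar_boundary S t =
     of_real (Sup {\<rho>. 0 \<le> \<rho> \<and> of_real \<rho> * cis (2 * pi * t) \<in> S}) * cis (2 * pi * t)"

text \<open>The vector-valued analogue of the library's \<open>contour_integral\<close>. The integrand below may be
  unbounded near the points of \<open>E\<close>, which lie on the boundary; this is harmless since the
  (gauge) integral covers absolutely convergent improper integrals.\<close>

definition vector_contour_integral ::
    "(real \<Rightarrow> complex) \<Rightarrow> (complex \<Rightarrow> 'b) \<Rightarrow> 'b :: complex_banach" where
  "vector_contour_integral \<gamma> f =
     integral {0..1} (\<lambda>t. vector_derivative \<gamma> (at t within {0..1}) *\<^sub>C f (\<gamma> t))"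

definition Hinf_calc_at ::
    "complex set \<Rightarrow> real \<Rightarrow> ('a :: complex_banach \<Rightarrow>\<^sub>L 'a) \<Rightarrow> (complex \<Rightarrow> complex) \<Rightarrow> 'a \<Rightarrow>\<^sub>L 'a" where
  "Hinf_calc_at E u T \<phi> =
     (1 / (2 * of_real pi * \<i>)) *\<^sub>C
       vector_contour_integral (polar_boundary (E_dom E u)) (\<lambda>z. \<phi> z *\<^sub>C resolvent z T)"

text \<open>The operator \<open>\<phi>(T)\<close> for \<open>T\<close> of type less than \<open>s\<close> and \<open>\<phi> \<in> Hinf0 E s\<close>: by Cauchy's theorem
  the contour integral does not depend on \<open>u\<close>, so an arbitrary admissible \<open>u\<close> is chosen.\<close>

definition Hinf_calc ::
    "complex set \<Rightarrow> real \<Rightarrow> ('a :: complex_banach \<Rightarrow>\<^sub>L 'a) \<Rightarrow> (complex \<Rightarrow> complex) \<Rightarrow> 'a \<Rightarrow>\<^sub>L 'a" where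
  "Hinf_calc E s T \<phi> =
     Hinf_calc_at E (SOME u. \<exists>r. ritt_type E r T \<and> r < u \<and> u < s) T \<phi>"

definition bounded_Hinf_calculus ::
    "complex set \<Rightarrow> real \<Rightarrow> ('a :: complex_banach \<Rightarrow>\<^sub>L 'a) \<Rightarrow> bool" where
  "bounded_Hinf_calculus E s T \<longleftrightarrow>
     ritt_type_less E s T \<and>
     (\<exists>K\<ge>1. \<forall>\<phi>\<in>Hinf0 E s.
        norm (Hinf_calc E s T \<phi>) \<le> K * (SUP z\<in>E_dom E s. cmod (\<phi> z)))"

definition rademacher_seq :: "'w measure \<Rightarrow> (nat \<Rightarrow> 'w \<Rightarrow> real) \<Rightarrow> bool" where
  "rademacher_seq M \<epsilon> \<longleftrightarrow>
     prob_space M \<and> prob_space.indep_vars M (\<lambda>_. borel) \<epsilon> {1..} \<and>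
     (\<forall>k\<ge>1. measure M {w \<in> space M. \<epsilon> k w = 1} = 1 / 2 \<and>
            measure M {w \<in> space M. \<epsilon> k w = -1} = 1 / 2)"

definition Rad_norm ::
    "'w measure \<Rightarrow> (nat \<Rightarrow> 'w \<Rightarrow> real) \<Rightarrow> nat \<Rightarrow> (nat \<Rightarrow> 'a :: real_normed_vector) \<Rightarrow> real" where
  "Rad_norm M \<epsilon> n x = sqrt (LINT w|M. (norm (\<Sum>k=1..n. \<epsilon> k w *\<^sub>R x k))\<^sup>2)"

definition has_cotype ::
    "'w measure \<Rightarrow> (nat \<Rightarrow> 'w \<Rightarrow> real) \<Rightarrow> 'a :: real_normed_vector itself \<Rightarrow> real \<Rightarrow> bool" where
  "has_cotype M \<epsilon> (_ :: 'a itself) q \<longleftrightarrow>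
     (\<exists>C>0. \<forall>n\<ge>1. \<forall>x :: nat \<Rightarrow> 'a.
        (\<Sum>k=1..n. norm (x k) powr q) powr (1 / q) \<le> C * Rad_norm M \<epsilon> n x)"

definition finite_cotype ::
    "'w measure \<Rightarrow> (nat \<Rightarrow> 'w \<Rightarrow> real) \<Rightarrow> 'a :: real_normed_vector itself \<Rightarrow> bool" where
  "finite_cotype M \<epsilon> X \<longleftrightarrow> (\<exists>q\<ge>2. has_cotype M \<epsilon> X q)"

definition quadratic_Hinf_calculus ::
    "'w measure \<Rightarrow> (nat \<Rightarrow> 'w \<Rightarrow> real) \<Rightarrow> complex set \<Rightarrow> real \<Rightarrow>
       ('a :: complex_banach \<Rightarrow>\<^sub>L 'a) \<Rightarrow> bool" where
  "quadratic_Hinf_calculus M \<epsilon> E s T \<longleftrightarrow>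
     ritt_type_less E s T \<and>
     (\<exists>K>0. \<forall>n\<ge>1. \<forall>\<phi> :: nat \<Rightarrow> complex \<Rightarrow> complex. \<forall>x.
        (\<forall>l\<in>{1..n}. \<phi> l \<in> Hinf0 E s) \<longrightarrow>
        Rad_norm M \<epsilon> n (\<lambda>l. blinfun_apply (Hinf_calc E s T (\<phi> l)) x) \<le>
          K * norm x * (SUP z\<in>E_dom E s. sqrt (\<Sum>l=1..n. (cmod (\<phi> l z))\<^sup>2)))"

end

theory Submission
  imports Defs "HOL-Complex_Analysis.Complex_Analysis"
begin

text \<open>
  A function \<open>\<phi>\<close> on the larger domain \<open>E_dom E s\<close> is written as a Cauchy integral over the boundary of an
  intermediate domain \<open>E_dom E v\<close>, with the kernel \<open>1 / (\<zeta> - z)\<close> multiplied by a factor that makes it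
  \<open>O (\<bar>z - \<xi>\<bar> / (\<bar>\<zeta> - \<xi>\<bar> + \<bar>z - \<xi>\<bar>)\<^sup>2)\<close> near each \<open>\<xi> \<in> E\<close>. Riemann sums over grids that are dyadic near \<open>E\<close>
  are averages of \<open>m\<close> sums \<open>\<Sum>\<^sub>k \<phi> (\<zeta>\<^sub>k) g\<^sub>k\<close>, one for each offset of the grid, with \<open>\<Sum>\<^sub>k \<bar>g\<^sub>k z\<bar>\<close> bounded
  uniformly in \<open>z \<in> E_dom E r\<close> and in the grid. The bounded calculus therefore bounds all signed sums
  \<open>\<Sum>\<^sub>k \<plusminus> g\<^sub>k(T) x\<close> by \<open>C \<parallel>x\<parallel>\<close>, and in a space of finite cotype such a bound implies
  \<open>\<parallel>\<Sum>\<^sub>l \<epsilon>\<^sub>l \<otimes> \<Sum>\<^sub>k a\<^sub>l\<^sub>k g\<^sub>k(T) x\<parallel> \<le> C' \<parallel>x\<parallel> sup\<^sub>k (\<Sum>\<^sub>l \<bar>a\<^sub>l\<^sub>k\<bar>\<^sup>2)\<^sup>1\<^sup>/\<^sup>2\<close>. For this last step,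
  normalise the multipliers \<open>\<Sum>\<^sub>l \<epsilon>\<^sub>l a\<^sub>l\<^sub>k\<close> and truncate them at a high level. The truncated part is controlled by the
  signed sums. Since \<open>N\<close> independent signed copies of the rest still add up to admissible multipliers, cotype
  shows that the rest contributes at most half of the optimal bound. The contour integrals that define the
  calculus do not depend on the contour, because \<open>\<integral> R(z, \<mu>T) dz\<close> is constant in \<open>0 \<le> \<mu> < 1\<close>.
\<close>

section \<open>Rademacher averages in spaces of finite cotype\<close>

text \<open>The plain kernel 1 / (\<zeta> - z) would not do. On the contour |\<zeta> - z| is
  comparable to |\<zeta> - \<xi>| + |z - \<xi>|, so its sums of absolute values grow like log (1 /
  |z - \<xi>|) as z approaches \<xi> \<in> E; the additional factor removes this divergence. The
  normalised multipliers are subgaussian but not bounded uniformly in the number of functions,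
  whereas signed sums control only bounded coefficients; cotype has to close this gap. Finally,
  \<open>Hinf_calc\<close> picks its contour by \<open>SOME\<close>, separately for \<open>r\<close>
  and for \<open>s\<close>, and the radius picked for \<open>s\<close> may exceed \<open>r\<close>,
  so the two calculi have to be identified. Independence of the contour is proved first for the
  polynomial \<open>P\<close> and passes to \<open>P\<close> times simple fractions by the resolvent
  identity. The modified kernels are of this form, so the Riemann sums that give the estimate also
  carry independence over to general functions.\<close>

definition signs :: "nat \<Rightarrow> (nat \<Rightarrow> real) set" where
  "signs n = (\<Pi>\<^sub>E k\<in>{1..n}. {-1, 1})"

lemma finite_signs [simp]: "finite (signs n)"
  by (simp add: signs_def finite_PiE)

lemma card_signs: "card (signs n) = 2 ^ n"
  by (simp add: signs_def card_PiE numeral_2_eq_2)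

text \<open>Only the joint law of the first \<open>n\<close> variables enters. Up to a null set the
  events \<open>A \<sigma>\<close> partition the space into cells of measure 2^-n, so the integral
  is an average over sign vectors, and all later estimates are about finite sums.\<close>

lemma Rad_norm_signs:
  fixes x :: "nat \<Rightarrow> 'a :: real_normed_vector"
  assumes "rademacher_seq M \<epsilon>"
  shows "(Rad_norm M \<epsilon> n x)\<^sup>2 = (\<Sum>\<sigma>\<in>signs n. (norm (\<Sum>k=1..n. \<sigma> k *\<^sub>R x k))\<^sup>2) / 2 ^ n"
proof -
  from assms have "prob_space M" and ind: "prob_space.indep_vars M (\<lambda>_. borel) \<epsilon> {1..}"
    and half: "\<And>k. k \<ge> 1 \<Longrightarrow> measure M {w \<in> space M. \<epsilon> k w = 1} = 1 / 2"
      "\<And>k. k \<ge> 1 \<Longrightarrow> measure M {w \<in> space M. \<epsilon> k w = -1} = 1 / 2"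
    unfolding rademacher_seq_def by auto
  interpret prob_space M by fact
  have rv [measurable]: "\<epsilon> k \<in> borel_measurable M" if "k \<ge> 1" for k
    using ind that unfolding indep_vars_def by auto
  define A where "A \<sigma> = {w \<in> space M. \<forall>k\<in>{1..n}. \<epsilon> k w = \<sigma> k}" for \<sigma> :: "nat \<Rightarrow> real"
  define F where "F \<sigma> = (norm (\<Sum>k=1..n. \<sigma> k *\<^sub>R x k))\<^sup>2" for \<sigma> :: "nat \<Rightarrow> real"
  have mA [measurable]: "A \<sigma> \<in> sets M" for \<sigma>
  proof -
    have "A \<sigma> = space M \<inter> (\<Inter>k\<in>{1..n}. {w \<in> space M. \<epsilon> k w = \<sigma> k})" if "n \<ge> 1"
      using that by (force simp: A_def)
    moreover have "A \<sigma> = space M" if "n = 0" using that by (simp add: A_def)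
    moreover have "{w \<in> space M. \<epsilon> k w = \<sigma> k} \<in> sets M" if "k \<ge> 1" for k
      using rv[OF that] by measurable
    ultimately show ?thesis
      by (cases "n = 0") (auto intro!: sets.Int sets.finite_INT)
  qed
  have PA: "prob (A \<sigma>) = 1 / 2 ^ n" if "\<sigma> \<in> signs n" for \<sigma>
  proof (cases "n = 0")
    case True
    then show ?thesis by (simp add: A_def prob_space)
  next
    case False
    have "A \<sigma> = (\<Inter>k\<in>{1..n}. \<epsilon> k -` {\<sigma> k} \<inter> space M)"
      using False by (auto simp: A_def)
    also have "prob \<dots> = (\<Prod>k\<in>{1..n}. prob (\<epsilon> k -` {\<sigma> k} \<inter> space M))"
      using indep_varsD[OF ind, of "{1..n}" "\<lambda>k. {\<sigma> k}"] False by auto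
    also have "\<dots> = (\<Prod>k\<in>{1..n}. 1 / 2)"
    proof (rule prod.cong[OF refl])
      fix k assume k: "k \<in> {1..n}"
      then have "\<sigma> k = 1 \<or> \<sigma> k = -1" using that by (force simp: signs_def PiE_iff)
      moreover have "\<epsilon> k -` {c} \<inter> space M = {w \<in> space M. \<epsilon> k w = c}" for c by auto
      ultimately show "prob (\<epsilon> k -` {\<sigma> k} \<inter> space M) = 1 / 2"
        using half[of k] k by auto
    qed
    finally show ?thesis by (simp add: power_one_over)
  qed
  have pm: "AE w in M. \<epsilon> k w = 1 \<or> \<epsilon> k w = -1" if "k \<ge> 1" for k
  proof -
    have "{w \<in> space M. \<epsilon> k w = 1 \<or> \<epsilon> k w = -1} = {w \<in> space M. \<epsilon> k w = 1} \<union> {w \<in> space M. \<epsilon> k w = -1}"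
      by auto
    also have "prob \<dots> = 1"
      using half[OF that] that by (subst finite_measure_Union) auto
    finally show ?thesis
      using prob_Collect_eq_1[of "\<lambda>w. \<epsilon> k w = 1 \<or> \<epsilon> k w = -1"] that by simp
  qed
  have "AE w in M. \<forall>k\<in>{1..n}. \<epsilon> k w = 1 \<or> \<epsilon> k w = -1"
    by (rule AE_finite_allI) (auto intro!: pm)
  then have ae: "AE w in M. (norm (\<Sum>k=1..n. \<epsilon> k w *\<^sub>R x k))\<^sup>2 = (\<Sum>\<sigma>\<in>signs n. indicator (A \<sigma>) w * F \<sigma>)"
  proof (rule AE_mp, intro AE_I2 impI)
    fix w assume w: "w \<in> space M" and e: "\<forall>k\<in>{1..n}. \<epsilon> k w = 1 \<or> \<epsilon> k w = -1"
    define \<tau> where "\<tau> = (\<lambda>k\<in>{1..n}. \<epsilon> k w)"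
    have \<tau>: "\<tau> \<in> signs n" using e by (auto simp: \<tau>_def signs_def)
    have ind1: "indicator (A \<sigma>) w = (if \<sigma> = \<tau> then 1 else (0::real))" if "\<sigma> \<in> signs n" for \<sigma>
    proof -
      have "w \<in> A \<sigma> \<longleftrightarrow> \<sigma> = \<tau>"
        using w that \<tau> unfolding A_def signs_def
        by (auto simp: \<tau>_def fun_eq_iff PiE_def extensional_def)
      then show ?thesis by (auto simp: indicator_def)
    qed
    have "(\<Sum>\<sigma>\<in>signs n. indicator (A \<sigma>) w * F \<sigma>) = (\<Sum>\<sigma>\<in>signs n. (if \<sigma> = \<tau> then F \<sigma> else 0))"
      using ind1 by (intro sum.cong) auto
    also have "\<dots> = F \<tau>" using \<tau> by simp
    also have "\<dots> = (norm (\<Sum>k=1..n. \<epsilon> k w *\<^sub>R x k))\<^sup>2"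
      unfolding F_def \<tau>_def by (intro arg_cong[where f = "\<lambda>y. (norm y)\<^sup>2"] sum.cong) auto
    finally show "(norm (\<Sum>k=1..n. \<epsilon> k w *\<^sub>R x k))\<^sup>2 = (\<Sum>\<sigma>\<in>signs n. indicator (A \<sigma>) w * F \<sigma>)" by simp
  qed
  have intA: "integrable M (indicat_real (A \<sigma>))" for \<sigma>
    by (rule integrable_real_indicator) (auto simp: emeasure_eq_measure)
  have int: "integrable M (\<lambda>w. \<Sum>\<sigma>\<in>signs n. indicator (A \<sigma>) w * F \<sigma>)"
    by (intro Bochner_Integration.integrable_sum integrable_mult_left intA)
  have "(LINT w|M. (norm (\<Sum>k=1..n. \<epsilon> k w *\<^sub>R x k))\<^sup>2) = (LINT w|M. (\<Sum>\<sigma>\<in>signs n. indicator (A \<sigma>) w * F \<sigma>))"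
  proof (rule integral_cong_AE[OF _ _ ae])
    \<comment> \<open>In a nonseparable space sums of measurable vector-valued maps need not be
      measurable. The integrand is therefore written as a continuous real function of the sequence
      of signs.\<close>
    let ?f = "\<lambda>w k. if k \<in> {1..n} then \<epsilon> k w else 0"
    have "?f \<in> measurable M (\<Pi>\<^sub>M k\<in>UNIV. borel)"
    proof (rule measurable_PiM_single')
      show "(\<lambda>w. ?f w k) \<in> borel_measurable M" for k
        using rv[of k] by (cases "1 \<le> k \<and> k \<le> n") auto
    qed (auto simp: space_PiM)
    then have 1: "?f \<in> borel_measurable M"
      using measurable_cong_sets[OF refl sets_PiM_equal_borel] by blast
    have "continuous_on UNIV (\<lambda>\<sigma>. (norm (\<Sum>k=1..n. (\<sigma> k::real) *\<^sub>R x k))\<^sup>2)"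
      by (intro continuous_intros continuous_on_product_coordinates)
    then have "(\<lambda>\<sigma>. (norm (\<Sum>k=1..n. (\<sigma> k::real) *\<^sub>R x k))\<^sup>2) \<in> borel_measurable borel"
      by (rule borel_measurable_continuous_onI)
    from measurable_compose[OF 1 this]
    show "(\<lambda>w. (norm (\<Sum>k=1..n. \<epsilon> k w *\<^sub>R x k))\<^sup>2) \<in> borel_measurable M"
      by simp
  qed (rule borel_measurable_integrable[OF int])
  also have "\<dots> = (\<Sum>\<sigma>\<in>signs n. F \<sigma> / 2 ^ n)"
    using PA by (subst Bochner_Integration.integral_sum)
      (auto intro!: integrable_mult_left sum.cong intA)
  finally have "(LINT w|M. (norm (\<Sum>k=1..n. \<epsilon> k w *\<^sub>R x k))\<^sup>2) = (\<Sum>\<sigma>\<in>signs n. F \<sigma> / 2 ^ n)" .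
  moreover have "0 \<le> (LINT w|M. (norm (\<Sum>k=1..n. \<epsilon> k w *\<^sub>R x k))\<^sup>2)" by simp
  ultimately show ?thesis
    unfolding Rad_norm_def F_def by (simp add: sum_divide_distrib)
qed


text \<open>cosh is the even part of exp, exp factorises over the product set
  \<open>signs n\<close>, and the two halves give the same product because cosh is even.\<close>

lemma sum_signs_cosh:
  "(\<Sum>\<sigma>\<in>signs n. cosh (\<Sum>i=1..n. \<sigma> i * a i)) = (\<Prod>i=1..n. 2 * cosh (a i :: real))"
proof -
  have e: "(\<Sum>\<sigma>\<in>signs n. exp (\<Sum>i=1..n. \<sigma> i * b i)) = (\<Prod>i=1..n. 2 * cosh (b i))" for b :: "nat \<Rightarrow> real"
  proof -
    have "(\<Sum>\<sigma>\<in>signs n. exp (\<Sum>i=1..n. \<sigma> i * b i)) = (\<Sum>\<sigma>\<in>signs n. \<Prod>i=1..n. exp (\<sigma> i * b i))"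
      by (simp add: exp_sum)
    also have "\<dots> = (\<Prod>i=1..n. \<Sum>s\<in>{-1,1}. exp (s * b i))"
      unfolding signs_def by (rule prod_sum_PiE[symmetric]) auto
    also have "\<dots> = (\<Prod>i=1..n. 2 * cosh (b i))"
      by (intro prod.cong) (auto simp: cosh_def)
    finally show ?thesis .
  qed
  have "(\<Sum>\<sigma>\<in>signs n. cosh (\<Sum>i=1..n. \<sigma> i * a i)) =
      ((\<Sum>\<sigma>\<in>signs n. exp (\<Sum>i=1..n. \<sigma> i * a i)) + (\<Sum>\<sigma>\<in>signs n. exp (\<Sum>i=1..n. \<sigma> i * - a i))) / 2"
    by (simp add: cosh_def sum_negf sum.distrib add_divide_distrib flip: sum_divide_distrib)
  also have "\<dots> = (\<Prod>i=1..n. 2 * cosh (a i))"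
    unfolding e by simp
  finally show ?thesis .
qed

text \<open>A convex function on a cube is bounded by its values at the vertices. The vector
  \<open>v\<close> collects the coordinates already fixed in the induction.\<close>

lemma norm_signed_sum_le:
  fixes y :: "'k \<Rightarrow> 'a :: real_normed_vector"
  assumes "finite K"
    and "\<And>\<eta>. \<forall>k\<in>K. \<eta> k \<in> {-1, 1 :: real} \<Longrightarrow> norm (v + (\<Sum>k\<in>K. \<eta> k *\<^sub>R y k)) \<le> W"
    and "\<And>k. k \<in> K \<Longrightarrow> \<bar>a k\<bar> \<le> 1"
  shows "norm (v + (\<Sum>k\<in>K. a k *\<^sub>R y k)) \<le> W"
  using assms
proof (induction K arbitrary: v rule: finite_induct)
  case empty
  then show ?case by simp
next
  case (insert j K)
  have s: "norm ((v + s *\<^sub>R y j) + (\<Sum>k\<in>K. a k *\<^sub>R y k)) \<le> W" if s: "s \<in> {-1, 1}" for s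
  proof (rule insert.IH)
    fix \<eta> assume \<eta>: "\<forall>k\<in>K. \<eta> k \<in> {-1, 1 :: real}"
    have "norm (v + (\<Sum>k\<in>insert j K. (\<eta>(j := s)) k *\<^sub>R y k)) \<le> W"
      using \<eta> s by (intro insert.prems(1)) auto
    moreover have "(\<Sum>k\<in>K. (\<eta>(j := s)) k *\<^sub>R y k) = (\<Sum>k\<in>K. \<eta> k *\<^sub>R y k)"
      using insert.hyps by (intro sum.cong) auto
    ultimately show "norm ((v + s *\<^sub>R y j) + (\<Sum>k\<in>K. \<eta> k *\<^sub>R y k)) \<le> W"
      using insert.hyps by (simp add: add.assoc)
  qed (use insert.prems in auto)
  define l where "l = (1 + a j) / 2"
  have l: "0 \<le> l" "l \<le> 1" using insert.prems(2)[of j] by (auto simp: l_def)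
  let ?S = "\<Sum>k\<in>K. a k *\<^sub>R y k"
  have "v + (\<Sum>k\<in>insert j K. a k *\<^sub>R y k) = l *\<^sub>R ((v + 1 *\<^sub>R y j) + ?S) + (1 - l) *\<^sub>R ((v + (-1) *\<^sub>R y j) + ?S)"
    using insert.hyps by (simp add: l_def algebra_simps flip: scaleR_add_left) (simp add: field_simps flip: scaleR_add_left)
  also have "norm \<dots> \<le> l * W + (1 - l) * W"
    using s[of 1] s[of "-1"] l
    by (intro norm_triangle_le add_mono) (auto intro!: mult_left_mono)
  finally show ?case by (simp add: algebra_simps)
qed

text \<open>Hoelder's inequality with exponent q / 2, obtained from convexity of the power q / 2. It
  turns the cotype inequality into one for squares.\<close>

lemma sum_squares_le_powr:
  fixes v :: "'i \<Rightarrow> real"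
  assumes "finite S" "S \<noteq> {}" "\<And>i. i \<in> S \<Longrightarrow> v i \<ge> 0" "q \<ge> 2"
  shows "(\<Sum>i\<in>S. (v i)\<^sup>2) \<le> real (card S) powr (1 - 2 / q) * (\<Sum>i\<in>S. v i powr q) powr (2 / q)"
proof -
  define P where "P = {i\<in>S. v i > 0}"
  have P: "finite P" "P \<subseteq> S" using assms by (auto simp: P_def)
  have sq: "(\<Sum>i\<in>S. (v i)\<^sup>2) = (\<Sum>i\<in>P. (v i)\<^sup>2)"
    using assms by (intro sum.mono_neutral_right) (auto simp: P_def order_less_le)
  show ?thesis
  proof (cases "P = {}")
    case True
    then show ?thesis using sq by simp
  next
    case False
    define c where "c = real (card P)"
    have c: "c > 0" "c \<le> real (card S)"
      using False P assms by (auto simp: c_def card_gt_0_iff intro!: card_mono)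
    have q: "q / 2 \<ge> 1" using assms by simp
    have "(\<Sum>i\<in>P. (1/c) *\<^sub>R (v i)\<^sup>2) powr (q/2) \<le> (\<Sum>i\<in>P. (1/c) * ((v i)\<^sup>2) powr (q/2))"
      using P False c by (intro convex_on_sum[OF _ _ powr_convex[OF q]]) (auto simp: c_def P_def)
    also have "(\<Sum>i\<in>P. (1/c) * ((v i)\<^sup>2) powr (q/2)) = (\<Sum>i\<in>P. (1/c) * (v i powr q))"
      by (intro sum.cong) (auto simp: P_def powr_powr simp flip: powr_numeral)
    finally have "((\<Sum>i\<in>P. (v i)\<^sup>2) / c) powr (q/2) \<le> (\<Sum>i\<in>P. v i powr q) / c"
      by (simp add: sum_divide_distrib)
    then have "(((\<Sum>i\<in>P. (v i)\<^sup>2) / c) powr (q/2)) powr (2/q) \<le> ((\<Sum>i\<in>P. v i powr q) / c) powr (2/q)"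
      using assms by (intro powr_mono2) auto
    then have "(\<Sum>i\<in>P. (v i)\<^sup>2) / c \<le> ((\<Sum>i\<in>P. v i powr q) / c) powr (2/q)"
      using assms c by (simp add: powr_powr sum_nonneg)
    then have "(\<Sum>i\<in>P. (v i)\<^sup>2) \<le> c * ((\<Sum>i\<in>P. v i powr q) / c) powr (2/q)"
      using c by (simp add: field_simps)
    also have "\<dots> = c powr (1 - 2/q) * (\<Sum>i\<in>P. v i powr q) powr (2/q)"
      using c by (simp add: powr_divide sum_nonneg powr_diff)
    also have "\<dots> \<le> real (card S) powr (1 - 2 / q) * (\<Sum>i\<in>S. v i powr q) powr (2 / q)"
      using c assms P by (intro mult_mono powr_mono2 sum_mono2 sum_nonneg) auto
    finally show ?thesis using sq by simp
  qed
qed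

text \<open>The probability space is a finite set with uniform weights, and the condition on \<open>cosh\<close> is an exponential
  tail bound that is stable under sums of independent signed copies of the large values of \<open>\<xi>\<close>.\<close>

definition rand_bound :: "'k set \<Rightarrow> ('k \<Rightarrow> 'a :: real_normed_vector) \<Rightarrow> real \<Rightarrow> bool" where
  "rand_bound K y B \<longleftrightarrow> (\<forall>(\<Omega> :: nat set) \<xi>. finite \<Omega> \<longrightarrow>
     (\<forall>k\<in>K. (\<Sum>\<omega>\<in>\<Omega>. cosh (\<xi> \<omega> k :: real)) \<le> 2 * card \<Omega>) \<longrightarrow>
     (\<Sum>\<omega>\<in>\<Omega>. (norm (\<Sum>k\<in>K. \<xi> \<omega> k *\<^sub>R y k))\<^sup>2) \<le> B * card \<Omega>)"

text \<open>A definition cannot quantify over types, so \<open>rand_bound\<close> ranges over finite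
  sets of naturals; an enumeration transports it to the sets of signs and the product spaces used
  below.\<close>

lemma rand_boundD:
  fixes \<Omega> :: "'b set"
  assumes "rand_bound K y B" "finite \<Omega>"
    and "\<And>k. k \<in> K \<Longrightarrow> (\<Sum>\<omega>\<in>\<Omega>. cosh (\<xi> \<omega> k :: real)) \<le> 2 * card \<Omega>"
  shows "(\<Sum>\<omega>\<in>\<Omega>. (norm (\<Sum>k\<in>K. \<xi> \<omega> k *\<^sub>R y k))\<^sup>2) \<le> B * card \<Omega>"
proof -
  obtain h where h: "bij_betw h {0..<card \<Omega>} \<Omega>"
    using ex_bij_betw_nat_finite assms(2) by blast
  show ?thesis
    using assms(1)[unfolded rand_bound_def, rule_format, of "{0..<card \<Omega>}" "\<lambda>n. \<xi> (h n)"] assms(3)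
    by (simp add: sum.reindex_bij_betw[OF h, of "\<lambda>\<omega>. cosh (\<xi> \<omega> _)"]
        sum.reindex_bij_betw[OF h, of "\<lambda>\<omega>. (norm (\<Sum>k\<in>K. \<xi> \<omega> k *\<^sub>R y k))\<^sup>2"])
qed

lemma square_le_cosh: "x\<^sup>2 \<le> 4 * cosh (x::real)"
proof -
  have "1 + \<bar>x\<bar> + \<bar>x\<bar>\<^sup>2 / 2 \<le> exp \<bar>x\<bar>"
    by (rule exp_lower_Taylor_quadratic) simp
  moreover have "exp \<bar>x\<bar> \<le> 2 * cosh x"
    by (cases "x \<ge> 0") (auto simp: cosh_def)
  ultimately show ?thesis by auto
qed

text \<open>A crude Cauchy-Schwarz bound. The improvement step has to start from some finite value,
  and the size of that value does not survive the iteration.\<close>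

lemma rand_bound_initial:
  assumes "finite K"
  shows "\<exists>B\<ge>0. rand_bound K y B"
proof (intro exI conjI)
  let ?Y = "\<Sum>k\<in>K. (norm (y k))\<^sup>2"
  show "0 \<le> 8 * card K * ?Y" by (simp add: sum_nonneg)
  show "rand_bound K y (8 * card K * ?Y)"
    unfolding rand_bound_def
  proof (intro allI impI)
    fix \<Omega> :: "nat set" and \<xi> assume fin: "finite \<Omega>" 
      and c: "\<forall>k\<in>K. (\<Sum>\<omega>\<in>\<Omega>. cosh (\<xi> \<omega> k :: real)) \<le> 2 * card \<Omega>"
    have "(\<Sum>\<omega>\<in>\<Omega>. (norm (\<Sum>k\<in>K. \<xi> \<omega> k *\<^sub>R y k))\<^sup>2) \<le> (\<Sum>\<omega>\<in>\<Omega>. (\<Sum>k\<in>K. (\<xi> \<omega> k)\<^sup>2) * ?Y)"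
    proof (rule sum_mono)
      fix \<omega>
      have "(norm (\<Sum>k\<in>K. \<xi> \<omega> k *\<^sub>R y k))\<^sup>2 \<le> (\<Sum>k\<in>K. \<bar>\<xi> \<omega> k\<bar> * norm (y k))\<^sup>2"
        by (intro power_mono order_trans[OF norm_sum] sum_mono) auto
      also have "\<dots> \<le> (\<Sum>k\<in>K. \<bar>\<xi> \<omega> k\<bar>\<^sup>2) * ?Y"
        by (rule Cauchy_Schwarz_ineq_sum)
      finally show "(norm (\<Sum>k\<in>K. \<xi> \<omega> k *\<^sub>R y k))\<^sup>2 \<le> (\<Sum>k\<in>K. (\<xi> \<omega> k)\<^sup>2) * ?Y" by simp
    qed
    also have "\<dots> = (\<Sum>k\<in>K. \<Sum>\<omega>\<in>\<Omega>. (\<xi> \<omega> k)\<^sup>2) * ?Y"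
      by (subst sum.swap) (simp add: sum_distrib_right)
    also have "\<dots> \<le> (\<Sum>k\<in>K. 8 * real (card \<Omega>)) * ?Y"
    proof (intro mult_right_mono sum_mono)
      fix k assume "k \<in> K"
      have "(\<Sum>\<omega>\<in>\<Omega>. (\<xi> \<omega> k)\<^sup>2) \<le> 4 * (\<Sum>\<omega>\<in>\<Omega>. cosh (\<xi> \<omega> k))"
        unfolding sum_distrib_left by (intro sum_mono square_le_cosh)
      also have "\<dots> \<le> 8 * real (card \<Omega>)" using c \<open>k \<in> K\<close> by force
      finally show "(\<Sum>\<omega>\<in>\<Omega>. (\<xi> \<omega> k)\<^sup>2) \<le> 8 * real (card \<Omega>)" .
    qed (simp add: sum_nonneg)
    finally show "(\<Sum>\<omega>\<in>\<Omega>. (norm (\<Sum>k\<in>K. \<xi> \<omega> k *\<^sub>R y k))\<^sup>2) \<le> 8 * card K * ?Y * card \<Omega>"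
      by (simp add: algebra_simps)
  qed
qed


text \<open>The truncated multipliers cost R W by convexity, and the tails cost half of the old
  bound by cotype. What matters is that \<open>R\<close> is chosen before \<open>K\<close>,
  \<open>y\<close>, \<open>W\<close> and \<open>B\<close>, so that the step can be iterated.\<close>

lemma rand_bound_step:
  fixes C q :: real
  assumes rad: "rademacher_seq M \<epsilon>" and q: "q \<ge> 2" and C: "C > 0"
    and cot: "\<And>n (x :: nat \<Rightarrow> 'a :: real_normed_vector). n \<ge> 1 \<Longrightarrow>
      (\<Sum>k=1..n. norm (x k) powr q) powr (1 / q) \<le> C * Rad_norm M \<epsilon> n x"
  shows "\<exists>R>0. \<forall>(K :: 'k set) (y :: 'k \<Rightarrow> 'a) W B. finite K \<longrightarrow>
    (\<forall>\<eta>. (\<forall>k\<in>K. \<eta> k \<in> {-1, 1 :: real}) \<longrightarrow> norm (\<Sum>k\<in>K. \<eta> k *\<^sub>R y k) \<le> W) \<longrightarrow> 0 \<le> B \<longrightarrow>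
    rand_bound K y B \<longrightarrow> rand_bound K y (2 * R\<^sup>2 * W\<^sup>2 + B / 2)"
proof -
  \<comment> \<open>Averaging over \<open>N\<close> copies gains a factor N powr (- 2 / q) through
    cotype; this size of \<open>N\<close> makes the gain beat 16 C^2, see \<open>NC\<close>.\<close>
  obtain N :: nat where N: "real N \<ge> (16 * C\<^sup>2) powr (q / 2)" "N \<ge> 1"
    by (metis le_cases nat_ceiling_le_eq order_trans real_nat_ceiling_ge)
  have NC: "8 * C\<^sup>2 * real N powr (- (2 / q)) \<le> 1 / 2"
  proof -
    have "((16 * C\<^sup>2) powr (q / 2)) powr (2 / q) \<le> real N powr (2 / q)"
      using N q by (intro powr_mono2) auto
    then have "16 * C\<^sup>2 \<le> real N powr (2 / q)"
      using q C by (simp add: powr_powr)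
    then show ?thesis using N by (simp add: powr_minus field_simps)
  qed
  define R where "R = 16 * real N"
  have coshR: "cosh (R / 2) \<ge> 4 * real N"
  proof -
    have "exp (8 * real N) \<ge> 1 + 8 * real N" by (rule exp_ge_add_one_self)
    moreover have "2 * cosh (8 * real N) \<ge> exp (8 * real N)" by (simp add: cosh_def)
    ultimately have "cosh (8 * real N) \<ge> 4 * real N" by linarith
    then show ?thesis by (simp add: R_def)
  qed
  have cot2: "(\<Sum>i=1..N. (norm (V i))\<^sup>2) \<le> real N * real N powr (- (2 / q)) * C\<^sup>2 *
      ((\<Sum>\<sigma>\<in>signs N. (norm (\<Sum>k=1..N. \<sigma> k *\<^sub>R V k))\<^sup>2) / 2 ^ N)" for V :: "nat \<Rightarrow> 'a"
  proof -
    let ?S = "\<Sum>k=1..N. norm (V k) powr q"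
    have "?S powr (2 / q) = (?S powr (1 / q))\<^sup>2"
      using q by (simp add: powr_powr sum_nonneg flip: powr_numeral)
    also have "\<dots> \<le> (C * Rad_norm M \<epsilon> N V)\<^sup>2"
      using cot[OF N(2), of V] by (intro power_mono) auto
    also have "\<dots> = C\<^sup>2 * ((\<Sum>\<sigma>\<in>signs N. (norm (\<Sum>k=1..N. \<sigma> k *\<^sub>R V k))\<^sup>2) / 2 ^ N)"
      by (simp add: power_mult_distrib Rad_norm_signs[OF rad])
    finally have 1: "?S powr (2 / q) \<le> C\<^sup>2 * ((\<Sum>\<sigma>\<in>signs N. (norm (\<Sum>k=1..N. \<sigma> k *\<^sub>R V k))\<^sup>2) / 2 ^ N)" .
    have "(\<Sum>i=1..N. (norm (V i))\<^sup>2) \<le> real N powr (1 - 2 / q) * ?S powr (2 / q)"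
      using sum_squares_le_powr[of "{1..N}" "\<lambda>i. norm (V i)" q] N q by simp
    also have "\<dots> \<le> real N powr (1 - 2 / q) * (C\<^sup>2 * ((\<Sum>\<sigma>\<in>signs N. (norm (\<Sum>k=1..N. \<sigma> k *\<^sub>R V k))\<^sup>2) / 2 ^ N))"
      by (rule mult_left_mono[OF 1]) simp
    also have "real N powr (1 - 2 / q) = real N * real N powr (- (2 / q))"
      using N by (simp add: powr_diff powr_minus field_simps)
    finally show ?thesis by (simp add: mult.assoc)
  qed
  show ?thesis
  proof (intro exI[of _ R] conjI allI impI)
    show "R > 0" using N by (simp add: R_def)
    fix K :: "'k set" and y :: "'k \<Rightarrow> 'a" and W B :: real
    assume K: "finite K"
      and W: "\<forall>\<eta>. (\<forall>k\<in>K. \<eta> k \<in> {-1, 1 :: real}) \<longrightarrow> norm (\<Sum>k\<in>K. \<eta> k *\<^sub>R y k) \<le> W"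
      and B: "0 \<le> B" "rand_bound K y B"
    show "rand_bound K y (2 * R\<^sup>2 * W\<^sup>2 + B / 2)"
      unfolding rand_bound_def
    proof (intro allI impI)
      fix \<Omega> :: "nat set" and \<xi> assume fin: "finite \<Omega>"
        and \<xi>: "\<forall>k\<in>K. (\<Sum>\<omega>\<in>\<Omega>. cosh (\<xi> \<omega> k :: real)) \<le> 2 * card \<Omega>"
      define b where "b \<omega> k = (if \<bar>\<xi> \<omega> k\<bar> \<le> R then \<xi> \<omega> k else 0)" for \<omega> k
      \<comment> \<open>Halving creates the gain: cosh (x / 2)^2 \<le> cosh x, and one of the two
        factors on the left is at least 4 N on the tail.\<close>
      define c where "c \<omega> k = (if \<bar>\<xi> \<omega> k\<bar> \<le> R then 0 else \<xi> \<omega> k / 2)" for \<omega> k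
      define V where "V \<omega> = (\<Sum>k\<in>K. c \<omega> k *\<^sub>R y k)" for \<omega>
      have bW: "norm (\<Sum>k\<in>K. b \<omega> k *\<^sub>R y k) \<le> R * W" for \<omega>
      proof -
        have "norm (0 + (\<Sum>k\<in>K. (b \<omega> k / R) *\<^sub>R y k)) \<le> W"
        proof (rule norm_signed_sum_le[OF K])
          fix \<eta> assume "\<forall>k\<in>K. \<eta> k \<in> {-1, 1 :: real}"
          then have "norm (\<Sum>k\<in>K. \<eta> k *\<^sub>R y k) \<le> W" by (rule W[THEN spec, THEN mp])
          then show "norm (0 + (\<Sum>k\<in>K. \<eta> k *\<^sub>R y k)) \<le> W" by simp
        qed (use \<open>R > 0\<close> in \<open>simp add: b_def\<close>)
        also have "(\<Sum>k\<in>K. (b \<omega> k / R) *\<^sub>R y k) = (1 / R) *\<^sub>R (\<Sum>k\<in>K. b \<omega> k *\<^sub>R y k)"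
          by (simp add: scaleR_sum_right)
        finally show ?thesis using \<open>R > 0\<close> by (simp add: field_simps)
      qed
      have cc: "(\<Sum>\<omega>\<in>\<Omega>. 2 * cosh (c \<omega> k)) \<le> 2 * card \<Omega> * (1 + 1 / (2 * real N))" if "k \<in> K" for k
      proof -
        have "cosh (c \<omega> k) \<le> 1 + cosh (\<xi> \<omega> k) / (4 * real N)" for \<omega>
        proof (cases "\<bar>\<xi> \<omega> k\<bar> \<le> R")
          case False
          have "cosh (R / 2) \<le> cosh (\<xi> \<omega> k / 2)"
            using False \<open>R > 0\<close> by (metis abs_divide abs_numeral abs_of_pos cosh_real_abs cosh_real_nonneg_le_iff divide_right_mono half_gt_zero less_eq_real_def linorder_not_less zero_le_numeral abs_ge_zero)
          then have "4 * real N * cosh (\<xi> \<omega> k / 2) \<le> cosh (\<xi> \<omega> k / 2) * cosh (\<xi> \<omega> k / 2)"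
            using coshR by (intro mult_right_mono) auto
          also have "\<dots> \<le> cosh (\<xi> \<omega> k)"
            using cosh_double_cosh[of "\<xi> \<omega> k / 2"] cosh_real_ge_1[of "\<xi> \<omega> k"] by (simp add: power2_eq_square)
          finally show ?thesis using False N by (simp add: c_def field_simps)
        qed (auto simp: c_def)
        then have "(\<Sum>\<omega>\<in>\<Omega>. 2 * cosh (c \<omega> k)) \<le> (\<Sum>\<omega>\<in>\<Omega>. 2 * (1 + cosh (\<xi> \<omega> k) / (4 * real N)))"
          by (intro sum_mono mult_left_mono) auto
        also have "\<dots> = 2 * card \<Omega> + (\<Sum>\<omega>\<in>\<Omega>. cosh (\<xi> \<omega> k)) / (2 * real N)"
          by (simp add: sum.distrib sum_divide_distrib algebra_simps)
        also have "\<dots> \<le> 2 * card \<Omega> + 2 * card \<Omega> / (2 * real N)"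
          using \<xi> that by (intro add_left_mono divide_right_mono) auto
        finally show ?thesis by (simp add: algebra_simps)
      qed
      \<comment> \<open>A sample consists of \<open>N\<close> independent draws from
        \<open>\<Omega>\<close> together with \<open>N\<close> independent signs.\<close>
      define \<Omega>' where "\<Omega>' = (\<Pi>\<^sub>E i\<in>{1..N}. \<Omega>) \<times> signs N"
      define \<xi>' where "\<xi>' = (\<lambda>(f, \<sigma>) k. \<Sum>i=1..N. \<sigma> i * c (f i) k)"
      have fin': "finite \<Omega>'" using fin by (auto simp: \<Omega>'_def intro: finite_PiE)
      have card': "real (card \<Omega>') = (2 * real (card \<Omega>)) ^ N"
        using fin by (simp add: \<Omega>'_def card_cartesian_product card_signs card_PiE power_mult_distrib)
      have "(\<Sum>\<omega>\<in>\<Omega>'. (norm (\<Sum>k\<in>K. \<xi>' \<omega> k *\<^sub>R y k))\<^sup>2) \<le> B * card \<Omega>'"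
      proof (rule rand_boundD[OF B(2) fin'])
        fix k assume k: "k \<in> K"
        have "(\<Sum>\<omega>\<in>\<Omega>'. cosh (\<xi>' \<omega> k)) = (\<Sum>f\<in>(\<Pi>\<^sub>E i\<in>{1..N}. \<Omega>). \<Sum>\<sigma>\<in>signs N. cosh (\<Sum>i=1..N. \<sigma> i * c (f i) k))"
          unfolding \<Omega>'_def \<xi>'_def by (simp add: sum.cartesian_product case_prod_unfold)
        also have "\<dots> = (\<Sum>f\<in>(\<Pi>\<^sub>E i\<in>{1..N}. \<Omega>). \<Prod>i=1..N. 2 * cosh (c (f i) k))"
          by (simp only: sum_signs_cosh)
        also have "\<dots> = (\<Prod>i=1..N. \<Sum>\<omega>\<in>\<Omega>. 2 * cosh (c \<omega> k))"
          using fin by (subst prod_sum_PiE) auto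
        also have "\<dots> = (\<Sum>\<omega>\<in>\<Omega>. 2 * cosh (c \<omega> k)) ^ N" by simp
        also have "\<dots> \<le> (2 * card \<Omega> * (1 + 1 / (2 * real N))) ^ N"
          using cc[OF k] by (intro power_mono sum_nonneg) auto
        also have "\<dots> = (1 + 1 / (2 * real N)) ^ N * card \<Omega>'"
          by (simp add: card' power_mult_distrib)
        \<comment> \<open>The excess 1 / (2 N) of a single copy accumulates over \<open>N\<close>
          copies to the factor exp (1 / 2) \<le> 2, so the signed sum of copies is again
          admissible.\<close>
        also have "\<dots> \<le> 2 * real (card \<Omega>')"
        proof (rule mult_right_mono)
          have "(1 + 1 / (2 * real N)) ^ N \<le> exp (1 / (2 * real N)) ^ N"
            by (intro power_mono exp_ge_add_one_self) auto
          also have "\<dots> = exp (1 / 2)" using N by (simp flip: exp_of_nat_mult)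
          also have "\<dots> \<le> 2"
            using exp_bound[of "1/2::real"] by (simp add: power2_eq_square)
          finally show "(1 + 1 / (2 * real N)) ^ N \<le> 2" .
        qed simp
        finally show "(\<Sum>\<omega>\<in>\<Omega>'. cosh (\<xi>' \<omega> k)) \<le> 2 * card \<Omega>'" by simp
      qed
      also have "(\<Sum>\<omega>\<in>\<Omega>'. (norm (\<Sum>k\<in>K. \<xi>' \<omega> k *\<^sub>R y k))\<^sup>2) =
          (\<Sum>f\<in>(\<Pi>\<^sub>E i\<in>{1..N}. \<Omega>). \<Sum>\<sigma>\<in>signs N. (norm (\<Sum>i=1..N. \<sigma> i *\<^sub>R V (f i)))\<^sup>2)"
      proof -
        have "(\<Sum>k\<in>K. \<xi>' (f, \<sigma>) k *\<^sub>R y k) = (\<Sum>i=1..N. \<sigma> i *\<^sub>R V (f i))" for f \<sigma>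
          unfolding \<xi>'_def V_def by (simp add: scaleR_sum_left scaleR_sum_right sum.swap[of _ K])
        then show ?thesis
          unfolding \<Omega>'_def sum.cartesian_product by (intro sum.cong) auto
      qed
      finally have main: "(\<Sum>f\<in>(\<Pi>\<^sub>E i\<in>{1..N}. \<Omega>). \<Sum>\<sigma>\<in>signs N. (norm (\<Sum>i=1..N. \<sigma> i *\<^sub>R V (f i)))\<^sup>2)
          \<le> B * (2 * real (card \<Omega>)) ^ N" by (simp add: card')
      have swap: "(\<Sum>f\<in>(\<Pi>\<^sub>E i\<in>{1..N}. \<Omega>). \<Sum>i=1..N. (norm (V (f i)))\<^sup>2) =
          real N * (card \<Omega> ^ (N - 1) * (\<Sum>\<omega>\<in>\<Omega>. (norm (V \<omega>))\<^sup>2))"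
      proof -
        have "(\<Sum>f\<in>(\<Pi>\<^sub>E i\<in>{1..N}. \<Omega>). (norm (V (f i)))\<^sup>2) = card \<Omega> ^ (N - 1) * (\<Sum>\<omega>\<in>\<Omega>. (norm (V \<omega>))\<^sup>2)"
          if i: "i \<in> {1..N}" for i
        proof -
          have "(\<Sum>f\<in>(\<Pi>\<^sub>E i\<in>{1..N}. \<Omega>). (norm (V (f i)))\<^sup>2)
            = (\<Sum>f\<in>(\<Pi>\<^sub>E i\<in>{1..N}. \<Omega>). \<Prod>j=1..N. if j = i then (norm (V (f j)))\<^sup>2 else 1)"
            using i by (intro sum.cong) auto
          also have "\<dots> = (\<Prod>j=1..N. \<Sum>\<omega>\<in>\<Omega>. if j = i then (norm (V \<omega>))\<^sup>2 else 1)"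
            using fin by (subst prod_sum_PiE) auto
          also have "\<dots> = (\<Prod>j=1..N. if j = i then (\<Sum>\<omega>\<in>\<Omega>. (norm (V \<omega>))\<^sup>2) else card \<Omega>)"
            by (intro prod.cong) auto
          also have "\<dots> = (\<Sum>\<omega>\<in>\<Omega>. (norm (V \<omega>))\<^sup>2) * (\<Prod>j\<in>{1..N}-{i}. card \<Omega>)"
            using i by (subst prod.remove[of _ i]) auto
          finally show ?thesis using i by (simp add: mult.commute)
        qed
        then have "(\<Sum>i=1..N. \<Sum>f\<in>(\<Pi>\<^sub>E i\<in>{1..N}. \<Omega>). (norm (V (f i)))\<^sup>2) = 
           (\<Sum>i=1..N. card \<Omega> ^ (N - 1) * (\<Sum>\<omega>\<in>\<Omega>. (norm (V \<omega>))\<^sup>2))"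
          by (intro sum.cong) auto
        then show ?thesis by (subst sum.swap) simp
      qed
      \<comment> \<open>The factor 8 is 2 * 2^2: one 2 from squaring a sum of two terms, and 2^2
        from undoing the halving in \<open>c\<close>.\<close>
      have VB: "8 * (\<Sum>\<omega>\<in>\<Omega>. (norm (V \<omega>))\<^sup>2) \<le> B / 2 * card \<Omega>"
      proof (cases "card \<Omega> = 0")
        case True
        then show ?thesis using fin by simp
      next
        case False
        let ?a = "real N powr (- (2 / q)) * C\<^sup>2"
        have "real N * (card \<Omega> ^ (N - 1) * (\<Sum>\<omega>\<in>\<Omega>. (norm (V \<omega>))\<^sup>2)) \<le>
          (\<Sum>f\<in>(\<Pi>\<^sub>E i\<in>{1..N}. \<Omega>). real N * real N powr (- (2 / q)) * C\<^sup>2 *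
            ((\<Sum>\<sigma>\<in>signs N. (norm (\<Sum>k=1..N. \<sigma> k *\<^sub>R V (f k)))\<^sup>2) / 2 ^ N))"
          unfolding swap[symmetric] by (intro sum_mono cot2)
        also have "\<dots> = real N * ?a / 2 ^ N * (\<Sum>f\<in>(\<Pi>\<^sub>E i\<in>{1..N}. \<Omega>). \<Sum>\<sigma>\<in>signs N. (norm (\<Sum>i=1..N. \<sigma> i *\<^sub>R V (f i)))\<^sup>2)"
          by (simp add: sum_distrib_left sum_divide_distrib algebra_simps)
        also have "\<dots> \<le> real N * ?a / 2 ^ N * (B * (2 * real (card \<Omega>)) ^ N)"
          by (intro mult_left_mono main) auto
        also have "\<dots> = real N * (card \<Omega> ^ (N - 1) * (?a * B * card \<Omega>))"
        proof -
          have "(2 * real (card \<Omega>)) ^ N = 2 ^ N * (real (card \<Omega>) ^ (N - 1) * card \<Omega>)"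
            using N power_minus_mult[of N "real (card \<Omega>)"] by (simp add: power_mult_distrib)
          then show ?thesis by simp
        qed
        finally have "(\<Sum>\<omega>\<in>\<Omega>. (norm (V \<omega>))\<^sup>2) \<le> ?a * B * card \<Omega>"
          using N False by simp
        then have "8 * (\<Sum>\<omega>\<in>\<Omega>. (norm (V \<omega>))\<^sup>2) \<le> (8 * C\<^sup>2 * real N powr (- (2 / q))) * (B * card \<Omega>)"
          by (simp add: algebra_simps)
        also have "\<dots> \<le> 1 / 2 * (B * card \<Omega>)"
          using B by (intro mult_right_mono NC) auto
        finally show ?thesis by simp
      qed
      have "(norm (\<Sum>k\<in>K. \<xi> \<omega> k *\<^sub>R y k))\<^sup>2 \<le> 2 * R\<^sup>2 * W\<^sup>2 + 8 * (norm (V \<omega>))\<^sup>2" for \<omega>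
      proof -
        have "\<xi> \<omega> k *\<^sub>R y k = b \<omega> k *\<^sub>R y k + 2 *\<^sub>R (c \<omega> k *\<^sub>R y k)" for k
          by (auto simp: b_def c_def)
        then have "(\<Sum>k\<in>K. \<xi> \<omega> k *\<^sub>R y k) = (\<Sum>k\<in>K. b \<omega> k *\<^sub>R y k) + 2 *\<^sub>R V \<omega>"
          unfolding V_def by (simp add: sum.distrib scaleR_sum_right)
        then have "norm (\<Sum>k\<in>K. \<xi> \<omega> k *\<^sub>R y k) \<le> R * W + 2 * norm (V \<omega>)"
          using norm_triangle_ineq[of "\<Sum>k\<in>K. b \<omega> k *\<^sub>R y k" "2 *\<^sub>R V \<omega>"] bW[of \<omega>] by simp
        then have "(norm (\<Sum>k\<in>K. \<xi> \<omega> k *\<^sub>R y k))\<^sup>2 \<le> (R * W + 2 * norm (V \<omega>))\<^sup>2"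
          by (intro power_mono) auto
        also have "\<dots> \<le> 2 * R\<^sup>2 * W\<^sup>2 + 8 * (norm (V \<omega>))\<^sup>2"
          using zero_le_power2[of "R * W - 2 * norm (V \<omega>)"] by (simp add: power2_eq_square algebra_simps)
        finally show ?thesis .
      qed
      then have "(\<Sum>\<omega>\<in>\<Omega>. (norm (\<Sum>k\<in>K. \<xi> \<omega> k *\<^sub>R y k))\<^sup>2) \<le> (\<Sum>\<omega>\<in>\<Omega>. 2 * R\<^sup>2 * W\<^sup>2 + 8 * (norm (V \<omega>))\<^sup>2)"
        by (intro sum_mono)
      also have "\<dots> = 2 * R\<^sup>2 * W\<^sup>2 * card \<Omega> + 8 * (\<Sum>\<omega>\<in>\<Omega>. (norm (V \<omega>))\<^sup>2)"
        by (simp add: sum.distrib sum_distrib_left)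
      finally show "(\<Sum>\<omega>\<in>\<Omega>. (norm (\<Sum>k\<in>K. \<xi> \<omega> k *\<^sub>R y k))\<^sup>2) \<le> (2 * R\<^sup>2 * W\<^sup>2 + B / 2) * card \<Omega>"
        using VB by (simp add: algebra_simps)
    qed
  qed
qed


text \<open>Comparison of the power series term by term, by 2^n n! \<le> (2 n)!. Multiplied over the
  coordinates it is the subgaussian estimate for Rademacher sums.\<close>

lemma cosh_le_exp_square: "cosh (x::real) \<le> exp (x\<^sup>2 / 2)"
proof -
  have s1: "(\<lambda>n. if even n then x ^ n /\<^sub>R fact n else 0) sums cosh x"
    using cosh_converges[of x] by (simp add: scaleR_conv_of_real divide_inverse mult.commute)
  have inj: "strict_mono (\<lambda>n::nat. 2 * n)" by (simp add: strict_mono_def)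
  have "(\<lambda>n. x ^ (2 * n) /\<^sub>R fact (2 * n)) sums cosh x"
  proof -
    have z: "(if even n then x ^ n /\<^sub>R fact n else 0) = 0" if "n \<notin> range ((*) 2)" for n :: nat
      using that by (auto elim!: evenE)
    show ?thesis
      using sums_mono_reindex[OF inj, of "\<lambda>n. if even n then x ^ n /\<^sub>R fact n else 0", OF z] s1 by simp
  qed
  moreover have "(\<lambda>n. (x\<^sup>2 / 2) ^ n /\<^sub>R fact n) sums exp (x\<^sup>2 / 2)"
    by (rule exp_converges)
  ultimately show ?thesis
  proof (rule sums_le[rotated])
    fix n
    have "(2::real) ^ n * fact n \<le> fact (2 * n)"
    proof (induction n)
      case (Suc n)
      have "(2::real) ^ Suc n * fact (Suc n) = 2 * real (Suc n) * (2 ^ n * fact n)" by simp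
      also have "\<dots> \<le> 2 * real (Suc n) * fact (2 * n)" using Suc by (intro mult_left_mono) auto
      also have "\<dots> \<le> real (2 * n + 2) * (real (2 * n + 1) * fact (2 * n))"
        by (intro mult_mono) auto
      finally show ?case by (simp add: algebra_simps)
    qed simp
    then have "inverse (fact (2 * n)) \<le> inverse (2 ^ n * fact n :: real)"
      by (intro le_imp_inverse_le) auto
    then have "inverse (fact (2 * n)) * (x\<^sup>2) ^ n \<le> inverse (2 ^ n * fact n) * (x\<^sup>2) ^ n"
      by (rule mult_right_mono) simp
    moreover have "x ^ (2 * n) /\<^sub>R fact (2 * n) = inverse (fact (2 * n)) * (x\<^sup>2) ^ n"
      by (simp only: power_mult real_scaleR_def)
    moreover have "(x\<^sup>2 / 2) ^ n /\<^sub>R fact n = inverse (2 ^ n * fact n) * (x\<^sup>2) ^ n"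
    proof -
      have "(x\<^sup>2 / 2) ^ n = (x\<^sup>2) ^ n * inverse (2 ^ n)"
        by (simp only: power_divide) (simp only: divide_inverse)
      then show ?thesis by (simp only: real_scaleR_def inverse_mult_distrib mult_ac)
    qed
    ultimately show "x ^ (2 * n) /\<^sub>R fact (2 * n) \<le> (x\<^sup>2 / 2) ^ n /\<^sub>R fact n"
      by (simp only:)
  qed
qed

text \<open>4 R^2 W^2 is the fixed point of B \<mapsto> 2 R^2 W^2 + B / 2. Iterating from an
  arbitrary finite bound approaches it, and the dependence on the starting value disappears in the
  limit.\<close>

lemma rand_bound_exists:
  assumes rad: "rademacher_seq M \<epsilon>" and cot: "finite_cotype M \<epsilon> TYPE('a :: real_normed_vector)"
  shows "\<exists>R>0. \<forall>(K :: 'k set) (y :: 'k \<Rightarrow> 'a) W. finite K \<longrightarrow>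
    (\<forall>\<eta>. (\<forall>k\<in>K. \<eta> k \<in> {-1, 1 :: real}) \<longrightarrow> norm (\<Sum>k\<in>K. \<eta> k *\<^sub>R y k) \<le> W) \<longrightarrow>
    rand_bound K y (R * W\<^sup>2)"
proof -
  obtain q C where "q \<ge> 2" "C > 0" and "\<And>n (x :: nat \<Rightarrow> 'a). n \<ge> 1 \<Longrightarrow>
      (\<Sum>k=1..n. norm (x k) powr q) powr (1 / q) \<le> C * Rad_norm M \<epsilon> n x"
    using cot unfolding finite_cotype_def has_cotype_def by blast
  from rand_bound_step[OF rad this, where 'k = 'k]
  obtain R where R: "R > 0" and step: "\<And>(K :: 'k set) (y :: 'k \<Rightarrow> 'a) W B. finite K \<Longrightarrow>
    (\<forall>\<eta>. (\<forall>k\<in>K. \<eta> k \<in> {-1, 1 :: real}) \<longrightarrow> norm (\<Sum>k\<in>K. \<eta> k *\<^sub>R y k) \<le> W) \<Longrightarrow> 0 \<le> B \<Longrightarrow>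
    rand_bound K y B \<Longrightarrow> rand_bound K y (2 * R\<^sup>2 * W\<^sup>2 + B / 2)"
    by blast
  show ?thesis
  proof (intro exI[of _ "4 * R\<^sup>2"] conjI allI impI)
    fix K :: "'k set" and y :: "'k \<Rightarrow> 'a" and W :: real
    assume K: "finite K"
      and W: "\<forall>\<eta>. (\<forall>k\<in>K. \<eta> k \<in> {-1, 1 :: real}) \<longrightarrow> norm (\<Sum>k\<in>K. \<eta> k *\<^sub>R y k) \<le> W"
    obtain B where B: "B \<ge> 0" "rand_bound K y B" using rand_bound_initial[OF K] by blast
    have bd: "rand_bound K y (4 * R\<^sup>2 * W\<^sup>2 + B / 2 ^ n)" for n
    proof (induction n)
      case 0
      have "rand_bound K y B'" if "B \<le> B'" for B'
        unfolding rand_bound_def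
      proof (intro allI impI)
        fix \<Omega> :: "nat set" and \<xi> assume *: "finite \<Omega>" "\<forall>k\<in>K. (\<Sum>\<omega>\<in>\<Omega>. cosh (\<xi> \<omega> k :: real)) \<le> 2 * card \<Omega>"
        then have "(\<Sum>\<omega>\<in>\<Omega>. (norm (\<Sum>k\<in>K. \<xi> \<omega> k *\<^sub>R y k))\<^sup>2) \<le> B * card \<Omega>"
          using B(2) unfolding rand_bound_def by blast
        also have "\<dots> \<le> B' * card \<Omega>" using that by (intro mult_right_mono) auto
        finally show "(\<Sum>\<omega>\<in>\<Omega>. (norm (\<Sum>k\<in>K. \<xi> \<omega> k *\<^sub>R y k))\<^sup>2) \<le> B' * card \<Omega>" .
      qed
      then show ?case by simp
    next
      case (Suc n)
      have "rand_bound K y (2 * R\<^sup>2 * W\<^sup>2 + (4 * R\<^sup>2 * W\<^sup>2 + B / 2 ^ n) / 2)"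
        using Suc B by (intro step[OF K W]) auto
      then show ?case by (simp add: field_simps)
    qed
    show "rand_bound K y (4 * R\<^sup>2 * W\<^sup>2)"
      unfolding rand_bound_def
    proof (intro allI impI)
      fix \<Omega> :: "nat set" and \<xi> assume *: "finite \<Omega>" "\<forall>k\<in>K. (\<Sum>\<omega>\<in>\<Omega>. cosh (\<xi> \<omega> k :: real)) \<le> 2 * card \<Omega>"
      have "(\<lambda>n. (4 * R\<^sup>2 * W\<^sup>2 + B / 2 ^ n) * card \<Omega>) \<longlonglongrightarrow> (4 * R\<^sup>2 * W\<^sup>2 + 0) * card \<Omega>"
        by (intro tendsto_intros LIMSEQ_divide_realpow_zero) auto
      then show "(\<Sum>\<omega>\<in>\<Omega>. (norm (\<Sum>k\<in>K. \<xi> \<omega> k *\<^sub>R y k))\<^sup>2) \<le> 4 * R\<^sup>2 * W\<^sup>2 * card \<Omega>"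
        using bd * unfolding rand_bound_def by (intro LIMSEQ_le_const) auto
    qed
  qed (use R in auto)
qed

text \<open>The sign vectors themselves serve as the probability space. The multiplier of
  \<open>y k\<close> is the signed sum of the coefficients a l k over l, and after division by
  \<open>B\<close> its average of cosh is at most exp (1 / 2). Complex coefficients are split into
  real and imaginary parts.\<close>

lemma Rad_multiplier_bound:
  assumes rad: "rademacher_seq M \<epsilon>" and cot: "finite_cotype M \<epsilon> TYPE('a :: complex_normed_vector)"
  shows "\<exists>C>0. \<forall>(K :: 'k set) (y :: 'k \<Rightarrow> 'a) W B \<alpha> n. finite K \<longrightarrow> 0 \<le> B \<longrightarrow>
    (\<forall>\<eta>. (\<forall>k\<in>K. \<eta> k \<in> {-1, 1 :: real}) \<longrightarrow> norm (\<Sum>k\<in>K. \<eta> k *\<^sub>R y k) \<le> W) \<longrightarrow>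
    (\<forall>k\<in>K. (\<Sum>l=1..n. (cmod (\<alpha> l k))\<^sup>2) \<le> B\<^sup>2) \<longrightarrow>
    Rad_norm M \<epsilon> n (\<lambda>l. \<Sum>k\<in>K. \<alpha> l k *\<^sub>C y k) \<le> C * B * W"
proof -
  from rand_bound_exists[OF rad cot, where 'k = 'k]
  obtain R where Rb: "R > 0 \<and> (\<forall>(K :: 'k set) (y :: 'k \<Rightarrow> 'a) W. finite K \<longrightarrow>
    (\<forall>\<eta>. (\<forall>k\<in>K. \<eta> k \<in> {-1, 1 :: real}) \<longrightarrow> norm (\<Sum>k\<in>K. \<eta> k *\<^sub>R y k) \<le> W) \<longrightarrow>
    rand_bound K y (R * W\<^sup>2))" ..
  then have R: "R > 0" ..
  show ?thesis
  proof (intro exI[of _ "sqrt (4 * R)"] conjI allI impI)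
    show "sqrt (4 * R) > 0" using R by simp
    fix K :: "'k set" and y :: "'k \<Rightarrow> 'a" and W B :: real and \<alpha> :: "nat \<Rightarrow> 'k \<Rightarrow> complex" and n
    assume K: "finite K" and B: "0 \<le> B"
      and W: "\<forall>\<eta>. (\<forall>k\<in>K. \<eta> k \<in> {-1, 1 :: real}) \<longrightarrow> norm (\<Sum>k\<in>K. \<eta> k *\<^sub>R y k) \<le> W"
      and \<alpha>: "\<forall>k\<in>K. (\<Sum>l=1..n. (cmod (\<alpha> l k))\<^sup>2) \<le> B\<^sup>2"
    have W0: "W \<ge> 0" using W[rule_format, of "\<lambda>_. 1"] norm_ge_zero order_trans by blast
    have rb: "rand_bound K y (R * W\<^sup>2)" using Rb K W by simp
    have part: "(\<Sum>\<sigma>\<in>signs n. (norm (\<Sum>k\<in>K. (\<Sum>l=1..n. \<sigma> l * a l k) *\<^sub>R y k))\<^sup>2) \<le> R * W\<^sup>2 * B\<^sup>2 * 2 ^ n"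
      if a: "\<forall>k\<in>K. (\<Sum>l=1..n. (a l k)\<^sup>2) \<le> B\<^sup>2" for a :: "nat \<Rightarrow> 'k \<Rightarrow> real"
    proof (cases "B = 0")
      case True
      have "a l k = 0" if "k \<in> K" "l \<in> {1..n}" for k l
      proof -
        have "(\<Sum>l=1..n. (a l k)\<^sup>2) = 0"
          using a that True by (intro antisym sum_nonneg) auto
        then show ?thesis using that by (subst (asm) sum_nonneg_eq_0_iff) auto
      qed
      then have "(\<Sum>k\<in>K. (\<Sum>l=1..n. \<sigma> l * a l k) *\<^sub>R y k) = 0" for \<sigma>
        by (intro sum.neutral ballI) simp
      then show ?thesis using True by simp
    next
      case False
      then have B: "B > 0" using B by simp
      have "(\<Sum>\<sigma>\<in>signs n. (norm (\<Sum>k\<in>K. (\<Sum>l=1..n. \<sigma> l * (a l k / B)) *\<^sub>R y k))\<^sup>2) \<le> R * W\<^sup>2 * card (signs n)"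
      proof (rule rand_boundD[OF rb])
        fix k assume k: "k \<in> K"
        have "(\<Sum>\<sigma>\<in>signs n. cosh (\<Sum>l=1..n. \<sigma> l * (a l k / B))) = (\<Prod>l=1..n. 2 * cosh (a l k / B))"
          by (rule sum_signs_cosh)
        also have "\<dots> \<le> (\<Prod>l=1..n. 2 * exp ((a l k / B)\<^sup>2 / 2))"
          by (intro prod_mono conjI mult_left_mono cosh_le_exp_square) auto
        also have "\<dots> = 2 ^ n * exp ((\<Sum>l=1..n. (a l k)\<^sup>2) / B\<^sup>2 / 2)"
          by (simp add: prod.distrib exp_sum sum_divide_distrib power_divide)
        also have "\<dots> \<le> 2 ^ n * exp (1 / 2)"
          using a k B by (intro mult_left_mono) (auto simp: field_simps)
        also have "\<dots> \<le> 2 ^ n * 2"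
          using exp_bound[of "1/2::real"] by (intro mult_left_mono) (auto simp: power2_eq_square)
        finally show "(\<Sum>\<sigma>\<in>signs n. cosh (\<Sum>l=1..n. \<sigma> l * (a l k / B))) \<le> 2 * card (signs n)"
          by (simp add: card_signs)
      qed simp
      also have "(\<lambda>\<sigma>. (norm (\<Sum>k\<in>K. (\<Sum>l=1..n. \<sigma> l * (a l k / B)) *\<^sub>R y k))\<^sup>2) =
        (\<lambda>\<sigma>. (norm (\<Sum>k\<in>K. (\<Sum>l=1..n. \<sigma> l * a l k) *\<^sub>R y k))\<^sup>2 / B\<^sup>2)"
      proof
        fix \<sigma>
        have "(\<Sum>k\<in>K. (\<Sum>l=1..n. \<sigma> l * (a l k / B)) *\<^sub>R y k) = (1 / B) *\<^sub>R (\<Sum>k\<in>K. (\<Sum>l=1..n. \<sigma> l * a l k) *\<^sub>R y k)"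
          by (simp add: scaleR_sum_right flip: sum_divide_distrib)
        then show "(norm (\<Sum>k\<in>K. (\<Sum>l=1..n. \<sigma> l * (a l k / B)) *\<^sub>R y k))\<^sup>2 =
          (norm (\<Sum>k\<in>K. (\<Sum>l=1..n. \<sigma> l * a l k) *\<^sub>R y k))\<^sup>2 / B\<^sup>2"
          using B by (simp add: power_divide)
      qed
      finally show ?thesis using B by (simp add: card_signs field_simps flip: sum_divide_distrib)
    qed
    let ?P = "\<lambda>\<sigma>. norm (\<Sum>k\<in>K. (\<Sum>l=1..n. \<sigma> l * Re (\<alpha> l k)) *\<^sub>R y k)"
    let ?Q = "\<lambda>\<sigma>. norm (\<Sum>k\<in>K. (\<Sum>l=1..n. \<sigma> l * Im (\<alpha> l k)) *\<^sub>R y k)"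
    have "(norm (\<Sum>l=1..n. \<sigma> l *\<^sub>R (\<Sum>k\<in>K. \<alpha> l k *\<^sub>C y k)))\<^sup>2 \<le> 2 * (?P \<sigma>)\<^sup>2 + 2 * (?Q \<sigma>)\<^sup>2" for \<sigma>
    proof -
      have "\<sigma> l *\<^sub>R (\<alpha> l k *\<^sub>C y k) = (\<sigma> l * Re (\<alpha> l k)) *\<^sub>R y k + \<i> *\<^sub>C ((\<sigma> l * Im (\<alpha> l k)) *\<^sub>R y k)" for l k
      proof -
        have "(\<sigma> l * Re (\<alpha> l k)) *\<^sub>R y k + \<i> *\<^sub>C ((\<sigma> l * Im (\<alpha> l k)) *\<^sub>R y k) =
          (of_real (\<sigma> l * Re (\<alpha> l k)) + \<i> * of_real (\<sigma> l * Im (\<alpha> l k))) *\<^sub>C y k"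
          by (simp only: scaleC_of_real[symmetric] scaleC_scaleC scaleC_add_left)
        also have "of_real (\<sigma> l * Re (\<alpha> l k)) + \<i> * of_real (\<sigma> l * Im (\<alpha> l k)) = of_real (\<sigma> l) * \<alpha> l k"
          by (simp add: complex_eq_iff)
        finally show ?thesis by (simp only: scaleC_of_real[symmetric] scaleC_scaleC)
      qed
      then have "(\<Sum>l=1..n. \<sigma> l *\<^sub>R (\<Sum>k\<in>K. \<alpha> l k *\<^sub>C y k)) =
        (\<Sum>l=1..n. \<Sum>k\<in>K. (\<sigma> l * Re (\<alpha> l k)) *\<^sub>R y k + \<i> *\<^sub>C ((\<sigma> l * Im (\<alpha> l k)) *\<^sub>R y k))"
        by (simp add: scaleR_sum_right)
      also have "\<dots> = (\<Sum>k\<in>K. \<Sum>l=1..n. (\<sigma> l * Re (\<alpha> l k)) *\<^sub>R y k + \<i> *\<^sub>C ((\<sigma> l * Im (\<alpha> l k)) *\<^sub>R y k))"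
        by (rule sum.swap)
      also have "\<dots> = (\<Sum>k\<in>K. \<Sum>l=1..n. (\<sigma> l * Re (\<alpha> l k)) *\<^sub>R y k) + \<i> *\<^sub>C (\<Sum>k\<in>K. \<Sum>l=1..n. (\<sigma> l * Im (\<alpha> l k)) *\<^sub>R y k)"
        unfolding sum.distrib linear_sum[OF bounded_linear.linear[OF bounded_linear_scaleC]] ..
      finally have "norm (\<Sum>l=1..n. \<sigma> l *\<^sub>R (\<Sum>k\<in>K. \<alpha> l k *\<^sub>C y k)) \<le> ?P \<sigma> + ?Q \<sigma>"
        using norm_triangle_ineq[of "\<Sum>k\<in>K. \<Sum>l=1..n. (\<sigma> l * Re (\<alpha> l k)) *\<^sub>R y k" "\<i> *\<^sub>C (\<Sum>k\<in>K. \<Sum>l=1..n. (\<sigma> l * Im (\<alpha> l k)) *\<^sub>R y k)"]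
        by (simp add: norm_scaleC scaleR_sum_left)
      then have "(norm (\<Sum>l=1..n. \<sigma> l *\<^sub>R (\<Sum>k\<in>K. \<alpha> l k *\<^sub>C y k)))\<^sup>2 \<le> (?P \<sigma> + ?Q \<sigma>)\<^sup>2"
        by (intro power_mono) auto
      also have "\<dots> \<le> 2 * (?P \<sigma>)\<^sup>2 + 2 * (?Q \<sigma>)\<^sup>2"
        using zero_le_power2[of "?P \<sigma> - ?Q \<sigma>"] by (simp add: power2_eq_square algebra_simps)
      finally show ?thesis .
    qed
    then have "(\<Sum>\<sigma>\<in>signs n. (norm (\<Sum>l=1..n. \<sigma> l *\<^sub>R (\<Sum>k\<in>K. \<alpha> l k *\<^sub>C y k)))\<^sup>2) \<le>
       2 * (\<Sum>\<sigma>\<in>signs n. (?P \<sigma>)\<^sup>2) + 2 * (\<Sum>\<sigma>\<in>signs n. (?Q \<sigma>)\<^sup>2)"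
      unfolding sum_distrib_left sum.distrib[symmetric] by (rule sum_mono)
    also have "\<dots> \<le> 2 * (R * W\<^sup>2 * B\<^sup>2 * 2 ^ n) + 2 * (R * W\<^sup>2 * B\<^sup>2 * 2 ^ n)"
    proof (intro add_mono mult_left_mono part)
      have "(Re z)\<^sup>2 \<le> (cmod z)\<^sup>2" "(Im z)\<^sup>2 \<le> (cmod z)\<^sup>2" for z
        by (auto simp: cmod_power2)
      then have "(\<Sum>l=1..n. (Re (\<alpha> l k))\<^sup>2) \<le> (\<Sum>l=1..n. (cmod (\<alpha> l k))\<^sup>2)"
        "(\<Sum>l=1..n. (Im (\<alpha> l k))\<^sup>2) \<le> (\<Sum>l=1..n. (cmod (\<alpha> l k))\<^sup>2)" for k
        by (auto intro!: sum_mono)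
      then show "\<forall>k\<in>K. (\<Sum>l=1..n. (Re (\<alpha> l k))\<^sup>2) \<le> B\<^sup>2" "\<forall>k\<in>K. (\<Sum>l=1..n. (Im (\<alpha> l k))\<^sup>2) \<le> B\<^sup>2"
        using \<alpha> order_trans by blast+
    qed auto
    finally have "(Rad_norm M \<epsilon> n (\<lambda>l. \<Sum>k\<in>K. \<alpha> l k *\<^sub>C y k))\<^sup>2 \<le> 4 * R * W\<^sup>2 * B\<^sup>2"
      by (simp add: Rad_norm_signs[OF rad] field_simps)
    then have "sqrt ((Rad_norm M \<epsilon> n (\<lambda>l. \<Sum>k\<in>K. \<alpha> l k *\<^sub>C y k))\<^sup>2) \<le> sqrt (4 * R * W\<^sup>2 * B\<^sup>2)"
      by (rule real_sqrt_le_mono)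
    then show "Rad_norm M \<epsilon> n (\<lambda>l. \<Sum>k\<in>K. \<alpha> l k *\<^sub>C y k) \<le> sqrt (4 * R) * B * W"
      using B W0 by (simp add: real_sqrt_mult algebra_simps)
  qed
qed

section \<open>Rademacher norms as Euclidean averages over sign vectors\<close>

lemma Rad_norm_nonneg: "rademacher_seq M \<epsilon> \<Longrightarrow> 0 \<le> Rad_norm M \<epsilon> n x"
  unfolding Rad_norm_def by simp

lemma Rad_norm_L2_set:
  assumes "rademacher_seq M \<epsilon>"
  shows "Rad_norm M \<epsilon> n x = L2_set (\<lambda>\<sigma>. norm (\<Sum>k=1..n. \<sigma> k *\<^sub>R x k)) (signs n) / sqrt (2 ^ n)"
  using real_sqrt_unique[OF Rad_norm_signs[OF assms, of n x] Rad_norm_nonneg[OF assms]]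
  by (simp add: L2_set_def real_sqrt_divide)

lemma Rad_norm_triangle:
  assumes "rademacher_seq M \<epsilon>"
  shows "Rad_norm M \<epsilon> n (\<lambda>l. x l + y l) \<le> Rad_norm M \<epsilon> n x + Rad_norm M \<epsilon> n y"
proof -
  have "L2_set (\<lambda>\<sigma>. norm (\<Sum>k=1..n. \<sigma> k *\<^sub>R (x k + y k))) (signs n) \<le>
    L2_set (\<lambda>\<sigma>. norm (\<Sum>k=1..n. \<sigma> k *\<^sub>R x k) + norm (\<Sum>k=1..n. \<sigma> k *\<^sub>R y k)) (signs n)"
    by (rule L2_set_mono) (auto simp: scaleR_add_right sum.distrib norm_triangle_ineq)
  also have "\<dots> \<le> L2_set (\<lambda>\<sigma>. norm (\<Sum>k=1..n. \<sigma> k *\<^sub>R x k)) (signs n) + L2_set (\<lambda>\<sigma>. norm (\<Sum>k=1..n. \<sigma> k *\<^sub>R y k)) (signs n)"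
    by (rule L2_set_triangle_ineq)
  finally show ?thesis
    unfolding Rad_norm_L2_set[OF assms] by (simp add: divide_right_mono flip: add_divide_distrib)
qed

lemma tendsto_Rad_norm:
  assumes "rademacher_seq M \<epsilon>" and "\<And>l. l \<in> {1..n} \<Longrightarrow> ((\<lambda>j. x j l) \<longlongrightarrow> y l) F"
  shows "((\<lambda>j. Rad_norm M \<epsilon> n (x j)) \<longlongrightarrow> Rad_norm M \<epsilon> n y) F"
  unfolding Rad_norm_L2_set[OF assms(1)] L2_set_def
  by (intro tendsto_divide tendsto_const tendsto_real_sqrt tendsto_sum tendsto_power tendsto_norm
      tendsto_scaleR assms(2)) auto

section \<open>The domains and their boundaries\<close>

lemma E_dom_convex: "convex (E_dom E r)"
  by (simp add: E_dom_def)

lemma E_dom_open [simp]: "open (E_dom E r)"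
  by (simp add: E_dom_def)

lemma ball_subset_E_dom: "ball 0 r \<subseteq> E_dom E r"
  unfolding E_dom_def
proof (rule interior_maximal)
  show "ball 0 r \<subseteq> convex hull (E \<union> ball 0 r)"
    using hull_subset[of "E \<union> ball 0 r" convex] by blast
qed simp

lemma E_dom_mono: "r \<le> u \<Longrightarrow> E_dom E r \<subseteq> E_dom E u"
  unfolding E_dom_def by (intro interior_mono hull_mono) auto

lemma zero_in_E_dom: "0 < r \<Longrightarrow> 0 \<in> E_dom E r"
  using ball_subset_E_dom[of r E] by auto

lemma closure_E_dom:
  assumes "0 < r"
  shows "closure (E_dom E r) = closure (convex hull (E \<union> ball 0 r))"
  unfolding E_dom_def using zero_in_E_dom[OF assms, of E]
  by (intro convex_closure_interior) (auto simp: E_dom_def)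

lemma interior_closure_E_dom: "interior (closure (E_dom E r)) = E_dom E r"
  using convex_interior_closure[OF E_dom_convex, of E r] by (simp add: interior_open)

lemma subset_closure_E_dom: "0 < r \<Longrightarrow> E \<subseteq> closure (E_dom E r)"
  unfolding closure_E_dom by (metis Un_subset_iff closure_subset hull_subset order_trans)

lemma cball_subset_closure_E_dom: "0 < r \<Longrightarrow> cball 0 r \<subseteq> closure (E_dom E r)"
  using closure_mono[OF ball_subset_E_dom[of r E]] by simp

text \<open>A ray from a point of an open convex set leaves the set only once; a point of the ray in
  the closure but not in the set must be the exit point.\<close>

lemma polar_boundary_eq:
  assumes S: "convex S" "open S" "0 \<in> S" and p: "p \<in> closure S" "p \<notin> S"
    and eq: "p = of_real \<rho> * cis (2 * pi * t)" and \<rho>: "\<rho> \<ge> 0"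
  shows "polar_boundary S t = p"
proof -
  let ?e = "cis (2 * pi * t)"
  have "p \<noteq> 0" using S p by auto
  then have "\<rho> > 0" using \<rho> eq by auto
  have "{\<rho>'. 0 \<le> \<rho>' \<and> of_real \<rho>' * ?e \<in> S} = {0..<\<rho>}"
  proof (intro equalityI subsetI)
    fix x assume x: "x \<in> {0..<\<rho>}"
    have "of_real x * ?e \<in> S"
    proof (cases "x = 0")
      case True
      then show ?thesis using S by simp
    next
      case False
      have "of_real x * ?e = (1 - x / \<rho>) *\<^sub>R 0 + (x / \<rho>) *\<^sub>R p"
        using \<open>\<rho> > 0\<close> by (simp add: eq scaleR_conv_of_real)
      then have "of_real x * ?e \<in> open_segment 0 p"
        using x False \<open>\<rho> > 0\<close> \<open>p \<noteq> 0\<close> unfolding in_segment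
        by (intro conjI exI[of _ "x / \<rho>"]) auto
      then show ?thesis
        using in_interior_closure_convex_segment[of S 0 p] S p by (auto simp: interior_open)
    qed
    then show "x \<in> {\<rho>'. 0 \<le> \<rho>' \<and> of_real \<rho>' * ?e \<in> S}" using x by auto
  next
    fix x assume "x \<in> {\<rho>'. 0 \<le> \<rho>' \<and> of_real \<rho>' * ?e \<in> S}"
    then have x: "0 \<le> x" "of_real x * ?e \<in> S" by auto
    have "x < \<rho>"
    proof (rule ccontr)
      assume "\<not> x < \<rho>"
      have "p = (1 - \<rho> / x) *\<^sub>R 0 + (\<rho> / x) *\<^sub>R (of_real x * ?e)"
        using \<open>\<not> x < \<rho>\<close> \<open>\<rho> > 0\<close> by (simp add: eq scaleR_conv_of_real)
      also have "\<dots> \<in> S"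
        using S x \<open>\<not> x < \<rho>\<close> \<open>\<rho> > 0\<close> by (intro convexD) auto
      finally show False using p by simp
    qed
    then show "x \<in> {0..<\<rho>}" using x by simp
  qed
  then show ?thesis
    using \<open>\<rho> > 0\<close> by (simp add: polar_boundary_def eq cSup_atLeastLessThan)
qed

text \<open>\<open>bump u e\<close> is the amount by which the gauge of the domain at \<open>e\<close> (with \<open>cmod e = 1\<close>) drops
  below \<open>1 / u\<close> because of the tangent segments from the point 1 to the circle of radius \<open>u\<close>;
  these are the segments seen under the angles with \<open>Re e > u\<close>.\<close>

definition bump :: "real \<Rightarrow> complex \<Rightarrow> real" where
  "bump u e = 1 / u - max u (Re e) - sqrt (1 - u\<^sup>2) / u * sqrt (1 - (max u (Re e))\<^sup>2)"

text \<open>The form with \<open>max\<close> in the definition is visibly continuous; this one can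
  be differentiated piece by piece. For Re e \<le> u both square roots equal sqrt (1 - u^2) and
  everything cancels.\<close>

lemma bump_eq:
  assumes "cmod e = 1" "0 < u" "u < 1"
  shows "bump u e = (if Re e > u then 1 / u - Re e - sqrt (1 - u\<^sup>2) / u * \<bar>Im e\<bar> else 0)"
proof -
  have "(Re e)\<^sup>2 + (Im e)\<^sup>2 = 1" using assms(1) by (simp add: cmod_def)
  then have "1 - (Re e)\<^sup>2 = (Im e)\<^sup>2" by simp
  then have s: "sqrt (1 - (Re e)\<^sup>2) = \<bar>Im e\<bar>" by simp
  have "u\<^sup>2 < 1" using assms by (simp add: power_less_one_iff abs_square_less_1)
  then have "1 / u - u - sqrt (1 - u\<^sup>2) / u * sqrt (1 - u\<^sup>2) = 0"
    using assms by (simp add: field_simps power2_eq_square)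
  then show ?thesis using s unfolding bump_def by (auto simp: max_def)
qed

text \<open>The Minkowski gauge of \<open>E_dom E u\<close> on the unit circle, that is the
  reciprocal of its polar radius, when 0 < u < 1 and \<open>u\<close> is \<open>E\<close>-large
  enough; at most one summand is then nonzero.\<close>

definition gauge :: "complex set \<Rightarrow> real \<Rightarrow> complex \<Rightarrow> real" where
  "gauge E u e = 1 / u - (\<Sum>\<xi>\<in>E. bump u (e * cnj \<xi>))"

section \<open>Supporting lines, tangents and cones\<close>

locale unit_points =
  fixes E :: "complex set"
  assumes fin: "finite E" and ne: "E \<noteq> {}" and sph: "E \<subseteq> sphere 0 1"
begin

lemma norm_E: "\<xi> \<in> E \<Longrightarrow> cmod \<xi> = 1"
  using sph by auto

lemma closure_E_dom_cball: "r < 1 \<Longrightarrow> closure (E_dom E r) \<subseteq> cball 0 1"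
proof -
  assume "r < 1"
  have "convex hull (E \<union> ball 0 r) \<subseteq> cball 0 1"
    using sph \<open>r < 1\<close> by (intro hull_minimal) auto
  then have "E_dom E r \<subseteq> cball 0 1"
    unfolding E_dom_def using interior_subset by blast
  then show ?thesis by (intro closure_minimal) auto
qed

lemma E_dom_ball: "r < 1 \<Longrightarrow> E_dom E r \<subseteq> ball 0 1"
  using interior_mono[OF closure_E_dom_cball[of r]] interior_closure_E_dom[of E r] by simp

lemma E_dom_disjoint: "r < 1 \<Longrightarrow> E \<inter> E_dom E r = {}"
  using E_dom_ball[of r] sph by force

lemma E_dom_halfspace:
  assumes "n \<noteq> 0" "\<And>\<xi>. \<xi> \<in> E \<Longrightarrow> inner n \<xi> \<le> c" "norm n * r \<le> c"
    and "z \<in> E_dom E r"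
  shows "inner n z < c"
proof -
  have "convex hull (E \<union> ball 0 r) \<subseteq> {x. inner n x \<le> c}"
  proof (rule hull_minimal)
    have "inner n x \<le> c" if "x \<in> ball 0 r" for x
      using that assms(3) norm_cauchy_schwarz[of n x] mult_left_mono[of "norm x" r "norm n"]
      by auto
    then show "E \<union> ball 0 r \<subseteq> {x. inner n x \<le> c}" using assms(2) by auto
  qed (rule convex_halfspace_le)
  from interior_mono[OF this] assms(1,4) show ?thesis
    by (auto simp: E_dom_def)
qed

text \<open>If both points lay in the half plane inner n x \<ge> u, so would the segment between
  them, which would then miss the ball of radius \<open>u\<close>. So a cap at distance
  \<open>u\<close> from 0 contains at most one point of \<open>E\<close>, and at most one bump acts
  in each direction.\<close>

lemma sector_disjoint:
  assumes "E_large_enough E u" "\<xi> \<in> E" "\<eta> \<in> E" "\<xi> \<noteq> \<eta>" "cmod n = 1" "inner n \<xi> \<ge> u"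
  shows "inner n \<eta> < u"
proof (rule ccontr)
  assume "\<not> inner n \<eta> < u"
  obtain x where x: "x \<in> closed_segment \<xi> \<eta>" "x \<in> ball 0 u"
    using assms unfolding E_large_enough_def by blast
  have "closed_segment \<xi> \<eta> \<subseteq> {x. inner n x \<ge> u}"
    using assms \<open>\<not> inner n \<eta> < u\<close> by (intro closed_segment_subset convex_halfspace_ge) auto
  then have "inner n x \<ge> u" using x by auto
  moreover have "inner n x \<le> norm x" using norm_cauchy_schwarz[of n x] assms by simp
  ultimately show False using x by simp
qed

text \<open>A direction outside all caps meets the circle of radius \<open>u\<close>. Otherwise the
  ray crosses a tangent segment from some \<xi> \<in> E to that circle. The tangent line then does
  both jobs: its touching point puts \<open>p\<close> in the closure, and its half plane supports
  the domain and keeps \<open>p\<close> out of it.\<close>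

lemma frontier_point:
  assumes large: "E_large_enough E u" and u: "0 < u" "u < 1" and e: "cmod e = 1"
  defines "p \<equiv> e / of_real (gauge E u e)"
  shows "gauge E u e \<ge> 1" and "p \<in> closure (E_dom E u)" and "p \<notin> E_dom E u"
    and "\<exists>\<xi>\<in>E. p \<in> convex hull (insert \<xi> (cball 0 u))"
proof -
  define \<beta> where "\<beta> = sqrt (1 - u\<^sup>2)"
  have u2: "u\<^sup>2 < 1" using u by (simp add: power_less_one_iff abs_square_less_1)
  then have \<beta>: "\<beta>\<^sup>2 = 1 - u\<^sup>2" "\<beta> > 0" unfolding \<beta>_def by auto
  have n: "cmod (e * cnj \<xi>) = 1" if "\<xi> \<in> E" for \<xi> using that e norm_E by (simp add: norm_mult)
  have inn: "inner e \<xi> = Re (e * cnj \<xi>)" for \<xi> by (simp add: inner_complex_def)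
  have "gauge E u e \<ge> 1 \<and> p \<in> closure (E_dom E u) \<and> p \<notin> E_dom E u \<and>
    (\<exists>\<xi>\<in>E. p \<in> convex hull (insert \<xi> (cball 0 u)))"
  proof (cases "\<exists>\<xi>\<in>E. inner e \<xi> > u")
    case False
    then have "(\<Sum>\<xi>\<in>E. bump u (e * cnj \<xi>)) = 0"
      using bump_eq[OF n u] by (intro sum.neutral) (auto simp: inn)
    then have N: "gauge E u e = 1 / u" by (simp add: gauge_def)
    have p: "p = of_real u * e" using u by (simp add: p_def N)
    have pc: "p \<in> cball 0 u" using u e by (simp add: p norm_mult)
    have "p \<notin> E_dom E u"
    proof
      assume "p \<in> E_dom E u"
      then have "inner e p < u"
        using False e by (intro E_dom_halfspace[of e _ u]) auto
      moreover have "inner e p = u * inner e e" by (simp add: p flip: scaleR_conv_of_real)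
      ultimately show False using e by (simp add: dot_square_norm)
    qed
    moreover have "p \<in> convex hull (insert \<xi> (cball 0 u))" for \<xi>
      using pc by (intro hull_inc) auto
    ultimately show ?thesis
      using N u ne pc cball_subset_closure_E_dom[of u E] by auto
  next
    case True
    then obtain \<xi> where \<xi>: "\<xi> \<in> E" "inner e \<xi> > u" by blast
    define x y where "x = Re (e * cnj \<xi>)" and "y = Im (e * cnj \<xi>)"
    have xu: "x > u" using \<xi> by (simp add: x_def inn)
    have xy: "x\<^sup>2 + y\<^sup>2 = 1" using n[OF \<xi>(1)] unfolding x_def y_def by (simp add: cmod_def)
    have others: "inner e \<eta> < u" if "\<eta> \<in> E" "\<eta> \<noteq> \<xi>" for \<eta>
      using sector_disjoint[OF large \<xi>(1) that(1) _ e] that \<xi> by auto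
    have "(\<Sum>\<eta>\<in>E. bump u (e * cnj \<eta>)) = (\<Sum>\<eta>\<in>{\<xi>}. bump u (e * cnj \<eta>))"
      using others \<xi> fin bump_eq[OF n u] by (intro sum.mono_neutral_right) (fastforce simp: inn)+
    then have N: "gauge E u e = x + \<beta> / u * \<bar>y\<bar>"
      using bump_eq[OF n[OF \<xi>(1)] u] xu by (simp add: gauge_def x_def y_def \<beta>_def)
    define N where "N = x + \<beta> / u * \<bar>y\<bar>"
    have y\<beta>: "\<bar>y\<bar> < \<beta>"
    proof -
      have "y\<^sup>2 < \<beta>\<^sup>2" using xy \<beta> xu u by (smt (verit) power_strict_mono zero_less_numeral)
      then show ?thesis using \<beta> by (metis abs_of_pos abs_less_iff power2_less_imp_less abs_le_square_iff linorder_not_less)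
    qed
    have N1: "N \<ge> 1"
    proof -
      have "1 = x * x + \<bar>y\<bar> * \<bar>y\<bar>" using xy by (simp add: power2_eq_square)
      also have "\<dots> \<le> x * 1 + \<bar>y\<bar> * (\<beta> / u)"
      proof (intro add_mono mult_left_mono)
        show "x \<le> 1" using xy u xu by (smt (verit) power2_less_eq_zero_iff sum_power2_ge_zero power_less_one_iff one_le_power zero_le_power2 power2_nonneg_gt_1_iff)
        have "\<beta> \<le> \<beta> / u" using \<beta> u by (simp add: field_simps)
        then show "\<bar>y\<bar> \<le> \<beta> / u" using y\<beta> by simp
      qed (use xu u in auto)
      finally show ?thesis by (simp add: N_def mult.commute)
    qed
    have pN: "p = e / of_real N" unfolding p_def N N_def ..
    \<comment> \<open>Selects, of the two tangents through \<xi>, the one on the side of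
      \<open>e\<close>.\<close>
    define s :: real where "s = (if y \<ge> 0 then 1 else -1)"
    have s: "s * y = \<bar>y\<bar>" "s * s = 1" by (auto simp: s_def)
    \<comment> \<open>Unit normal of the tangent line inner n x = u; the line passes through \<xi>
      and touches the circle at u n.\<close>
    define n where "n = \<xi> * Complex u (s * \<beta>)"
    have n1: "cmod n = 1"
    proof -
      have "(s * \<beta>)\<^sup>2 = \<beta>\<^sup>2" using s by (simp add: power_mult_distrib power2_eq_square[of s])
      then have "cmod (Complex u (s * \<beta>)) = 1" using \<beta> by (simp add: complex_norm)
      then show ?thesis using norm_E[OF \<xi>(1)] by (simp add: n_def norm_mult)
    qed
    have \<xi>\<xi>: "\<xi> * cnj \<xi> = 1" using norm_E[OF \<xi>(1)] by (simp add: complex_norm_square[symmetric])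
    have e: "e = \<xi> * Complex x y"
    proof -
      have "Complex x y = e * cnj \<xi>" by (simp only: x_def y_def complex_surj)
      then show ?thesis using \<xi>\<xi> by (simp add: mult.left_commute)
    qed
    have in\<xi>: "inner (\<xi> * a) (\<xi> * b) = inner a b" for a b
    proof -
      have "inner (\<xi> * a) (\<xi> * b) = Re ((\<xi> * cnj \<xi>) * (a * cnj b))"
        by (simp add: inner_complex_def algebra_simps)
      then show ?thesis by (simp add: \<xi>\<xi> inner_complex_def)
    qed
    have n\<xi>: "inner n \<xi> = u" using in\<xi>[of "Complex u (s * \<beta>)" 1] by (simp add: n_def inner_complex_def)
    have np: "inner n p = u"
    proof -
      have "inner n e = u * N"
        using in\<xi>[of "Complex u (s * \<beta>)" "Complex x y"] u s
        by (simp add: n_def e[symmetric] inner_complex_def N_def field_simps)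
      moreover have "p = (1 / N) *\<^sub>R e" by (simp add: pN scaleR_conv_of_real)
      ultimately show ?thesis using N1 by simp
    qed
    have "p \<notin> E_dom E u"
    proof
      assume p: "p \<in> E_dom E u"
      have "inner n p < u"
      proof (rule E_dom_halfspace[OF _ _ _ p])
        show "inner n \<eta> \<le> u" if "\<eta> \<in> E" for \<eta>
          using sector_disjoint[OF large \<xi>(1) that _ n1] n\<xi> by (cases "\<eta> = \<xi>") auto
      qed (use n1 in auto)
      then show False using np by simp
    qed
    moreover
    \<comment> \<open>Position of \<open>p\<close> on the segment from \<xi> to the touching point u
      n, read off from the imaginary parts after rotation by cnj \<xi>.\<close>
    define \<tau> where "\<tau> = \<bar>y\<bar> / (N * u * \<beta>)"
    have pseg: "p = (1 - \<tau>) *\<^sub>R \<xi> + \<tau> *\<^sub>R (of_real u * n)"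
    proof -
      have "Complex x y / of_real N = of_real (1 - \<tau>) + of_real \<tau> * (of_real u * Complex u (s * \<beta>))"
      proof (rule complex_eqI)
        have "N * u = x * u + \<beta> * \<bar>y\<bar>" using u by (simp add: N_def field_simps)
        have "1 - \<tau> * \<beta>\<^sup>2 = x / N" 
          using N1 u \<beta>(2) unfolding \<tau>_def by (simp add: field_simps power2_eq_square) (simp add: N_def field_simps)
        then have "x / N = 1 - \<tau> + \<tau> * (u * u)"
          unfolding \<beta>(1) by (simp add: power2_eq_square algebra_simps)
        then show "Re (Complex x y / of_real N) = Re (of_real (1 - \<tau>) + of_real \<tau> * (of_real u * Complex u (s * \<beta>)))"
          by simp
        have "\<bar>y\<bar> * s = y" by (simp add: s_def)
        then show "Im (Complex x y / of_real N) = Im (of_real (1 - \<tau>) + of_real \<tau> * (of_real u * Complex u (s * \<beta>)))"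
          using N1 u \<beta>(2) by (simp add: \<tau>_def)
      qed
      then have "\<xi> * (Complex x y / of_real N) = \<xi> * (of_real (1 - \<tau>) + of_real \<tau> * (of_real u * Complex u (s * \<beta>)))"
        by simp
      then show ?thesis by (simp add: pN e n_def scaleR_conv_of_real algebra_simps)
    qed
    have \<tau>: "0 \<le> \<tau>" "\<tau> \<le> 1"
    proof -
      show "0 \<le> \<tau>" using N1 u \<beta> by (simp add: \<tau>_def)
      have "\<bar>y\<bar> * u \<le> \<beta> * x" using y\<beta> xu u by (intro mult_mono) auto
      then have "\<bar>y\<bar> * (u * u) \<le> \<beta> * x * u" using u by (simp add: mult_right_mono flip: mult.assoc)
      moreover have "u * u = 1 - \<beta> * \<beta>" using \<beta>(1) by (simp add: power2_eq_square)
      ultimately have "\<bar>y\<bar> \<le> \<beta> * (x * u + \<beta> * \<bar>y\<bar>)" by (simp add: algebra_simps)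
      also have "x * u + \<beta> * \<bar>y\<bar> = N * u" using u by (simp add: N_def field_simps)
      finally show "\<tau> \<le> 1" using N1 u \<beta>(2) by (simp add: \<tau>_def divide_le_eq mult_ac)
    qed
    have un: "of_real u * n \<in> cball 0 u" using n1 u by (simp add: norm_mult)
    have "p \<in> convex hull (insert \<xi> (cball 0 u))"
      unfolding pseg using \<tau> un by (intro convexD[OF convex_convex_hull] hull_inc) auto
    moreover have "p \<in> closure (E_dom E u)"
      unfolding pseg using \<tau> un \<xi> u cball_subset_closure_E_dom[of u E] subset_closure_E_dom[of u E]
      by (intro convexD[OF convex_closure[OF E_dom_convex]]) auto
    ultimately show ?thesis using N1 \<xi>(1) by (auto simp: N N_def)
  qed
  then show "gauge E u e \<ge> 1" and "p \<in> closure (E_dom E u)" and "p \<notin> E_dom E u"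
    and "\<exists>\<xi>\<in>E. p \<in> convex hull (insert \<xi> (cball 0 u))" by auto
qed

text \<open>Each cone is convex and contains 0, so a point inherits the cone of its radial
  projection to the frontier.\<close>

lemma closure_E_dom_cone:
  assumes large: "E_large_enough E u" and u: "0 < u" "u < 1" and z: "z \<in> closure (E_dom E u)"
  shows "\<exists>\<xi>\<in>E. z \<in> convex hull (insert \<xi> (cball 0 u))"
proof (cases "z = 0")
  case True
  then show ?thesis using ne u by (auto intro!: hull_inc)
next
  case False
  define e where "e = z / of_real (cmod z)"
  have e: "cmod e = 1" using False by (simp add: e_def norm_divide)
  define p where "p = e / of_real (gauge E u e)"
  note fp = frontier_point[OF large u e, folded p_def]
  define \<tau> where "\<tau> = cmod z * gauge E u e"
  have zp: "z = of_real \<tau> * p" using False fp(1) by (simp add: \<tau>_def p_def e_def)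
  have \<tau>0: "\<tau> > 0" using False fp(1) by (simp add: \<tau>_def)
  have "\<tau> \<le> 1"
  proof (rule ccontr)
    assume "\<not> \<tau> \<le> 1"
    have "p = (1 - 1 / \<tau>) *\<^sub>R 0 + (1 / \<tau>) *\<^sub>R z" using \<tau>0 by (simp add: zp scaleR_conv_of_real)
    moreover have "0 \<noteq> z" using False by simp
    ultimately have "p \<in> open_segment 0 z"
      using \<open>\<not> \<tau> \<le> 1\<close> unfolding in_segment by (intro conjI exI[of _ "1 / \<tau>"]) auto
    then have "p \<in> interior (E_dom E u)"
      using in_interior_closure_convex_segment[OF E_dom_convex, of 0 E u z] z zero_in_E_dom[OF u(1)]
      by (auto simp: interior_open)
    then show False using fp(3) by (simp add: interior_open)
  qed
  obtain \<xi> where \<xi>: "\<xi> \<in> E" "p \<in> convex hull (insert \<xi> (cball 0 u))" using fp by blast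
  have "z = (1 - \<tau>) *\<^sub>R 0 + \<tau> *\<^sub>R p" by (simp add: zp scaleR_conv_of_real)
  also have "\<dots> \<in> convex hull (insert \<xi> (cball 0 u))"
    using \<xi> \<tau>0 \<open>\<tau> \<le> 1\<close> u by (intro convexD[OF convex_convex_hull]) (auto intro: hull_inc)
  finally show ?thesis using \<xi> by blast
qed

text \<open>In z = a \<xi> + \<mu> y a perturbation of \<open>z\<close> is absorbed by
  \<open>y\<close>. As \<open>y\<close> may move by u - r, the point \<open>z\<close> may move by (u
  - r) \<mu>, while |z - \<xi>| \<le> 2 \<mu>. Thus the smaller domain keeps a distance from the
  frontier of the larger one that is proportional to the distance from \<open>E\<close>.\<close>

lemma cone_ball:
  assumes large: "E_large_enough E r" and r: "0 < r" "r < u" "u < 1"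
    and z: "z \<in> closure (E_dom E r)"
  shows "\<exists>\<xi>\<in>E. ball z ((u - r) / 2 * cmod (z - \<xi>)) \<subseteq> E_dom E u"
proof -
  obtain \<xi> where \<xi>: "\<xi> \<in> E" "z \<in> convex hull (insert \<xi> (cball 0 r))"
    using closure_E_dom_cone[OF large _ _ z] r by auto
  then obtain a \<mu> y where z: "a \<ge> 0" "\<mu> \<ge> 0" "a + \<mu> = 1" "y \<in> convex hull (cball 0 r)" "z = a *\<^sub>R \<xi> + \<mu> *\<^sub>R y"
    using convex_hull_insert[of "cball 0 r" \<xi>] r by auto
  then have y: "cmod y \<le> r" by (simp add: convex_hull_eq[THEN iffD2, OF convex_cball] hull_same)
  have a: "a = 1 - \<mu>" using z by simp
  have "z - \<xi> = \<mu> *\<^sub>R (y - \<xi>)" unfolding z(5) a by (simp add: algebra_simps)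
  moreover have "cmod (y - \<xi>) \<le> 2" using norm_triangle_ineq4[of y \<xi>] y r norm_E[OF \<xi>(1)] by simp
  ultimately have d: "cmod (z - \<xi>) \<le> \<mu> * 2" using z(2) by (simp add: mult_left_mono)
  have "ball z ((u - r) / 2 * cmod (z - \<xi>)) \<subseteq> convex hull (E \<union> ball 0 u)"
  proof
    fix w assume w: "w \<in> ball z ((u - r) / 2 * cmod (z - \<xi>))"
    then have "cmod (w - z) < (u - r) / 2 * cmod (z - \<xi>)" by (simp add: dist_norm norm_minus_commute)
    also have "\<dots> \<le> (u - r) / 2 * (\<mu> * 2)" using d r by (intro mult_left_mono) auto
    finally have wz: "cmod (w - z) < (u - r) * \<mu>" by simp
    then have \<mu>: "\<mu> > 0" using z(2) r by (cases "\<mu> = 0") auto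
    define y' where "y' = y + (1 / \<mu>) *\<^sub>R (w - z)"
    have "cmod y' < u"
    proof -
      have "cmod y' \<le> cmod y + cmod (w - z) / \<mu>"
        unfolding y'_def using norm_triangle_ineq[of y "(1 / \<mu>) *\<^sub>R (w - z)"] \<mu> by simp
      also have "cmod (w - z) / \<mu> < u - r" using wz \<mu> by (simp add: field_simps)
      finally show ?thesis using y by simp
    qed
    moreover have "w = a *\<^sub>R \<xi> + \<mu> *\<^sub>R y'"
      using \<mu> by (simp add: y'_def z(5) scaleR_add_right)
    moreover from calculation have "a *\<^sub>R \<xi> + \<mu> *\<^sub>R y' \<in> convex hull (E \<union> ball 0 u)"
      using z(1-3) \<xi>(1) by (intro convexD[OF convex_convex_hull] hull_inc) auto
    ultimately show "w \<in> convex hull (E \<union> ball 0 u)" by simp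
  qed
  then have "ball z ((u - r) / 2 * cmod (z - \<xi>)) \<subseteq> E_dom E u"
    unfolding E_dom_def by (rule interior_maximal) simp
  then show ?thesis using \<xi> by blast
qed

text \<open>For a fixed constant the Stolz condition cuts out a closed convex set, so it only has to
  be checked on the generators, which are \<open>E\<close> and the ball.\<close>

lemma stolz:
  assumes u: "0 < u" "u < 1"
  shows "\<exists>C>0. \<forall>z\<in>closure (E_dom E u). \<forall>\<xi>\<in>E. cmod (1 - cnj \<xi> * z) \<le> C * Re (1 - cnj \<xi> * z)"
proof -
  define q where "q = (\<lambda>\<xi> \<eta>. cmod (1 - cnj \<xi> * \<eta>) / Re (1 - cnj \<xi> * \<eta>))"
  \<comment> \<open>The first summand serves the ball, the double sum serves the finitely many pairs
    in \<open>E\<close>; on the diagonal \<open>q\<close> is 0 / 0 = 0.\<close>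
  define C where "C = 2 / (1 - u) + (\<Sum>\<xi>\<in>E. \<Sum>\<eta>\<in>E. q \<xi> \<eta>)"
  have Re1: "Re (cnj \<xi> * z) \<le> cmod z" if "\<xi> \<in> E" for \<xi> z
    using complex_Re_le_cmod[of "cnj \<xi> * z"] norm_E[OF that] by (simp add: norm_mult)
  have q0: "q \<xi> \<eta> \<ge> 0" if "\<xi> \<in> E" "\<eta> \<in> E" for \<xi> \<eta>
    using Re1[OF that(1), of \<eta>] norm_E[OF that(2)] by (simp add: q_def)
  have C: "C > 0" unfolding C_def using u q0 by (intro add_pos_nonneg sum_nonneg) auto
  have "closure (E_dom E u) \<subseteq> {z. cmod (1 - cnj \<xi> * z) \<le> C * Re (1 - cnj \<xi> * z)}" (is "_ \<subseteq> ?S")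
    if \<xi>: "\<xi> \<in> E" for \<xi>
    unfolding closure_E_dom[OF u(1)]
  proof (intro closure_minimal hull_minimal)
    show "closed ?S" by (intro closed_Collect_le continuous_intros)
    show "convex ?S"
    proof (rule convexI)
      fix x y :: complex and a b :: real
      assume *: "x \<in> ?S" "y \<in> ?S" "0 \<le> a" "0 \<le> b" "a + b = 1"
      have b: "b = 1 - a" using * by simp
      have eq: "1 - cnj \<xi> * (a *\<^sub>R x + b *\<^sub>R y) = a *\<^sub>R (1 - cnj \<xi> * x) + b *\<^sub>R (1 - cnj \<xi> * y)"
        unfolding b by (simp add: scaleR_conv_of_real algebra_simps)
      have "cmod (1 - cnj \<xi> * (a *\<^sub>R x + b *\<^sub>R y)) \<le> a * cmod (1 - cnj \<xi> * x) + b * cmod (1 - cnj \<xi> * y)"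
        unfolding eq using * norm_triangle_ineq[of "a *\<^sub>R (1 - cnj \<xi> * x)" "b *\<^sub>R (1 - cnj \<xi> * y)"] by simp
      also have "\<dots> \<le> a * (C * Re (1 - cnj \<xi> * x)) + b * (C * Re (1 - cnj \<xi> * y))"
        using * by (intro add_mono mult_left_mono) auto
      also have "\<dots> = C * Re (1 - cnj \<xi> * (a *\<^sub>R x + b *\<^sub>R y))"
        unfolding eq by (simp add: algebra_simps)
      finally show "a *\<^sub>R x + b *\<^sub>R y \<in> ?S" by simp
    qed
    show "E \<union> ball 0 u \<subseteq> ?S"
    proof
      fix z assume "z \<in> E \<union> ball 0 u"
      then show "z \<in> ?S"
      proof
        assume z: "z \<in> ball 0 u"
        have "cmod (1 - cnj \<xi> * z) \<le> 2"
          using norm_triangle_ineq4[of 1 "cnj \<xi> * z"] norm_E[OF \<xi>] z u by (simp add: norm_mult)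
        also have "2 \<le> C * (1 - u)"
        proof -
          have "2 / (1 - u) \<le> C" unfolding C_def using q0 by (simp add: sum_nonneg)
          then show ?thesis using u by (simp add: field_simps)
        qed
        also have "\<dots> \<le> C * Re (1 - cnj \<xi> * z)"
          using Re1[OF \<xi>, of z] z C by (intro mult_left_mono) auto
        finally show ?thesis by simp
      next
        assume z: "z \<in> E"
        show ?thesis
        proof (cases "z = \<xi>")
          case True
          then have "cnj \<xi> * z = 1" using norm_E[OF \<xi>] by (simp add: complex_norm_square[symmetric] mult.commute)
          then have "1 - cnj \<xi> * z = 0" by simp
          then show ?thesis
            by (simp only: mem_Collect_eq norm_zero zero_complex.sel mult_zero_right order_refl)
        next
          case False
          have "Re (cnj \<xi> * z) \<noteq> 1"
          proof
            assume 1: "Re (cnj \<xi> * z) = 1"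
            have "cmod (cnj \<xi> * z) = 1" using norm_E \<xi> z by (simp add: norm_mult)
            then have "(Re (cnj \<xi> * z))\<^sup>2 + (Im (cnj \<xi> * z))\<^sup>2 = 1" by (metis cmod_power2 one_power2)
            then have "cnj \<xi> * z = 1" using 1 by (simp add: complex_eq_iff)
            have "z = \<xi> * (cnj \<xi> * z)"
              using norm_E[OF \<xi>] complex_norm_square[of \<xi>] by (simp flip: mult.assoc)
            also have "\<dots> = \<xi>" using \<open>cnj \<xi> * z = 1\<close> by simp
            finally show False using False by simp
          qed
          then have pos: "Re (1 - cnj \<xi> * z) > 0" using Re1[OF \<xi>, of z] norm_E[OF z] by simp
          have "q \<xi> z \<le> (\<Sum>\<eta>\<in>E. q \<xi> \<eta>)" using fin z q0 \<xi> by (intro member_le_sum) auto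
          also have "\<dots> \<le> (\<Sum>\<xi>\<in>E. \<Sum>\<eta>\<in>E. q \<xi> \<eta>)"
            using fin \<xi> q0 by (intro member_le_sum[of \<xi> E "\<lambda>\<xi>. \<Sum>\<eta>\<in>E. q \<xi> \<eta>"] sum_nonneg) auto
          also have "\<dots> \<le> C" using u by (simp add: C_def)
          finally show ?thesis using pos by (simp add: q_def divide_le_eq)
        qed
      qed
    qed
  qed
  then show ?thesis using C by blast
qed

end

section \<open>Chord lengths and smoothness of the gauge\<close>

lemma sin_ge_half: "0 \<le> x \<Longrightarrow> x \<le> pi / 2 \<Longrightarrow> x / 2 \<le> sin x"
proof -
  have small: "x / 2 \<le> sin x" if "0 \<le> x" "x \<le> pi / 3" for x :: real
  proof -
    have "(\<lambda>x. sin x - x / 2) 0 \<le> (\<lambda>x. sin x - x / 2) x"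
    proof (rule DERIV_nonneg_imp_nondecreasing[OF that(1)])
      fix y assume y: "0 \<le> y" "y \<le> x"
      have "cos (pi / 3) \<le> cos y" using y that by (intro cos_monotone_0_pi_le) auto
      then show "\<exists>d. ((\<lambda>x. sin x - x / 2) has_real_derivative d) (at y) \<and> 0 \<le> d"
        by (intro exI[of _ "cos y - 1 / 2"]) (auto intro!: derivative_eq_intros simp: cos_60)
    qed
    then show ?thesis by simp
  qed
  assume x: "0 \<le> x" "x \<le> pi / 2"
  show ?thesis
  proof (cases "x \<le> pi / 3")
    case False
    have "pi / 2 / 2 \<le> sqrt 3 / 2"
    proof -
      have "pi \<le> 3.2" using pi_approx by simp
      moreover have "(1.6::real) \<le> sqrt 3" by (rule real_le_rsqrt) (simp add: power2_eq_square)
      ultimately show ?thesis by simp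
    qed
    also have "\<dots> = sin (pi / 3)" by (simp add: sin_60)
    also have "\<dots> \<le> sin x" using False x by (intro sin_monotone_2pi_le) auto
    finally show ?thesis using x by simp
  qed (use small x in auto)
qed

text \<open>The chord has length 2 |sin (pi (t - x))|. The minimum is the distance modulo 1, because
  the parameters 0 and 1 give the same point.\<close>

lemma cis_dist_ge:
  assumes "t \<in> {0..1}" "x \<in> {0..1}"
  shows "cmod (cis (2 * pi * t) - cis (2 * pi * x)) \<ge> 2 * min \<bar>t - x\<bar> (1 - \<bar>t - x\<bar>)"
proof -
  define s where "s = \<bar>t - x\<bar>"
  have s: "0 \<le> s" "s \<le> 1" using assms by (auto simp: s_def)
  have "cmod (cis (2 * pi * t) - cis (2 * pi * x)) = cmod (cis (2 * pi * x) * (cis (2 * pi * (t - x)) - 1))"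
    by (simp add: algebra_simps cis_mult)
  also have "\<dots> = cmod (cis (2 * pi * (t - x)) - 1)" by (simp add: norm_mult)
  also have "\<dots> = 2 * \<bar>sin (pi * (t - x))\<bar>"
  proof -
    have "(cmod (cis (2 * pi * (t - x)) - 1))\<^sup>2 = (cos (2 * (pi * (t - x))) - 1)\<^sup>2 + (sin (2 * (pi * (t - x))))\<^sup>2"
      by (simp add: cmod_power2 mult.assoc)
    also have "\<dots> = 2 - 2 * cos (2 * (pi * (t - x)))"
      using sin_cos_squared_add[of "2 * (pi * (t - x))"] by (simp add: power2_eq_square algebra_simps)
    also have "\<dots> = (2 * \<bar>sin (pi * (t - x))\<bar>)\<^sup>2"
      by (simp add: cos_double_sin power_mult_distrib)
    finally show ?thesis by (rule power2_eq_imp_eq) auto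
  qed
  also have "\<bar>sin (pi * (t - x))\<bar> = \<bar>sin (pi * s)\<bar>"
    by (auto simp: s_def abs_if minus_diff_eq[symmetric, of x t] simp del: minus_diff_eq)
  also have "2 * \<bar>sin (pi * s)\<bar> \<ge> 2 * min s (1 - s)"
  proof (cases "s \<le> 1 / 2")
    case True
    have "s \<le> pi * s / 2" using s pi_ge_two mult_right_mono[of 2 pi s] by (simp add: mult.commute)
    also have "\<dots> \<le> sin (pi * s)" using s True by (intro sin_ge_half) (auto simp: field_simps)
    finally show ?thesis by auto
  next
    case False
    have "1 - s \<le> pi * (1 - s) / 2" using s pi_ge_two mult_right_mono[of 2 pi "1 - s"] by simp
    also have "\<dots> \<le> sin (pi * (1 - s))" using s False by (intro sin_ge_half) (auto simp: field_simps)
    also have "\<dots> = sin (pi * s)" by (simp add: right_diff_distrib sin_diff)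
    finally show ?thesis by auto
  qed
  finally show ?thesis by (simp add: s_def)
qed

lemma finite_cis_eq: "finite {t \<in> {0..1}. cis (2 * pi * t) = w}"
proof (cases "\<exists>x\<in>{0..1}. cis (2 * pi * x) = w")
  case True
  then obtain x where x: "x \<in> {0..1}" "cis (2 * pi * x) = w" by blast
  have "{t \<in> {0..1}. cis (2 * pi * t) = w} \<subseteq> {x - 1, x, x + 1}"
  proof
    fix t assume t: "t \<in> {t \<in> {0..1}. cis (2 * pi * t) = w}"
    then have "min \<bar>t - x\<bar> (1 - \<bar>t - x\<bar>) \<le> 0" using cis_dist_ge[of t x] x by simp
    then show "t \<in> {x - 1, x, x + 1}" using t x by (auto simp: min_def abs_if split: if_splits)
  qed
  then show ?thesis by (rule finite_subset) simp
next
  case False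
  then have "{t \<in> {0..1}. cis (2 * pi * t) = w} = {}" by auto
  then show ?thesis by (simp only: finite.emptyI)
qed

text \<open>Moving radially from \<rho> e to \<open>e\<close> costs 1 - \<rho>, which is at most the
  distance from \<rho> e to the unit vector \<xi>.\<close>

lemma dist_unit_radial:
  assumes "cmod \<xi> = 1" "\<rho> \<ge> 0" "cmod e = 1" "\<rho> \<le> 1"
  shows "cmod (e - \<xi>) \<le> 2 * cmod (of_real \<rho> * e - \<xi>)"
proof -
  have "cmod (e - of_real \<rho> * e) = 1 - \<rho>"
  proof -
    have "e - of_real \<rho> * e = of_real (1 - \<rho>) * e" by (simp add: algebra_simps)
    then show ?thesis using assms by (simp only: norm_mult norm_of_real) simp
  qed
  also have "\<dots> \<le> cmod (of_real \<rho> * e - \<xi>)"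
    using norm_triangle_ineq2[of \<xi> "of_real \<rho> * e"] assms by (simp add: norm_mult norm_minus_commute)
  finally show ?thesis
    using norm_triangle_ineq[of "e - of_real \<rho> * e" "of_real \<rho> * e - \<xi>"] by simp
qed

lemma bump_C1:
  assumes \<xi>: "cmod \<xi> = 1" and u: "0 < u" "u < 1"
  shows "\<exists>D' S. finite S \<and> (\<forall>t\<in>{0..1}-S. ((\<lambda>t. bump u (cis (2 * pi * t) * cnj \<xi>)) has_real_derivative D' t) (at t)
    \<and> isCont D' t \<and> \<bar>D' t\<bar> \<le> 2 * pi * (1 + 1 / u))"
proof -
  obtain \<theta> where \<theta>: "\<xi> = cis \<theta>" using \<xi> by (metis rcis_Ex cis_rcis_eq complex_mod_rcis abs_eq_iff' rcis_cmod_Arg)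
  define \<beta> where "\<beta> = sqrt (1 - u\<^sup>2)"
  have u2: "u\<^sup>2 < 1" using u by (simp add: power_less_one_iff abs_square_less_1)
  have \<beta>: "0 \<le> \<beta>" "\<beta> \<le> 1" using u u2 by (auto simp: \<beta>_def)
  define x y where "x t = cos (2 * pi * t - \<theta>)" and "y t = sin (2 * pi * t - \<theta>)" for t
  have e: "cis (2 * pi * t) * cnj \<xi> = cis (2 * pi * t - \<theta>)" for t by (simp add: \<theta> cis_cnj cis_mult)
  have D: "bump u (cis (2 * pi * t) * cnj \<xi>) = (if x t > u then 1 / u - x t - \<beta> / u * \<bar>y t\<bar> else 0)" for t
    unfolding e using bump_eq[of "cis (2 * pi * t - \<theta>)" u] u by (simp add: x_def y_def \<beta>_def)
  define D' where "D' t = (if x t > u then 2 * pi * y t - \<beta> / u * (sgn (y t) * (2 * pi * x t)) else 0)" for t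
  \<comment> \<open>At e = \<xi> and e = - \<xi> the function |Im| has a corner; the other two
    directions are the tangent points, where the formula for the bump changes.\<close>
  define S where "S = (\<Union>w\<in>{\<xi>, - \<xi>, \<xi> * Complex u \<beta>, \<xi> * Complex u (- \<beta>)}. {t \<in> {0..1}. cis (2 * pi * t) = w})"
  have cont: "continuous_on UNIV x" "continuous_on UNIV y"
    unfolding x_def y_def by (intro continuous_intros)+
  have xd: "(x has_real_derivative - y t * (2 * pi)) (at t)" for t
    unfolding x_def y_def by (auto intro!: derivative_eq_intros)
  have yd: "(y has_real_derivative x t * (2 * pi)) (at t)" for t
    unfolding x_def y_def by (auto intro!: derivative_eq_intros)
  have "((\<lambda>t. bump u (cis (2 * pi * t) * cnj \<xi>)) has_real_derivative D' t) (at t)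
    \<and> isCont D' t \<and> \<bar>D' t\<bar> \<le> 2 * pi * (1 + 1 / u)" if t: "t \<in> {0..1} - S" for t
  proof -
    have ct: "cis (2 * pi * t) = \<xi> * Complex (x t) (y t)"
    proof -
      have "Complex (x t) (y t) = cis (2 * pi * t - \<theta>)" by (simp add: complex_eq_iff x_def y_def)
      then show ?thesis by (simp add: \<theta> cis_mult)
    qed
    have xy: "(x t)\<^sup>2 + (y t)\<^sup>2 = 1" by (simp add: x_def y_def)
    have "y t \<noteq> 0"
    proof
      assume y0: "y t = 0"
      then have "x t = 1 \<or> x t = -1" using xy by (simp add: power2_eq_1_iff)
      moreover have "Complex 1 0 = 1" "Complex (-1) 0 = -1" by (auto simp: complex_eq_iff)
      ultimately show False using ct t y0 by (auto simp: S_def)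
    qed
    have "x t \<noteq> u"
    proof
      assume x: "x t = u"
      then have "(y t)\<^sup>2 = \<beta>\<^sup>2" using xy u2 by (simp add: \<beta>_def)
      then have "y t = \<beta> \<or> y t = - \<beta>" by (simp add: power2_eq_iff)
      then show False using ct t x by (auto simp: S_def)
    qed
    define s where "s = sgn (y t)"
    have s: "s * s = 1" using \<open>y t \<noteq> 0\<close> by (simp add: s_def sgn_if)
    have abs1: "\<bar>D' t\<bar> \<le> 2 * pi * (1 + 1 / u)"
    proof (cases "x t > u")
      case True
      have "\<bar>D' t\<bar> \<le> \<bar>2 * pi * y t\<bar> + \<bar>\<beta> / u * (s * (2 * pi * x t))\<bar>"
        using True abs_triangle_ineq4[of "2 * pi * y t" "\<beta> / u * (s * (2 * pi * x t))"]
        by (simp only: D'_def s_def if_True)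
      also have "\<dots> = 2 * pi * \<bar>y t\<bar> + \<beta> / u * (\<bar>s\<bar> * (2 * pi * \<bar>x t\<bar>))"
        using u \<beta> by (simp add: abs_mult)
      also have "\<dots> \<le> 2 * pi * 1 + 1 / u * (1 * (2 * pi * 1))"
        using u \<beta> by (intro add_mono mult_mono divide_right_mono) (auto simp: x_def y_def s_def sgn_if)
      finally show ?thesis by (simp add: algebra_simps)
    qed (use u in \<open>auto simp: D'_def\<close>)
    show ?thesis
    proof (cases "x t > u")
      case True
      define U where "U = {t. x t > u \<and> s * y t > 0}"
      have U: "open U" "t \<in> U"
        using True \<open>y t \<noteq> 0\<close> cont unfolding U_def s_def
        by (auto intro!: open_Collect_conj open_Collect_less continuous_intros simp: sgn_if)
      have sU: "sgn (y t') = s \<and> \<bar>y t'\<bar> = s * y t'" if "t' \<in> U" for t'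
        using that \<open>y t \<noteq> 0\<close> by (auto simp: U_def s_def sgn_if split: if_splits)
      have "((\<lambda>t. 1 / u - x t - \<beta> / u * (s * y t)) has_real_derivative D' t) (at t)"
        using True u by (auto intro!: derivative_eq_intros xd yd simp: D'_def s_def)
      then have 1: "((\<lambda>t. bump u (cis (2 * pi * t) * cnj \<xi>)) has_real_derivative D' t) (at t)"
        by (rule has_field_derivative_transform_within_open[OF _ U]) (use sU D in \<open>auto simp: U_def\<close>)
      have "isCont (\<lambda>t. 2 * pi * y t - \<beta> / u * (s * (2 * pi * x t))) t"
        using cont by (intro continuous_intros) (auto simp: continuous_on_eq_continuous_at)
      moreover have "\<forall>\<^sub>F t' in nhds t. D' t' = 2 * pi * y t' - \<beta> / u * (s * (2 * pi * x t'))"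
        unfolding eventually_nhds using U sU by (intro exI[of _ U]) (auto simp: D'_def U_def)
      ultimately have "isCont D' t" using isCont_cong by fastforce
      with 1 abs1 show ?thesis by blast
    next
      case False
      then have xu: "x t < u" using \<open>x t \<noteq> u\<close> by simp
      define U where "U = {t. x t < u}"
      have U: "open U" "t \<in> U"
        using xu cont unfolding U_def by (auto intro!: open_Collect_less continuous_intros)
      have "((\<lambda>t. 0) has_real_derivative D' t) (at t)" using xu by (simp add: D'_def)
      then have 1: "((\<lambda>t. bump u (cis (2 * pi * t) * cnj \<xi>)) has_real_derivative D' t) (at t)"
        by (rule has_field_derivative_transform_within_open[OF _ U]) (use D in \<open>auto simp: U_def\<close>)
      have "\<forall>\<^sub>F t' in nhds t. D' t' = 0"
        unfolding eventually_nhds using U by (intro exI[of _ U]) (auto simp: D'_def U_def)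
      then have "isCont D' t" using isCont_cong[of D' "\<lambda>_. 0" t] by simp
      with 1 abs1 show ?thesis by blast
    qed
  qed
  moreover have "finite S" unfolding S_def using finite_cis_eq by blast
  ultimately show ?thesis by blast
qed

context unit_points
begin

section \<open>The boundary parametrisation\<close>

abbreviation bd :: "real \<Rightarrow> real \<Rightarrow> complex" where
  "bd u \<equiv> polar_boundary (E_dom E u)"

lemma bd_eq:
  assumes "E_large_enough E u" "0 < u" "u < 1"
  shows "bd u t = of_real (1 / gauge E u (cis (2 * pi * t))) * cis (2 * pi * t)"
    and "gauge E u (cis (2 * pi * t)) \<ge> 1"
    and "bd u t \<in> closure (E_dom E u)" and "bd u t \<notin> E_dom E u"
proof -
  note fp = frontier_point[OF assms, of "cis (2 * pi * t)", simplified]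
  have "bd u t = cis (2 * pi * t) / of_real (gauge E u (cis (2 * pi * t)))"
    using assms fp by (intro polar_boundary_eq[OF E_dom_convex E_dom_open zero_in_E_dom,
       of _ _ _ "1 / gauge E u (cis (2 * pi * t))"]) auto
  then show "bd u t = of_real (1 / gauge E u (cis (2 * pi * t))) * cis (2 * pi * t)"
    "gauge E u (cis (2 * pi * t)) \<ge> 1" "bd u t \<in> closure (E_dom E u)" "bd u t \<notin> E_dom E u"
    using fp by auto
qed

lemma bd_at_E:
  assumes u: "0 < u" "u < 1" and "cis (2 * pi * t) \<in> E"
  shows "bd u t = cis (2 * pi * t)"
  using assms subset_closure_E_dom[of u E] E_dom_disjoint[of u]
  by (intro polar_boundary_eq[OF E_dom_convex E_dom_open zero_in_E_dom, of _ _ _ 1]) auto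

lemma E_param: "\<xi> \<in> E \<Longrightarrow> \<exists>x\<in>{0..<1}. \<xi> = cis (2 * pi * x)"
proof -
  assume "\<xi> \<in> E"
  then have "\<xi> = exp (\<i> * of_real (Arg2pi \<xi>))" using Arg2pi_eq[of \<xi>] norm_E by simp
  then show ?thesis
    using Arg2pi_ge_0[of \<xi>] Arg2pi_lt_2pi[of \<xi>]
    by (intro bexI[of _ "Arg2pi \<xi> / (2 * pi)"]) (auto simp: cis_conv_exp)
qed

lemma bd_dist_ge:
  assumes "E_large_enough E u" "0 < u" "u < 1" "t \<in> {0..1}" "x \<in> {0..1}" "cis (2 * pi * x) \<in> E"
  shows "cmod (bd u t - cis (2 * pi * x)) \<ge> min \<bar>t - x\<bar> (1 - \<bar>t - x\<bar>)"
proof -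
  have g: "1 / gauge E u (cis (2 * pi * t)) \<ge> 0" "1 / gauge E u (cis (2 * pi * t)) \<le> 1"
    using bd_eq(2)[OF assms(1-3), of t] by auto
  have "2 * min \<bar>t - x\<bar> (1 - \<bar>t - x\<bar>) \<le> cmod (cis (2 * pi * t) - cis (2 * pi * x))"
    by (rule cis_dist_ge) fact+
  also have "\<dots> \<le> 2 * cmod (bd u t - cis (2 * pi * x))"
    unfolding bd_eq(1)[OF assms(1-3)] by (rule dist_unit_radial) (use g in auto)
  finally show ?thesis by simp
qed

lemma bd_in_E_iff:
  assumes "E_large_enough E u" "0 < u" "u < 1"
  shows "bd u t \<in> E \<longleftrightarrow> cis (2 * pi * t) \<in> E"
proof
  assume "bd u t \<in> E"
  then have "cmod (bd u t) = 1" by (rule norm_E)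
  then have "gauge E u (cis (2 * pi * t)) = 1"
    using bd_eq(1,2)[OF assms, of t] by (simp add: norm_divide)
  then show "cis (2 * pi * t) \<in> E" using \<open>bd u t \<in> E\<close> bd_eq(1)[OF assms, of t] by simp
qed (use bd_at_E assms in auto)

lemma finite_bd_E:
  assumes "E_large_enough E u" "0 < u" "u < 1"
  shows "finite {t \<in> {0..1}. bd u t \<in> E}"
proof -
  have "{t \<in> {0..1}. bd u t \<in> E} = (\<Union>w\<in>E. {t \<in> {0..1}. cis (2 * pi * t) = w})"
    using bd_in_E_iff[OF assms] by auto
  then show ?thesis using fin finite_cis_eq by simp
qed

lemma bd_C1:
  assumes large: "E_large_enough E u" and u: "0 < u" "u < 1"
  shows "\<exists>\<gamma>' S L. finite S \<and> {0, 1} \<subseteq> S \<and> L > 0 \<and> continuous_on UNIV (bd u) \<and>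
    (\<forall>t\<in>{0..1}-S. (bd u has_vector_derivative \<gamma>' t) (at t) \<and> isCont \<gamma>' t \<and> cmod (\<gamma>' t) \<le> L)"
proof -
  have "\<forall>\<xi>\<in>E. \<exists>D' S. finite S \<and> (\<forall>t\<in>{0..1}-S. ((\<lambda>t. bump u (cis (2 * pi * t) * cnj \<xi>)) has_real_derivative D' t) (at t)
    \<and> isCont D' t \<and> \<bar>D' t\<bar> \<le> 2 * pi * (1 + 1 / u))"
    using bump_C1[OF norm_E u] by blast
  from bchoice[OF this] obtain D' where D': "\<forall>\<xi>\<in>E. \<exists>S. finite S \<and>
      (\<forall>t\<in>{0..1}-S. ((\<lambda>t. bump u (cis (2 * pi * t) * cnj \<xi>)) has_real_derivative D' \<xi> t) (at t)
    \<and> isCont (D' \<xi>) t \<and> \<bar>D' \<xi> t\<bar> \<le> 2 * pi * (1 + 1 / u))" ..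
  from bchoice[OF this] obtain S where S: "\<forall>\<xi>\<in>E. finite (S \<xi>) \<and>
      (\<forall>t\<in>{0..1}-S \<xi>. ((\<lambda>t. bump u (cis (2 * pi * t) * cnj \<xi>)) has_real_derivative D' \<xi> t) (at t)
    \<and> isCont (D' \<xi>) t \<and> \<bar>D' \<xi> t\<bar> \<le> 2 * pi * (1 + 1 / u))" ..
  have DS: "\<And>\<xi>. \<xi> \<in> E \<Longrightarrow> finite (S \<xi>)"
    "\<And>\<xi> t. \<xi> \<in> E \<Longrightarrow> t \<in> {0..1} - S \<xi> \<Longrightarrow> ((\<lambda>t. bump u (cis (2 * pi * t) * cnj \<xi>)) has_real_derivative D' \<xi> t) (at t)"
    "\<And>\<xi> t. \<xi> \<in> E \<Longrightarrow> t \<in> {0..1} - S \<xi> \<Longrightarrow> isCont (D' \<xi>) t"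
    "\<And>\<xi> t. \<xi> \<in> E \<Longrightarrow> t \<in> {0..1} - S \<xi> \<Longrightarrow> \<bar>D' \<xi> t\<bar> \<le> 2 * pi * (1 + 1 / u)"
    using S by blast+
  define N where "N t = gauge E u (cis (2 * pi * t))" for t
  have N1: "N t \<ge> 1" for t using bd_eq(2)[OF assms] by (simp add: N_def)
  then have N0: "N t \<noteq> 0" for t by (metis not_one_le_zero)
  define N' where "N' t = - (\<Sum>\<xi>\<in>E. D' \<xi> t)" for t
  \<comment> \<open>The end points count as exceptional, so that elsewhere the derivative within
    {0..1} is two-sided.\<close>
  define S' where "S' = {0, 1} \<union> (\<Union>\<xi>\<in>E. S \<xi>)"
  have Nd: "(N has_real_derivative N' t) (at t)" if "t \<in> {0..1} - S'" for t
    unfolding N_def gauge_def N'_def using that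
    by (auto intro!: derivative_eq_intros DS simp: S'_def sum_negf)
  have N'c: "isCont N' t" if "t \<in> {0..1} - S'" for t
    unfolding N'_def using that by (auto intro!: continuous_intros DS simp: S'_def)
  have N'b: "\<bar>N' t\<bar> \<le> card E * (2 * pi * (1 + 1 / u))" if "t \<in> {0..1} - S'" for t
  proof -
    have "\<bar>N' t\<bar> \<le> (\<Sum>\<xi>\<in>E. \<bar>D' \<xi> t\<bar>)" unfolding N'_def by (simp add: sum_abs)
    also have "\<dots> \<le> (\<Sum>\<xi>\<in>E. 2 * pi * (1 + 1 / u))"
      using that by (intro sum_mono DS) (auto simp: S'_def)
    finally show ?thesis by simp
  qed
  have Nc: "continuous_on UNIV N"
    unfolding N_def gauge_def bump_def using u by (intro continuous_intros) auto
  define e where "e t = cis (2 * pi * t)" for t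
  have ec: "continuous_on UNIV e" unfolding e_def by (intro continuous_intros)
  have ed: "(e has_vector_derivative 2 * of_real pi * \<i> * e t) (at t)" for t
  proof -
    have "e = circlepath 0 1" by (auto simp: e_def circlepath cis_conv_exp fun_eq_iff mult_ac)
    moreover have "exp (2 * of_real pi * \<i> * of_real t) = e t" by (simp add: e_def cis_conv_exp mult_ac)
    ultimately show ?thesis
      using has_vector_derivative_circlepath[of 0 1 t UNIV] by simp
  qed
  have bd: "bd u = (\<lambda>t. (1 / N t) *\<^sub>R e t)"
    using bd_eq(1)[OF assms] by (auto simp: N_def e_def fun_eq_iff scaleR_conv_of_real)
  define \<gamma>' where "\<gamma>' t = (1 / N t) *\<^sub>R (2 * of_real pi * \<i> * e t) + (- N' t / (N t)\<^sup>2) *\<^sub>R e t" for t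
  define L where "L = card E * (2 * pi * (1 + 1 / u)) + 2 * pi"
  have main: "(bd u has_vector_derivative \<gamma>' t) (at t) \<and> isCont \<gamma>' t \<and> cmod (\<gamma>' t) \<le> L"
    if t: "t \<in> {0..1} - S'" for t
  proof (intro conjI)
    have 1: "((\<lambda>t. 1 / N t) has_real_derivative - N' t / (N t)\<^sup>2) (at t)"
      using Nd[OF t] N0[of t] by (auto intro!: derivative_eq_intros simp: power2_eq_square)
    show "(bd u has_vector_derivative \<gamma>' t) (at t)"
      unfolding bd \<gamma>'_def by (rule has_vector_derivative_scaleR[OF 1 ed])
    show "isCont \<gamma>' t"
      unfolding \<gamma>'_def using N'c[OF t] Nc ec N0
      by (intro continuous_intros) (auto simp: continuous_on_eq_continuous_at)
    have "cmod (\<gamma>' t) \<le> cmod ((1 / N t) *\<^sub>R (2 * of_real pi * \<i> * e t)) + cmod ((- N' t / (N t)\<^sup>2) *\<^sub>R e t)"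
      unfolding \<gamma>'_def by (rule norm_triangle_ineq)
    also have "\<dots> = 2 * pi / N t + \<bar>N' t\<bar> / (N t)\<^sup>2"
      using N1[of t] by (simp add: norm_mult e_def)
    also have "\<dots> \<le> 2 * pi + \<bar>N' t\<bar>"
      using N1[of t] by (intro add_mono) (auto simp: divide_le_eq mult_le_cancel_left1)
    finally show "cmod (\<gamma>' t) \<le> L" using N'b[OF t] by (simp add: L_def)
  qed
  have "finite S'" using fin DS by (auto simp: S'_def)
  moreover have "continuous_on UNIV (bd u)"
    unfolding bd using Nc ec N0 by (intro continuous_intros) auto
  moreover have "L > 0" unfolding L_def using u by (intro add_nonneg_pos) auto
  ultimately show ?thesis using main by (intro exI[of _ \<gamma>'] exI[of _ S'] exI[of _ L]) (auto simp: S'_def)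
qed

end

section \<open>Vector-valued integrals and resolvents\<close>

text \<open>For Banach space values there is no reduction to coordinates. The primitive
  \<open>F\<close> has increments dominated by those of the primitive of \<open>g\<close>, hence is
  uniformly continuous and extends to the closed interval, where the fundamental theorem yields the
  integral. Its base point \<open>c\<close> is interior, since integrability of \<open>f\<close> is
  at first known only on compact subintervals of the open interval.\<close>

lemma integrable_dominated_open:
  fixes f :: "real \<Rightarrow> 'b :: banach"
  assumes ab: "a < b" and f: "continuous_on {a<..<b} f" and g: "g integrable_on {a..b}"
    and fg: "\<And>t. t \<in> {a<..<b} \<Longrightarrow> norm (f t) \<le> g t"
  shows "f integrable_on {a..b}"
proof -
  define c where "c = (a + b) / 2"
  have c: "a < c" "c < b" using ab by (auto simp: c_def)
  define F where "F t = integral {c..t} f - integral {t..c} f" for t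
  define G where "G t = integral {a..t} g" for t
  have fi: "f integrable_on {s..t}" if "a < s" "t < b" for s t
    using that by (intro integrable_continuous_real continuous_on_subset[OF f]) auto
  have gi: "g integrable_on {s..t}" if "a \<le> s" "t \<le> b" for s t
    using g that by (rule_tac integrable_subinterval_real) auto
  have Fdiff: "F t - F s = integral {s..t} f" if st: "a < s" "s \<le> t" "t < b" for s t
  proof -
    consider "c \<le> s" | "s \<le> c" "c \<le> t" | "t \<le> c" by linarith
    then show ?thesis
    proof cases
      case 1
      have "integral {c..s} f + integral {s..t} f = integral {c..t} f"
        using 1 st c by (intro Henstock_Kurzweil_Integration.integral_combine fi) auto
      moreover have "integral {s..c} f = 0" "integral {t..c} f = 0" using 1 st
        by (cases "s = c"; cases "t = c"; simp)+
      ultimately show ?thesis by (simp add: F_def algebra_simps)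
    next
      case 2
      have "integral {s..c} f + integral {c..t} f = integral {s..t} f"
        using 2 st c by (intro Henstock_Kurzweil_Integration.integral_combine fi) auto
      moreover have "integral {c..s} f = 0" "integral {t..c} f = 0" using 2
        by (cases "s = c"; cases "t = c"; simp)+
      ultimately show ?thesis by (simp add: F_def algebra_simps)
    next
      case 3
      have "integral {s..t} f + integral {t..c} f = integral {s..c} f"
        using 3 st c by (intro Henstock_Kurzweil_Integration.integral_combine fi) auto
      moreover have "integral {c..s} f = 0" "integral {c..t} f = 0" using 3 st
        by (cases "s = c"; cases "t = c"; simp)+
      ultimately show ?thesis by (simp add: F_def algebra_simps)
    qed
  qed
  have FG: "norm (F t - F s) \<le> G t - G s" if st: "a < s" "s \<le> t" "t < b" for s t
  proof -
    have "norm (F t - F s) \<le> integral {s..t} g"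
      unfolding Fdiff[OF st] using st by (intro integral_norm_bound_integral fi gi fg) auto
    also have "integral {s..t} g = G t - G s"
      using Henstock_Kurzweil_Integration.integral_combine[of a s t g] gi st by (simp add: G_def)
    finally show ?thesis .
  qed
  have FG': "dist (F s) (F t) \<le> dist (G s) (G t)" if "s \<in> {a<..<b}" "t \<in> {a<..<b}" for s t
    using FG[of s t] FG[of t s] that by (cases "s \<le> t") (auto simp: dist_norm norm_minus_commute)
  have "continuous_on {a..b} G" unfolding G_def by (rule indefinite_integral_continuous_1[OF g])
  then have "uniformly_continuous_on {a..b} G" by (rule compact_uniformly_continuous) simp
  then have "uniformly_continuous_on {a<..<b} F"
    unfolding uniformly_continuous_on_def using FG'
    by (meson greaterThanLessThan_subseteq_atLeastAtMost_iff order_le_less_trans order_refl subsetD)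
  from uniformly_continuous_on_extension_on_closure[OF this]
  obtain H where H: "uniformly_continuous_on {a..b} H" "\<And>t. t \<in> {a<..<b} \<Longrightarrow> F t = H t"
    using ab by (metis closure_greaterThanLessThan)
  have "(f has_integral (H b - H a)) {a..b}"
  proof (rule fundamental_theorem_of_calculus_interior)
    show "continuous_on {a..b} H" using H uniformly_continuous_imp_continuous by blast
    fix t assume t: "t \<in> {a<..<b}"
    define d where "d = min (t - a) (b - t) / 2"
    have d: "d > 0" "a < t - d" "t + d < b" using t by (auto simp: d_def min_def field_simps)
    have "((\<lambda>s. integral {t - d..s} f) has_vector_derivative f t) (at t within {t - d..t + d})"
      using d by (intro integral_has_vector_derivative continuous_on_subset[OF f]) auto
    then have "((\<lambda>s. integral {t - d..s} f) has_vector_derivative f t) (at t)"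
      using d at_within_Icc_at[of "t - d" t "t + d"] by simp
    then have "((\<lambda>s. F (t - d) + integral {t - d..s} f) has_vector_derivative f t) (at t)"
      by (auto intro!: derivative_eq_intros)
    then show "(H has_vector_derivative f t) (at t)"
    proof (rule has_vector_derivative_transform_within_open[of _ _ _ "{t - d<..<t + d}"])
      fix s assume s: "s \<in> {t - d<..<t + d}"
      then show "F (t - d) + integral {t - d..s} f = H s"
        using Fdiff[of "t - d" s] H(2)[of s] d by (simp add: algebra_simps)
    qed (use d in auto)
  qed (use ab in auto)
  then show ?thesis by blast
qed

text \<open>Induction on the number of exceptional points in the open interval, which is split at
  one of them.\<close>

lemma integrable_dominated:
  fixes f :: "real \<Rightarrow> 'b :: banach"
  assumes S: "finite S" and f: "continuous_on ({a..b} - S) f" and g: "g integrable_on {a..b}"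
    and fg: "\<And>t. t \<in> {a..b} - S \<Longrightarrow> norm (f t) \<le> g t"
  shows "f integrable_on {a..b}"
  using f g fg
proof (induction "card (S \<inter> {a<..<b})" arbitrary: a b rule: less_induct)
  case less
  show ?case
  proof (cases "a < b")
    case False
    then consider "b < a" | "b = a" by linarith
    then show ?thesis
    proof cases
      case 2
      then show ?thesis using integrable_on_refl[of f a] unfolding box_real by (simp only:)
    qed (simp add: integrable_on_empty)
  next
    case ab: True
    show ?thesis
    proof (cases "S \<inter> {a<..<b} = {}")
      case True
      show ?thesis
      proof (rule integrable_dominated_open[OF ab _ less.prems(2)])
        have sub: "{a<..<b} \<subseteq> {a..b} - S" using True by auto
        show "continuous_on {a<..<b} f" by (rule continuous_on_subset[OF less.prems(1) sub])
        show "norm (f t) \<le> g t" if "t \<in> {a<..<b}" for t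
          using sub that by (intro less.prems(3)) blast
      qed
    next
      case False
      then obtain x where x: "x \<in> S" "a < x" "x < b" by auto
      have "f integrable_on {a..x}"
      proof (rule less.hyps)
        show "card (S \<inter> {a<..<x}) < card (S \<inter> {a<..<b})" using x S by (intro psubset_card_mono) auto
        show "g integrable_on {a..x}" using less.prems(2) x by (rule_tac integrable_subinterval_real) auto
        show "continuous_on ({a..x} - S) f"
          using x by (intro continuous_on_subset[OF less.prems(1)]) auto
        show "norm (f t) \<le> g t" if "t \<in> {a..x} - S" for t
          using that x by (intro less.prems(3)) auto
      qed
      moreover have "f integrable_on {x..b}"
      proof (rule less.hyps)
        show "card (S \<inter> {x<..<b}) < card (S \<inter> {a<..<b})" using x S by (intro psubset_card_mono) auto
        show "g integrable_on {x..b}" using less.prems(2) x by (rule_tac integrable_subinterval_real) auto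
        show "continuous_on ({x..b} - S) f"
          using x by (intro continuous_on_subset[OF less.prems(1)]) auto
        show "norm (f t) \<le> g t" if "t \<in> {x..b} - S" for t
          using that x by (intro less.prems(3)) auto
      qed
      ultimately show ?thesis using x by (intro Henstock_Kurzweil_Integration.integrable_combine[of a x b]) auto
    qed
  qed
qed

text \<open>Reduced to the scalar theorem for the norms of f n - h, which are bounded by 2 g. They
  are set to 0 on \<open>S\<close>, where nothing is known about \<open>f\<close> and
  \<open>h\<close>.\<close>

lemma dominated_convergence_Icc:
  fixes f :: "nat \<Rightarrow> real \<Rightarrow> 'b :: banach"
  assumes S: "finite S" and f: "\<And>n. continuous_on ({a..b} - S) (f n)" and h: "continuous_on ({a..b} - S) h"
    and g: "g integrable_on {a..b}"
    and fg: "\<And>n t. t \<in> {a..b} - S \<Longrightarrow> norm (f n t) \<le> g t"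
    and lim: "\<And>t. t \<in> {a..b} - S \<Longrightarrow> (\<lambda>n. f n t) \<longlonglongrightarrow> h t"
  shows "(\<lambda>n. integral {a..b} (f n)) \<longlonglongrightarrow> integral {a..b} h"
proof -
  have hg: "norm (h t) \<le> g t" if "t \<in> {a..b} - S" for t
    by (rule LIMSEQ_le_const2[OF tendsto_norm[OF lim[OF that]]]) (use fg[OF that] in auto)
  have fi: "f n integrable_on {a..b}" for n by (rule integrable_dominated[OF S f g fg])
  have hi: "h integrable_on {a..b}" by (rule integrable_dominated[OF S h g hg])
  define D where "D n t = (if t \<in> S then 0 else norm (f n t - h t))" for n t
  have D2: "D n t \<le> (if t \<in> S then 0 else 2 * g t)" if "t \<in> {a..b}" for n t
    using fg[of t n] hg[of t] norm_triangle_ineq4[of "f n t" "h t"] that by (auto simp: D_def)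
  have g2: "(\<lambda>t. if t \<in> S then 0 else 2 * g t) integrable_on {a..b}"
    by (rule integrable_spike_finite[OF S, of _ _ "\<lambda>t. 2 * g t"]) (use g in auto)
  have Di: "D n integrable_on {a..b}" for n
  proof (rule integrable_dominated[OF S _ g2])
    have "continuous_on ({a..b} - S) (\<lambda>t. norm (f n t - h t))"
      by (intro continuous_intros f h)
    then show "continuous_on ({a..b} - S) (D n)"
      by (rule continuous_on_eq) (simp add: D_def)
    show "norm (D n t) \<le> (if t \<in> S then 0 else 2 * g t)" if "t \<in> {a..b} - S" for t
      using D2[of t n] that by (simp add: D_def)
  qed
  have "(\<lambda>n. integral {a..b} (D n)) \<longlonglongrightarrow> integral {a..b} (\<lambda>_. 0)"
  proof (rule dominated_convergence(2)[OF Di g2])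
    show "norm (D n t) \<le> (if t \<in> S then 0 else 2 * g t)" if "t \<in> {a..b}" for n t
      using D2[OF that] by (simp add: D_def)
    show "(\<lambda>n. D n t) \<longlonglongrightarrow> 0" if "t \<in> {a..b}" for t
      using tendsto_norm_zero[OF Lim_null[THEN iffD1, OF lim[of t]]] that by (cases "t \<in> S") (auto simp: D_def)
  qed
  then have lim0: "(\<lambda>n. integral {a..b} (D n)) \<longlonglongrightarrow> 0" by simp
  have "norm (integral {a..b} (f n) - integral {a..b} h) \<le> integral {a..b} (D n)" for n
  proof -
    have "integral {a..b} (f n) - integral {a..b} h = integral {a..b} (\<lambda>t. f n t - h t)"
      using fi hi by (simp add: Henstock_Kurzweil_Integration.integral_diff)
    also have "\<dots> = integral {a..b} (\<lambda>t. if t \<in> S then 0 else f n t - h t)"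
      by (rule integral_spike[of S]) (use S in auto)
    also have "norm \<dots> \<le> integral {a..b} (D n)"
    proof (rule integral_norm_bound_integral[OF _ Di])
      show "(\<lambda>t. if t \<in> S then 0 else f n t - h t) integrable_on {a..b}"
        by (rule integrable_spike_finite[OF S, of _ _ "\<lambda>t. f n t - h t"])
          (use fi hi in \<open>auto intro: integrable_diff\<close>)
    qed (auto simp: D_def)
    finally show ?thesis .
  qed
  then have "(\<lambda>n. integral {a..b} (f n) - integral {a..b} h) \<longlonglongrightarrow> 0"
    by (intro Lim_null_comparison[OF _ lim0]) auto
  then show ?thesis by (rule LIM_zero_cancel)
qed

text \<open>With this instance scalar contour integrals, as in Cauchy's theorem, and operator-valued
  ones fall under the same lemmas.\<close>

instantiation complex :: complex_normed_vector
begin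
definition scaleC_complex :: "complex \<Rightarrow> complex \<Rightarrow> complex" where
  [simp]: "scaleC_complex a z = a * z"
instance
  by standard (auto simp: algebra_simps scaleR_conv_of_real norm_mult)
end

instance complex :: complex_banach ..

section \<open>Complex scalars, products of operators, resolvents\<close>

lemma scaleC_left_diff: "(a - b) *\<^sub>C x = a *\<^sub>C x - b *\<^sub>C (x :: 'a :: complex_vector)"
  using scaleC_add_left[of "a - b" b x] by (simp add: algebra_simps)

lemma scaleC_zero_left [simp]: "0 *\<^sub>C (x :: 'a :: complex_vector) = 0"
  using scaleC_left_diff[of 0 0 x] by simp

lemma scaleC_zero_right [simp]: "a *\<^sub>C (0 :: 'a :: complex_vector) = 0"
  using scaleC_add_right[of a 0 0] by simp

lemma scaleC_minus_left: "(- a) *\<^sub>C x = - (a *\<^sub>C (x :: 'a :: complex_vector))"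
  using scaleC_left_diff[of 0 a x] by simp

lemma scaleC_minus_right: "a *\<^sub>C (- x) = - (a *\<^sub>C (x :: 'a :: complex_vector))"
  using scaleC_add_right[of a x "-x"] by (simp add: minus_unique)

lemma scaleC_diff_right: "a *\<^sub>C (x - y) = a *\<^sub>C x - a *\<^sub>C (y :: 'a :: complex_vector)"
  using scaleC_add_right[of a x "-y"] by (simp add: scaleC_minus_right)

lemma bounded_bilinear_scaleC: "bounded_bilinear (\<lambda>a (x :: 'a :: complex_normed_vector). a *\<^sub>C x)"
proof (rule bounded_bilinear.intro)
  show "\<exists>K. \<forall>a (x :: 'a). norm (a *\<^sub>C x) \<le> norm a * norm x * K"
    by (intro exI[of _ 1]) (simp add: norm_scaleC)
  fix r and a :: complex and x :: 'a
  show "(r *\<^sub>R a) *\<^sub>C x = r *\<^sub>R (a *\<^sub>C x)"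
    by (simp add: scaleR_conv_of_real scaleC_scaleC[symmetric] scaleC_of_real)
  show "a *\<^sub>C (r *\<^sub>R x) = r *\<^sub>R (a *\<^sub>C x)"
    using linear_scale[OF bounded_linear.linear[OF bounded_linear_scaleC]] .
qed (auto simp: scaleC_add_left scaleC_add_right)

lemmas continuous_on_scaleC = bounded_bilinear.continuous_on[OF bounded_bilinear_scaleC]
lemmas tendsto_scaleC = bounded_bilinear.tendsto[OF bounded_bilinear_scaleC]

lemma scaleC_compose_left: "(c *\<^sub>C F) o\<^sub>L G = c *\<^sub>C (F o\<^sub>L G)"
  by (rule blinfun_eqI) (simp add: scaleC_blinfun.rep_eq)

lemma compose_scaleC: "complex_linear_op F \<Longrightarrow> F o\<^sub>L (c *\<^sub>C G) = c *\<^sub>C (F o\<^sub>L G)"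
  by (rule blinfun_eqI) (simp add: scaleC_blinfun.rep_eq complex_linear_op_def)

lemmas compose_diff_left = bounded_bilinear.diff_left[OF bounded_bilinear_blinfun_compose]
lemmas compose_diff_right = bounded_bilinear.diff_right[OF bounded_bilinear_blinfun_compose]
lemma compose_assoc: "(F o\<^sub>L G) o\<^sub>L H = F o\<^sub>L (G o\<^sub>L H)"
  by (rule blinfun_eqI) simp

lemma id_compose [simp]: "id_blinfun o\<^sub>L F = F" "F o\<^sub>L id_blinfun = F"
  by (auto intro: blinfun_eqI)

lemma is_inverse_op_unique: "is_inverse_op A B \<Longrightarrow> is_inverse_op A B' \<Longrightarrow> B = B'"
  unfolding is_inverse_op_def by (metis compose_assoc id_compose)

lemma resolvent_eqI: "is_inverse_op (z *\<^sub>C id_blinfun - T) B \<Longrightarrow> resolvent z T = B"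
  unfolding resolvent_def using is_inverse_op_unique by (intro the_equality) blast+

lemma resolvent_inverse: "z \<notin> spectrum_op T \<Longrightarrow> is_inverse_op (z *\<^sub>C id_blinfun - T) (resolvent z T)"
  unfolding spectrum_op_def using resolvent_eqI by fastforce

lemma resolvent_props:
  assumes "z \<notin> spectrum_op T"
  shows "complex_linear_op (resolvent z T)"
    and "(z *\<^sub>C id_blinfun - T) o\<^sub>L resolvent z T = id_blinfun"
    and "resolvent z T o\<^sub>L (z *\<^sub>C id_blinfun - T) = id_blinfun"
  using resolvent_inverse[OF assms] by (auto simp: is_inverse_op_def)

text \<open>Point and operator vary together, so that one formula covers the resolvent identity (A =
  B) and the perturbation of the operator at a fixed point (z = w).\<close>

lemma resolvent_diff:
  assumes z: "z \<notin> spectrum_op A" and w: "w \<notin> spectrum_op B"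
  shows "resolvent z A - resolvent w B =
    resolvent z A o\<^sub>L ((w - z) *\<^sub>C id_blinfun + (A - B)) o\<^sub>L resolvent w B"
proof -
  have "resolvent z A - resolvent w B =
    (resolvent z A o\<^sub>L ((w *\<^sub>C id_blinfun - B) o\<^sub>L resolvent w B)) -
    ((resolvent z A o\<^sub>L (z *\<^sub>C id_blinfun - A)) o\<^sub>L resolvent w B)"
    by (simp add: resolvent_props[OF z] resolvent_props[OF w])
  also have "\<dots> = resolvent z A o\<^sub>L ((w *\<^sub>C id_blinfun - B) - (z *\<^sub>C id_blinfun - A)) o\<^sub>L resolvent w B"
    by (simp only: compose_assoc compose_diff_left compose_diff_right)
  also have "(w *\<^sub>C id_blinfun - B) - (z *\<^sub>C id_blinfun - A) = (w - z) *\<^sub>C id_blinfun + (A - B)"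
    by (simp add: scaleC_left_diff)
  finally show ?thesis .
qed

lemma resolvent_identity:
  assumes "z \<notin> spectrum_op T" "w \<notin> spectrum_op T"
  shows "resolvent z T - resolvent w T = (w - z) *\<^sub>C (resolvent z T o\<^sub>L resolvent w T)"
  using resolvent_diff[OF assms] resolvent_props(1)[OF assms(1)]
  by (simp add: compose_scaleC scaleC_compose_left)

text \<open>Both resolvents exist by assumption, so the estimate is obtained by absorption: the
  difference formula gives norm R(z) \<le> norm R(w) + norm R(z) / 2, which is solved for norm
  R(z).\<close>

lemma norm_resolvent_le:
  assumes z: "z \<notin> spectrum_op A" and w: "w \<notin> spectrum_op B"
    and small: "(cmod (w - z) + norm (A - B)) * norm (resolvent w B) \<le> 1 / 2"
  shows "norm (resolvent z A) \<le> 2 * norm (resolvent w B)"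
    and "norm (resolvent z A - resolvent w B) \<le> 2 * (norm (resolvent w B))\<^sup>2 * (cmod (w - z) + norm (A - B))"
proof -
  let ?z = "resolvent z A" and ?w = "resolvent w B" and ?d = "cmod (w - z) + norm (A - B)"
  have "norm ((w - z) *\<^sub>C id_blinfun + (A - B)) \<le> ?d"
  proof -
    have "norm ((w - z) *\<^sub>C (id_blinfun :: 'a \<Rightarrow>\<^sub>L 'a)) \<le> cmod (w - z) * 1"
      unfolding norm_scaleC by (intro mult_left_mono norm_blinfun_id_le) auto
    then show ?thesis using norm_triangle_ineq[of "(w - z) *\<^sub>C id_blinfun" "A - B"] by simp
  qed
  then have d: "norm (?z - ?w) \<le> norm ?z * ?d * norm ?w"
    unfolding resolvent_diff[OF z w]
    by (intro order_trans[OF norm_blinfun_compose] mult_right_mono order_trans[OF norm_blinfun_compose] mult_left_mono) auto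
  also have "\<dots> \<le> norm ?z * (1 / 2)"
    unfolding mult.assoc by (intro mult_left_mono small) auto
  finally have "norm ?z \<le> norm ?w + norm ?z / 2"
    using norm_triangle_ineq[of ?w "?z - ?w"] by simp
  then show z2: "norm ?z \<le> 2 * norm ?w" by simp
  have "norm ?z * ?d * norm ?w \<le> (2 * norm ?w) * ?d * norm ?w"
    by (intro mult_right_mono z2) auto
  with d show "norm (?z - ?w) \<le> 2 * (norm ?w)\<^sup>2 * ?d"
    by (simp add: power2_eq_square mult_ac)
qed

lemma tendsto_resolvent:
  assumes nw: "w \<notin> spectrum_op B" and z: "(z \<longlongrightarrow> w) F" and A: "(A \<longlongrightarrow> B) F"
    and ev: "\<forall>\<^sub>F x in F. z x \<notin> spectrum_op (A x)"
  shows "((\<lambda>x. resolvent (z x) (A x)) \<longlongrightarrow> resolvent w B) F"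
proof -
  define d where "d x = cmod (w - z x) + norm (A x - B)" for x
  have "(d \<longlongrightarrow> cmod (w - w) + norm (B - B)) F"
    unfolding d_def by (intro tendsto_intros z A)
  then have d0: "(d \<longlongrightarrow> 0) F" by simp
  have "((\<lambda>x. d x * norm (resolvent w B)) \<longlongrightarrow> 0 * norm (resolvent w B)) F"
    by (intro tendsto_intros d0)
  then have "\<forall>\<^sub>F x in F. d x * norm (resolvent w B) < 1 / 2"
    by (rule order_tendstoD) simp
  with ev have "\<forall>\<^sub>F x in F. norm (resolvent (z x) (A x) - resolvent w B) \<le> 2 * (norm (resolvent w B))\<^sup>2 * d x"
    by eventually_elim (auto simp: d_def intro!: norm_resolvent_le(2)[OF _ nw])
  moreover have "((\<lambda>x. 2 * (norm (resolvent w B))\<^sup>2 * d x) \<longlongrightarrow> 0) F"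
    by (rule tendsto_mult_right_zero[OF d0])
  ultimately have "((\<lambda>x. resolvent (z x) (A x) - resolvent w B) \<longlongrightarrow> 0) F"
    by (rule Lim_null_comparison)
  then show ?thesis by (rule LIM_zero_cancel)
qed

lemma continuous_on_resolvent: "continuous_on (- spectrum_op T) (\<lambda>z. resolvent z T)"
  unfolding continuous_on_def
  by (auto intro!: tendsto_resolvent simp: eventually_at_filter)

text \<open>The derivative is taken within the resolvent set, which is what
  \<open>cint_primitive\<close> asks for along a path in that set.\<close>

lemma resolvent_has_derivative:
  assumes z: "z \<notin> spectrum_op T"
  shows "((\<lambda>z. resolvent z T) has_derivative (\<lambda>h. - (h *\<^sub>C (resolvent z T o\<^sub>L resolvent z T))))
    (at z within - spectrum_op T)"
proof -
  let ?R = "resolvent z T"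
  have bl: "bounded_linear (\<lambda>h. - (h *\<^sub>C (?R o\<^sub>L ?R)))"
    by (intro bounded_linear_minus bounded_bilinear.bounded_linear_left[OF bounded_bilinear_scaleC])
  have lim: "((\<lambda>w. norm ((?R - resolvent w T) o\<^sub>L ?R)) \<longlongrightarrow> norm ((?R - ?R) o\<^sub>L ?R)) (at z within - spectrum_op T)"
    using continuous_on_resolvent[of T] z
    by (intro tendsto_norm bounded_bilinear.tendsto[OF bounded_bilinear_blinfun_compose] tendsto_diff tendsto_const)
      (auto simp: continuous_on_def)
  show ?thesis
    unfolding has_derivative_iff_norm
  proof (intro conjI bl, rule Lim_null_comparison)
    show "((\<lambda>w. norm ((?R - resolvent w T) o\<^sub>L ?R)) \<longlongrightarrow> 0) (at z within - spectrum_op T)"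
      using lim by simp
    show "\<forall>\<^sub>F w in at z within - spectrum_op T.
      norm (norm (resolvent w T - ?R - - ((w - z) *\<^sub>C (?R o\<^sub>L ?R))) / norm (w - z)) \<le> norm ((?R - resolvent w T) o\<^sub>L ?R)"
      unfolding eventually_at_filter
    proof (intro always_eventually allI impI)
      fix w assume w: "w \<noteq> z" "w \<in> - spectrum_op T"
      have "resolvent w T - ?R - - ((w - z) *\<^sub>C (?R o\<^sub>L ?R)) = (w - z) *\<^sub>C ((?R - resolvent w T) o\<^sub>L ?R)"
        using resolvent_identity[of w T z] w z
        by (simp add: compose_diff_left scaleC_diff_right scaleC_left_diff)
      then show "norm (norm (resolvent w T - ?R - - ((w - z) *\<^sub>C (?R o\<^sub>L ?R))) / norm (w - z)) \<le> norm ((?R - resolvent w T) o\<^sub>L ?R)"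
        using w by (simp add: norm_scaleC)
    qed
  qed
qed

section \<open>Contour integrals of the resolvent\<close>

text \<open>A closed path that is C^1 with bounded derivative off a finite set. Integrals are formed
  with the chosen derivative \<open>\<gamma>'\<close>, whose values on \<open>S\<close> do not
  affect them.\<close>

locale contour =
  fixes \<gamma> \<gamma>' :: "real \<Rightarrow> complex" and S :: "real set" and L :: real
  assumes fin_S: "finite S" and S01: "{0, 1} \<subseteq> S" and L_pos: "L > 0"
    and cont: "continuous_on UNIV \<gamma>" and closed_path: "\<gamma> 0 = \<gamma> 1"
    and deriv: "\<And>t. t \<in> {0..1} - S \<Longrightarrow> (\<gamma> has_vector_derivative \<gamma>' t) (at t)"
    and deriv_cont: "\<And>t. t \<in> {0..1} - S \<Longrightarrow> isCont \<gamma>' t"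
    and deriv_bound: "\<And>t. t \<in> {0..1} - S \<Longrightarrow> cmod (\<gamma>' t) \<le> L"
begin

definition cint :: "(complex \<Rightarrow> 'b :: complex_banach) \<Rightarrow> 'b" where
  "cint f = integral {0..1} (\<lambda>t. \<gamma>' t *\<^sub>C f (\<gamma> t))"

text \<open>Absolute integrability along the path, up to finitely many parameters. The majorant may
  be unbounded, which admits the blow-up of the resolvent where the contour passes through
  \<open>E\<close>.\<close>

definition adm :: "(complex \<Rightarrow> 'b :: complex_banach) \<Rightarrow> bool" where
  "adm f \<longleftrightarrow> (\<exists>S' g. finite S' \<and> continuous_on ({0..1} - S') (\<lambda>t. f (\<gamma> t)) \<and> g integrable_on {0..1}
    \<and> (\<forall>t\<in>{0..1}-S'. norm (f (\<gamma> t)) \<le> g t))"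

lemma admI:
  assumes "finite S'" "continuous_on ({0..1} - S') (\<lambda>t. f (\<gamma> t))" "g integrable_on {0..1}"
    "\<And>t. t \<in> {0..1} - S' \<Longrightarrow> norm (f (\<gamma> t)) \<le> g t"
  shows "adm f"
  using assms unfolding adm_def by blast

lemma vector_derivative_eq: "t \<in> {0..1} - S \<Longrightarrow> vector_derivative \<gamma> (at t within {0..1}) = \<gamma>' t"
proof -
  assume t: "t \<in> {0..1} - S"
  then have "t \<noteq> 0" "t \<noteq> 1" using S01 by auto
  then have "0 < t" "t < 1" using t by auto
  then show ?thesis
    using vector_derivative_at[OF deriv[OF t]] at_within_Icc_at[of 0 t 1] by simp
qed

lemma vector_contour_integral_eq: "vector_contour_integral \<gamma> f = cint f"
  unfolding vector_contour_integral_def cint_def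
  by (rule integral_spike[OF negligible_finite[OF fin_S]]) (simp add: vector_derivative_eq)

lemma integrand_continuous:
  fixes f :: "complex \<Rightarrow> 'b :: complex_banach"
  assumes "continuous_on ({0..1} - S') (\<lambda>t. f (\<gamma> t))"
  shows "continuous_on ({0..1} - (S \<union> S')) (\<lambda>t. \<gamma>' t *\<^sub>C f (\<gamma> t))"
proof (rule continuous_on_scaleC)
  show "continuous_on ({0..1} - (S \<union> S')) \<gamma>'"
    by (intro continuous_at_imp_continuous_on ballI deriv_cont) auto
  show "continuous_on ({0..1} - (S \<union> S')) (\<lambda>t. f (\<gamma> t))"
    using assms by (rule continuous_on_subset) auto
qed

lemma integrand_bound:
  fixes f :: "complex \<Rightarrow> 'b :: complex_banach"
  shows "t \<in> {0..1} - S \<Longrightarrow> norm (f (\<gamma> t)) \<le> g \<Longrightarrow> norm (\<gamma>' t *\<^sub>C f (\<gamma> t)) \<le> L * g"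
  unfolding norm_scaleC using deriv_bound[of t] L_pos by (intro mult_mono) auto

lemma integrable_integrand:
  assumes "adm f"
  shows "(\<lambda>t. \<gamma>' t *\<^sub>C f (\<gamma> t)) integrable_on {0..1}"
proof -
  obtain S' g where *: "finite S'" "continuous_on ({0..1} - S') (\<lambda>t. f (\<gamma> t))" "g integrable_on {0..1}"
    "\<And>t. t \<in> {0..1} - S' \<Longrightarrow> norm (f (\<gamma> t)) \<le> g t"
    using assms unfolding adm_def by blast
  show ?thesis
  proof (rule integrable_dominated[OF _ integrand_continuous[OF *(2)]])
    show "(\<lambda>t. L * g t) integrable_on {0..1}"
      using *(3) by (rule integrable_on_mult_right)
  qed (use * fin_S integrand_bound in auto)
qed

lemma cint_has_integral: "adm f \<Longrightarrow> ((\<lambda>t. \<gamma>' t *\<^sub>C f (\<gamma> t)) has_integral cint f) {0..1}"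
  unfolding cint_def by (rule integrable_integral[OF integrable_integrand])

lemma cint_cong:
  assumes "finite S'" "\<And>t. t \<in> {0..1} - S' \<Longrightarrow> f (\<gamma> t) = g (\<gamma> t)"
  shows "cint f = cint g"
  unfolding cint_def by (rule integral_spike[OF negligible_finite[OF assms(1)]]) (simp add: assms(2))

lemma adm_linear:
  assumes "adm f" "bounded_linear h"
  shows "adm (\<lambda>z. h (f z))"
proof -
  obtain S' g where *: "finite S'" "continuous_on ({0..1} - S') (\<lambda>t. f (\<gamma> t))" "g integrable_on {0..1}"
    "\<And>t. t \<in> {0..1} - S' \<Longrightarrow> norm (f (\<gamma> t)) \<le> g t"
    using assms unfolding adm_def by blast
  obtain K where K: "K > 0" "\<And>x. norm (h x) \<le> norm x * K" using bounded_linear.pos_bounded[OF assms(2)] by blast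
  show ?thesis
  proof (rule admI[OF *(1)])
    show "continuous_on ({0..1} - S') (\<lambda>t. h (f (\<gamma> t)))"
      by (rule bounded_linear.continuous_on[OF assms(2) *(2)])
    show "(\<lambda>t. g t * K) integrable_on {0..1}" using *(3) by (rule integrable_on_mult_left)
    show "norm (h (f (\<gamma> t))) \<le> g t * K" if "t \<in> {0..1} - S'" for t
    proof -
      have "norm (h (f (\<gamma> t))) \<le> norm (f (\<gamma> t)) * K" by (rule K(2))
      also have "\<dots> \<le> g t * K" using K(1) by (intro mult_right_mono *(4)[OF that]) simp
      finally show ?thesis .
    qed
  qed
qed

lemma cint_linear:
  assumes f: "adm f" and h: "bounded_linear h" and c: "\<And>c x. h (c *\<^sub>C x) = c *\<^sub>C h x"
  shows "cint (\<lambda>z. h (f z)) = h (cint f)"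
proof -
  have "((\<lambda>t. h (\<gamma>' t *\<^sub>C f (\<gamma> t))) has_integral h (cint f)) {0..1}"
    using has_integral_linear[OF cint_has_integral[OF f] h] unfolding o_def .
  then show ?thesis unfolding c cint_def[of "\<lambda>z. h (f z)"] by (rule integral_unique)
qed

lemma adm_scale: "adm f \<Longrightarrow> adm (\<lambda>z. c *\<^sub>C f z)"
  by (rule adm_linear[OF _ bounded_linear_scaleC])

lemma cint_scale: "adm f \<Longrightarrow> cint (\<lambda>z. c *\<^sub>C f z) = c *\<^sub>C cint f"
  by (rule cint_linear[OF _ bounded_linear_scaleC]) (simp_all add: scaleC_scaleC mult.commute)

lemma adm_add:
  assumes "adm f" "adm g"
  shows "adm (\<lambda>z. f z + g z)"
proof -
  obtain S' G where *: "finite S'" "continuous_on ({0..1} - S') (\<lambda>t. f (\<gamma> t))" "G integrable_on {0..1}"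
    "\<And>t. t \<in> {0..1} - S' \<Longrightarrow> norm (f (\<gamma> t)) \<le> G t"
    using assms(1) unfolding adm_def by blast
  obtain S'' H where **: "finite S''" "continuous_on ({0..1} - S'') (\<lambda>t. g (\<gamma> t))" "H integrable_on {0..1}"
    "\<And>t. t \<in> {0..1} - S'' \<Longrightarrow> norm (g (\<gamma> t)) \<le> H t"
    using assms(2) unfolding adm_def by blast
  show ?thesis
  proof (rule admI[of "S' \<union> S''"])
    show "continuous_on ({0..1} - (S' \<union> S'')) (\<lambda>t. f (\<gamma> t) + g (\<gamma> t))"
      by (intro continuous_on_add continuous_on_subset[OF *(2)] continuous_on_subset[OF **(2)]) auto
    show "(\<lambda>t. G t + H t) integrable_on {0..1}" using *(3) **(3) by (rule integrable_add)
    show "norm (f (\<gamma> t) + g (\<gamma> t)) \<le> G t + H t" if "t \<in> {0..1} - (S' \<union> S'')" for t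
      using that by (intro norm_triangle_le add_mono *(4) **(4)) auto
  qed (use * ** in auto)
qed

lemma cint_add: "adm f \<Longrightarrow> adm g \<Longrightarrow> cint (\<lambda>z. f z + g z) = cint f + cint g"
  unfolding cint_def scaleC_add_right by (intro Henstock_Kurzweil_Integration.integral_add integrable_integrand)

lemma adm_minus: "adm f \<Longrightarrow> adm (\<lambda>z. - f z)"
  by (rule adm_linear[OF _ bounded_linear_minus[OF bounded_linear_ident]])

lemma cint_minus: "adm f \<Longrightarrow> cint (\<lambda>z. - f z) = - cint f"
  by (rule cint_linear[OF _ bounded_linear_minus[OF bounded_linear_ident]]) (simp_all add: scaleC_minus_right)

lemma adm_diff: "adm f \<Longrightarrow> adm g \<Longrightarrow> adm (\<lambda>z. f z - g z)"
  using adm_add[of f "\<lambda>z. - g z"] adm_minus[of g] by simp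

lemma cint_diff: "adm f \<Longrightarrow> adm g \<Longrightarrow> cint (\<lambda>z. f z - g z) = cint f - cint g"
  using cint_add[of f "\<lambda>z. - g z"] adm_minus[of g] cint_minus[of g] by simp

lemma cint_bound:
  assumes f: "adm f" and S': "finite S'" and B: "\<And>t. t \<in> {0..1} - S' \<Longrightarrow> norm (f (\<gamma> t)) \<le> B" "B \<ge> 0"
  shows "norm (cint f) \<le> L * B"
proof -
  have "norm (cint f) \<le> (L * B) * measure lborel (cbox 0 (1::real))"
  proof (rule has_integral_bound_spike_finite)
    show "((\<lambda>t. \<gamma>' t *\<^sub>C f (\<gamma> t)) has_integral cint f) (cbox 0 1)"
      using cint_has_integral[OF f] by simp
    show "finite (S \<union> S')" using S' fin_S by simp
    show "norm (\<gamma>' t *\<^sub>C f (\<gamma> t)) \<le> L * B" if "t \<in> cbox 0 1 - (S \<union> S')" for t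
      using that by (intro integrand_bound B) auto
  qed (use B L_pos in auto)
  then show ?thesis by simp
qed

lemma cint_dominated_convergence:
  assumes S': "finite S'" and f: "\<And>n. continuous_on ({0..1} - S') (\<lambda>t. f n (\<gamma> t))"
    and h: "continuous_on ({0..1} - S') (\<lambda>t. h (\<gamma> t))" and g: "g integrable_on {0..1}"
    and fg: "\<And>n t. t \<in> {0..1} - S' \<Longrightarrow> norm (f n (\<gamma> t)) \<le> g t"
    and lim: "\<And>t. t \<in> {0..1} - S' \<Longrightarrow> (\<lambda>n. f n (\<gamma> t)) \<longlonglongrightarrow> h (\<gamma> t)"
  shows "(\<lambda>n. cint (f n)) \<longlonglongrightarrow> cint h"
  unfolding cint_def
proof (rule dominated_convergence_Icc)
  show "finite (S \<union> S')" using S' fin_S by simp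
  show "(\<lambda>t. L * g t) integrable_on {0..1}" using g by (rule integrable_on_mult_right)
  show "(\<lambda>n. \<gamma>' t *\<^sub>C f n (\<gamma> t)) \<longlonglongrightarrow> \<gamma>' t *\<^sub>C h (\<gamma> t)" if "t \<in> {0..1} - (S \<union> S')" for t
    using that by (intro tendsto_scaleC tendsto_const lim) auto
  show "continuous_on ({0..1} - (S \<union> S')) (\<lambda>t. \<gamma>' t *\<^sub>C f n (\<gamma> t))" for n
    by (rule integrand_continuous[OF f])
  show "continuous_on ({0..1} - (S \<union> S')) (\<lambda>t. \<gamma>' t *\<^sub>C h (\<gamma> t))"
    by (rule integrand_continuous[OF h])
  show "norm (\<gamma>' t *\<^sub>C f n (\<gamma> t)) \<le> L * g t" if "t \<in> {0..1} - (S \<union> S')" for n t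
    using that by (intro integrand_bound fg) auto
qed

lemma cint_primitive:
  assumes "\<And>t. \<gamma> t \<in> U" "\<And>z. z \<in> U \<Longrightarrow> (F has_derivative (\<lambda>h. h *\<^sub>C f z)) (at z within U)"
  shows "cint f = 0"
proof -
  have "((\<lambda>t. \<gamma>' t *\<^sub>C f (\<gamma> t)) has_integral (F (\<gamma> 1) - F (\<gamma> 0))) {0..1}"
  proof (rule fundamental_theorem_of_calculus_interior_strong[OF fin_S])
    have "continuous_on U F" by (rule has_derivative_continuous_on[OF assms(2)])
    then show "continuous_on {0..1} (\<lambda>t. F (\<gamma> t))"
      by (rule continuous_on_compose2) (use assms(1) continuous_on_subset[OF cont] in auto)
    fix t assume t: "t \<in> {0<..<1} - S"
    have "(\<gamma> has_derivative (\<lambda>x. x *\<^sub>R \<gamma>' t)) (at t)"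
      using deriv[of t] t unfolding has_vector_derivative_def by auto
    moreover have "(F has_derivative (\<lambda>h. h *\<^sub>C f (\<gamma> t))) (at (\<gamma> t) within range \<gamma>)"
      using assms by (intro has_derivative_subset[OF assms(2)]) auto
    ultimately have "((\<lambda>t. F (\<gamma> t)) has_derivative (\<lambda>x. (x *\<^sub>R \<gamma>' t) *\<^sub>C f (\<gamma> t))) (at t)"
      by (rule has_derivative_in_compose)
    then show "((\<lambda>t. F (\<gamma> t)) has_vector_derivative \<gamma>' t *\<^sub>C f (\<gamma> t)) (at t)"
      unfolding has_vector_derivative_def
      by (simp add: bounded_bilinear.scaleR_left[OF bounded_bilinear_scaleC])
  qed simp
  then show ?thesis using closed_path by (simp add: cint_def integral_unique)
qed

lemma valid_path: "valid_path \<gamma>"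
  unfolding valid_path_def piecewise_C1_differentiable_on_def
proof (intro conjI exI[of _ S] fin_S)
  show "continuous_on {0..1} \<gamma>" using cont continuous_on_subset by blast
  show "\<gamma> C1_differentiable_on {0..1} - S"
    unfolding C1_differentiable_on_def
    using deriv deriv_cont continuous_at_imp_continuous_on by (intro exI[of _ \<gamma>']) blast
qed

lemma closed: "pathfinish \<gamma> = pathstart \<gamma>"
  by (simp add: pathfinish_def pathstart_def closed_path)

lemma contour_integral_eq: "contour_integral \<gamma> f = cint f"
  unfolding contour_integral_integral cint_def
  by (rule integral_spike[OF negligible_finite[OF fin_S]])
    (simp add: vector_derivative_at[OF deriv] mult.commute)

lemma lipschitz:
  assumes "s \<in> {0..1}" "t \<in> {0..1}"
  shows "cmod (\<gamma> t - \<gamma> s) \<le> L * \<bar>t - s\<bar>"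
proof -
  have *: "cmod (\<gamma> t - \<gamma> s) \<le> L * (t - s)" if "0 \<le> s" "s \<le> t" "t \<le> 1" for s t
  proof -
    have "(\<gamma>' has_integral (\<gamma> t - \<gamma> s)) {s..t}"
      using that deriv continuous_on_subset[OF cont]
      by (intro fundamental_theorem_of_calculus_interior_strong[OF fin_S]) auto
    then have "cmod (\<gamma> t - \<gamma> s) \<le> L * measure lborel (cbox s t)"
      using that deriv_bound L_pos by (intro has_integral_bound_spike_finite[OF _ fin_S]) auto
    then show ?thesis using that by simp
  qed
  show ?thesis
    using *[of s t] *[of t s] assms by (cases "s \<le> t") (auto simp: norm_minus_commute)
qed

end

lemma (in unit_points) contour_bd:
  assumes "E_large_enough E u" "0 < u" "u < 1"
  shows "\<exists>\<gamma>' S L. contour (bd u) \<gamma>' S L"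
proof -
  obtain \<gamma>' S L where "finite S \<and> {0, 1} \<subseteq> S \<and> L > 0 \<and> continuous_on UNIV (bd u) \<and>
    (\<forall>t\<in>{0..1}-S. (bd u has_vector_derivative \<gamma>' t) (at t) \<and> isCont \<gamma>' t \<and> cmod (\<gamma>' t) \<le> L)"
    using bd_C1[OF assms] by (elim exE)
  moreover have "bd u 0 = bd u 1" using bd_eq(1)[OF assms] by simp
  ultimately have "contour (bd u) \<gamma>' S L" by unfold_locales auto
  then show ?thesis by blast
qed

lemma E_large_enough_mono: "E_large_enough E r \<Longrightarrow> r \<le> u \<Longrightarrow> E_large_enough E u"
  unfolding E_large_enough_def by fastforce

context unit_points
begin

section \<open>The polynomial vanishing on \<open>E\<close>, and decay at \<open>E\<close>\<close>

definition P :: "complex \<Rightarrow> complex" where "P z = (\<Prod>\<xi>\<in>E. \<xi> - z)"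

lemma P_nonzero: "z \<notin> E \<Longrightarrow> P z \<noteq> 0"
  using fin by (auto simp: P_def)

lemma P_zero: "z \<in> E \<Longrightarrow> P z = 0"
  using fin by (auto simp: P_def)

lemma P_le: "cmod z \<le> 1 \<Longrightarrow> cmod (P z) \<le> 2 ^ card E"
proof -
  assume "cmod z \<le> 1"
  then have "cmod (P z) \<le> (\<Prod>\<xi>\<in>E. 2)"
    unfolding P_def prod_norm[symmetric] using norm_E
    by (intro prod_mono conjI order_trans[OF norm_triangle_ineq4]) auto
  then show ?thesis by simp
qed

lemma P_continuous: "continuous_on A P"
  unfolding P_def by (intro continuous_intros)

lemma P_holomorphic: "P holomorphic_on A"
  unfolding P_def by (intro holomorphic_intros)

text \<open>The ball from \<open>cone_ball\<close> has positive radius unless z \<in> E, so the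
  closure of the smaller domain meets the frontier of the larger one only in
  \<open>E\<close>.\<close>

lemma notin_closure_smaller:
  assumes "E_large_enough E r" "0 < r" "r < u" "u < 1" "z \<notin> E_dom E u" "z \<notin> E"
  shows "z \<notin> closure (E_dom E r)"
proof
  assume z: "z \<in> closure (E_dom E r)"
  obtain \<xi> where \<xi>: "\<xi> \<in> E" "ball z ((u - r) / 2 * cmod (z - \<xi>)) \<subseteq> E_dom E u"
    using cone_ball[OF assms(1-4) z] by blast
  have "z \<noteq> \<xi>" using assms(6) \<xi>(1) by blast
  then have "z \<in> ball z ((u - r) / 2 * cmod (z - \<xi>))" using assms(3) by simp
  then show False using \<xi> assms by blast
qed

lemma closure_subset_larger:
  assumes "E_large_enough E r" "0 < r" "r < u" "u < 1"
  shows "closure (E_dom E r) - E \<subseteq> E_dom E u"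
  using notin_closure_smaller[OF assms] by blast

lemma bd_in_larger:
  assumes "E_large_enough E r" "0 < r" "r < u" "u < 1" "bd r t \<notin> E"
  shows "bd r t \<in> E_dom E u"
  using closure_subset_larger[OF assms(1-4)] bd_eq(3)[OF assms(1,2), of t] assms by auto

text \<open>All exponents are lowered to a common one, at the cost of powers of 2, the diameter of
  the disc. With \<sigma> \<le> 1 the function t powr (\<sigma> - 1) is nonincreasing, as
  \<open>singular_dominated\<close> requires.\<close>

lemma Hinf0_decay:
  assumes "\<phi> \<in> Hinf0 E s" "s < 1"
  shows "\<exists>C \<sigma>. 0 < C \<and> 0 < \<sigma> \<and> \<sigma> \<le> 1 \<and> (\<forall>z\<in>E_dom E s. cmod (\<phi> z) \<le> C * cmod (P z) powr \<sigma>)"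
proof -
  obtain C p where C: "C > 0" and p: "\<And>\<xi>. \<xi> \<in> E \<Longrightarrow> p \<xi> > 0"
    and le: "\<And>z. z \<in> E_dom E s \<Longrightarrow> cmod (\<phi> z) \<le> C * (\<Prod>\<xi>\<in>E. cmod (\<xi> - z) powr p \<xi>)"
    using assms unfolding Hinf0_def by blast
  define \<sigma> where "\<sigma> = min 1 (Min (p ` E))"
  have \<sigma>: "0 < \<sigma>" "\<sigma> \<le> 1" "\<And>\<xi>. \<xi> \<in> E \<Longrightarrow> \<sigma> \<le> p \<xi>"
    using fin ne p by (auto simp: \<sigma>_def min_le_iff_disj)
  define D where "D = (\<Prod>\<xi>\<in>E. 2 powr (p \<xi> - \<sigma>))"
  have "cmod (\<phi> z) \<le> (C * D) * cmod (P z) powr \<sigma>" if z: "z \<in> E_dom E s" for z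
  proof -
    have "cmod (\<xi> - z) powr p \<xi> \<le> 2 powr (p \<xi> - \<sigma>) * cmod (\<xi> - z) powr \<sigma>" if "\<xi> \<in> E" for \<xi>
    proof -
      have "cmod (\<xi> - z) \<le> 2"
        using norm_triangle_ineq4[of \<xi> z] norm_E[OF that] E_dom_ball[OF assms(2)] z by fastforce
      then have "cmod (\<xi> - z) powr (p \<xi> - \<sigma>) \<le> 2 powr (p \<xi> - \<sigma>)"
        using \<sigma>(3)[OF that] by (intro powr_mono2) auto
      then have "cmod (\<xi> - z) powr (p \<xi> - \<sigma>) * cmod (\<xi> - z) powr \<sigma> \<le> 2 powr (p \<xi> - \<sigma>) * cmod (\<xi> - z) powr \<sigma>"
        by (intro mult_right_mono) auto
      then show ?thesis by (simp flip: powr_add)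
    qed
    then have "(\<Prod>\<xi>\<in>E. cmod (\<xi> - z) powr p \<xi>) \<le> (\<Prod>\<xi>\<in>E. 2 powr (p \<xi> - \<sigma>) * cmod (\<xi> - z) powr \<sigma>)"
      by (intro prod_mono) auto
    also have "\<dots> = D * cmod (P z) powr \<sigma>"
      by (simp add: D_def P_def prod.distrib prod_powr_distrib flip: prod_norm)
    finally have "C * (\<Prod>\<xi>\<in>E. cmod (\<xi> - z) powr p \<xi>) \<le> C * (D * cmod (P z) powr \<sigma>)"
      using C by (intro mult_left_mono) auto
    with le[OF z] show ?thesis by (simp add: mult.assoc)
  qed
  moreover have "C * D > 0" using C by (auto simp: D_def intro!: mult_pos_pos prod_pos)
  ultimately show ?thesis using \<sigma> by blast
qed

lemma Hinf0I:
  assumes "\<phi> holomorphic_on E_dom E s" "s < 1" "\<sigma> > 0" "C \<ge> 0"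
    and le: "\<And>z. z \<in> E_dom E s \<Longrightarrow> cmod (\<phi> z) \<le> C * cmod (P z) powr \<sigma>"
  shows "\<phi> \<in> Hinf0 E s"
  unfolding Hinf0_def
proof (intro CollectI conjI exI[of _ "C + 1"] exI[of _ "\<lambda>_. \<sigma>"] ballI)
  have 1: "cmod (P z) \<le> 2 ^ card E" if "z \<in> E_dom E s" for z
    using P_le that E_dom_ball[OF assms(2)] by (intro P_le) fastforce
  show "bounded (\<phi> ` E_dom E s)"
    unfolding bounded_iff
  proof (intro exI[of _ "C * (2 ^ card E) powr \<sigma>"] ballI, elim imageE, simp only:)
    fix z assume z: "z \<in> E_dom E s"
    show "cmod (\<phi> z) \<le> C * (2 ^ card E) powr \<sigma>"
      using le[OF z] 1[OF z] assms by (elim order_trans) (intro mult_left_mono powr_mono2, auto)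
  qed
  show "cmod (\<phi> z) \<le> (C + 1) * (\<Prod>\<xi>\<in>E. cmod (\<xi> - z) powr \<sigma>)" if z: "z \<in> E_dom E s" for z
  proof -
    have "(\<Prod>\<xi>\<in>E. cmod (\<xi> - z) powr \<sigma>) = cmod (P z) powr \<sigma>"
      by (simp add: P_def prod_powr_distrib flip: prod_norm)
    moreover have "C * cmod (P z) powr \<sigma> \<le> (C + 1) * cmod (P z) powr \<sigma>"
      by (rule mult_right_mono) auto
    ultimately show ?thesis using le[OF z] by simp
  qed
qed (use assms in auto)

lemma powr_integrable:
  assumes "\<sigma> > 0"
  shows "(\<lambda>t. \<bar>t - y\<bar> powr (\<sigma> - 1)) integrable_on {0..1::real}"
proof -
  let ?f = "\<lambda>x :: real. \<bar>x\<bar> powr (\<sigma> - 1)"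
  have pos: "?f integrable_on {0..c}" if "c \<ge> 0" for c :: real
    by (rule integrable_eq[OF integrable_on_powr_from_0[of "\<sigma> - 1" c]]) (use that assms in auto)
  define c where "c = \<bar>y\<bar> + 1"
  have c: "c \<ge> 0" by (simp add: c_def)
  have "((\<lambda>x. ?f (- x)) integrable_on {- c..- 0}) = (?f integrable_on {0..c})"
    by (rule Henstock_Kurzweil_Integration.integrable_reflect_real)
  then have "(\<lambda>x. ?f (- x)) integrable_on {- c..- 0}" using pos[OF c] by (rule iffD2)
  then have "?f integrable_on {- c..0}" by (simp only: abs_minus_cancel minus_zero)
  then have "?f integrable_on {- c..c}"
    using pos[OF c] c by (intro Henstock_Kurzweil_Integration.integrable_combine[of "- c" 0 c]) auto
  then have "?f integrable_on {0 + - y..1 + - y}"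
    by (rule integrable_subinterval_real) (auto simp: c_def)
  then have "(?f \<circ> (+) (- y)) integrable_on {0..1}"
    by (rule integrable_on_shift_Icc_real[where f = ?f and c = "- y" and a = 0 and b = 1, THEN iffD2])
  moreover have "?f \<circ> (+) (- y) = (\<lambda>t. \<bar>t - y\<bar> powr (\<sigma> - 1))"
    by (auto simp: fun_eq_iff)
  ultimately show ?thesis by (simp only:)
qed

text \<open>The nearest point of \<open>E\<close> contributes the distance, and every other factor
  is bounded below by half the minimal separation of \<open>E\<close>.\<close>

lemma P_lower: "\<exists>c>0. \<forall>z. cmod z \<le> 1 \<longrightarrow> (\<exists>\<xi>\<in>E. cmod (P z) \<ge> c * cmod (z - \<xi>))"
proof -
  \<comment> \<open>The entry 1 makes the minimum meaningful when \<open>E\<close> is a single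
    point, and it forces d \<le> 1, so that powers of \<open>d\<close> decrease.\<close>
  define D where "D = insert 1 ((\<lambda>(\<xi>, \<eta>). cmod (\<xi> - \<eta>) / 2) ` {(\<xi>, \<eta>) \<in> E \<times> E. \<xi> \<noteq> \<eta>})"
  define d where "d = Min D"
  have fD: "finite D" unfolding D_def using fin by (intro finite.insertI finite_imageI) (auto intro: finite_subset[of _ "E \<times> E"])
  have d0: "0 < d" unfolding d_def using fD by (subst Min_gr_iff) (auto simp: D_def)
  have d1: "d \<le> 1" unfolding d_def using fD by (intro Min_le) (auto simp: D_def)
  have dd: "2 * d \<le> cmod (\<xi> - \<eta>)" if "\<xi> \<in> E" "\<eta> \<in> E" "\<xi> \<noteq> \<eta>" for \<xi> \<eta>
  proof -
    have "d \<le> cmod (\<xi> - \<eta>) / 2" unfolding d_def using fD that by (intro Min_le) (auto simp: D_def)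
    then show ?thesis by simp
  qed
  have "\<exists>\<xi>\<in>E. cmod (P z) \<ge> d ^ card E * cmod (z - \<xi>)" for z
  proof -
    define m where "m = Min ((\<lambda>\<xi>. cmod (z - \<xi>)) ` E)"
    have "m \<in> (\<lambda>\<xi>. cmod (z - \<xi>)) ` E" unfolding m_def using fin ne by (intro Min_in) auto
    then obtain \<xi> where \<xi>: "\<xi> \<in> E" "m = cmod (z - \<xi>)" by blast
    have near: "cmod (z - \<xi>) \<le> cmod (z - \<eta>)" if "\<eta> \<in> E" for \<eta>
      unfolding \<xi>(2)[symmetric] m_def using that fin by (intro Min_le) auto
    have far: "d \<le> cmod (\<eta> - z)" if "\<eta> \<in> E - {\<xi>}" for \<eta>
    proof -
      have "2 * d \<le> cmod (\<xi> - \<eta>)" using dd \<xi> that by auto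
      also have "\<dots> \<le> cmod (z - \<xi>) + cmod (z - \<eta>)"
        using norm_triangle_ineq4[of "z - \<eta>" "z - \<xi>"] by simp
      also have "\<dots> \<le> 2 * cmod (z - \<eta>)" using near that by auto
      finally show ?thesis by (simp add: norm_minus_commute)
    qed
    have "d ^ card E * cmod (z - \<xi>) \<le> d ^ card (E - {\<xi>}) * cmod (z - \<xi>)"
      using d0 d1 fin by (intro mult_right_mono power_decreasing card_mono) auto
    also have "d ^ card (E - {\<xi>}) = (\<Prod>\<eta>\<in>E-{\<xi>}. d)" by simp
    also have "\<dots> * cmod (z - \<xi>) \<le> (\<Prod>\<eta>\<in>E-{\<xi>}. cmod (\<eta> - z)) * cmod (z - \<xi>)"
      using far d0 by (intro mult_right_mono prod_mono) auto
    also have "\<dots> = cmod (P z)"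
      unfolding P_def using fin \<xi> by (simp add: prod.remove[of E \<xi>] norm_mult prod_norm norm_minus_commute mult.commute)
    finally show ?thesis using \<xi> by blast
  qed
  then show ?thesis using d0 by (intro exI[of _ "d ^ card E"]) auto
qed

text \<open>Along the boundary |P| dominates the distance of the parameter to one of finitely many
  parameters, and powers with exponent \<sigma> - 1 > -1 are integrable. The shifts by 1 account for
  the identification of the parameters 0 and 1.\<close>

lemma singular_dominated:
  assumes u: "E_large_enough E u" "0 < u" "u < 1" and \<sigma>: "0 < \<sigma>" "\<sigma> \<le> 1"
  shows "\<exists>g. g integrable_on {0..1} \<and> (\<forall>t\<in>{0..1}. bd u t \<notin> E \<longrightarrow> cmod (P (bd u t)) powr (\<sigma> - 1) \<le> g t)"
proof -
  obtain c where c: "c > 0" "\<And>z. cmod z \<le> 1 \<Longrightarrow> \<exists>\<xi>\<in>E. cmod (P z) \<ge> c * cmod (z - \<xi>)"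
    using P_lower by blast
  obtain X where X: "\<forall>\<xi>\<in>E. X \<xi> \<in> {0..<1} \<and> \<xi> = cis (2 * pi * X \<xi>)"
    using E_param by metis
  define g where "g t = c powr (\<sigma> - 1) * (\<Sum>\<xi>\<in>E. \<Sum>y\<in>{X \<xi> - 1, X \<xi>, X \<xi> + 1}. \<bar>t - y\<bar> powr (\<sigma> - 1))" for t :: real
  have "g integrable_on {0..1}"
    unfolding g_def by (intro integrable_on_mult_right integrable_sum powr_integrable \<sigma>) (use fin in auto)
  moreover have "cmod (P (bd u t)) powr (\<sigma> - 1) \<le> g t" if t: "t \<in> {0..1}" "bd u t \<notin> E" for t
  proof -
    have "cmod (bd u t) \<le> 1" using bd_eq(3)[OF u, of t] closure_E_dom_cball[OF u(3)] by auto
    then obtain \<xi> where \<xi>: "\<xi> \<in> E" "cmod (P (bd u t)) \<ge> c * cmod (bd u t - \<xi>)" using c by blast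
    let ?x = "X \<xi>"
    have x: "?x \<in> {0..1}" "\<xi> = cis (2 * pi * ?x)" using X \<xi> by auto
    define m where "m = min \<bar>t - ?x\<bar> (1 - \<bar>t - ?x\<bar>)"
    have "m \<noteq> 0"
    proof
      assume "m = 0"
      then have "t = ?x \<or> t = ?x + 1 \<or> t = ?x - 1" by (auto simp: m_def min_def abs_if split: if_splits)
      then have "cis (2 * pi * t) = \<xi>"
        using x by (auto simp: ring_distribs cis_mult[symmetric] cis_divide[symmetric])
      then show False using bd_at_E[OF u(2,3), of t] \<xi> t by auto
    qed
    moreover have "m \<ge> 0" using t x by (auto simp: m_def min_def abs_if)
    ultimately have m: "m > 0" by simp
    have "m \<le> cmod (bd u t - \<xi>)"
      using bd_dist_ge[OF u t(1) x(1)] x(2) \<xi>(1) by (simp add: m_def)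
    then have "c * m \<le> cmod (P (bd u t))" using \<xi>(2) c(1) by (meson mult_left_mono order_trans less_imp_le)
    then have "cmod (P (bd u t)) powr (\<sigma> - 1) \<le> (c * m) powr (\<sigma> - 1)"
      using c m \<sigma> by (intro powr_mono2') auto
    also have "\<dots> = c powr (\<sigma> - 1) * m powr (\<sigma> - 1)" using c m by (simp add: powr_mult)
    also have "\<dots> \<le> g t"
      unfolding g_def
    proof (rule mult_left_mono)
      have "\<exists>y\<in>{?x - 1, ?x, ?x + 1}. m = \<bar>t - y\<bar>"
      proof (cases "m = \<bar>t - ?x\<bar>")
        case False
        then have m1: "m = 1 - \<bar>t - ?x\<bar>" by (simp add: m_def min_def split: if_splits)
        show ?thesis
          using t x m1 by (cases "?x \<le> t") (auto simp: abs_if)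
      qed auto
      then obtain y where y: "y \<in> {?x - 1, ?x, ?x + 1}" "m = \<bar>t - y\<bar>" by blast
      have "m powr (\<sigma> - 1) \<le> (\<Sum>y\<in>{?x - 1, ?x, ?x + 1}. \<bar>t - y\<bar> powr (\<sigma> - 1))"
        unfolding y(2) using y(1) by (intro member_le_sum) auto
      also have "\<dots> \<le> (\<Sum>\<xi>\<in>E. \<Sum>y\<in>{X \<xi> - 1, X \<xi>, X \<xi> + 1}. \<bar>t - y\<bar> powr (\<sigma> - 1))"
        using \<xi> fin by (intro member_le_sum[of \<xi> E "\<lambda>\<xi>. \<Sum>y\<in>{X \<xi> - 1, X \<xi>, X \<xi> + 1}. \<bar>t - y\<bar> powr (\<sigma> - 1)"] sum_nonneg) auto
      finally show "m powr (\<sigma> - 1) \<le> (\<Sum>\<xi>\<in>E. \<Sum>y\<in>{X \<xi> - 1, X \<xi>, X \<xi> + 1}. \<bar>t - y\<bar> powr (\<sigma> - 1))" .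
    qed simp
    finally show ?thesis .
  qed
  ultimately show ?thesis by blast
qed

end

section \<open>Growth of the resolvent near \<open>E\<close>\<close>

locale ritt_operator = unit_points E for E :: "complex set" +
  fixes T :: "'a :: complex_banach \<Rightarrow>\<^sub>L 'a" and r0 :: real
  assumes type: "ritt_type E r0 T"
begin

lemma r0: "0 < r0" "r0 < 1"
  using type by (auto simp: ritt_type_def)

lemma large: "r0 \<le> u \<Longrightarrow> E_large_enough E u"
  using type E_large_enough_mono by (auto simp: ritt_type_def)

lemma T_linear: "complex_linear_op T"
  using type by (auto simp: ritt_type_def ritt_op_def)

lemma spectrum_subset: "spectrum_op T \<subseteq> closure (E_dom E r0)"
  using type by (auto simp: ritt_type_def)

lemma notin_spectrum:
  assumes "r0 < u" "u < 1" "z \<notin> E_dom E u" "z \<notin> E"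
  shows "z \<notin> spectrum_op T"
  using notin_closure_smaller[OF large[OF order_refl] r0(1) assms] spectrum_subset by blast

lemma resolvent_bound:
  assumes u: "r0 < u" "u < 1"
  shows "\<exists>C>0. \<forall>z. cmod z < 2 \<longrightarrow> z \<notin> E_dom E u \<longrightarrow> z \<notin> E \<longrightarrow> cmod (P z) * norm (resolvent z T) \<le> C"
proof -
  \<comment> \<open>The type condition gives a bound off the closure of \<open>E_dom E s\<close> for
    s > r0. With s < u this region contains the frontier of \<open>E_dom E u\<close> except
    \<open>E\<close>.\<close>
  define s where "s = (r0 + u) / 2"
  have s: "r0 < s" "s < u" "s < 1" using u by (auto simp: s_def)
  have "bounded ((\<lambda>z. (\<Prod>\<xi>\<in>E. \<xi> - z) *\<^sub>C resolvent z T) ` (ball 0 2 - closure (E_dom E s)))"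
    using type s by (auto simp: ritt_type_def)
  then obtain C where C: "C > 0" "\<And>z. z \<in> ball 0 2 - closure (E_dom E s) \<Longrightarrow> norm (P z *\<^sub>C resolvent z T) \<le> C"
    unfolding bounded_pos P_def by blast
  have "cmod (P z) * norm (resolvent z T) \<le> C" if "cmod z < 2" "z \<notin> E_dom E u" "z \<notin> E" for z
    using C(2)[of z] notin_closure_smaller[OF large _ s(2) u(2) that(2,3)] s r0 that by (simp add: norm_scaleC)
  then show ?thesis using C(1) by blast
qed

text \<open>The decay |P| powr \<sigma> of \<phi> meets the growth 1 / |P| of the resolvent, which
  leaves the integrable singularity |P| powr (\<sigma> - 1).\<close>

lemma adm_Hinf0:
  assumes u: "r0 < u" "u < s" "s < 1" and \<phi>: "\<phi> \<in> Hinf0 E s" and \<gamma>: "contour (bd u) \<gamma>' S L"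
  shows "\<exists>g. g integrable_on {0..1} \<and>
      (\<forall>t\<in>{0..1} - {t\<in>{0..1}. bd u t \<in> E}. cmod (\<phi> (bd u t)) * norm (resolvent (bd u t) T) \<le> g t)"
    and "continuous_on ({0..1} - {t\<in>{0..1}. bd u t \<in> E}) (\<lambda>t. \<phi> (bd u t) *\<^sub>C resolvent (bd u t) T)"
    and "contour.adm (bd u) (\<lambda>z. \<phi> z *\<^sub>C resolvent z T)"
proof -
  interpret contour "bd u" \<gamma>' S L by (rule \<gamma>)
  have u': "E_large_enough E u" "0 < u" "u < 1" using u r0 large by auto
  obtain C \<sigma> where C: "0 < C" "0 < \<sigma>" "\<sigma> \<le> 1" "\<And>z. z \<in> E_dom E s \<Longrightarrow> cmod (\<phi> z) \<le> C * cmod (P z) powr \<sigma>"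
    using Hinf0_decay[OF \<phi> u(3)] by blast
  obtain D where D: "D > 0" "\<And>z. cmod z < 2 \<Longrightarrow> z \<notin> E_dom E u \<Longrightarrow> z \<notin> E \<Longrightarrow> cmod (P z) * norm (resolvent z T) \<le> D"
    using resolvent_bound[OF u(1) u'(3)] by blast
  obtain g where g: "g integrable_on {0..1}" "\<And>t. t \<in> {0..1} \<Longrightarrow> bd u t \<notin> E \<Longrightarrow> cmod (P (bd u t)) powr (\<sigma> - 1) \<le> g t"
    using singular_dominated[OF u' C(2,3)] by blast
  have in_s: "bd u t \<in> E_dom E s" if "bd u t \<notin> E" for t
    using bd_in_larger[OF u'(1,2) u(2,3) that] .
  have le1: "cmod (bd u t) \<le> 1" for t
    using bd_eq(3)[OF u', of t] closure_E_dom_cball[OF u'(3)] by auto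
  have bound: "cmod (\<phi> (bd u t)) * norm (resolvent (bd u t) T) \<le> C * D * g t"
    if t: "t \<in> {0..1}" "bd u t \<notin> E" for t
  proof -
    let ?z = "bd u t"
    have Pz: "cmod (P ?z) > 0" using P_nonzero t by simp
    have "cmod (P ?z) * norm (resolvent ?z T) \<le> D"
      using D(2)[of ?z] le1[of t] bd_eq(4)[OF u', of t] t by auto
    then have R: "norm (resolvent ?z T) \<le> D / cmod (P ?z)" using Pz by (simp add: field_simps)
    have "cmod (\<phi> ?z) * norm (resolvent ?z T) \<le> (C * cmod (P ?z) powr \<sigma>) * (D / cmod (P ?z))"
      using C in_s[OF t(2)] R by (intro mult_mono) auto
    also have "\<dots> = C * D * cmod (P ?z) powr (\<sigma> - 1)" using Pz by (simp add: powr_diff)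
    also have "\<dots> \<le> C * D * g t" using C D g(2) t by (intro mult_left_mono) auto
    finally show ?thesis .
  qed
  have gi: "(\<lambda>t. C * D * g t) integrable_on {0..1}" using g(1) by (rule integrable_on_mult_right)
  show 1: "\<exists>g. g integrable_on {0..1} \<and>
      (\<forall>t\<in>{0..1} - {t\<in>{0..1}. bd u t \<in> E}. cmod (\<phi> (bd u t)) * norm (resolvent (bd u t) T) \<le> g t)"
    using gi bound by (intro exI[of _ "\<lambda>t. C * D * g t"]) auto
  show 2: "continuous_on ({0..1} - {t\<in>{0..1}. bd u t \<in> E}) (\<lambda>t. \<phi> (bd u t) *\<^sub>C resolvent (bd u t) T)"
  proof (rule continuous_on_scaleC)
    have "continuous_on (E_dom E s) \<phi>" using \<phi> by (auto simp: Hinf0_def intro: holomorphic_on_imp_continuous_on)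
    then show "continuous_on ({0..1} - {t\<in>{0..1}. bd u t \<in> E}) (\<lambda>t. \<phi> (bd u t))"
      by (rule continuous_on_compose2) (use in_s continuous_on_subset[OF cont] in auto)
    show "continuous_on ({0..1} - {t\<in>{0..1}. bd u t \<in> E}) (\<lambda>t. resolvent (bd u t) T)"
      by (rule continuous_on_compose2[OF continuous_on_resolvent])
        (use notin_spectrum[OF u(1) u'(3) bd_eq(4)[OF u']] continuous_on_subset[OF cont] in auto)
  qed
  show "adm (\<lambda>z. \<phi> z *\<^sub>C resolvent z T)"
    using 1 by (elim exE conjE) (rule admI[OF finite_bd_E[OF u'] 2], auto simp: norm_scaleC)
qed

end

section \<open>Cauchy's theorem on the domains\<close>

lemma (in contour) cint_scalar_const: "adm f \<Longrightarrow> cint (\<lambda>z. f z *\<^sub>C x) = cint f *\<^sub>C (x :: 'b :: complex_banach)"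
  by (rule cint_linear) (simp_all add: scaleC_scaleC bounded_bilinear.bounded_linear_left[OF bounded_bilinear_scaleC])

lemma (in contour) adm_continuous:
  fixes f :: "complex \<Rightarrow> 'b :: complex_banach"
  assumes "continuous_on {0..1} (\<lambda>t. f (\<gamma> t))"
  shows "adm f"
proof -
  have "compact ((\<lambda>t. f (\<gamma> t)) ` {0..1})" by (intro compact_continuous_image assms) simp
  then obtain B where "\<forall>x\<in>(\<lambda>t. f (\<gamma> t)) ` {0..1}. norm x \<le> B"
    using compact_imp_bounded bounded_iff by metis
  then show ?thesis by (intro admI[of "{}" f "\<lambda>_. B"]) (use assms in auto)
qed

context unit_points
begin

lemma bd_path_image: "E_large_enough E u \<Longrightarrow> 0 < u \<Longrightarrow> u < 1 \<Longrightarrow> path_image (bd u) \<subseteq> closure (E_dom E u) - E_dom E u"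
  using bd_eq(3,4) by (auto simp: path_image_def)

text \<open>Each boundary point lies on the same ray as the corresponding point of the unit circle,
  so the straight homotopy between the two paths avoids 0. Inside the domain the index is
  constant.\<close>

lemma winding_bd:
  assumes u: "E_large_enough E u" "0 < u" "u < 1" and z: "z \<in> E_dom E u"
  shows "winding_number (bd u) z = 1"
proof -
  obtain \<gamma>' S L where \<gamma>: "contour (bd u) \<gamma>' S L" using contour_bd[OF u] by blast
  interpret contour "bd u" \<gamma>' S L by (rule \<gamma>)
  have path: "path (bd u)" using valid_path valid_path_imp_path by blast
  have "winding_number (bd u) 0 = winding_number (circlepath 0 1) 0"
  proof (rule winding_number_loops_linear_eq)
    show "0 \<notin> closed_segment (circlepath 0 1 t) (bd u t)" if "t \<in> {0..1}" for t
    proof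
      define g where "g = 1 / gauge E u (cis (2 * pi * t))"
      have g: "g > 0" using bd_eq(2)[OF u, of t] by (auto simp: g_def intro!: divide_pos_pos)
      have c: "circlepath 0 1 t = cis (2 * pi * t)" by (simp add: circlepath cis_conv_exp mult_ac)
      assume "0 \<in> closed_segment (circlepath 0 1 t) (bd u t)"
      then obtain x where x: "0 \<le> x" "x \<le> 1" "0 = (1 - x) *\<^sub>R circlepath 0 1 t + x *\<^sub>R bd u t"
        unfolding in_segment by blast
      have "0 = of_real ((1 - x) + x * g) * cis (2 * pi * t)"
        using x(3) unfolding c bd_eq(1)[OF u] g_def by (simp add: scaleR_conv_of_real algebra_simps)
      then have "(1 - x) + x * g = 0" by (metis cis_neq_zero mult_eq_0_iff of_real_eq_0_iff)
      moreover have "(1 - x) + x * g > 0"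
        using x g by (cases "x = 1") (auto intro!: add_pos_nonneg)
      ultimately show False by simp
    qed
  qed (use path closed in auto)
  also have "\<dots> = 1" by (rule winding_number_circlepath_centre) simp
  finally have 0: "winding_number (bd u) 0 = 1" .
  have "winding_number (bd u) constant_on (E_dom E u)"
    using bd_path_image[OF u]
    by (intro winding_number_constant path closed convex_connected[OF E_dom_convex]) auto
  then show ?thesis
    using 0 z zero_in_E_dom[OF u(2)] unfolding constant_on_def by metis
qed

text \<open>The path is the frontier itself, where \<open>f\<close> is only continuous; hence the
  form of Cauchy's theorem for a convex set with differentiability required in its interior.\<close>

lemma cauchy_zero:
  assumes u: "E_large_enough E u" "0 < u" "u < 1" and \<gamma>: "contour (bd u) \<gamma>' S L"
    and f: "continuous_on (closure (E_dom E u)) f" "f holomorphic_on E_dom E u"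
  shows "contour.cint (bd u) \<gamma>' f = 0"
proof -
  interpret contour "bd u" \<gamma>' S L by (rule \<gamma>)
  have "(f has_contour_integral 0) (bd u)"
  proof (rule Cauchy_theorem_convex[OF f(1) convex_closure[OF E_dom_convex] finite.emptyI _ valid_path _ closed])
    show "f field_differentiable at x" if "x \<in> interior (closure (E_dom E u)) - {}" for x
      using that f(2) unfolding interior_closure_E_dom
      by (auto intro: holomorphic_on_imp_differentiable_at)
    show "path_image (bd u) \<subseteq> closure (E_dom E u)" using bd_path_image[OF u] by blast
  qed
  then show ?thesis using contour_integral_eq[of f] contour_integral_unique by metis
qed

lemma cauchy_formula:
  assumes u: "E_large_enough E u" "0 < u" "u < 1" and \<gamma>: "contour (bd u) \<gamma>' S L"
    and f: "continuous_on (closure (E_dom E u)) f" "f holomorphic_on E_dom E u" and z: "z \<in> E_dom E u"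
  shows "contour.cint (bd u) \<gamma>' (\<lambda>w. f w / (w - z)) = 2 * of_real pi * \<i> * f z"
proof -
  interpret contour "bd u" \<gamma>' S L by (rule \<gamma>)
  have "((\<lambda>w. f w / (w - z)) has_contour_integral (2 * pi * \<i> * winding_number (bd u) z * f z)) (bd u)"
  proof (rule Cauchy_integral_formula_weak[OF convex_closure[OF E_dom_convex] finite.emptyI f(1) _ _ valid_path _ closed])
    show "f field_differentiable at x" if "x \<in> interior (closure (E_dom E u)) - {}" for x
      using that f(2) unfolding interior_closure_E_dom
      by (auto intro: holomorphic_on_imp_differentiable_at)
    show "z \<in> interior (closure (E_dom E u)) - {}" using z by (simp add: interior_closure_E_dom)
    show "path_image (bd u) \<subseteq> closure (E_dom E u) - {z}" using bd_path_image[OF u] z by blast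
  qed
  then show ?thesis
    using contour_integral_eq[of "\<lambda>w. f w / (w - z)"] contour_integral_unique winding_bd[OF u z] by fastforce
qed

text \<open>Membership in \<open>Hinf0\<close> says nothing about values at \<open>E\<close>, where
  the contour passes; the decay dictates the continuous boundary value 0.\<close>

definition ext0 :: "(complex \<Rightarrow> complex) \<Rightarrow> complex \<Rightarrow> complex" where
  "ext0 f z = (if z \<in> E then 0 else f z)"

lemma ext0_props:
  assumes f: "f \<in> Hinf0 E s" and u: "E_large_enough E u" "0 < u" "u < s" "s < 1"
  shows "continuous_on (closure (E_dom E u)) (ext0 f)" and "ext0 f holomorphic_on E_dom E u"
proof -
  have hol: "f holomorphic_on E_dom E s" using f by (simp add: Hinf0_def)
  obtain C \<sigma> where C: "0 < C" "0 < \<sigma>" "\<And>z. z \<in> E_dom E s \<Longrightarrow> cmod (f z) \<le> C * cmod (P z) powr \<sigma>"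
    using Hinf0_decay[OF f u(4)] by blast
  have sub: "closure (E_dom E u) - E \<subseteq> E_dom E s" by (rule closure_subset_larger[OF u])
  have disj: "E_dom E s \<inter> E = {}" using E_dom_disjoint[OF u(4)] by blast
  have hol2: "ext0 f holomorphic_on E_dom E s"
    by (rule holomorphic_transform[OF hol]) (use disj in \<open>auto simp: ext0_def\<close>)
  then show "ext0 f holomorphic_on E_dom E u"
    by (rule holomorphic_on_subset) (rule E_dom_mono, use u in simp)
  show "continuous_on (closure (E_dom E u)) (ext0 f)"
    unfolding continuous_on_eq_continuous_within
  proof
    fix z assume z: "z \<in> closure (E_dom E u)"
    show "continuous (at z within closure (E_dom E u)) (ext0 f)"
    proof (cases "z \<in> E")
      case False
      then have "z \<in> E_dom E s" using z sub by blast
      then have "isCont (ext0 f) z"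
        using holomorphic_on_imp_continuous_on[OF hol2] E_dom_open continuous_on_eq_continuous_at by blast
      then show ?thesis by (rule continuous_at_imp_continuous_at_within)
    next
      case True
      have "((\<lambda>w. C * cmod (P w) powr \<sigma>) \<longlongrightarrow> C * cmod (P z) powr \<sigma>) (at z within closure (E_dom E u))"
        using P_continuous[of UNIV] C(2)
        by (intro tendsto_intros tendsto_powr') (auto simp: continuous_on_def intro: tendsto_within_subset)
      then have lim: "((\<lambda>w. C * cmod (P w) powr \<sigma>) \<longlongrightarrow> 0) (at z within closure (E_dom E u))"
        using P_zero[OF True] by simp
      have "((ext0 f) \<longlongrightarrow> 0) (at z within closure (E_dom E u))"
      proof (rule Lim_null_comparison[OF _ lim])
        show "\<forall>\<^sub>F w in at z within closure (E_dom E u). norm (ext0 f w) \<le> C * cmod (P w) powr \<sigma>"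
          unfolding eventually_at_filter
          using sub C by (intro always_eventually) (auto simp: ext0_def)
      qed
      then show ?thesis using True by (simp add: continuous_within ext0_def)
    qed
  qed
qed

end

context ritt_operator
begin

section \<open>Integrals of functions against the resolvent\<close>

lemma large_u: "r0 < u \<Longrightarrow> u < 1 \<Longrightarrow> E_large_enough E u \<and> 0 < u"
  using large r0 by auto

definition I :: "real \<Rightarrow> (complex \<Rightarrow> complex) \<Rightarrow> 'a \<Rightarrow>\<^sub>L 'a" where
  "I u f = vector_contour_integral (bd u) (\<lambda>z. f z *\<^sub>C resolvent z T)"

lemma Hinf_calc_at_eq: "Hinf_calc_at E u T f = (1 / (2 * of_real pi * \<i>)) *\<^sub>C I u f"
  by (simp add: Hinf_calc_at_def I_def)

lemma I_add:
  assumes "r0 < u" "u < s" "s < 1" "f \<in> Hinf0 E s" "g \<in> Hinf0 E s"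
  shows "I u (\<lambda>z. f z + g z) = I u f + I u g"
proof -
  obtain \<gamma>' S L where \<gamma>: "contour (bd u) \<gamma>' S L" using contour_bd large_u[of u] assms by force
  interpret contour "bd u" \<gamma>' S L by (rule \<gamma>)
  show ?thesis
    unfolding I_def vector_contour_integral_eq scaleC_add_left
    by (intro cint_add adm_Hinf0(3)[OF assms(1-3) _ \<gamma>] assms)
qed

lemma I_scale:
  assumes "r0 < u" "u < s" "s < 1" "f \<in> Hinf0 E s"
  shows "I u (\<lambda>z. c * f z) = c *\<^sub>C I u f"
proof -
  obtain \<gamma>' S L where \<gamma>: "contour (bd u) \<gamma>' S L" using contour_bd large_u[of u] assms by force
  interpret contour "bd u" \<gamma>' S L by (rule \<gamma>)
  show ?thesis
    unfolding I_def vector_contour_integral_eq scaleC_scaleC[symmetric]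
    by (intro cint_scale adm_Hinf0(3)[OF assms(1-3) _ \<gamma>] assms)
qed

lemma inverse_bounded_off_closure:
  assumes "a \<notin> closure A"
  shows "\<exists>B>0. \<forall>z\<in>A. cmod (1 / (a - z)) \<le> B"
proof -
  obtain d where d: "d > 0" "\<And>z. z \<in> closure A \<Longrightarrow> d \<le> dist a z"
    using separate_point_closed[of "closure A" a] assms by auto
  have "cmod (1 / (a - z)) \<le> 1 / d" if "z \<in> A" for z
  proof -
    have "d \<le> cmod (a - z)" using d(2)[of z] closure_subset[of A] that by (auto simp: dist_norm)
    then show ?thesis using d(1) by (simp add: norm_divide frac_le)
  qed
  then show ?thesis using d(1) by (intro exI[of _ "1 / d"]) auto
qed

lemma Hinf0_mult:
  assumes "f \<in> Hinf0 E s" "s < 1" "g holomorphic_on E_dom E s" "\<And>z. z \<in> E_dom E s \<Longrightarrow> cmod (g z) \<le> B"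
  shows "(\<lambda>z. f z * g z) \<in> Hinf0 E s"
proof -
  obtain C \<sigma> where C: "0 < C" "0 < \<sigma>" "\<And>z. z \<in> E_dom E s \<Longrightarrow> cmod (f z) \<le> C * cmod (P z) powr \<sigma>"
    using Hinf0_decay[OF assms(1,2)] by blast
  show ?thesis
  proof (rule Hinf0I[OF _ assms(2) C(2)])
    show "(\<lambda>z. f z * g z) holomorphic_on E_dom E s"
      using assms by (intro holomorphic_intros) (auto simp: Hinf0_def)
    show "C * max B 0 \<ge> 0" using C by simp
    fix z assume z: "z \<in> E_dom E s"
    have "cmod (f z * g z) \<le> (C * cmod (P z) powr \<sigma>) * max B 0"
      unfolding norm_mult using C assms(4)[OF z] z by (intro mult_mono) auto
    then show "cmod (f z * g z) \<le> C * max B 0 * cmod (P z) powr \<sigma>" by (simp add: mult_ac)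
  qed
qed

lemma Hinf0_divide:
  assumes f: "f \<in> Hinf0 E s" "s < 1" and a: "a \<notin> closure (E_dom E s)"
  shows "(\<lambda>z. f z / (a - z)) \<in> Hinf0 E s"
proof -
  obtain B where B: "\<And>z. z \<in> E_dom E s \<Longrightarrow> cmod (1 / (a - z)) \<le> B"
    using inverse_bounded_off_closure[OF a] by blast
  have "(\<lambda>z. f z * (1 / (a - z))) \<in> Hinf0 E s"
  proof (rule Hinf0_mult[OF f _ B])
    have "a - z \<noteq> 0" if "z \<in> E_dom E s" for z using that a closure_subset[of "E_dom E s"] by auto
    then show "(\<lambda>z. 1 / (a - z)) holomorphic_on E_dom E s" by (intro holomorphic_intros) auto
  qed
  then show ?thesis by simp
qed

text \<open>By the resolvent identity (f z / (a - z)) R(z) is the sum of f z R(z) R(a) and (f z / (a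
  - z)) R(a). The second term has a scalar integral, which vanishes by Cauchy's theorem. So division
  by a - z hands on independence of the contour.\<close>

lemma I_divide:
  assumes u: "r0 < u" "u < s" "s < 1" and f: "f \<in> Hinf0 E s" and a: "a \<notin> closure (E_dom E s)"
  shows "I u (\<lambda>z. f z / (a - z)) = I u f o\<^sub>L resolvent a T"
proof -
  have u': "E_large_enough E u" "0 < u" "u < 1" using large_u[of u] u by auto
  obtain \<gamma>' S L where \<gamma>: "contour (bd u) \<gamma>' S L" using contour_bd[OF u'] by blast
  interpret contour "bd u" \<gamma>' S L by (rule \<gamma>)
  have cl: "closure (E_dom E u) \<subseteq> closure (E_dom E s)" using u by (intro closure_mono E_dom_mono) simp
  have cl0: "closure (E_dom E r0) \<subseteq> closure (E_dom E s)" using u by (intro closure_mono E_dom_mono) simp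
  have aT: "a \<notin> spectrum_op T" using spectrum_subset cl0 a by blast
  have fa: "(\<lambda>z. f z / (a - z)) \<in> Hinf0 E s" by (rule Hinf0_divide[OF f u(3) a])
  note adm = adm_Hinf0(3)[OF u _ \<gamma>]
  let ?R = "\<lambda>z. resolvent z T"
  define h where "h z = ext0 (\<lambda>z. f z / (a - z)) z" for z
  have hc: "continuous_on (closure (E_dom E u)) h" and hh: "h holomorphic_on E_dom E u"
    unfolding h_def using ext0_props[OF fa u'(1,2) u(2,3)] by auto
  have "cint h = 0" by (rule cauchy_zero[OF u' \<gamma> hc hh])
  have admh: "adm h"
    by (intro adm_continuous continuous_on_compose2[OF hc] continuous_on_subset[OF cont])
      (use bd_eq(3)[OF u'] in auto)
  have eq: "(f z / (a - z)) *\<^sub>C ?R z = ((f z *\<^sub>C ?R z) o\<^sub>L ?R a) + (h z *\<^sub>C ?R a)"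
    if z: "z \<notin> E" "z \<notin> E_dom E u" "z \<in> closure (E_dom E u)" for z
  proof -
    have zT: "z \<notin> spectrum_op T" using notin_spectrum[OF u(1) u'(3)] z by blast
    have az: "a - z \<noteq> 0" using a cl z by auto
    have "?R z = (a - z) *\<^sub>C (?R z o\<^sub>L ?R a) + ?R a"
      using resolvent_identity[OF zT aT] by (simp add: algebra_simps)
    then have "(f z / (a - z)) *\<^sub>C ?R z = (f z / (a - z)) *\<^sub>C ((a - z) *\<^sub>C (?R z o\<^sub>L ?R a) + ?R a)"
      by simp
    also have "\<dots> = (f z *\<^sub>C (?R z o\<^sub>L ?R a)) + ((f z / (a - z)) *\<^sub>C ?R a)"
      using az by (simp add: scaleC_add_right scaleC_scaleC)
    finally show ?thesis using z by (simp add: scaleC_compose_left h_def ext0_def)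
  qed
  have "cint (\<lambda>z. (f z / (a - z)) *\<^sub>C ?R z) = cint (\<lambda>z. ((f z *\<^sub>C ?R z) o\<^sub>L ?R a) + (h z *\<^sub>C ?R a))"
    by (rule cint_cong[OF finite_bd_E[OF u']]) (use bd_eq(3,4)[OF u'] in \<open>auto intro!: eq\<close>)
  also have "\<dots> = cint (\<lambda>z. (f z *\<^sub>C ?R z) o\<^sub>L ?R a) + cint (\<lambda>z. h z *\<^sub>C ?R a)"
    by (intro cint_add adm_linear[OF adm[OF f]] adm_linear[OF admh]
        bounded_bilinear.bounded_linear_left[OF bounded_bilinear_blinfun_compose]
        bounded_bilinear.bounded_linear_left[OF bounded_bilinear_scaleC])
  also have "cint (\<lambda>z. h z *\<^sub>C ?R a) = 0"
    using cint_scalar_const[OF admh, of "?R a"] \<open>cint h = 0\<close> by simp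
  also have "cint (\<lambda>z. (f z *\<^sub>C ?R z) o\<^sub>L ?R a) = cint (\<lambda>z. f z *\<^sub>C ?R z) o\<^sub>L ?R a"
    by (rule cint_linear[OF adm[OF f] bounded_bilinear.bounded_linear_left[OF bounded_bilinear_blinfun_compose]])
      (simp add: scaleC_compose_left)
  finally show ?thesis unfolding I_def vector_contour_integral_eq by simp
qed

text \<open>The closure of the domain shrunk by \<mu> < 1 lies in the open domain. So the spectrum
  of \<mu> T is off the contour even at the points of \<open>E\<close>, and its resolvent is
  continuous along the whole path.\<close>

lemma scaled_notin_spectrum:
  assumes u: "r0 < u" "u < 1" and z: "z \<notin> E_dom E u" and \<mu>: "0 \<le> \<mu>" "\<mu> < 1"
  shows "z \<notin> spectrum_op (\<mu> *\<^sub>R T)"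
    and "\<mu> > 0 \<Longrightarrow> resolvent z (\<mu> *\<^sub>R T) = (1 / \<mu>) *\<^sub>R resolvent (z / of_real \<mu>) T"
    and "\<mu> = 0 \<Longrightarrow> resolvent z (\<mu> *\<^sub>R T) = (1 / z) *\<^sub>C id_blinfun"
    and "\<mu> > 0 \<Longrightarrow> z / of_real \<mu> \<notin> E_dom E u \<and> z / of_real \<mu> \<notin> E"
proof -
  have u0: "0 < u" using u r0 by simp
  have z0: "z \<noteq> 0" using z zero_in_E_dom[OF u0] by auto
  have cl: "z / of_real \<mu> \<notin> closure (E_dom E u)" if "\<mu> > 0"
  proof
    assume c: "z / of_real \<mu> \<in> closure (E_dom E u)"
    have "z = (1 - \<mu>) *\<^sub>R 0 + \<mu> *\<^sub>R (z / of_real \<mu>)" using that by (simp add: scaleR_conv_of_real)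
    then have "z \<in> open_segment 0 (z / of_real \<mu>)"
      using that \<mu> z0 unfolding in_segment by (intro conjI exI[of _ \<mu>]) auto
    then have "z \<in> E_dom E u"
      using in_interior_closure_convex_segment[OF E_dom_convex, of 0 E u "z / of_real \<mu>"] c
        zero_in_E_dom[OF u0, of E] by (auto simp: interior_open)
    then show False using z by simp
  qed
  show nE: "\<mu> > 0 \<Longrightarrow> z / of_real \<mu> \<notin> E_dom E u \<and> z / of_real \<mu> \<notin> E"
    using cl closure_subset subset_closure_E_dom[OF u0] by blast
  have inv1: "is_inverse_op (z *\<^sub>C id_blinfun - \<mu> *\<^sub>R T) ((1 / \<mu>) *\<^sub>R resolvent (z / of_real \<mu>) T)" if m: "\<mu> > 0"
  proof -
    define w where "w = z / of_real \<mu>"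
    have "w \<notin> spectrum_op T" unfolding w_def using notin_spectrum[OF u] nE[OF m] by blast
    note R = resolvent_props[OF this]
    have A: "z *\<^sub>C id_blinfun - \<mu> *\<^sub>R T = \<mu> *\<^sub>R (w *\<^sub>C id_blinfun - T)"
    proof -
      have "\<mu> *\<^sub>R (w *\<^sub>C (id_blinfun :: 'a \<Rightarrow>\<^sub>L 'a)) = (of_real \<mu> * w) *\<^sub>C id_blinfun"
        by (simp only: scaleC_of_real[symmetric] scaleC_scaleC)
      then show ?thesis using m by (simp add: w_def scaleR_diff_right)
    qed
    have "complex_linear_op ((1 / \<mu>) *\<^sub>R resolvent w T)"
      using R(1) unfolding complex_linear_op_def
      by (simp add: scaleR_blinfun.rep_eq linear_scale[OF bounded_linear.linear[OF bounded_linear_scaleC]])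
    then show ?thesis
      unfolding is_inverse_op_def A w_def[symmetric]
      using R(2,3) m
      by (simp add: bounded_bilinear.scaleR_left[OF bounded_bilinear_blinfun_compose]
          bounded_bilinear.scaleR_right[OF bounded_bilinear_blinfun_compose])
  qed
  have inv0: "is_inverse_op (z *\<^sub>C id_blinfun - \<mu> *\<^sub>R T) ((1 / z) *\<^sub>C id_blinfun)" if "\<mu> = 0"
    unfolding is_inverse_op_def using that z0
    by (simp add: scaleC_compose_left scaleC_scaleC scaleC_one complex_linear_op_def scaleC_blinfun.rep_eq mult.commute)
  show "\<mu> > 0 \<Longrightarrow> resolvent z (\<mu> *\<^sub>R T) = (1 / \<mu>) *\<^sub>R resolvent (z / of_real \<mu>) T"
    using resolvent_eqI[OF inv1] by simp
  show "\<mu> = 0 \<Longrightarrow> resolvent z (\<mu> *\<^sub>R T) = (1 / z) *\<^sub>C id_blinfun"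
    using resolvent_eqI[OF inv0] by simp
  show "z \<notin> spectrum_op (\<mu> *\<^sub>R T)"
    unfolding spectrum_op_def using inv1 inv0 \<mu> by (cases "\<mu> = 0") auto
qed

lemma resolvent_commute:
  assumes z: "z \<notin> spectrum_op A" and AB: "A o\<^sub>L B = B o\<^sub>L A" and B: "complex_linear_op B"
  shows "resolvent z A o\<^sub>L B = B o\<^sub>L resolvent z A"
proof -
  let ?A = "z *\<^sub>C id_blinfun - A" and ?R = "resolvent z A"
  have com: "B o\<^sub>L ?A = ?A o\<^sub>L B"
    using AB B by (simp add: compose_diff_left compose_diff_right scaleC_compose_left compose_scaleC)
  have "?R o\<^sub>L B = ?R o\<^sub>L (B o\<^sub>L (?A o\<^sub>L ?R))" by (simp add: resolvent_props[OF z])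
  also have "\<dots> = ?R o\<^sub>L ((B o\<^sub>L ?A) o\<^sub>L ?R)" by (simp only: compose_assoc)
  also have "\<dots> = (?R o\<^sub>L ?A) o\<^sub>L (B o\<^sub>L ?R)" by (simp only: com compose_assoc)
  finally show ?thesis by (simp add: resolvent_props[OF z])
qed

section \<open>Dilations of the operator\<close>

definition J :: "real \<Rightarrow> real \<Rightarrow> 'a \<Rightarrow>\<^sub>L 'a" where
  "J u \<mu> = vector_contour_integral (bd u) (\<lambda>z. resolvent z (\<mu> *\<^sub>R T))"

lemma scaled_continuous:
  assumes u: "r0 < u" "u < 1" and \<mu>: "0 \<le> \<mu>" "\<mu> < 1" and \<gamma>: "contour (bd u) \<gamma>' S L"
  shows "continuous_on {0..1} (\<lambda>t. resolvent (bd u t) (\<mu> *\<^sub>R T))"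
proof (rule continuous_on_compose2[OF continuous_on_resolvent])
  interpret contour "bd u" \<gamma>' S L by (rule \<gamma>)
  show "continuous_on {0..1} (bd u)" using cont continuous_on_subset by blast
  show "bd u ` {0..1} \<subseteq> - spectrum_op (\<mu> *\<^sub>R T)"
    using scaled_notin_spectrum(1)[OF u _ \<mu>] bd_eq(4) large_u[OF u] u(2) by blast
qed

text \<open>The derivative of R(z, \<mu> T) in \<mu> is T R^2, which is also the derivative of - T R
  in z. Its integral over a closed path vanishes, so only a quadratic remainder is left.\<close>

lemma J_local:
  assumes u: "r0 < u" "u < 1" and \<mu>: "0 \<le> \<mu>" "\<mu> < 1"
  shows "\<exists>C d. d > 0 \<and> (\<forall>\<nu>. 0 \<le> \<nu> \<and> \<nu> < 1 \<and> \<bar>\<nu> - \<mu>\<bar> < d \<longrightarrow> norm (J u \<nu> - J u \<mu>) \<le> C * \<bar>\<nu> - \<mu>\<bar>\<^sup>2)"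
proof -
  have u': "E_large_enough E u" "0 < u" "u < 1" using large_u[of u] u by auto
  obtain \<gamma>' S L where \<gamma>: "contour (bd u) \<gamma>' S L" using contour_bd[OF u'] by blast
  interpret contour "bd u" \<gamma>' S L by (rule \<gamma>)
  let ?R = "\<lambda>\<mu> z. resolvent z (\<mu> *\<^sub>R T)"
  note sc = scaled_continuous[OF u _ _ \<gamma>]
  have nb: "bd u t \<notin> E_dom E u" for t by (rule bd_eq(4)[OF u'])
  note ns = scaled_notin_spectrum(1)[OF u nb]
  have "compact ((\<lambda>t. ?R \<mu> (bd u t)) ` {0..1})" by (intro compact_continuous_image sc \<mu>) simp
  then have "bounded ((\<lambda>t. ?R \<mu> (bd u t)) ` {0..1})" by (rule compact_imp_bounded)
  then obtain M where M0: "M > 0 \<and> (\<forall>x\<in>(\<lambda>t. ?R \<mu> (bd u t)) ` {0..1}. norm x \<le> M)"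
    unfolding bounded_pos ..
  have M: "M > 0" "\<And>t. t \<in> {0..1} \<Longrightarrow> norm (?R \<mu> (bd u t)) \<le> M" using M0 by auto
  define d where "d = 1 / (2 * M * (norm T + 1))"
  have d0: "d > 0" unfolding d_def using M(1) by (intro divide_pos_pos mult_pos_pos add_nonneg_pos) auto
  have com: "(\<mu> *\<^sub>R T) o\<^sub>L T = T o\<^sub>L (\<mu> *\<^sub>R T)"
    by (simp add: bounded_bilinear.scaleR_left[OF bounded_bilinear_blinfun_compose]
        bounded_bilinear.scaleR_right[OF bounded_bilinear_blinfun_compose])
  define G where "G z = T o\<^sub>L (?R \<mu> z o\<^sub>L ?R \<mu> z)" for z
  have G0: "cint G = 0"
  proof (rule cint_primitive)
    show "bd u t \<in> - spectrum_op (\<mu> *\<^sub>R T)" for t using ns[OF \<mu>] by simp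
    fix z assume z: "z \<in> - spectrum_op (\<mu> *\<^sub>R T)"
    have "((\<lambda>z. ?R \<mu> z) has_derivative (\<lambda>h. - (h *\<^sub>C (?R \<mu> z o\<^sub>L ?R \<mu> z)))) (at z within - spectrum_op (\<mu> *\<^sub>R T))"
      using z by (intro resolvent_has_derivative) simp
    then have "((\<lambda>z. - (T o\<^sub>L ?R \<mu> z)) has_derivative (\<lambda>h. - (T o\<^sub>L - (h *\<^sub>C (?R \<mu> z o\<^sub>L ?R \<mu> z))))) (at z within - spectrum_op (\<mu> *\<^sub>R T))"
      by (intro has_derivative_minus bounded_linear.has_derivative[OF bounded_bilinear.bounded_linear_right[OF bounded_bilinear_blinfun_compose]])
    then show "((\<lambda>z. - (T o\<^sub>L ?R \<mu> z)) has_derivative (\<lambda>h. h *\<^sub>C G z)) (at z within - spectrum_op (\<mu> *\<^sub>R T))"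
      by (simp add: G_def bounded_bilinear.minus_right[OF bounded_bilinear_blinfun_compose] compose_scaleC[OF T_linear])
  qed
  have contR: "continuous_on {0..1} (\<lambda>t. ?R \<nu> (bd u t))" if "0 \<le> \<nu>" "\<nu> < 1" for \<nu>
    using sc that by blast
  have contG: "continuous_on {0..1} (\<lambda>t. G (bd u t))"
    unfolding G_def
    by (intro bounded_bilinear.continuous_on[OF bounded_bilinear_blinfun_compose] continuous_on_const contR \<mu>)
  have "norm (J u \<nu> - J u \<mu>) \<le> (L * (2 * M ^ 3 * (norm T)\<^sup>2)) * \<bar>\<nu> - \<mu>\<bar>\<^sup>2"
    if \<nu>: "0 \<le> \<nu> \<and> \<nu> < 1 \<and> \<bar>\<nu> - \<mu>\<bar> < d" for \<nu>
  proof -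
    have \<nu>1: "0 \<le> \<nu>" "\<nu> < 1" using \<nu> by auto
    have admR: "adm (?R \<nu>)" "adm (?R \<mu>)" "adm G"
      using contR[OF \<nu>1] contR[OF \<mu>] contG by (auto intro: adm_continuous)
    have admG: "adm (\<lambda>z. (\<nu> - \<mu>) *\<^sub>R G z)"
      by (rule adm_linear[OF admR(3) bounded_linear_scaleR_right])
    have cG: "cint (\<lambda>z. (\<nu> - \<mu>) *\<^sub>R G z) = 0"
      using cint_scale[OF admR(3), of "of_real (\<nu> - \<mu>)"] G0 by (simp add: scaleC_of_real del: of_real_diff)
    have "J u \<nu> - J u \<mu> = cint (\<lambda>z. ?R \<nu> z - ?R \<mu> z - (\<nu> - \<mu>) *\<^sub>R G z)"
      unfolding J_def vector_contour_integral_eq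
      using cint_diff[OF adm_diff[OF admR(1,2)] admG] cint_diff[OF admR(1,2)] cG by simp
    also have "norm \<dots> \<le> L * (2 * M ^ 3 * (norm T)\<^sup>2 * \<bar>\<nu> - \<mu>\<bar>\<^sup>2)"
    proof (rule cint_bound[OF adm_diff[OF adm_diff[OF admR(1,2)] admG] finite.emptyI])
      fix t :: real assume "t \<in> {0..1} - {}" then have t: "t \<in> {0..1}" by simp
      let ?z = "bd u t"
      let ?D = "?R \<nu> ?z - ?R \<mu> ?z"
      have nT: "norm (\<nu> *\<^sub>R T - \<mu> *\<^sub>R T) = \<bar>\<nu> - \<mu>\<bar> * norm T"
        by (simp flip: scaleR_diff_left)
      have small: "(cmod (?z - ?z) + norm (\<nu> *\<^sub>R T - \<mu> *\<^sub>R T)) * norm (?R \<mu> ?z) \<le> 1 / 2"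
      proof -
        have "\<bar>\<nu> - \<mu>\<bar> * norm T * norm (?R \<mu> ?z) \<le> d * (norm T + 1) * M"
          using \<nu> d0 M(2)[OF t] by (intro mult_mono) auto
        also have "\<dots> = 1 / 2" using M(1) by (simp add: d_def add_nonneg_eq_0_iff)
        finally show ?thesis using nT by simp
      qed
      have D: "norm ?D \<le> 2 * M\<^sup>2 * (\<bar>\<nu> - \<mu>\<bar> * norm T)"
      proof -
        have "norm ?D \<le> 2 * (norm (?R \<mu> ?z))\<^sup>2 * (\<bar>\<nu> - \<mu>\<bar> * norm T)"
          using norm_resolvent_le(2)[OF ns[OF \<nu>1] ns[OF \<mu>] small] nT by simp
        also have "\<dots> \<le> 2 * M\<^sup>2 * (\<bar>\<nu> - \<mu>\<bar> * norm T)"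
          using M t by (intro mult_right_mono mult_left_mono power_mono) auto
        finally show ?thesis .
      qed
      have RT: "?R \<mu> ?z o\<^sub>L T = T o\<^sub>L ?R \<mu> ?z"
        by (rule resolvent_commute[OF ns[OF \<mu>] com T_linear])
      have "?D = ?R \<nu> ?z o\<^sub>L (\<nu> *\<^sub>R T - \<mu> *\<^sub>R T) o\<^sub>L ?R \<mu> ?z"
        using resolvent_diff[OF ns[OF \<nu>1] ns[OF \<mu>], of t t] by simp
      also have "\<dots> = (\<nu> - \<mu>) *\<^sub>R (?R \<nu> ?z o\<^sub>L T o\<^sub>L ?R \<mu> ?z)"
        by (simp add: bounded_bilinear.scaleR_left[OF bounded_bilinear_blinfun_compose]
          bounded_bilinear.scaleR_right[OF bounded_bilinear_blinfun_compose] flip: scaleR_diff_left)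
      finally have eqD: "?D = (\<nu> - \<mu>) *\<^sub>R (?R \<nu> ?z o\<^sub>L T o\<^sub>L ?R \<mu> ?z)" .
      have eqG: "G ?z = ?R \<mu> ?z o\<^sub>L T o\<^sub>L ?R \<mu> ?z"
        by (simp add: G_def RT compose_assoc)
      have "?D - (\<nu> - \<mu>) *\<^sub>R G ?z =
          (\<nu> - \<mu>) *\<^sub>R (?R \<nu> ?z o\<^sub>L T o\<^sub>L ?R \<mu> ?z) - (\<nu> - \<mu>) *\<^sub>R (?R \<mu> ?z o\<^sub>L T o\<^sub>L ?R \<mu> ?z)"
        by (subst eqD) (simp only: eqG)
      also have "\<dots> = (\<nu> - \<mu>) *\<^sub>R (?D o\<^sub>L T o\<^sub>L ?R \<mu> ?z)"
        by (simp only: compose_diff_left scaleR_diff_right)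
      also have "norm \<dots> \<le> \<bar>\<nu> - \<mu>\<bar> * ((2 * M\<^sup>2 * (\<bar>\<nu> - \<mu>\<bar> * norm T)) * norm T * M)"
        unfolding norm_scaleR
      proof (rule mult_left_mono)
        have "norm (?D o\<^sub>L T o\<^sub>L ?R \<mu> ?z) \<le> norm ?D * norm T * norm (?R \<mu> ?z)"
          by (rule order_trans[OF norm_blinfun_compose]) (intro mult_right_mono norm_blinfun_compose, simp)
        also have "\<dots> \<le> (2 * M\<^sup>2 * (\<bar>\<nu> - \<mu>\<bar> * norm T)) * norm T * M"
          using D M(1) M(2)[OF t] by (intro mult_mono) auto
        finally show "norm (?D o\<^sub>L T o\<^sub>L ?R \<mu> ?z) \<le> (2 * M\<^sup>2 * (\<bar>\<nu> - \<mu>\<bar> * norm T)) * norm T * M" .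
      qed simp
      also have "\<dots> = 2 * M ^ 3 * (norm T)\<^sup>2 * \<bar>\<nu> - \<mu>\<bar>\<^sup>2"
        by (simp add: power2_eq_square power3_eq_cube)
      finally show "norm (?R \<nu> ?z - ?R \<mu> ?z - (\<nu> - \<mu>) *\<^sub>R G ?z) \<le> 2 * M ^ 3 * (norm T)\<^sup>2 * \<bar>\<nu> - \<mu>\<bar>\<^sup>2" .
    qed (use M in auto)
    finally show ?thesis by (simp add: mult.assoc)
  qed
  then have "\<forall>\<nu>. 0 \<le> \<nu> \<and> \<nu> < 1 \<and> \<bar>\<nu> - \<mu>\<bar> < d \<longrightarrow>
      norm (J u \<nu> - J u \<mu>) \<le> (L * (2 * M ^ 3 * (norm T)\<^sup>2)) * \<bar>\<nu> - \<mu>\<bar>\<^sup>2"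
    by (intro allI impI)
  then show ?thesis using d0 by (intro exI conjI)
qed

text \<open>The quadratic estimate makes the derivative in \<mu> zero, and at \<mu> = 0 the
  resolvent is 1 / z, so Cauchy's formula evaluates the integral. The value does not involve
  \<open>u\<close>.\<close>

lemma J_eq:
  assumes u: "r0 < u" "u < 1" and \<mu>: "0 \<le> \<mu>" "\<mu> < 1"
  shows "J u \<mu> = (2 * of_real pi * \<i>) *\<^sub>C id_blinfun"
proof -
  have u': "E_large_enough E u" "0 < u" "u < 1" using large_u[of u] u by auto
  obtain \<gamma>' S L where \<gamma>: "contour (bd u) \<gamma>' S L" using contour_bd[OF u'] by blast
  interpret contour "bd u" \<gamma>' S L by (rule \<gamma>)
  have "\<exists>c. \<forall>\<mu>\<in>{0..<1}. J u \<mu> = c"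
  proof (rule has_derivative_zero_constant)
    fix \<mu> :: real assume m: "\<mu> \<in> {0..<1}"
    obtain C d where d: "d > 0" "\<And>\<nu>. 0 \<le> \<nu> \<and> \<nu> < 1 \<and> \<bar>\<nu> - \<mu>\<bar> < d \<Longrightarrow> norm (J u \<nu> - J u \<mu>) \<le> C * \<bar>\<nu> - \<mu>\<bar>\<^sup>2"
      using J_local[OF u, of \<mu>] m by auto
    show "(J u has_derivative (\<lambda>h. 0)) (at \<mu> within {0..<1})"
      unfolding has_derivative_iff_norm
    proof (intro conjI bounded_linear_zero, rule Lim_null_comparison)
      have "((\<lambda>\<nu>. C * \<bar>\<nu> - \<mu>\<bar>) \<longlongrightarrow> C * \<bar>\<mu> - \<mu>\<bar>) (at \<mu> within {0..<1})"
        by (intro tendsto_intros)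
      then show "((\<lambda>\<nu>. C * \<bar>\<nu> - \<mu>\<bar>) \<longlongrightarrow> 0) (at \<mu> within {0..<1})" by simp
      show "\<forall>\<^sub>F \<nu> in at \<mu> within {0..<1}. norm (norm (J u \<nu> - J u \<mu> - 0) / norm (\<nu> - \<mu>)) \<le> C * \<bar>\<nu> - \<mu>\<bar>"
        unfolding eventually_at
      proof (intro exI[of _ d] conjI d(1) ballI impI)
        fix \<nu> assume "\<nu> \<in> {0..<1}" "\<nu> \<noteq> \<mu> \<and> dist \<nu> \<mu> < d"
        then show "norm (norm (J u \<nu> - J u \<mu> - 0) / norm (\<nu> - \<mu>)) \<le> C * \<bar>\<nu> - \<mu>\<bar>"
          using d(2)[of \<nu>] by (simp add: dist_norm divide_le_eq power2_eq_square mult.assoc)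
      qed
    qed
  qed simp
  then obtain c where c: "\<And>\<mu>. \<mu> \<in> {0..<1} \<Longrightarrow> J u \<mu> = c" by blast
  have b0: "bd u t \<noteq> 0" for t using bd_eq(4)[OF u', of t] zero_in_E_dom[OF u'(2), of E] by auto
  have adm1: "adm (\<lambda>z. 1 / z :: complex)"
    using b0 by (intro adm_continuous continuous_intros continuous_on_subset[OF cont]) auto
  have "J u 0 = cint (\<lambda>z. (1 / z) *\<^sub>C id_blinfun)"
    unfolding J_def vector_contour_integral_eq
    by (rule cint_cong[of "{}"]) (use scaled_notin_spectrum(3)[OF u bd_eq(4)[OF u']] in auto)
  also have "\<dots> = cint (\<lambda>z. 1 / z) *\<^sub>C id_blinfun" by (rule cint_scalar_const[OF adm1])
  also have "cint (\<lambda>z. 1 / z) = 2 * of_real pi * \<i>"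
    using cauchy_formula[OF u' \<gamma>, of "\<lambda>_. 1" 0] zero_in_E_dom[OF u'(2)] by simp
  finally show ?thesis using c[of 0] c[of \<mu>] \<mu> by simp
qed

end

section \<open>Independence of the contour\<close>

context ritt_operator
begin

text \<open>Since z R(z) = 1 + \<mu> T R(z), a further factor \<xi> - z turns the integral Q into
  \<xi> Q - \<mu> T Q, up to the integral of a polynomial, which vanishes. Nothing in this recursion
  involves \<open>u\<close>.\<close>

lemma scaled_product_independent:
  assumes \<mu>: "0 \<le> \<mu>" "\<mu> < 1" and F: "finite F"
  shows "\<exists>Q. \<forall>u. r0 < u \<and> u < 1 \<longrightarrow>
    vector_contour_integral (bd u) (\<lambda>z. (\<Prod>\<xi>\<in>F. \<xi> - z) *\<^sub>C resolvent z (\<mu> *\<^sub>R T)) = Q"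
  using F
proof (induction F rule: finite_induct)
  case empty
  show ?case
    using J_eq[OF _ _ \<mu>] unfolding J_def by (intro exI[of _ "(2 * of_real pi * \<i>) *\<^sub>C id_blinfun"]) (auto simp: scaleC_one)
next
  case (insert \<xi> F)
  let ?q = "\<lambda>z. \<Prod>\<xi>\<in>F. \<xi> - z" and ?R = "\<lambda>z. resolvent z (\<mu> *\<^sub>R T)"
  obtain Q where Q: "\<And>u. r0 < u \<Longrightarrow> u < 1 \<Longrightarrow> vector_contour_integral (bd u) (\<lambda>z. ?q z *\<^sub>C ?R z) = Q"
    using insert.IH by blast
  have "vector_contour_integral (bd u) (\<lambda>z. (\<Prod>\<xi>\<in>insert \<xi> F. \<xi> - z) *\<^sub>C ?R z) = \<xi> *\<^sub>C Q - ((\<mu> *\<^sub>R T) o\<^sub>L Q)"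
    if u: "r0 < u" "u < 1" for u
  proof -
    have u': "E_large_enough E u" "0 < u" "u < 1" using large_u[of u] u by auto
    obtain \<gamma>' S L where \<gamma>: "contour (bd u) \<gamma>' S L" using contour_bd[OF u'] by blast
    interpret contour "bd u" \<gamma>' S L by (rule \<gamma>)
    have ns: "bd u t \<notin> spectrum_op (\<mu> *\<^sub>R T)" for t
      by (rule scaled_notin_spectrum(1)[OF u bd_eq(4)[OF u'] \<mu>])
    have cq: "continuous_on {0..1} (\<lambda>t. ?q (bd u t))"
      by (intro continuous_intros continuous_on_subset[OF cont]) auto
    have admq: "adm ?q" by (rule adm_continuous[OF cq])
    have admR: "adm (\<lambda>z. ?q z *\<^sub>C ?R z)"
      by (intro adm_continuous continuous_on_scaleC cq scaled_continuous[OF u \<mu> \<gamma>])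
    have q0: "cint ?q = 0"
      by (rule cauchy_zero[OF u' \<gamma>]) (intro continuous_intros holomorphic_intros)+
    have "cint (\<lambda>z. (\<Prod>\<xi>\<in>insert \<xi> F. \<xi> - z) *\<^sub>C ?R z) =
      cint (\<lambda>z. (\<xi> *\<^sub>C (?q z *\<^sub>C ?R z) - ?q z *\<^sub>C id_blinfun) - ((\<mu> *\<^sub>R T) o\<^sub>L (?q z *\<^sub>C ?R z)))"
    proof (rule cint_cong[of "{}"])
      fix t
      let ?z = "bd u t"
      have lin: "complex_linear_op (\<mu> *\<^sub>R T)"
        using T_linear unfolding complex_linear_op_def
        by (simp add: scaleR_blinfun.rep_eq linear_scale[OF bounded_linear.linear[OF bounded_linear_scaleC]])
      have "?z *\<^sub>C ?R ?z = id_blinfun + ((\<mu> *\<^sub>R T) o\<^sub>L ?R ?z)"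
        using resolvent_props(2)[OF ns[of t]] by (simp add: compose_diff_left scaleC_compose_left algebra_simps)
      then have "(\<xi> - ?z) *\<^sub>C ?R ?z = \<xi> *\<^sub>C ?R ?z - (id_blinfun + ((\<mu> *\<^sub>R T) o\<^sub>L ?R ?z))"
        by (simp only: scaleC_left_diff)
      then have "?q ?z *\<^sub>C ((\<xi> - ?z) *\<^sub>C ?R ?z) = ?q ?z *\<^sub>C (\<xi> *\<^sub>C ?R ?z - (id_blinfun + ((\<mu> *\<^sub>R T) o\<^sub>L ?R ?z)))"
        by simp
      also have "\<dots> = (\<xi> *\<^sub>C (?q ?z *\<^sub>C ?R ?z) - ?q ?z *\<^sub>C id_blinfun) - ((\<mu> *\<^sub>R T) o\<^sub>L (?q ?z *\<^sub>C ?R ?z))"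
        by (simp add: scaleC_diff_right scaleC_add_right scaleC_scaleC mult.commute compose_scaleC[OF lin])
      finally show "(\<Prod>\<xi>\<in>insert \<xi> F. \<xi> - ?z) *\<^sub>C ?R ?z =
         (\<xi> *\<^sub>C (?q ?z *\<^sub>C ?R ?z) - ?q ?z *\<^sub>C id_blinfun) - ((\<mu> *\<^sub>R T) o\<^sub>L (?q ?z *\<^sub>C ?R ?z))"
        using insert.hyps by (simp add: scaleC_scaleC mult.commute)
    qed simp
    also have "\<dots> = \<xi> *\<^sub>C cint (\<lambda>z. ?q z *\<^sub>C ?R z) - cint ?q *\<^sub>C id_blinfun - ((\<mu> *\<^sub>R T) o\<^sub>L cint (\<lambda>z. ?q z *\<^sub>C ?R z))"
    proof -
      have blT: "bounded_linear (\<lambda>X. (\<mu> *\<^sub>R T) o\<^sub>L X)"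
        by (rule bounded_bilinear.bounded_linear_right[OF bounded_bilinear_blinfun_compose])
      have 1: "adm (\<lambda>z. \<xi> *\<^sub>C (?q z *\<^sub>C ?R z))" by (rule adm_scale[OF admR])
      have 2: "adm (\<lambda>z. ?q z *\<^sub>C id_blinfun)"
        by (rule adm_linear[OF admq bounded_bilinear.bounded_linear_left[OF bounded_bilinear_scaleC]])
      have 3: "adm (\<lambda>z. (\<mu> *\<^sub>R T) o\<^sub>L (?q z *\<^sub>C ?R z))" by (rule adm_linear[OF admR blT])
      have lin: "complex_linear_op (\<mu> *\<^sub>R T)"
        using T_linear unfolding complex_linear_op_def
        by (simp add: scaleR_blinfun.rep_eq linear_scale[OF bounded_linear.linear[OF bounded_linear_scaleC]])
      show ?thesis
        unfolding cint_diff[OF adm_diff[OF 1 2] 3] cint_diff[OF 1 2] cint_scale[OF admR]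
          cint_scalar_const[OF admq] cint_linear[OF admR blT compose_scaleC[OF lin]] ..
    qed
    finally show ?thesis
      using q0 Q[OF u] by (simp only: vector_contour_integral_eq) (simp add: vector_contour_integral_eq)
  qed
  then show ?case by blast
qed

text \<open>The ball about \<mu> \<xi> of radius (1 - \<mu>) u lies in the domain, so
  \<open>z\<close> stays that far from \<mu> \<xi>. This makes the bound on P(z) R(z, \<mu> T)
  uniform as \<mu> tends to 1.\<close>

lemma radial_dist:
  assumes u: "0 < u" and \<xi>: "\<xi> \<in> E" and \<mu>: "0 < \<mu>" "\<mu> < 1" and z: "z \<notin> E_dom E u"
  shows "cmod (\<xi> - z) \<le> (1 + 1 / u) * cmod (\<xi> - z / of_real \<mu>)"
proof -
  have "ball (of_real \<mu> * \<xi>) ((1 - \<mu>) * u) \<subseteq> convex hull (E \<union> ball 0 u)"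
  proof
    fix w assume "w \<in> ball (of_real \<mu> * \<xi>) ((1 - \<mu>) * u)"
    then have w: "cmod (w - of_real \<mu> * \<xi>) < (1 - \<mu>) * u" by (simp add: dist_norm norm_minus_commute)
    define y where "y = (1 / (1 - \<mu>)) *\<^sub>R (w - of_real \<mu> * \<xi>)"
    have "cmod y = cmod (w - of_real \<mu> * \<xi>) / (1 - \<mu>)" unfolding y_def norm_scaleR using \<mu> by simp
    then have "cmod y < u" using w \<mu> by (simp add: divide_less_eq mult.commute)
    moreover have "w = \<mu> *\<^sub>R \<xi> + (1 - \<mu>) *\<^sub>R y" using \<mu> by (simp add: y_def scaleR_conv_of_real)
    moreover from calculation(1) have "\<mu> *\<^sub>R \<xi> + (1 - \<mu>) *\<^sub>R y \<in> convex hull (E \<union> ball 0 u)"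
      using \<mu> \<xi> by (intro convexD[OF convex_convex_hull] hull_inc) auto
    ultimately show "w \<in> convex hull (E \<union> ball 0 u)" by simp
  qed
  then have "ball (of_real \<mu> * \<xi>) ((1 - \<mu>) * u) \<subseteq> E_dom E u"
    unfolding E_dom_def by (intro interior_maximal) auto
  then have "z \<notin> ball (of_real \<mu> * \<xi>) ((1 - \<mu>) * u)" using z by blast
  then have d: "(1 - \<mu>) * u \<le> cmod (of_real \<mu> * \<xi> - z)" by (simp add: dist_norm)
  have "cmod (\<xi> - of_real \<mu> * \<xi>) = 1 - \<mu>"
  proof -
    have "\<xi> - of_real \<mu> * \<xi> = of_real (1 - \<mu>) * \<xi>" by (simp add: algebra_simps)
    then show ?thesis using \<mu> norm_E[OF \<xi>] by (simp only: norm_mult norm_of_real) simp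
  qed
  then have "cmod (\<xi> - z) \<le> (1 - \<mu>) + cmod (of_real \<mu> * \<xi> - z)"
    using norm_triangle_ineq[of "\<xi> - of_real \<mu> * \<xi>" "of_real \<mu> * \<xi> - z"] by simp
  also have "\<dots> \<le> (1 + 1 / u) * cmod (of_real \<mu> * \<xi> - z)"
    using d u by (simp add: field_simps)
  also have "cmod (of_real \<mu> * \<xi> - z) = \<mu> * cmod (\<xi> - z / of_real \<mu>)"
  proof -
    have "of_real \<mu> * \<xi> - z = of_real \<mu> * (\<xi> - z / of_real \<mu>)" using \<mu> by (simp add: field_simps)
    then show ?thesis using \<mu> by (simp add: norm_mult)
  qed
  also have "(1 + 1 / u) * (\<mu> * cmod (\<xi> - z / of_real \<mu>)) \<le> (1 + 1 / u) * (1 * cmod (\<xi> - z / of_real \<mu>))"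
    using u \<mu> by (intro mult_left_mono mult_right_mono) auto
  finally show ?thesis by simp
qed

lemma P_Hinf0: "s < 1 \<Longrightarrow> P \<in> Hinf0 E s"
  by (rule Hinf0I[of P s 1 1]) (auto intro: P_holomorphic)

text \<open>One factor \<xi> - z for each point of \<open>E\<close> keeps the integrand bounded
  uniformly in the dilation, so dominated convergence removes the dilation.\<close>

lemma I_P_limit:
  assumes u: "r0 < u" "u < 1"
  shows "(\<lambda>n. vector_contour_integral (bd u) (\<lambda>z. P z *\<^sub>C resolvent z ((1 - 1 / (real n + 3)) *\<^sub>R T))) \<longlonglongrightarrow> I u P"
proof -
  have u': "E_large_enough E u" "0 < u" "u < 1" using large_u[of u] u by auto
  obtain \<gamma>' S L where \<gamma>: "contour (bd u) \<gamma>' S L" using contour_bd[OF u'] by blast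
  interpret contour "bd u" \<gamma>' S L by (rule \<gamma>)
  \<comment> \<open>The shift by 3 keeps \<mu> above 1 / 2, hence |z / \<mu>| < 2 on the closed unit
    disc, where the resolvent bound applies.\<close>
  define \<mu> where "\<mu> n = 1 - 1 / (real n + 3)" for n
  have \<mu>: "1 / 2 < \<mu> n" "0 < \<mu> n" "\<mu> n < 1" for n by (auto simp: \<mu>_def field_simps)
  have nb: "bd u t \<notin> E_dom E u" for t by (rule bd_eq(4)[OF u'])
  obtain D where D: "D > 0" "\<And>z. cmod z < 2 \<Longrightarrow> z \<notin> E_dom E u \<Longrightarrow> z \<notin> E \<Longrightarrow> cmod (P z) * norm (resolvent z T) \<le> D"
    using resolvent_bound[OF u] by blast
  define S' where "S' = {t \<in> {0..1}. bd u t \<in> E}"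
  have fS': "finite S'" unfolding S'_def by (rule finite_bd_E[OF u'])
  show ?thesis
    unfolding I_def vector_contour_integral_eq \<mu>_def[symmetric]
  proof (rule cint_dominated_convergence[OF fS'])
    show "continuous_on ({0..1} - S') (\<lambda>t. P (bd u t) *\<^sub>C resolvent (bd u t) (\<mu> n *\<^sub>R T))" for n
    proof (rule continuous_on_scaleC)
      show "continuous_on ({0..1} - S') (\<lambda>t. P (bd u t))"
        by (rule continuous_on_compose2[OF P_continuous[of UNIV] continuous_on_subset[OF cont]]) auto
      show "continuous_on ({0..1} - S') (\<lambda>t. resolvent (bd u t) (\<mu> n *\<^sub>R T))"
        using \<mu>[of n] by (intro continuous_on_subset[OF scaled_continuous[OF u _ _ \<gamma>]]) auto
    qed
    obtain s where s: "u < s" "s < 1" using u dense by blast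
    show "continuous_on ({0..1} - S') (\<lambda>t. P (bd u t) *\<^sub>C resolvent (bd u t) T)"
      unfolding S'_def by (rule adm_Hinf0(2)[OF u(1) s P_Hinf0[OF s(2)] \<gamma>])
    show "(\<lambda>_. (1 + 1 / u) ^ card E * 2 * D) integrable_on {0..1::real}" by (rule integrable_const_ivl)
    fix t assume t: "t \<in> {0..1} - S'"
    let ?z = "bd u t"
    have zE: "?z \<notin> E" using t by (auto simp: S'_def)
    show "norm (P ?z *\<^sub>C resolvent ?z (\<mu> n *\<^sub>R T)) \<le> (1 + 1 / u) ^ card E * 2 * D" for n
    proof -
      let ?w = "?z / of_real (\<mu> n)"
      have "cmod ?z \<le> 1" using bd_eq(3)[OF u', of t] closure_E_dom_cball[OF u'(3)] by auto
      then have "cmod ?w < 2" using \<mu>[of n] by (simp add: norm_divide divide_less_eq)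
      moreover have "?w \<notin> E_dom E u" "?w \<notin> E"
        using scaled_notin_spectrum(4)[OF u nb, of "\<mu> n"] \<mu>[of n] by auto
      ultimately have Dw: "cmod (P ?w) * norm (resolvent ?w T) \<le> D" by (rule D(2))
      have "cmod (P ?z) \<le> (\<Prod>\<xi>\<in>E. (1 + 1 / u) * cmod (\<xi> - ?w))"
        unfolding P_def prod_norm[symmetric]
        by (intro prod_mono conjI radial_dist u' \<mu> nb) auto
      also have "\<dots> = (1 + 1 / u) ^ card E * cmod (P ?w)"
        by (simp add: prod.distrib P_def flip: prod_norm)
      finally have Pz: "cmod (P ?z) \<le> (1 + 1 / u) ^ card E * cmod (P ?w)" .
      have "norm (P ?z *\<^sub>C resolvent ?z (\<mu> n *\<^sub>R T)) = cmod (P ?z) * (norm (resolvent ?w T) / \<mu> n)"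
        using scaled_notin_spectrum(2)[OF u nb, of "\<mu> n"] \<mu>[of n] by (simp add: norm_scaleC)
      also have "\<dots> \<le> ((1 + 1 / u) ^ card E * cmod (P ?w)) * (2 * norm (resolvent ?w T))"
      proof (rule mult_mono[OF Pz])
        have "norm (resolvent ?w T) * 1 \<le> norm (resolvent ?w T) * (2 * \<mu> n)"
          using \<mu>(1)[of n] by (intro mult_left_mono) auto
        then show "norm (resolvent ?w T) / \<mu> n \<le> 2 * norm (resolvent ?w T)"
          using \<mu>(2)[of n] by (simp add: divide_le_eq mult_ac)
      qed (use u' \<mu>(2)[of n] in auto)
      also have "\<dots> = (1 + 1 / u) ^ card E * 2 * (cmod (P ?w) * norm (resolvent ?w T))" by simp
      also have "\<dots> \<le> (1 + 1 / u) ^ card E * 2 * D" using u' by (intro mult_left_mono Dw) auto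
      finally show ?thesis .
    qed
    have "(\<lambda>n. 1 / (real n + 3)) \<longlonglongrightarrow> 0"
      using LIMSEQ_ignore_initial_segment[OF lim_1_over_n[where 'a = real], of 3] by (simp add: add.commute)
    then have "\<mu> \<longlonglongrightarrow> 1 - 0"
      unfolding \<mu>_def by (intro tendsto_diff tendsto_const)
    then have lim: "(\<lambda>n. \<mu> n *\<^sub>R T) \<longlonglongrightarrow> 1 *\<^sub>R T" by (intro tendsto_scaleR tendsto_const) simp
    have "?z \<notin> spectrum_op T" using notin_spectrum[OF u nb zE] .
    then have "(\<lambda>n. resolvent ?z (\<mu> n *\<^sub>R T)) \<longlonglongrightarrow> resolvent ?z T"
      using lim scaled_notin_spectrum(1)[OF u nb, of "\<mu> _" t] \<mu>
      by (intro tendsto_resolvent tendsto_const always_eventually allI) (auto intro: less_imp_le)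
    then show "(\<lambda>n. P ?z *\<^sub>C resolvent ?z (\<mu> n *\<^sub>R T)) \<longlonglongrightarrow> P ?z *\<^sub>C resolvent ?z T"
      by (intro tendsto_scaleC tendsto_const)
  qed
qed

lemma I_P_independent:
  assumes u: "r0 < u" "u < 1" "r0 < v" "v < 1"
  shows "I u P = I v P"
proof -
  have eq: "vector_contour_integral (bd u) (\<lambda>z. P z *\<^sub>C resolvent z ((1 - 1 / (real n + 3)) *\<^sub>R T)) =
    vector_contour_integral (bd v) (\<lambda>z. P z *\<^sub>C resolvent z ((1 - 1 / (real n + 3)) *\<^sub>R T))" for n
    using scaled_product_independent[of "1 - 1 / (real n + 3)" E] fin u unfolding P_def
    by (auto simp: field_simps)
  show ?thesis
    using I_P_limit[OF u(3,4)] unfolding eq[symmetric] by (rule LIMSEQ_unique[OF I_P_limit[OF u(1,2)]])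
qed

text \<open>A working class for independence of the contour: it contains \<open>P\<close> and is
  stable under linear combinations and under division by a - z with \<open>a\<close> off the
  closure, which is enough for the modified kernels.\<close>

definition indep :: "real \<Rightarrow> (complex \<Rightarrow> complex) \<Rightarrow> bool" where
  "indep s f \<longleftrightarrow> f \<in> Hinf0 E s \<and> (\<forall>u v. r0 < u \<longrightarrow> u < s \<longrightarrow> r0 < v \<longrightarrow> v < s \<longrightarrow> I u f = I v f)"

section \<open>Closure properties of the contour-independent class\<close>

lemma Hinf0_add:
  assumes "f \<in> Hinf0 E s" "g \<in> Hinf0 E s" "s < 1"
  shows "(\<lambda>z. f z + g z) \<in> Hinf0 E s"
proof -
  obtain C \<sigma> where C: "0 < C" "0 < \<sigma>" "\<sigma> \<le> 1" "\<And>z. z \<in> E_dom E s \<Longrightarrow> cmod (f z) \<le> C * cmod (P z) powr \<sigma>"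
    using Hinf0_decay[OF assms(1,3)] by blast
  obtain D \<tau> where D: "0 < D" "0 < \<tau>" "\<tau> \<le> 1" "\<And>z. z \<in> E_dom E s \<Longrightarrow> cmod (g z) \<le> D * cmod (P z) powr \<tau>"
    using Hinf0_decay[OF assms(2,3)] by blast
  define M where "M = (2::real) ^ card E"
  have M: "M \<ge> 1" by (simp add: M_def)
  define \<rho> where "\<rho> = min \<sigma> \<tau>"
  have PM: "cmod (P z) powr a \<le> M * cmod (P z) powr \<rho>" if z: "z \<in> E_dom E s" and a: "\<rho> \<le> a" "a \<le> 1" for z a
  proof -
    have le: "cmod (P z) \<le> M" unfolding M_def using E_dom_ball[OF assms(3)] z by (intro P_le) fastforce
    have "cmod (P z) powr (a - \<rho>) \<le> M powr (a - \<rho>)" using a le by (intro powr_mono2) auto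
    also have "\<dots> \<le> M powr 1" using M a C D by (intro powr_mono) (auto simp: \<rho>_def)
    finally have "cmod (P z) powr (a - \<rho>) * cmod (P z) powr \<rho> \<le> M * cmod (P z) powr \<rho>"
      using M by (intro mult_right_mono) auto
    then show ?thesis by (simp flip: powr_add)
  qed
  show ?thesis
  proof (rule Hinf0I[OF _ assms(3), of _ \<rho> "(C + D) * M"])
    show "(\<lambda>z. f z + g z) holomorphic_on E_dom E s"
      using assms by (intro holomorphic_intros) (auto simp: Hinf0_def)
    fix z assume z: "z \<in> E_dom E s"
    have "cmod (f z + g z) \<le> C * cmod (P z) powr \<sigma> + D * cmod (P z) powr \<tau>"
      using C(4)[OF z] D(4)[OF z] by (intro norm_triangle_le add_mono)
    also have "\<dots> \<le> C * (M * cmod (P z) powr \<rho>) + D * (M * cmod (P z) powr \<rho>)"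
      using C D z by (intro add_mono mult_left_mono PM) (auto simp: \<rho>_def)
    finally show "cmod (f z + g z) \<le> (C + D) * M * cmod (P z) powr \<rho>" by (simp add: algebra_simps)
  qed (use C D M in \<open>auto simp: \<rho>_def\<close>)
qed

lemma Hinf0_scale: "f \<in> Hinf0 E s \<Longrightarrow> s < 1 \<Longrightarrow> (\<lambda>z. c * f z) \<in> Hinf0 E s"
  using Hinf0_mult[of f s "\<lambda>_. c" "cmod c"] by (simp add: mult.commute)

lemma indepI:
  assumes "f \<in> Hinf0 E s" "\<And>u v. r0 < u \<Longrightarrow> u < s \<Longrightarrow> r0 < v \<Longrightarrow> v < s \<Longrightarrow> I u f = I v f"
  shows "indep s f"
  using assms unfolding indep_def by blast

lemma indepD:
  assumes "indep s f"
  shows "f \<in> Hinf0 E s" and "r0 < u \<Longrightarrow> u < s \<Longrightarrow> r0 < v \<Longrightarrow> v < s \<Longrightarrow> I u f = I v f"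
  using assms unfolding indep_def by blast+

lemma indep_cong:
  assumes f: "indep s f" "s < 1" and eq: "\<And>z. z \<in> E_dom E s \<Longrightarrow> f z = g z"
  shows "indep s g"
proof -
  have "f holomorphic_on E_dom E s \<longleftrightarrow> g holomorphic_on E_dom E s" by (rule holomorphic_cong[OF refl eq])
  moreover have "f ` E_dom E s = g ` E_dom E s" by (rule image_cong[OF refl eq])
  ultimately have g: "g \<in> Hinf0 E s" using f(1) eq unfolding indep_def Hinf0_def by auto
  have "I u g = I u f" if u: "r0 < u" "u < s" for u
  proof -
    have u': "E_large_enough E u" "0 < u" "u < 1" using large_u[of u] u f(2) by auto
    obtain \<gamma>' S L where \<gamma>: "contour (bd u) \<gamma>' S L" using contour_bd[OF u'] by blast
    interpret contour "bd u" \<gamma>' S L by (rule \<gamma>)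
    show ?thesis
      unfolding I_def vector_contour_integral_eq
      by (rule cint_cong[OF finite_bd_E[OF u']]) (use bd_in_larger[OF u'(1,2) u(2) f(2)] eq in auto)
  qed
  note eqI = this
  show ?thesis
  proof (rule indepI[OF g])
    fix u v assume uv: "r0 < u" "u < s" "r0 < v" "v < s"
    show "I u g = I v g"
      unfolding eqI[OF uv(1,2)] eqI[OF uv(3,4)] by (rule indepD(2)[OF f(1) uv])
  qed
qed

lemma indep_P: "s < 1 \<Longrightarrow> indep s P"
  by (rule indepI) (rule P_Hinf0, assumption, rule I_P_independent, simp_all)

lemma indep_add:
  assumes f: "indep s f" and g: "indep s g" and s: "s < 1"
  shows "indep s (\<lambda>z. f z + g z)"
proof (rule indepI[OF Hinf0_add[OF indepD(1)[OF f] indepD(1)[OF g] s]])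
  fix u v assume uv: "r0 < u" "u < s" "r0 < v" "v < s"
  show "I u (\<lambda>z. f z + g z) = I v (\<lambda>z. f z + g z)"
    by (simp only: I_add[OF uv(1,2) s indepD(1)[OF f] indepD(1)[OF g]]
        I_add[OF uv(3,4) s indepD(1)[OF f] indepD(1)[OF g]] indepD(2)[OF f uv] indepD(2)[OF g uv])
qed

lemma indep_scale:
  assumes f: "indep s f" and s: "s < 1"
  shows "indep s (\<lambda>z. c * f z)"
proof (rule indepI[OF Hinf0_scale[OF indepD(1)[OF f] s]])
  fix u v assume uv: "r0 < u" "u < s" "r0 < v" "v < s"
  show "I u (\<lambda>z. c * f z) = I v (\<lambda>z. c * f z)"
    by (simp only: I_scale[OF uv(1,2) s indepD(1)[OF f]] I_scale[OF uv(3,4) s indepD(1)[OF f]] indepD(2)[OF f uv])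
qed

lemma indep_divide:
  assumes f: "indep s f" and s: "s < 1" and a: "a \<notin> closure (E_dom E s)"
  shows "indep s (\<lambda>z. f z / (a - z))"
proof (rule indepI[OF Hinf0_divide[OF indepD(1)[OF f] s a]])
  fix u v assume uv: "r0 < u" "u < s" "r0 < v" "v < s"
  show "I u (\<lambda>z. f z / (a - z)) = I v (\<lambda>z. f z / (a - z))"
    by (simp only: I_divide[OF uv(1,2) s indepD(1)[OF f] a] I_divide[OF uv(3,4) s indepD(1)[OF f] a] indepD(2)[OF f uv])
qed

lemma indep_prod_divide:
  assumes "finite F" "indep s f" "s < 1" "\<And>\<xi>. \<xi> \<in> F \<Longrightarrow> a \<xi> \<notin> closure (E_dom E s)"
  shows "indep s (\<lambda>z. f z * (\<Prod>\<xi>\<in>F. 1 / (a \<xi> - z)))"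
  using assms
proof (induction F rule: finite_induct)
  case (insert \<xi> F)
  then have "indep s (\<lambda>z. f z * (\<Prod>\<xi>\<in>F. 1 / (a \<xi> - z)) / (a \<xi> - z))"
    by (intro indep_divide) auto
  then show ?case using insert.hyps by simp
qed simp

lemma indep_sum:
  assumes "finite F" "F \<noteq> {}" "\<And>i. i \<in> F \<Longrightarrow> indep s (f i)" "s < 1"
  shows "indep s (\<lambda>z. \<Sum>i\<in>F. f i z)"
  using assms
proof (induction F rule: finite_ne_induct)
  case (insert i F)
  then show ?case using indep_add[of s "f i" "\<lambda>z. \<Sum>i\<in>F. f i z"] by simp
qed simp

text \<open>An approximate unit: it is bounded by 1 on the closed disc, tends to 1 off
  \<open>E\<close> as \<epsilon> tends to 0, and is O(|P|) for fixed \<epsilon>. The poles (1 +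
  \<epsilon>) \<xi> lie outside the disc.\<close>

definition damp :: "real \<Rightarrow> complex \<Rightarrow> complex" where
  "damp \<epsilon> z = (\<Prod>\<xi>\<in>E. (\<xi> - z) / (of_real (1 + \<epsilon>) * \<xi> - z))"

lemma damp_pole: "\<epsilon> > 0 \<Longrightarrow> s < 1 \<Longrightarrow> \<xi> \<in> E \<Longrightarrow> of_real (1 + \<epsilon>) * \<xi> \<notin> closure (E_dom E s)"
proof
  assume *: "\<epsilon> > 0" "s < 1" "\<xi> \<in> E" "of_real (1 + \<epsilon>) * \<xi> \<in> closure (E_dom E s)"
  then have "cmod (of_real (1 + \<epsilon>) * \<xi>) \<le> 1" using closure_E_dom_cball[of s] by auto
  then show False using * norm_E by (simp only: norm_mult norm_of_real) simp
qed

lemma damp_factor: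
  assumes "\<epsilon> > 0" "cmod z \<le> 1" "\<xi> \<in> E"
  shows "\<epsilon> \<le> cmod (of_real (1 + \<epsilon>) * \<xi> - z)" and "cmod (\<xi> - z) \<le> cmod (of_real (1 + \<epsilon>) * \<xi> - z)"
proof -
  have "cmod (of_real (1 + \<epsilon>) * \<xi>) = 1 + \<epsilon>" using assms norm_E by (simp only: norm_mult norm_of_real) simp
  then show "\<epsilon> \<le> cmod (of_real (1 + \<epsilon>) * \<xi> - z)"
    using norm_triangle_ineq2[of "of_real (1 + \<epsilon>) * \<xi>" z] assms by simp
  have \<xi>: "cmod \<xi> = 1" using assms norm_E by simp
  have "inner \<xi> z \<le> 1" using norm_cauchy_schwarz[of \<xi> z] \<xi> assms by simp
  then have "0 \<le> inner (\<epsilon> *\<^sub>R \<xi>) (\<xi> - z)"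
    using assms \<xi> by (simp add: inner_diff_right dot_square_norm)
  moreover have "of_real (1 + \<epsilon>) * \<xi> - z = (\<xi> - z) + \<epsilon> *\<^sub>R \<xi>" by (simp add: scaleR_conv_of_real algebra_simps)
  moreover have "(cmod a)\<^sup>2 \<le> (cmod (a + b))\<^sup>2" if "0 \<le> inner b a" for a b :: complex
    using that by (simp add: power2_norm_eq_inner inner_add_left inner_add_right inner_commute)
  ultimately have "(cmod (\<xi> - z))\<^sup>2 \<le> (cmod (of_real (1 + \<epsilon>) * \<xi> - z))\<^sup>2"
    by (simp only:)
  then show "cmod (\<xi> - z) \<le> cmod (of_real (1 + \<epsilon>) * \<xi> - z)" by (rule power2_le_imp_le) simp
qed

lemma damp_le_1: "\<epsilon> > 0 \<Longrightarrow> cmod z \<le> 1 \<Longrightarrow> cmod (damp \<epsilon> z) \<le> 1"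
  unfolding damp_def prod_norm[symmetric] norm_divide
  using damp_factor by (intro prod_le_1) (auto simp: divide_le_eq_1)

lemma damp_le_P:
  assumes "\<epsilon> > 0" "cmod z \<le> 1"
  shows "cmod (damp \<epsilon> z) \<le> (1 / \<epsilon>) ^ card E * cmod (P z)"
proof -
  have "cmod (damp \<epsilon> z) = (\<Prod>\<xi>\<in>E. cmod (\<xi> - z) / cmod (of_real (1 + \<epsilon>) * \<xi> - z))"
    by (simp add: damp_def norm_divide flip: prod_norm)
  also have "\<dots> \<le> (\<Prod>\<xi>\<in>E. (1 / \<epsilon>) * cmod (\<xi> - z))"
  proof (intro prod_mono conjI)
    fix \<xi> assume "\<xi> \<in> E"
    from damp_factor(1)[OF assms this]
    have "cmod (\<xi> - z) / cmod (of_real (1 + \<epsilon>) * \<xi> - z) \<le> cmod (\<xi> - z) / \<epsilon>"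
      using assms by (intro frac_le) auto
    then show "cmod (\<xi> - z) / cmod (of_real (1 + \<epsilon>) * \<xi> - z) \<le> (1 / \<epsilon>) * cmod (\<xi> - z)" by simp
  qed simp
  also have "\<dots> = (1 / \<epsilon>) ^ card E * cmod (P z)"
    by (simp only: prod.distrib prod_constant prod_norm P_def)
  finally show ?thesis .
qed

lemma damp_holomorphic:
  assumes "\<epsilon> > 0"
  shows "damp \<epsilon> holomorphic_on cball 0 1"
  unfolding damp_def using damp_factor(1)[OF assms] assms by (intro holomorphic_intros) fastforce+

text \<open>With b = (1 + \<epsilon>) \<xi> each factor equals 1 - \<epsilon> \<xi> / (b - z), so
  the closure properties of \<open>indep\<close> apply factor by factor.\<close>

lemma indep_damp:
  assumes f: "indep s f" "s < 1" and \<epsilon>: "\<epsilon> > 0"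
  shows "indep s (\<lambda>z. f z * damp \<epsilon> z)"
proof -
  have "indep s (\<lambda>z. f z * (\<Prod>\<xi>\<in>F. (\<xi> - z) / (of_real (1 + \<epsilon>) * \<xi> - z)))" if "F \<subseteq> E" for F
    using finite_subset[OF that fin] that
  proof (induction F rule: finite_induct)
    case (insert \<xi> F)
    let ?g = "\<lambda>z. f z * (\<Prod>\<xi>\<in>F. (\<xi> - z) / (of_real (1 + \<epsilon>) * \<xi> - z))" and ?b = "of_real (1 + \<epsilon>) * \<xi>"
    have pole: "?b \<notin> closure (E_dom E s)" using damp_pole[OF \<epsilon> f(2)] insert.prems by simp
    have g: "indep s ?g" using insert by simp
    have g2: "indep s (\<lambda>z. ?g z + (- of_real \<epsilon> * \<xi>) * (?g z / (?b - z)))"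
      by (intro indep_add indep_scale indep_divide g f(2) pole)
    have "f z * (\<Prod>\<xi>\<in>insert \<xi> F. (\<xi> - z) / (of_real (1 + \<epsilon>) * \<xi> - z)) = ?g z + (- of_real \<epsilon> * \<xi>) * (?g z / (?b - z))"
      if "?b - z \<noteq> 0" for z
    proof -
      have "(\<xi> - z) / (?b - z) = 1 + (- of_real \<epsilon> * \<xi>) / (?b - z)"
      proof -
        have "\<xi> - z = (?b - z) + (- of_real \<epsilon> * \<xi>)" by (simp add: algebra_simps)
        then show ?thesis using that by (simp only: add_divide_distrib) simp
      qed
      then have "(\<Prod>\<xi>\<in>insert \<xi> F. (\<xi> - z) / (of_real (1 + \<epsilon>) * \<xi> - z)) =
          (1 + (- of_real \<epsilon> * \<xi>) / (?b - z)) * (\<Prod>\<xi>\<in>F. (\<xi> - z) / (of_real (1 + \<epsilon>) * \<xi> - z))"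
        by (simp only: prod.insert[OF insert.hyps])
      then show ?thesis by (simp only: distrib_right distrib_left mult_1_left times_divide_eq_left times_divide_eq_right mult_ac)
    qed
    moreover have "?b - z \<noteq> 0" if "z \<in> E_dom E s" for z
      using pole that closure_subset[of "E_dom E s"] by auto
    ultimately show ?case by (intro indep_cong[OF g2 f(2)]) simp
  qed (use f in simp)
  from this[of E] show ?thesis by (simp add: damp_def)
qed

end

section \<open>The discretised Cauchy representation\<close>

context ritt_operator
begin

lemma Hinf0_damp:
  assumes "f \<in> Hinf0 E s" "s < 1" "\<epsilon> > 0"
  shows "(\<lambda>z. f z * damp \<epsilon> z) \<in> Hinf0 E s"
proof (rule Hinf0_mult[OF assms(1,2)])
  have sub: "E_dom E s \<subseteq> cball 0 1" using E_dom_ball[OF assms(2)] by (auto simp: subset_iff less_imp_le)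
  show "damp \<epsilon> holomorphic_on E_dom E s" by (rule holomorphic_on_subset[OF damp_holomorphic[OF assms(3)] sub])
  show "cmod (damp \<epsilon> z) \<le> 1" if "z \<in> E_dom E s" for z
    using sub that by (intro damp_le_1 assms(3)) auto
qed

lemma damp_tendsto:
  assumes "z \<notin> E"
  shows "(\<lambda>n. damp (1 / real (Suc n)) z) \<longlonglongrightarrow> 1"
proof -
  have e: "(\<lambda>n. of_real (1 + 1 / real (Suc n)) :: complex) \<longlonglongrightarrow> of_real (1 + 0)"
    by (intro tendsto_of_real tendsto_add tendsto_const LIMSEQ_Suc[OF lim_1_over_n[where 'a = real]])
  have "(\<lambda>n. damp (1 / real (Suc n)) z) \<longlonglongrightarrow> (\<Prod>\<xi>\<in>E. (\<xi> - z) / (of_real (1 + 0) * \<xi> - z))"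
    unfolding damp_def using assms by (intro tendsto_prod tendsto_divide tendsto_diff tendsto_const tendsto_mult e) auto
  also have "(\<Prod>\<xi>\<in>E. (\<xi> - z) / (of_real (1 + 0) * \<xi> - z)) = 1"
    using assms by (intro prod.neutral) auto
  finally show ?thesis .
qed

lemma I_damp_tendsto:
  assumes u: "r0 < u" "u < s" "s < 1" and f: "f \<in> Hinf0 E s"
  shows "(\<lambda>n. I u (\<lambda>z. f z * damp (1 / real (Suc n)) z)) \<longlonglongrightarrow> I u f"
proof -
  have u': "E_large_enough E u" "0 < u" "u < 1" using large_u[of u] u by auto
  obtain \<gamma>' S L where \<gamma>: "contour (bd u) \<gamma>' S L" using contour_bd[OF u'] by blast
  interpret contour "bd u" \<gamma>' S L by (rule \<gamma>)
  let ?S = "{t\<in>{0..1}. bd u t \<in> E}"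
  have e0: "1 / real (Suc n) > 0" for n by simp
  obtain g where g: "g integrable_on {0..1}"
    "\<And>t. t \<in> {0..1} - ?S \<Longrightarrow> cmod (f (bd u t)) * norm (resolvent (bd u t) T) \<le> g t"
    using adm_Hinf0(1)[OF u f \<gamma>] by blast
  show ?thesis
    unfolding I_def vector_contour_integral_eq
  proof (rule cint_dominated_convergence[OF finite_bd_E[OF u'] _ _ g(1)])
    show "continuous_on ({0..1} - ?S) (\<lambda>t. (f (bd u t) * damp (1 / real (Suc n)) (bd u t)) *\<^sub>C resolvent (bd u t) T)" for n
      by (rule adm_Hinf0(2)[OF u Hinf0_damp[OF f u(3) e0] \<gamma>])
    show "continuous_on ({0..1} - ?S) (\<lambda>t. f (bd u t) *\<^sub>C resolvent (bd u t) T)"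
      by (rule adm_Hinf0(2)[OF u f \<gamma>])
    fix t assume t: "t \<in> {0..1} - ?S"
    have "cmod (bd u t) \<le> 1" using bd_eq(3)[OF u', of t] closure_E_dom_cball[OF u'(3)] by auto
    then have d: "cmod (damp (1 / real (Suc n)) (bd u t)) \<le> 1" for n by (intro damp_le_1 e0)
    show "norm ((f (bd u t) * damp (1 / real (Suc n)) (bd u t)) *\<^sub>C resolvent (bd u t) T) \<le> g t" for n
    proof -
      have "norm ((f (bd u t) * damp (1 / real (Suc n)) (bd u t)) *\<^sub>C resolvent (bd u t) T)
        = cmod (damp (1 / real (Suc n)) (bd u t)) * (cmod (f (bd u t)) * norm (resolvent (bd u t) T))"
        by (simp add: norm_scaleC norm_mult mult_ac)
      also have "\<dots> \<le> 1 * (cmod (f (bd u t)) * norm (resolvent (bd u t) T))"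
        by (intro mult_right_mono d) auto
      finally show ?thesis using g(2)[OF t] by simp
    qed
    have "(\<lambda>n. f (bd u t) * damp (1 / real (Suc n)) (bd u t)) \<longlonglongrightarrow> f (bd u t) * 1"
      using t by (intro tendsto_mult tendsto_const damp_tendsto) auto
    then show "(\<lambda>n. (f (bd u t) * damp (1 / real (Suc n)) (bd u t)) *\<^sub>C resolvent (bd u t) T) \<longlonglongrightarrow> f (bd u t) *\<^sub>C resolvent (bd u t) T"
      by (intro tendsto_scaleC tendsto_const) simp
  qed
qed

text \<open>Decay of first order at \<open>E\<close>, enough for the Cauchy integrand to stay
  bounded on the contour uniformly in \<open>z\<close>. Every damped function of
  \<open>Hinf0\<close> qualifies.\<close>

definition small :: "real \<Rightarrow> (complex \<Rightarrow> complex) \<Rightarrow> bool" where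
  "small s \<phi> \<longleftrightarrow> \<phi> holomorphic_on E_dom E s \<and> (\<exists>D\<ge>0. \<forall>z\<in>E_dom E s. cmod (\<phi> z) \<le> D * cmod (P z))"

lemma small_Hinf0: "small s \<phi> \<Longrightarrow> s < 1 \<Longrightarrow> \<phi> \<in> Hinf0 E s"
proof -
  assume "small s \<phi>" "s < 1"
  then obtain D where "\<phi> holomorphic_on E_dom E s" "D \<ge> 0" "\<And>z. z \<in> E_dom E s \<Longrightarrow> cmod (\<phi> z) \<le> D * cmod (P z)"
    unfolding small_def by blast
  then show ?thesis using \<open>s < 1\<close> by (intro Hinf0I[of \<phi> s 1 D]) auto
qed

lemma small_damp:
  assumes f: "f \<in> Hinf0 E s" "s < 1" and e: "\<epsilon> > 0"
  shows "small s (\<lambda>z. f z * damp \<epsilon> z)"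
proof -
  obtain B where B: "\<And>z. z \<in> E_dom E s \<Longrightarrow> cmod (f z) \<le> B"
    using f unfolding Hinf0_def bounded_iff by blast
  have "cmod (f z * damp \<epsilon> z) \<le> (max B 0 * (1 / \<epsilon>) ^ card E) * cmod (P z)" if z: "z \<in> E_dom E s" for z
  proof -
    have "cmod z \<le> 1" using E_dom_ball[OF f(2)] z by fastforce
    then have "cmod (f z * damp \<epsilon> z) \<le> max B 0 * ((1 / \<epsilon>) ^ card E * cmod (P z))"
      unfolding norm_mult using B[OF z] by (intro mult_mono damp_le_P e) auto
    then show ?thesis by (simp add: mult.assoc)
  qed
  then show ?thesis
    unfolding small_def using Hinf0_damp[OF f e] e
    by (intro conjI exI[of _ "max B 0 * (1 / \<epsilon>) ^ card E"]) (auto simp: Hinf0_def)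
qed

text \<open>Uniform convergence alone does not control the integrals, since the available bound 1 /
  |P| for the resolvent is not integrable along the contour; a fixed damping factor compensates
  it.\<close>

lemma I_uniform_limit_damp:
  assumes u: "r0 < u" "u < w" "w < 1" and e: "\<epsilon> > 0" and f: "f \<in> Hinf0 E w" and A: "\<And>n. A n \<in> Hinf0 E w"
    and lim: "\<And>n z. z \<in> E_dom E w \<Longrightarrow> cmod (A n z - f z) \<le> d n" and d: "d \<longlonglongrightarrow> 0"
  shows "(\<lambda>n. I u (\<lambda>z. A n z * damp \<epsilon> z)) \<longlonglongrightarrow> I u (\<lambda>z. f z * damp \<epsilon> z)"
proof -
  have u': "E_large_enough E u" "0 < u" "u < 1" using large_u[of u] u by auto
  obtain \<gamma>' S L where \<gamma>: "contour (bd u) \<gamma>' S L" using contour_bd[OF u'] by blast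
  interpret contour "bd u" \<gamma>' S L by (rule \<gamma>)
  obtain D where D: "D > 0" "\<And>z. cmod z < 2 \<Longrightarrow> z \<notin> E_dom E u \<Longrightarrow> z \<notin> E \<Longrightarrow> cmod (P z) * norm (resolvent z T) \<le> D"
    using resolvent_bound[OF u(1) u'(3)] by blast
  note adm = adm_Hinf0(3)[OF u Hinf0_damp[OF _ u(3) e] \<gamma>]
  have d0: "d n \<ge> 0" for n
  proof -
    have "0 \<in> E_dom E w" by (rule zero_in_E_dom) (use u r0 in simp)
    then show ?thesis using lim[of 0 n] order_trans[OF norm_ge_zero] by blast
  qed
  have "norm (I u (\<lambda>z. A n z * damp \<epsilon> z) - I u (\<lambda>z. f z * damp \<epsilon> z)) \<le> (L * ((1 / \<epsilon>) ^ card E * D)) * d n" for n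
  proof -
    have bnd: "norm ((A n (bd u t) * damp \<epsilon> (bd u t)) *\<^sub>C resolvent (bd u t) T - (f (bd u t) * damp \<epsilon> (bd u t)) *\<^sub>C resolvent (bd u t) T) \<le> d n * ((1 / \<epsilon>) ^ card E * D)"
      if t: "t \<in> {0..1} - {t\<in>{0..1}. bd u t \<in> E}" for t
    proof -
      let ?z = "bd u t"
      have zE: "?z \<notin> E" using t by auto
      have z1: "cmod ?z \<le> 1" using bd_eq(3)[OF u', of t] closure_E_dom_cball[OF u'(3)] by auto
      have "(A n ?z * damp \<epsilon> ?z) *\<^sub>C resolvent ?z T - (f ?z * damp \<epsilon> ?z) *\<^sub>C resolvent ?z T =
        ((A n ?z - f ?z) * damp \<epsilon> ?z) *\<^sub>C resolvent ?z T"
        by (simp add: scaleC_left_diff left_diff_distrib)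
      then have "norm ((A n ?z * damp \<epsilon> ?z) *\<^sub>C resolvent ?z T - (f ?z * damp \<epsilon> ?z) *\<^sub>C resolvent ?z T) =
        cmod (A n ?z - f ?z) * (cmod (damp \<epsilon> ?z) * norm (resolvent ?z T))"
        by (simp add: norm_scaleC norm_mult)
      also have "\<dots> \<le> d n * ((1 / \<epsilon>) ^ card E * D)"
      proof (rule mult_mono)
        show "cmod (A n ?z - f ?z) \<le> d n" by (rule lim[OF bd_in_larger[OF u'(1,2) u(2,3) zE]])
        have "cmod (damp \<epsilon> ?z) * norm (resolvent ?z T) \<le> ((1 / \<epsilon>) ^ card E * cmod (P ?z)) * norm (resolvent ?z T)"
          by (intro mult_right_mono damp_le_P e z1) auto
        also have "\<dots> = (1 / \<epsilon>) ^ card E * (cmod (P ?z) * norm (resolvent ?z T))" by simp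
        also have "\<dots> \<le> (1 / \<epsilon>) ^ card E * D"
          using e z1 zE bd_eq(4)[OF u', of t] by (intro mult_left_mono D(2)) auto
        finally show "cmod (damp \<epsilon> ?z) * norm (resolvent ?z T) \<le> (1 / \<epsilon>) ^ card E * D" .
      qed (use d0 in auto)
      finally show ?thesis .
    qed
    have "I u (\<lambda>z. A n z * damp \<epsilon> z) - I u (\<lambda>z. f z * damp \<epsilon> z) =
      cint (\<lambda>z. (A n z * damp \<epsilon> z) *\<^sub>C resolvent z T - (f z * damp \<epsilon> z) *\<^sub>C resolvent z T)"
      unfolding I_def vector_contour_integral_eq by (rule cint_diff[OF adm[OF A] adm[OF f], symmetric])
    also have "norm \<dots> \<le> L * (d n * ((1 / \<epsilon>) ^ card E * D))"
      by (rule cint_bound[OF adm_diff[OF adm[OF A] adm[OF f]] finite_bd_E[OF u'] bnd]) (use e D(1) d0 in auto)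
    finally show ?thesis by (simp add: mult_ac)
  qed
  then have "(\<lambda>n. I u (\<lambda>z. A n z * damp \<epsilon> z) - I u (\<lambda>z. f z * damp \<epsilon> z)) \<longlonglongrightarrow> 0"
    by (intro Lim_null_comparison[OF always_eventually tendsto_mult_right_zero[OF d]]) auto
  then show ?thesis by (rule LIM_zero_cancel)
qed

text \<open>The factor \<open>G\<close> makes the Cauchy kernel decay where \<open>z\<close> is much closer to a point of \<open>E\<close> than \<open>\<zeta>\<close>;
  as \<open>G z z = 1\<close>, it does not affect Cauchy's formula.\<close>

definition G :: "complex \<Rightarrow> complex \<Rightarrow> complex" where
  "G \<zeta> z = (\<Prod>\<xi>\<in>E. 2 * (\<xi> - z) / (2 * \<xi> - \<zeta> - z))"

definition kern :: "complex \<Rightarrow> complex \<Rightarrow> complex" where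
  "kern \<zeta> z = G \<zeta> z / (\<zeta> - z)"

text \<open>By the Stolz inequality 1 - cnj \<xi> \<zeta> and 1 - cnj \<xi> z have real parts
  comparable to their moduli, and nonnegative real parts add without cancellation.\<close>

lemma stolz_sum:
  assumes v: "0 < v" "v < 1"
  shows "\<exists>C\<ge>1. \<forall>z\<in>closure (E_dom E v). \<forall>\<zeta>\<in>closure (E_dom E v). \<forall>\<xi>\<in>E.
    cmod (\<xi> - \<zeta>) + cmod (\<xi> - z) \<le> C * cmod (2 * \<xi> - \<zeta> - z)"
proof -
  obtain C where C: "C > 0" "\<And>z \<xi>. z \<in> closure (E_dom E v) \<Longrightarrow> \<xi> \<in> E \<Longrightarrow> cmod (1 - cnj \<xi> * z) \<le> C * Re (1 - cnj \<xi> * z)"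
    using stolz[OF v] by blast
  have "cmod (\<xi> - \<zeta>) + cmod (\<xi> - z) \<le> (C + 1) * cmod (2 * \<xi> - \<zeta> - z)"
    if z: "z \<in> closure (E_dom E v)" "\<zeta> \<in> closure (E_dom E v)" and \<xi>: "\<xi> \<in> E" for z \<zeta> \<xi>
  proof -
    have \<xi>\<xi>: "cnj \<xi> * \<xi> = 1" using norm_E[OF \<xi>] complex_norm_square[of \<xi>] by (simp add: mult.commute)
    have n: "cmod (\<xi> - y) = cmod (1 - cnj \<xi> * y)" for y
    proof -
      have "1 - cnj \<xi> * y = cnj \<xi> * (\<xi> - y)" by (simp add: right_diff_distrib \<xi>\<xi>)
      then show ?thesis using norm_E[OF \<xi>] by (simp add: norm_mult)
    qed
    have "cmod (\<xi> - \<zeta>) + cmod (\<xi> - z) \<le> C * (Re (1 - cnj \<xi> * \<zeta>) + Re (1 - cnj \<xi> * z))"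
      unfolding n distrib_left by (rule add_mono[OF C(2)[OF z(2) \<xi>] C(2)[OF z(1) \<xi>]])
    also have "Re (1 - cnj \<xi> * \<zeta>) + Re (1 - cnj \<xi> * z) = Re (cnj \<xi> * (2 * \<xi> - \<zeta> - z))"
    proof -
      have "cnj \<xi> * (2 * \<xi> - \<zeta> - z) = 2 * (cnj \<xi> * \<xi>) - cnj \<xi> * \<zeta> - cnj \<xi> * z" by (simp add: algebra_simps)
      then show ?thesis unfolding \<xi>\<xi> by simp
    qed
    also have "\<dots> \<le> cmod (2 * \<xi> - \<zeta> - z)"
      using complex_Re_le_cmod[of "cnj \<xi> * (2 * \<xi> - \<zeta> - z)"] norm_E[OF \<xi>] by (simp add: norm_mult)
    finally have 1: "cmod (\<xi> - \<zeta>) + cmod (\<xi> - z) \<le> C * cmod (2 * \<xi> - \<zeta> - z)" using C(1) by simp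
    have "C * cmod (2 * \<xi> - \<zeta> - z) \<le> (C + 1) * cmod (2 * \<xi> - \<zeta> - z)" by (intro mult_right_mono) auto
    with 1 show ?thesis by (rule order_trans)
  qed
  then show ?thesis using C(1) by (intro exI[of _ "C + 1"]) auto
qed

end

text \<open>The radii have separate tasks: the functions live on \<open>E_dom E s\<close>, the
  Cauchy contour is the boundary of \<open>E_dom E v\<close>, and approximation takes place on
  \<open>E_dom E w\<close>.\<close>

locale ritt_contour = ritt_operator E T r0 + contour "polar_boundary (E_dom E v)" \<gamma>' S L
  for E :: "complex set" and T :: "'a :: complex_banach \<Rightarrow>\<^sub>L 'a" and r0 v \<gamma>' S L +
  fixes w s :: real
  assumes ord: "r0 < w" "w < v" "v < s" "s < 1"
begin

section \<open>Bounds for the modified kernel\<close>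

lemma v: "E_large_enough E v" "0 < v" "v < 1"
  using large_u[of v] ord by auto

lemma w: "E_large_enough E w" "0 < w" "w < 1"
  using large_u[of w] ord by auto

lemma cl_wv: "closure (E_dom E w) \<subseteq> closure (E_dom E v)"
  using ord by (intro closure_mono E_dom_mono) simp

lemma bd_s: "bd v t \<notin> E \<Longrightarrow> bd v t \<in> E_dom E s"
  using bd_in_larger[OF v(1,2) ord(3,4)] .

lemma bd_cl: "bd v t \<in> closure (E_dom E v)"
  by (rule bd_eq(3)[OF v])

lemma bd_not_w: "bd v t \<notin> E \<Longrightarrow> bd v t \<notin> closure (E_dom E w)"
  by (rule notin_closure_smaller[OF w(1,2) ord(2) v(3) bd_eq(4)[OF v]])

definition Cst where "Cst = (SOME C. C \<ge> 1 \<and> (\<forall>z\<in>closure (E_dom E v). \<forall>\<zeta>\<in>closure (E_dom E v). \<forall>\<xi>\<in>E.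
    cmod (\<xi> - \<zeta>) + cmod (\<xi> - z) \<le> C * cmod (2 * \<xi> - \<zeta> - z)))"

lemma Cst: "Cst \<ge> 1" "\<And>z \<zeta> \<xi>. z \<in> closure (E_dom E v) \<Longrightarrow> \<zeta> \<in> closure (E_dom E v) \<Longrightarrow> \<xi> \<in> E \<Longrightarrow>
    cmod (\<xi> - \<zeta>) + cmod (\<xi> - z) \<le> Cst * cmod (2 * \<xi> - \<zeta> - z)"
  using someI_ex[OF stolz_sum[OF v(2,3)], folded Cst_def] by blast+

lemma factor_bound:
  assumes "z \<in> closure (E_dom E v)" "\<zeta> \<in> closure (E_dom E v)" "\<xi> \<in> E" "\<zeta> \<noteq> \<xi> \<or> z \<noteq> \<xi>"
  shows "cmod (2 * (\<xi> - z) / (2 * \<xi> - \<zeta> - z)) \<le> 2 * Cst * (cmod (\<xi> - z) / (cmod (\<xi> - \<zeta>) + cmod (\<xi> - z)))"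
    and "2 * \<xi> - \<zeta> - z \<noteq> 0"
proof -
  have s: "cmod (\<xi> - \<zeta>) + cmod (\<xi> - z) > 0" using assms(4) by (auto intro: add_pos_nonneg add_nonneg_pos)
  note C = Cst(2)[OF assms(1-3)]
  have d: "cmod (2 * \<xi> - \<zeta> - z) > 0" using C s Cst(1) by (cases "cmod (2 * \<xi> - \<zeta> - z) = 0") auto
  then show "2 * \<xi> - \<zeta> - z \<noteq> 0" by auto
  have "1 / cmod (2 * \<xi> - \<zeta> - z) \<le> Cst / (cmod (\<xi> - \<zeta>) + cmod (\<xi> - z))"
    using C s d by (simp add: divide_simps mult.commute)
  then have "2 * cmod (\<xi> - z) * (1 / cmod (2 * \<xi> - \<zeta> - z)) \<le> 2 * cmod (\<xi> - z) * (Cst / (cmod (\<xi> - \<zeta>) + cmod (\<xi> - z)))"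
    by (intro mult_left_mono) auto
  moreover have "cmod (2 * (\<xi> - z) / (2 * \<xi> - \<zeta> - z)) = 2 * cmod (\<xi> - z) * (1 / cmod (2 * \<xi> - \<zeta> - z))"
    by (simp only: norm_divide norm_mult norm_numeral) simp
  ultimately show "cmod (2 * (\<xi> - z) / (2 * \<xi> - \<zeta> - z)) \<le> 2 * Cst * (cmod (\<xi> - z) / (cmod (\<xi> - \<zeta>) + cmod (\<xi> - z)))"
    by (simp only: times_divide_eq_right mult_ac)
qed

text \<open>The factor of \<xi> is kept with its decay; each of the others is at most 2 Cst.\<close>

lemma G_bound_factor:
  assumes z: "z \<in> closure (E_dom E v)" and \<zeta>: "\<zeta> \<in> closure (E_dom E v)" "\<zeta> \<notin> E" and \<xi>: "\<xi> \<in> E"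
  shows "cmod (G \<zeta> z) \<le> (2 * Cst) ^ card E * (cmod (\<xi> - z) / (cmod (\<xi> - \<zeta>) + cmod (\<xi> - z)))"
proof -
  let ?q = "\<lambda>\<eta>. cmod (\<eta> - z) / (cmod (\<eta> - \<zeta>) + cmod (\<eta> - z))"
  have "cmod (G \<zeta> z) \<le> (\<Prod>\<eta>\<in>E. 2 * Cst * ?q \<eta>)"
    unfolding G_def prod_norm[symmetric] using \<zeta>
    by (intro prod_mono conjI factor_bound(1)[OF z \<zeta>(1)]) auto
  also have "\<dots> = (2 * Cst) ^ card E * (\<Prod>\<eta>\<in>E. ?q \<eta>)" by (simp only: prod.distrib prod_constant power_mult_distrib)
  also have "(\<Prod>\<eta>\<in>E. ?q \<eta>) = ?q \<xi> * (\<Prod>\<eta>\<in>E-{\<xi>}. ?q \<eta>)" by (rule prod.remove[OF fin \<xi>])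
  also have "(2 * Cst) ^ card E * (?q \<xi> * (\<Prod>\<eta>\<in>E-{\<xi>}. ?q \<eta>)) \<le> (2 * Cst) ^ card E * (?q \<xi> * 1)"
    using Cst(1) by (intro mult_left_mono prod_le_1 conjI) (auto intro: divide_nonneg_nonneg simp: divide_le_eq_1 add_nonneg_eq_0_iff order_less_le)
  finally show ?thesis by simp
qed

lemma G_bound:
  assumes z: "z \<in> closure (E_dom E v)" and \<zeta>: "\<zeta> \<in> closure (E_dom E v)" "\<zeta> \<notin> E"
  shows "cmod (G \<zeta> z) \<le> (2 * Cst) ^ card E"
proof -
  obtain \<xi> where \<xi>: "\<xi> \<in> E" using ne by blast
  have "cmod (\<xi> - z) / (cmod (\<xi> - \<zeta>) + cmod (\<xi> - z)) \<le> 1"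
    by (auto simp: divide_le_eq_1 add_nonneg_eq_0_iff order_less_le)
  then have "(2 * Cst) ^ card E * (cmod (\<xi> - z) / (cmod (\<xi> - \<zeta>) + cmod (\<xi> - z))) \<le> (2 * Cst) ^ card E * 1"
    using Cst(1) by (intro mult_left_mono) auto
  then show ?thesis using G_bound_factor[OF z \<zeta> \<xi>] by simp
qed

definition csep where "csep = (v - w) / 2"

lemma csep: "csep > 0" using ord by (simp add: csep_def)

text \<open>The point \<xi> depends on \<open>z\<close> alone and serves all \<zeta> off
  \<open>E_dom E v\<close> at once: all of them lie outside the ball about \<open>z\<close> from
  \<open>cone_ball\<close>, whose radius relative to |z - \<xi>| is \<open>csep\<close>.\<close>

lemma separation:
  assumes z: "z \<in> closure (E_dom E w)"
  shows "\<exists>\<xi>\<in>E. \<forall>\<zeta>. \<zeta> \<notin> E_dom E v \<longrightarrow> cmod (\<zeta> - \<xi>) + cmod (z - \<xi>) \<le> (1 + 2 / csep) * cmod (\<zeta> - z)"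
proof -
  obtain \<xi> where \<xi>: "\<xi> \<in> E" "ball z (csep * cmod (z - \<xi>)) \<subseteq> E_dom E v"
    using cone_ball[OF w(1,2) ord(2) v(3) z] unfolding csep_def by blast
  have "cmod (\<zeta> - \<xi>) + cmod (z - \<xi>) \<le> (1 + 2 / csep) * cmod (\<zeta> - z)" if "\<zeta> \<notin> E_dom E v" for \<zeta>
  proof -
    have "\<zeta> \<notin> ball z (csep * cmod (z - \<xi>))" using \<xi>(2) that by blast
    then have "csep * cmod (z - \<xi>) \<le> cmod (\<zeta> - z)" by (simp add: dist_norm norm_minus_commute)
    then have 1: "cmod (z - \<xi>) \<le> (1 / csep) * cmod (\<zeta> - z)" using csep by (simp add: field_simps)
    have "cmod (\<zeta> - \<xi>) \<le> cmod (\<zeta> - z) + cmod (z - \<xi>)" using norm_triangle_ineq[of "\<zeta> - z" "z - \<xi>"] by simp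
    then show ?thesis using 1 by (simp add: algebra_simps)
  qed
  then show ?thesis using \<xi>(1) by blast
qed

text \<open>As a function of \<open>z\<close> the kernel is a multiple of \<open>P\<close> divided
  by linear factors. Their zeros are \<zeta> and the reflected points 2 \<xi> - \<zeta>, all outside
  the closure of \<open>E_dom E w\<close>.\<close>

lemma kern_indep:
  assumes "bd v t \<notin> E"
  shows "indep w (kern (bd v t))"
proof -
  let ?\<zeta> = "bd v t"
  have p: "2 * \<xi> - ?\<zeta> \<notin> closure (E_dom E w)" if "\<xi> \<in> E" for \<xi>
  proof
    assume "2 * \<xi> - ?\<zeta> \<in> closure (E_dom E w)"
    then have "2 * \<xi> - ?\<zeta> \<in> closure (E_dom E v)" using cl_wv by blast
    from factor_bound(2)[OF this bd_cl that] assms that show False by auto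
  qed
  have "indep w (\<lambda>z. (2 ^ card E * (P z * (\<Prod>\<xi>\<in>E. 1 / ((2 * \<xi> - ?\<zeta>) - z)))) / (?\<zeta> - z))"
    using p by (intro indep_divide indep_scale indep_prod_divide indep_P fin bd_not_w assms w(3)) auto
  moreover have "kern ?\<zeta> = (\<lambda>z. (2 ^ card E * (P z * (\<Prod>\<xi>\<in>E. 1 / ((2 * \<xi> - ?\<zeta>) - z)))) / (?\<zeta> - z))"
  proof
    fix z
    have "G ?\<zeta> z = (\<Prod>\<xi>\<in>E. 2 * ((\<xi> - z) * (1 / ((2 * \<xi> - ?\<zeta>) - z))))"
      unfolding G_def by (rule prod.cong) auto
    also have "\<dots> = 2 ^ card E * (P z * (\<Prod>\<xi>\<in>E. 1 / ((2 * \<xi> - ?\<zeta>) - z)))"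
      unfolding P_def by (simp only: prod.distrib prod_constant)
    finally show "kern ?\<zeta> z = (2 ^ card E * (P z * (\<Prod>\<xi>\<in>E. 1 / ((2 * \<xi> - ?\<zeta>) - z)))) / (?\<zeta> - z)"
      by (simp only: kern_def)
  qed
  ultimately show ?thesis by simp
qed

text \<open>|\<phi> \<zeta>| is at most a multiple of |\<zeta> - \<xi>|, hence of |\<zeta> - z| by
  \<open>separation\<close>, and this cancels the singularity of the kernel.\<close>

lemma integrand_small_bound:
  assumes \<phi>: "small s \<phi>"
  shows "\<exists>B>0. \<forall>t z. bd v t \<notin> E \<longrightarrow> z \<in> closure (E_dom E w) \<longrightarrow> cmod (\<phi> (bd v t) * kern (bd v t) z) \<le> B"
proof -
  obtain D where D: "D \<ge> 0" "\<And>z. z \<in> E_dom E s \<Longrightarrow> cmod (\<phi> z) \<le> D * cmod (P z)"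
    using \<phi> unfolding small_def by blast
  define B where "B = D * (2 ^ card E * (1 + 2 / csep)) * (2 * Cst) ^ card E"
  have "cmod (\<phi> (bd v t) * kern (bd v t) z) \<le> B" if t: "bd v t \<notin> E" and z: "z \<in> closure (E_dom E w)" for t z
  proof -
    let ?\<zeta> = "bd v t"
    obtain \<xi> where \<xi>: "\<xi> \<in> E" "\<And>\<zeta>. \<zeta> \<notin> E_dom E v \<Longrightarrow> cmod (\<zeta> - \<xi>) + cmod (z - \<xi>) \<le> (1 + 2 / csep) * cmod (\<zeta> - z)"
      using separation[OF z] by blast
    have \<zeta>1: "cmod ?\<zeta> \<le> 1" using bd_cl[of t] closure_E_dom_cball[OF v(3)] by auto
    have \<zeta>z: "cmod (?\<zeta> - z) > 0" using bd_not_w[OF t] z by auto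
    have "cmod (P ?\<zeta>) = cmod (\<xi> - ?\<zeta>) * (\<Prod>\<eta>\<in>E-{\<xi>}. cmod (\<eta> - ?\<zeta>))"
      unfolding P_def prod_norm[symmetric] by (rule prod.remove[OF fin \<xi>(1)])
    also have "\<dots> \<le> cmod (\<xi> - ?\<zeta>) * (\<Prod>\<eta>\<in>E-{\<xi>}. 2)"
      using norm_E \<zeta>1 by (intro mult_left_mono prod_mono conjI order_trans[OF norm_triangle_ineq4]) auto
    also have "\<dots> \<le> cmod (\<xi> - ?\<zeta>) * 2 ^ card E"
      using fin by (intro mult_left_mono) (auto intro!: power_increasing card_mono)
    also have "\<dots> \<le> ((1 + 2 / csep) * cmod (?\<zeta> - z)) * 2 ^ card E"
    proof (rule mult_right_mono)
      show "cmod (\<xi> - ?\<zeta>) \<le> (1 + 2 / csep) * cmod (?\<zeta> - z)"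
        using \<xi>(2)[OF bd_eq(4)[OF v, of t]] by (simp add: norm_minus_commute) (smt (verit) norm_ge_zero)
    qed simp
    finally have P: "cmod (P ?\<zeta>) \<le> 2 ^ card E * (1 + 2 / csep) * cmod (?\<zeta> - z)" by (simp add: mult_ac)
    have "cmod (\<phi> ?\<zeta>) \<le> D * (2 ^ card E * (1 + 2 / csep) * cmod (?\<zeta> - z))"
      using D(2)[OF bd_s[OF t]] mult_left_mono[OF P D(1)] by (rule order_trans)
    moreover have "cmod (kern ?\<zeta> z) \<le> (2 * Cst) ^ card E / cmod (?\<zeta> - z)"
      unfolding kern_def norm_divide using G_bound[OF _ bd_cl t, of z] z cl_wv by (intro divide_right_mono) auto
    ultimately have "cmod (\<phi> ?\<zeta>) * cmod (kern ?\<zeta> z) \<le>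
      (D * (2 ^ card E * (1 + 2 / csep) * cmod (?\<zeta> - z))) * ((2 * Cst) ^ card E / cmod (?\<zeta> - z))"
      using D(1) csep by (intro mult_mono) auto
    also have "\<dots> = B" using \<zeta>z by (simp add: B_def)
    finally show ?thesis by (simp add: norm_mult)
  qed
  then have "cmod (\<phi> (bd v t) * kern (bd v t) z) \<le> max B 1" if "bd v t \<notin> E" "z \<in> closure (E_dom E w)" for t z
    using that by (simp add: le_max_iff_disj)
  then show ?thesis by (intro exI[of _ "max B 1"]) auto
qed

lemma kern_cont_pair:
  assumes \<phi>: "small s \<phi>" and Z: "Z \<subseteq> closure (E_dom E w)" and A: "\<And>t. t \<in> A \<Longrightarrow> bd v t \<notin> E"
  shows "continuous_on (A \<times> Z) (\<lambda>(t, z). \<phi> (bd v t) * kern (bd v t) z)"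
proof -
  have c1: "continuous_on (A \<times> Z) (\<lambda>p. bd v (fst p))"
    by (rule continuous_on_compose2[OF cont]) (auto intro: continuous_intros)
  have "continuous_on (E_dom E s) \<phi>" using \<phi> by (auto simp: small_def intro: holomorphic_on_imp_continuous_on)
  then have c2: "continuous_on (A \<times> Z) (\<lambda>p. \<phi> (bd v (fst p)))"
    by (rule continuous_on_compose2[OF _ c1]) (use A bd_s in auto)
  have nz: "bd v (fst p) - snd p \<noteq> 0" if "p \<in> A \<times> Z" for p
    using that bd_not_w[OF A, of "fst p"] Z by auto
  have nz2: "2 * \<xi> - bd v (fst p) - snd p \<noteq> 0" if "p \<in> A \<times> Z" "\<xi> \<in> E" for p \<xi>
    using that Z cl_wv A by (intro factor_bound(2)[OF _ bd_cl]) auto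
  have "continuous_on (A \<times> Z) (\<lambda>p. \<phi> (bd v (fst p)) * kern (bd v (fst p)) (snd p))"
    unfolding kern_def G_def using nz nz2 by (intro continuous_intros c1 c2) auto
  then show ?thesis by (simp add: case_prod_unfold)
qed

section \<open>The Cauchy integral over parts of the contour\<close>

definition F :: "(complex \<Rightarrow> complex) \<Rightarrow> complex \<Rightarrow> real \<Rightarrow> complex" where
  "F \<phi> z t = \<phi> (bd v t) * kern (bd v t) z"

text \<open>The share of Cauchy's integral over the parameters up to \<open>t\<close>. Differences
  of its values are additive over intervals, so local approximations can be glued.\<close>

definition H :: "(complex \<Rightarrow> complex) \<Rightarrow> complex \<Rightarrow> real \<Rightarrow> complex" where
  "H \<phi> z t = 1 / (2 * of_real pi * \<i>) * integral {0..t} (\<lambda>\<tau>. \<gamma>' \<tau> * F \<phi> z \<tau>)"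

lemma F_integrable:
  assumes \<phi>: "small s \<phi>" and z: "z \<in> closure (E_dom E w)"
  shows "(\<lambda>\<tau>. \<gamma>' \<tau> * F \<phi> z \<tau>) integrable_on {0..1}" and "adm (\<lambda>\<zeta>. \<phi> \<zeta> * kern \<zeta> z)"
proof -
  obtain B where B: "\<And>t z. bd v t \<notin> E \<Longrightarrow> z \<in> closure (E_dom E w) \<Longrightarrow> cmod (\<phi> (bd v t) * kern (bd v t) z) \<le> B"
    using integrand_small_bound[OF \<phi>] by blast
  let ?A = "{0..1} - {t\<in>{0..1}. bd v t \<in> E}"
  show adm: "adm (\<lambda>\<zeta>. \<phi> \<zeta> * kern \<zeta> z)"
  proof (rule admI[OF finite_bd_E[OF v], of _ "\<lambda>_. B"])
    have "continuous_on (?A \<times> {z}) (\<lambda>(t, z). \<phi> (bd v t) * kern (bd v t) z)"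
      by (rule kern_cont_pair[OF \<phi>]) (use z in auto)
    then have "continuous_on ?A ((\<lambda>(t, z). \<phi> (bd v t) * kern (bd v t) z) \<circ> (\<lambda>t. (t, z)))"
      by (intro continuous_on_compose continuous_intros) (auto elim: continuous_on_subset)
    then show "continuous_on ?A (\<lambda>t. \<phi> (bd v t) * kern (bd v t) z)" by (simp add: o_def)
  qed (use B z in auto)
  show "(\<lambda>\<tau>. \<gamma>' \<tau> * F \<phi> z \<tau>) integrable_on {0..1}"
    using integrable_integrand[OF adm] by (simp add: F_def)
qed

text \<open>The error of a single Riemann step, with the exact increment of the path in place of its
  derivative. The ends may come in either order, and c = 0 yields a plain size estimate.\<close>

lemma H_riemann:
  assumes \<phi>: "small s \<phi>" and z: "z \<in> closure (E_dom E w)" and t: "a \<in> {0..1}" "b \<in> {0..1}"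
    and S': "finite S'" and osc: "\<And>\<tau>. \<tau> \<in> closed_segment a b - S' \<Longrightarrow> cmod (F \<phi> z \<tau> - c) \<le> \<omega>" and \<omega>: "\<omega> \<ge> 0"
  shows "cmod (H \<phi> z b - H \<phi> z a - 1 / (2 * of_real pi * \<i>) * c * (bd v b - bd v a)) \<le> \<omega> * L * \<bar>b - a\<bar>"
proof -
  have *: "cmod (H \<phi> z b - H \<phi> z a - 1 / (2 * of_real pi * \<i>) * c * (bd v b - bd v a)) \<le> \<omega> * L * (b - a)"
    if ab: "0 \<le> a" "a \<le> b" "b \<le> 1" and osc: "\<And>\<tau>. \<tau> \<in> {a..b} - S' \<Longrightarrow> cmod (F \<phi> z \<tau> - c) \<le> \<omega>" for a b
  proof -
    let ?f = "\<lambda>\<tau>. \<gamma>' \<tau> * F \<phi> z \<tau>"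
    have int: "?f integrable_on {p..q}" if "0 \<le> p" "q \<le> 1" for p q
      by (rule integrable_subinterval_real[OF F_integrable(1)[OF \<phi> z]]) (use that in auto)
    have comb: "integral {0..a} ?f + integral {a..b} ?f = integral {0..b} ?f"
      by (rule Henstock_Kurzweil_Integration.integral_combine) (use ab int in auto)
    then have Hd: "H \<phi> z b - H \<phi> z a = 1 / (2 * of_real pi * \<i>) * integral {a..b} ?f"
      unfolding H_def by (simp only: comb[symmetric] distrib_left) simp
    have 1: "(?f has_integral integral {a..b} ?f) {a..b}" by (rule integrable_integral[OF int]) (use ab in auto)
    have "(\<gamma>' has_integral (bd v b - bd v a)) {a..b}"
      using ab deriv continuous_on_subset[OF cont]
      by (intro fundamental_theorem_of_calculus_interior_strong[OF fin_S]) auto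
    from has_integral_mult_left[OF this, of c]
    have 2: "((\<lambda>\<tau>. \<gamma>' \<tau> * c) has_integral (bd v b - bd v a) * c) {a..b}" .
    have "cmod (integral {a..b} ?f - (bd v b - bd v a) * c) \<le> (\<omega> * L) * measure lborel (cbox a b)"
    proof (rule has_integral_bound_spike_finite)
      show "((\<lambda>\<tau>. \<gamma>' \<tau> * F \<phi> z \<tau> - \<gamma>' \<tau> * c) has_integral (integral {a..b} ?f - (bd v b - bd v a) * c)) (cbox a b)"
        using has_integral_diff[OF 1 2] by simp
      show "finite (S \<union> S')" using fin_S S' by simp
      show "cmod (\<gamma>' \<tau> * F \<phi> z \<tau> - \<gamma>' \<tau> * c) \<le> \<omega> * L" if "\<tau> \<in> cbox a b - (S \<union> S')" for \<tau>
      proof -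
        have "\<gamma>' \<tau> * F \<phi> z \<tau> - \<gamma>' \<tau> * c = (F \<phi> z \<tau> - c) * \<gamma>' \<tau>" by (simp add: algebra_simps)
        then have "cmod (\<gamma>' \<tau> * F \<phi> z \<tau> - \<gamma>' \<tau> * c) = cmod (F \<phi> z \<tau> - c) * cmod (\<gamma>' \<tau>)" by (simp only: norm_mult)
        also have "\<dots> \<le> \<omega> * L"
          using that ab \<omega> by (intro mult_mono osc deriv_bound) auto
        finally show ?thesis .
      qed
    qed (use \<omega> L_pos in auto)
    then have 3: "cmod (integral {a..b} ?f - (bd v b - bd v a) * c) \<le> \<omega> * L * (b - a)" using ab by simp
    have "H \<phi> z b - H \<phi> z a - 1 / (2 * of_real pi * \<i>) * c * (bd v b - bd v a) =
      1 / (2 * of_real pi * \<i>) * (integral {a..b} ?f - (bd v b - bd v a) * c)"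
      unfolding Hd by (simp add: algebra_simps diff_divide_distrib)
    also have "cmod \<dots> = cmod (integral {a..b} ?f - (bd v b - bd v a) * c) / (2 * pi)"
      by (simp add: norm_mult norm_divide)
    also have "\<dots> \<le> cmod (integral {a..b} ?f - (bd v b - bd v a) * c) / 1"
      using pi_ge_two by (intro divide_left_mono) auto
    finally show ?thesis using 3 by simp
  qed
  show ?thesis
  proof (cases "a \<le> b")
    case True
    then show ?thesis using *[of a b] t osc by (auto simp: closed_segment_eq_real_ivl)
  next
    case False
    have "cmod (H \<phi> z b - H \<phi> z a - 1 / (2 * of_real pi * \<i>) * c * (bd v b - bd v a)) =
      cmod (H \<phi> z a - H \<phi> z b - 1 / (2 * of_real pi * \<i>) * c * (bd v a - bd v b))"
    proof -
      have "H \<phi> z b - H \<phi> z a - 1 / (2 * of_real pi * \<i>) * c * (bd v b - bd v a) =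
        - (H \<phi> z a - H \<phi> z b - 1 / (2 * of_real pi * \<i>) * c * (bd v a - bd v b))" by (simp add: algebra_simps)
      then show ?thesis by (simp only: norm_minus_cancel)
    qed
    also have "\<dots> \<le> \<omega> * L * (a - b)"
      using False t osc by (intro *) (auto simp: closed_segment_eq_real_ivl)
    finally show ?thesis using False by simp
  qed
qed

lemma H_representation:
  assumes \<phi>: "small s \<phi>" and z: "z \<in> E_dom E w"
  shows "H \<phi> z 1 - H \<phi> z 0 = \<phi> z"
proof -
  have zv: "z \<in> E_dom E v" using E_dom_mono[of w v E] ord z by auto
  have zE: "z \<notin> E" using E_dom_disjoint[OF w(3)] z by blast
  have zc: "z \<in> closure (E_dom E v)" using zv closure_subset by blast
  have nz: "2 * \<xi> - \<zeta> - z \<noteq> 0" if "\<xi> \<in> E" "\<zeta> \<in> closure (E_dom E v)" for \<xi> \<zeta>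
    using that zE by (intro factor_bound(2)[OF zc]) auto
  \<comment> \<open>As a function of \<zeta> the factor \<open>G\<close> has its poles at 2 \<xi> -
    z, outside the closed domain.\<close>
  define f where "f \<zeta> = ext0 \<phi> \<zeta> * G \<zeta> z" for \<zeta>
  have ext: "continuous_on (closure (E_dom E v)) (ext0 \<phi>)" "ext0 \<phi> holomorphic_on E_dom E v"
    using ext0_props[OF small_Hinf0[OF \<phi> ord(4)] v(1,2) ord(3,4)] by auto
  have fc: "continuous_on (closure (E_dom E v)) f"
    unfolding f_def G_def using nz by (intro continuous_intros ext) auto
  have fh: "f holomorphic_on E_dom E v"
    unfolding f_def G_def using nz closure_subset by (intro holomorphic_intros ext) blast+
  have con: "contour (bd v) \<gamma>' S L" by unfold_locales
  have "cint (\<lambda>\<zeta>. f \<zeta> / (\<zeta> - z)) = 2 * of_real pi * \<i> * f z"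
    by (rule cauchy_formula[OF v con fc fh zv])
  moreover have "f z = \<phi> z"
  proof -
    have "G z z = 1" unfolding G_def using zE by (intro prod.neutral) (auto simp: field_simps)
    then show ?thesis using zE by (simp add: f_def ext0_def)
  qed
  moreover have "cint (\<lambda>\<zeta>. f \<zeta> / (\<zeta> - z)) = cint (\<lambda>\<zeta>. \<phi> \<zeta> * kern \<zeta> z)"
    by (rule cint_cong[OF finite_bd_E[OF v]]) (auto simp: f_def ext0_def kern_def)
  moreover have "cint (\<lambda>\<zeta>. \<phi> \<zeta> * kern \<zeta> z) = integral {0..1} (\<lambda>\<tau>. \<gamma>' \<tau> * F \<phi> z \<tau>)"
    by (simp add: cint_def F_def)
  ultimately have int: "integral {0..1} (\<lambda>\<tau>. \<gamma>' \<tau> * F \<phi> z \<tau>) = 2 * of_real pi * \<i> * \<phi> z"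
    by (simp only:)
  have "H \<phi> z 0 = 0" unfolding H_def using integral_refl[of 0 "\<lambda>\<tau>. \<gamma>' \<tau> * F \<phi> z \<tau>"] by simp
  moreover have "H \<phi> z 1 = \<phi> z" unfolding H_def int by simp
  ultimately show ?thesis by simp
qed

end

section \<open>Square function estimates\<close>

lemma Rad_norm_sum:
  assumes rad: "rademacher_seq M \<epsilon>" and "finite Q"
  shows "Rad_norm M \<epsilon> n (\<lambda>l. \<Sum>i\<in>Q. x i l) \<le> (\<Sum>i\<in>Q. Rad_norm M \<epsilon> n (x i))"
  using assms(2)
proof (induction Q rule: finite_induct)
  case empty
  then show ?case by (simp add: Rad_norm_def)
next
  case (insert j Q)
  then show ?case
    using Rad_norm_triangle[OF rad, of n "x j" "\<lambda>l. \<Sum>i\<in>Q. x i l"] by simp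
qed

lemma Rad_norm_minus: "Rad_norm M \<epsilon> n (\<lambda>l. - x l) = Rad_norm M \<epsilon> n x"
  by (simp add: Rad_norm_def sum_negf)

text \<open>The terms are dominated by the increments of \<open>y \<mapsto> y / (y + w)\<close>.\<close>

lemma dyadic_sum_le:
  fixes y w :: real
  assumes y: "y > 0" and w: "w \<ge> 0"
  shows "(\<Sum>k<N. (y / 2 ^ k) * (w / (y / 2 ^ k + w)\<^sup>2)) \<le> 2"
proof -
  define f where "f a = a / (a + w)" for a :: real
  have step: "a * (w / (a + w)\<^sup>2) \<le> 2 * (f a - f (a / 2))" if a: "a > 0" for a
  proof -
    have 1: "a + w > 0" "a / 2 + w > 0" using a w by auto
    have "f a - f (a / 2) = (a / 2) * w / ((a + w) * (a / 2 + w))"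
      unfolding f_def using 1 by (simp add: field_simps)
    also have "\<dots> \<ge> (a / 2) * w / ((a + w) * (a + w))"
      using a w 1 by (intro divide_left_mono mult_left_mono mult_pos_pos) auto
    finally have "2 * ((a / 2) * w / ((a + w) * (a + w))) \<le> 2 * (f a - f (a / 2))"
      by (rule mult_left_mono) simp
    moreover have "a * (w / (a + w)\<^sup>2) = 2 * ((a / 2) * w / ((a + w) * (a + w)))"
      by (simp add: power2_eq_square)
    ultimately show ?thesis by (simp only:)
  qed
  have "(\<Sum>k<N. (y / 2 ^ k) * (w / (y / 2 ^ k + w)\<^sup>2)) \<le> 2 * (f y - f (y / 2 ^ N))"
  proof (induction N)
    case (Suc N)
    have "y / 2 ^ N > 0" using y by simp
    from step[OF this] Suc show ?case by (simp add: mult.commute)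
  qed simp
  also have "\<dots> \<le> 2"
  proof -
    have "f y \<le> 1" using y w by (simp add: f_def divide_le_eq)
    moreover have "f (y / 2 ^ N) \<ge> 0" using y w by (simp add: f_def)
    ultimately show ?thesis by simp
  qed
  finally show ?thesis .
qed

context ritt_operator
begin

lemma Hinf0_mono: "f \<in> Hinf0 E s \<Longrightarrow> r \<le> s \<Longrightarrow> f \<in> Hinf0 E r"
  using E_dom_mono[of r s E] unfolding Hinf0_def
  by (auto intro: holomorphic_on_subset bounded_subset[OF _ image_mono]) (meson subsetD)

lemma Hinf0_zero: "s < 1 \<Longrightarrow> (\<lambda>_. 0) \<in> Hinf0 E s"
  using Hinf0_scale[OF P_Hinf0, of s 0] by simp

lemma indep_zero: "s < 1 \<Longrightarrow> indep s (\<lambda>_. 0)"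
  using indep_scale[OF indep_P, of s 0] by simp

lemma indep_sum':
  assumes "finite Q" "\<And>i. i \<in> Q \<Longrightarrow> indep s (f i)" "s < 1"
  shows "indep s (\<lambda>z. \<Sum>i\<in>Q. f i z)"
  using assms indep_sum[of Q s f] indep_zero[of s] by (cases "Q = {}") auto

end

text \<open>\<open>u\<close> is the contour radius of the given calculus on
  \<open>E_dom E r\<close>; with r \<le> w every approximant on \<open>E_dom E w\<close> can be fed
  into that calculus.\<close>

locale ritt_quadratic = ritt_contour E T r0 v \<gamma>' S L w s
  for E :: "complex set" and T :: "'a :: complex_banach \<Rightarrow>\<^sub>L 'a" and r0 v \<gamma>' S L w s +
  fixes M :: "'w measure" and \<epsilon> :: "nat \<Rightarrow> 'w \<Rightarrow> real" and u r K :: real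
  assumes u: "r0 < u" "u < r" "r \<le> w"
    and rad: "rademacher_seq M \<epsilon>" and cotype: "finite_cotype M \<epsilon> TYPE('a)"
    and K: "K \<ge> 1"
    and calculus: "\<And>\<phi>. \<phi> \<in> Hinf0 E r \<Longrightarrow> norm (Hinf_calc_at E u T \<phi>) \<le> K * (SUP z\<in>E_dom E r. cmod (\<phi> z))"
begin

section \<open>The calculus on sums of kernels\<close>

lemma r: "0 < r" "r < 1" using u r0 w by auto

abbreviation Calc :: "(complex \<Rightarrow> complex) \<Rightarrow> 'a \<Rightarrow>\<^sub>L 'a" where
  "Calc \<equiv> Hinf_calc_at E u T"

lemma w_r: "E_dom E r \<subseteq> E_dom E w" by (rule E_dom_mono[OF u(3)])

lemma Calc_bound:
  assumes "\<phi> \<in> Hinf0 E r" "\<And>z. z \<in> E_dom E r \<Longrightarrow> cmod (\<phi> z) \<le> B"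
  shows "norm (Calc \<phi>) \<le> K * B"
proof -
  have "(SUP z\<in>E_dom E r. cmod (\<phi> z)) \<le> B"
    using zero_in_E_dom[OF r(1), of E] assms(2) by (intro cSUP_least) auto
  then have "K * (SUP z\<in>E_dom E r. cmod (\<phi> z)) \<le> K * B" using K by (intro mult_left_mono) auto
  then show ?thesis using calculus[OF assms(1)] by simp
qed

lemma Calc_add: "f \<in> Hinf0 E r \<Longrightarrow> g \<in> Hinf0 E r \<Longrightarrow> Calc (\<lambda>z. f z + g z) = Calc f + Calc g"
  unfolding Hinf_calc_at_eq by (simp add: I_add[OF u(1,2) r(2)] scaleC_add_right)

lemma Calc_scale: "f \<in> Hinf0 E r \<Longrightarrow> Calc (\<lambda>z. c * f z) = c *\<^sub>C Calc f"
  unfolding Hinf_calc_at_eq by (simp add: I_scale[OF u(1,2) r(2)] scaleC_scaleC)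

lemma Calc_sum:
  assumes "finite Q" "\<And>i. i \<in> Q \<Longrightarrow> g i \<in> Hinf0 E r"
  shows "(\<lambda>z. \<Sum>i\<in>Q. c i * g i z) \<in> Hinf0 E r \<and> Calc (\<lambda>z. \<Sum>i\<in>Q. c i * g i z) = (\<Sum>i\<in>Q. c i *\<^sub>C Calc (g i))"
  using assms
proof (induction Q rule: finite_induct)
  case empty
  have "Calc (\<lambda>_. 0) = 0" using Calc_scale[OF P_Hinf0[OF r(2)], of 0] by simp
  then show ?case using Hinf0_zero[OF r(2)] by simp
next
  case (insert i Q)
  have IH: "(\<lambda>z. \<Sum>i\<in>Q. c i * g i z) \<in> Hinf0 E r" "Calc (\<lambda>z. \<Sum>i\<in>Q. c i * g i z) = (\<Sum>i\<in>Q. c i *\<^sub>C Calc (g i))"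
    using insert by auto
  have gi: "g i \<in> Hinf0 E r" using insert.prems by simp
  have cg: "(\<lambda>z. c i * g i z) \<in> Hinf0 E r" by (rule Hinf0_scale[OF gi r(2)])
  show ?case
    using insert.hyps Hinf0_add[OF cg IH(1) r(2)] Calc_add[OF cg IH(1)]
    by (simp add: IH(2) Calc_scale[OF gi])
qed

lemma kern_Hinf0: "bd v t \<notin> E \<Longrightarrow> kern (bd v t) \<in> Hinf0 E r"
  by (rule Hinf0_mono[OF indepD(1)[OF kern_indep] u(3)])

text \<open>For fixed signs the bounded calculus gives norm at most K B |x|, because the absolute
  sum of the kernels bounds the signed one. The multiplier theorem then inserts the coefficients,
  which will be the values of the functions at the nodes. The constant precedes all quantifiers over
  grids.\<close>

lemma core_bound:
  "\<exists>C>0. \<forall>(N::nat) (t :: nat \<Rightarrow> real) \<Delta> \<alpha> (n::nat) Bd B x. (\<forall>k<N. bd v (t k) \<notin> E) \<longrightarrow>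
    (\<forall>z\<in>E_dom E r. (\<Sum>k<N. cmod (\<Delta> k) * cmod (kern (bd v (t k)) z)) \<le> B) \<longrightarrow> 0 \<le> Bd \<longrightarrow>
    (\<forall>k<N. (\<Sum>l=1..n. (cmod (\<alpha> l k))\<^sup>2) \<le> Bd\<^sup>2) \<longrightarrow>
    Rad_norm M \<epsilon> n (\<lambda>l. blinfun_apply (Calc (\<lambda>z. \<Sum>k<N. \<alpha> l k * (\<Delta> k * kern (bd v (t k)) z))) x)
      \<le> C * Bd * B * norm x"
proof -
  from Rad_multiplier_bound[OF rad cotype, where 'k = nat]
  obtain C where C: "C > 0 \<and> (\<forall>(Q :: nat set) (y :: nat \<Rightarrow> 'a) W B \<alpha> n. finite Q \<longrightarrow> 0 \<le> B \<longrightarrow>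
    (\<forall>\<eta>. (\<forall>k\<in>Q. \<eta> k \<in> {-1, 1 :: real}) \<longrightarrow> norm (\<Sum>k\<in>Q. \<eta> k *\<^sub>R y k) \<le> W) \<longrightarrow>
    (\<forall>k\<in>Q. (\<Sum>l=1..n. (cmod (\<alpha> l k))\<^sup>2) \<le> B\<^sup>2) \<longrightarrow>
    Rad_norm M \<epsilon> n (\<lambda>l. \<Sum>k\<in>Q. \<alpha> l k *\<^sub>C y k) \<le> C * B * W)" ..
  show ?thesis
  proof (intro exI[of _ "C * K"] conjI allI impI)
    show "C * K > 0" using C K by simp
    fix N n :: nat and t :: "nat \<Rightarrow> real" and \<Delta> \<alpha> Bd B and x :: 'a
    assume t: "\<forall>k<N. bd v (t k) \<notin> E"
      and B: "\<forall>z\<in>E_dom E r. (\<Sum>k<N. cmod (\<Delta> k) * cmod (kern (bd v (t k)) z)) \<le> B" and Bd: "0 \<le> Bd"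
      and \<alpha>: "\<forall>k<N. (\<Sum>l=1..n. (cmod (\<alpha> l k :: complex))\<^sup>2) \<le> Bd\<^sup>2"
    define g where "g k z = \<Delta> k * kern (bd v (t k)) z" for k z
    have g: "g k \<in> Hinf0 E r" if "k \<in> {..<N}" for k
      unfolding g_def using t that by (intro Hinf0_scale kern_Hinf0 r) auto
    define y where "y k = blinfun_apply (Calc (g k)) x" for k
    have apply_sum: "blinfun_apply (Calc (\<lambda>z. \<Sum>k<N. c k * g k z)) x = (\<Sum>k<N. c k *\<^sub>C y k)" for c
      using Calc_sum[OF finite_lessThan g, where c = c]
      by (simp add: y_def blinfun.sum_left scaleC_blinfun.rep_eq)
    have W: "norm (\<Sum>k<N. \<eta> k *\<^sub>R y k) \<le> K * B * norm x" if \<eta>: "\<forall>k\<in>{..<N}. \<eta> k \<in> {-1, 1 :: real}" for \<eta>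
    proof -
      have "(\<Sum>k<N. \<eta> k *\<^sub>R y k) = blinfun_apply (Calc (\<lambda>z. \<Sum>k<N. of_real (\<eta> k) * g k z)) x"
        unfolding apply_sum by (simp add: scaleC_of_real)
      also have "norm \<dots> \<le> norm (Calc (\<lambda>z. \<Sum>k<N. of_real (\<eta> k) * g k z)) * norm x" by (rule norm_blinfun)
      also have "\<dots> \<le> K * B * norm x"
      proof (intro mult_right_mono Calc_bound)
        show "(\<lambda>z. \<Sum>k<N. of_real (\<eta> k) * g k z) \<in> Hinf0 E r"
          using Calc_sum[OF finite_lessThan g, where c = "\<lambda>k. of_real (\<eta> k)"] by simp
        fix z assume z: "z \<in> E_dom E r"
        have "cmod (\<Sum>k<N. of_real (\<eta> k) * g k z) \<le> (\<Sum>k<N. cmod (of_real (\<eta> k) * g k z))" by (rule norm_sum)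
        also have "\<dots> = (\<Sum>k<N. cmod (\<Delta> k) * cmod (kern (bd v (t k)) z))"
        proof (rule sum.cong[OF refl])
          fix k assume "k \<in> {..<N}"
          then have "\<eta> k \<in> {-1, 1}" using \<eta> by blast
          then have "\<bar>\<eta> k\<bar> = 1" by auto
          then show "cmod (of_real (\<eta> k) * g k z) = cmod (\<Delta> k) * cmod (kern (bd v (t k)) z)"
            by (simp only: norm_mult norm_of_real g_def mult_1_left)
        qed
        finally show "cmod (\<Sum>k<N. of_real (\<eta> k) * g k z) \<le> B" using B z by force
      qed simp
      finally show ?thesis .
    qed
    have "Rad_norm M \<epsilon> n (\<lambda>l. \<Sum>k\<in>{..<N}. \<alpha> l k *\<^sub>C y k) \<le> C * Bd * (K * B * norm x)"
    proof (rule C[THEN conjunct2, THEN spec, THEN spec, THEN spec, THEN spec, THEN spec, THEN spec, THEN mp, THEN mp, THEN mp, THEN mp])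
      show "\<forall>\<eta>. (\<forall>k\<in>{..<N}. \<eta> k \<in> {-1, 1 :: real}) \<longrightarrow> norm (\<Sum>k\<in>{..<N}. \<eta> k *\<^sub>R y k) \<le> K * B * norm x"
        by (intro allI impI) (rule W)
      show "\<forall>k\<in>{..<N}. (\<Sum>l=1..n. (cmod (\<alpha> l k))\<^sup>2) \<le> Bd\<^sup>2" using \<alpha> by simp
    qed (use Bd in simp_all)
    then show "Rad_norm M \<epsilon> n (\<lambda>l. blinfun_apply (Calc (\<lambda>z. \<Sum>k<N. \<alpha> l k * (\<Delta> k * kern (bd v (t k)) z))) x)
      \<le> C * K * Bd * B * norm x"
      unfolding g_def[symmetric] apply_sum by (simp add: mult_ac)
  qed
qed

text \<open>The quadratic estimate for the part of the Cauchy integral between two parameters. It is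
  stated for approximants within any \<delta>, with \<open>C\<close> independent of \<delta>; in
  this form it can be localised and chained.\<close>

definition Good :: "real \<Rightarrow> real \<Rightarrow> bool" where
  "Good a b \<longleftrightarrow> (\<exists>C\<ge>0. \<forall>n \<phi> Bd x \<delta>. (\<forall>l\<in>{1..n}. small s (\<phi> l)) \<longrightarrow> 0 \<le> Bd \<longrightarrow>
    (\<forall>z\<in>E_dom E s. (\<Sum>l=1..n. (cmod (\<phi> l z))\<^sup>2) \<le> Bd\<^sup>2) \<longrightarrow> 0 < \<delta> \<longrightarrow>
    (\<exists>A. (\<forall>l\<in>{1..n}. indep w (A l) \<and> (\<forall>z\<in>E_dom E w. cmod (A l z - (H (\<phi> l) z b - H (\<phi> l) z a)) \<le> \<delta>)) \<and>
      Rad_norm M \<epsilon> n (\<lambda>l. blinfun_apply (Calc (A l)) x) \<le> C * Bd * norm x))"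

lemma GoodI:
  assumes "C \<ge> 0"
    and "\<And>n \<phi> Bd x \<delta>. \<lbrakk>\<And>l. l \<in> {1..n} \<Longrightarrow> small s (\<phi> l); 0 \<le> Bd;
      \<And>z. z \<in> E_dom E s \<Longrightarrow> (\<Sum>l=1..n. (cmod (\<phi> l z))\<^sup>2) \<le> Bd\<^sup>2; 0 < \<delta>\<rbrakk> \<Longrightarrow>
    \<exists>A. (\<forall>l\<in>{1..n}. indep w (A l) \<and> (\<forall>z\<in>E_dom E w. cmod (A l z - (H (\<phi> l) z b - H (\<phi> l) z a)) \<le> \<delta>)) \<and>
      Rad_norm M \<epsilon> n (\<lambda>l. blinfun_apply (Calc (A l)) x) \<le> C * Bd * norm x"
  shows "Good a b"
  unfolding Good_def
proof (rule exI[of _ C], intro conjI allI impI assms(1))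
  fix n :: nat and \<phi> Bd x \<delta>
  assume "\<forall>l\<in>{1..n}. small s (\<phi> l)" "0 \<le> Bd"
    "\<forall>z\<in>E_dom E s. (\<Sum>l=1..n. (cmod (\<phi> l z))\<^sup>2) \<le> Bd\<^sup>2" "0 < (\<delta>::real)"
  then show "\<exists>A. (\<forall>l\<in>{1..n}. indep w (A l) \<and> (\<forall>z\<in>E_dom E w. cmod (A l z - (H (\<phi> l) z b - H (\<phi> l) z a)) \<le> \<delta>)) \<and>
      Rad_norm M \<epsilon> n (\<lambda>l. blinfun_apply (Calc (A l)) x) \<le> C * Bd * norm x"
    by (intro assms(2)) simp_all
qed

lemma GoodE:
  assumes "Good a b"
  obtains C where "C \<ge> 0"
    "\<And>n \<phi> Bd x \<delta>. \<lbrakk>\<And>l. l \<in> {1..n} \<Longrightarrow> small s (\<phi> l); 0 \<le> Bd;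
      \<And>z. z \<in> E_dom E s \<Longrightarrow> (\<Sum>l=1..n. (cmod (\<phi> l z))\<^sup>2) \<le> Bd\<^sup>2; 0 < \<delta>\<rbrakk> \<Longrightarrow>
    \<exists>A. (\<forall>l\<in>{1..n}. indep w (A l) \<and> (\<forall>z\<in>E_dom E w. cmod (A l z - (H (\<phi> l) z b - H (\<phi> l) z a)) \<le> \<delta>)) \<and>
      Rad_norm M \<epsilon> n (\<lambda>l. blinfun_apply (Calc (A l)) x) \<le> C * Bd * norm x"
proof -
  from assms[unfolded Good_def] obtain C where C: "C \<ge> 0 \<and> (\<forall>n \<phi> Bd x \<delta>. (\<forall>l\<in>{1..n}. small s (\<phi> l)) \<longrightarrow> 0 \<le> Bd \<longrightarrow>
    (\<forall>z\<in>E_dom E s. (\<Sum>l=1..n. (cmod (\<phi> l z))\<^sup>2) \<le> Bd\<^sup>2) \<longrightarrow> 0 < \<delta> \<longrightarrow>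
    (\<exists>A. (\<forall>l\<in>{1..n}. indep w (A l) \<and> (\<forall>z\<in>E_dom E w. cmod (A l z - (H (\<phi> l) z b - H (\<phi> l) z a)) \<le> \<delta>)) \<and>
      Rad_norm M \<epsilon> n (\<lambda>l. blinfun_apply (Calc (A l)) x) \<le> C * Bd * norm x))" ..
  show thesis
  proof (rule that[OF C[THEN conjunct1]])
    fix n :: nat and \<phi> Bd x \<delta>
    assume a: "\<And>l. l \<in> {1..n} \<Longrightarrow> small s (\<phi> l)" and b: "0 \<le> Bd"
      and c: "\<And>z. z \<in> E_dom E s \<Longrightarrow> (\<Sum>l=1..n. (cmod (\<phi> l z))\<^sup>2) \<le> Bd\<^sup>2" and d: "0 < (\<delta>::real)"
    show "\<exists>A. (\<forall>l\<in>{1..n}. indep w (A l) \<and> (\<forall>z\<in>E_dom E w. cmod (A l z - (H (\<phi> l) z b - H (\<phi> l) z a)) \<le> \<delta>)) \<and>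
      Rad_norm M \<epsilon> n (\<lambda>l. blinfun_apply (Calc (A l)) x) \<le> C * Bd * norm x"
      by (rule C[THEN conjunct2, THEN spec, THEN spec, THEN spec, THEN spec, THEN spec, THEN mp, THEN mp, THEN mp, THEN mp])
        (use a b c d in \<open>simp_all\<close>)
  qed
qed

lemma indep_Hinf0_r: "indep w f \<Longrightarrow> f \<in> Hinf0 E r"
  by (rule Hinf0_mono[OF indepD(1) u(3)])

lemma Good_refl: "Good a a"
proof (rule GoodI[of 0])
  fix n :: nat and \<phi> Bd x and \<delta> :: real assume "0 < \<delta>"
  have "Calc (\<lambda>_. 0) = 0" using Calc_scale[OF P_Hinf0[OF r(2)], of 0] by simp
  then show "\<exists>A. (\<forall>l\<in>{1..n}. indep w (A l) \<and> (\<forall>z\<in>E_dom E w. cmod (A l z - (H (\<phi> l) z a - H (\<phi> l) z a)) \<le> \<delta>)) \<and>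
      Rad_norm M \<epsilon> n (\<lambda>l. blinfun_apply (Calc (A l)) x) \<le> 0 * Bd * norm x"
    using \<open>0 < \<delta>\<close> indep_zero[OF w(3)] by (intro exI[of _ "\<lambda>_ _. 0"]) (simp add: Rad_norm_def)
qed simp

text \<open>The local statements below start from a centre \<open>x\<close> with the other end on
  either side; to chain them across \<open>x\<close> the direction must be reversible.\<close>

lemma Good_sym:
  assumes "Good a b"
  shows "Good b a"
proof -
  obtain C where C: "C \<ge> 0" and ex: "\<And>n \<phi> Bd x \<delta>. \<lbrakk>\<And>l. l \<in> {1..n} \<Longrightarrow> small s (\<phi> l); 0 \<le> Bd;
      \<And>z. z \<in> E_dom E s \<Longrightarrow> (\<Sum>l=1..n. (cmod (\<phi> l z))\<^sup>2) \<le> Bd\<^sup>2; 0 < \<delta>\<rbrakk> \<Longrightarrow>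
    \<exists>A. (\<forall>l\<in>{1..n}. indep w (A l) \<and> (\<forall>z\<in>E_dom E w. cmod (A l z - (H (\<phi> l) z b - H (\<phi> l) z a)) \<le> \<delta>)) \<and>
      Rad_norm M \<epsilon> n (\<lambda>l. blinfun_apply (Calc (A l)) x) \<le> C * Bd * norm x"
    using assms by (rule GoodE) blast
  show ?thesis
  proof (rule GoodI[OF C])
    fix n :: nat and \<phi> Bd x and \<delta> :: real
    assume a: "\<And>l. l \<in> {1..n} \<Longrightarrow> small s (\<phi> l)" "0 \<le> Bd"
      "\<And>z. z \<in> E_dom E s \<Longrightarrow> (\<Sum>l=1..n. (cmod (\<phi> l z))\<^sup>2) \<le> Bd\<^sup>2" "0 < \<delta>"
    obtain A where A: "\<forall>l\<in>{1..n}. indep w (A l) \<and> (\<forall>z\<in>E_dom E w. cmod (A l z - (H (\<phi> l) z b - H (\<phi> l) z a)) \<le> \<delta>)"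
      "Rad_norm M \<epsilon> n (\<lambda>l. blinfun_apply (Calc (A l)) x) \<le> C * Bd * norm x"
      using ex[of n \<phi> Bd \<delta> x, OF a] by blast
    have 1: "indep w (\<lambda>z. -1 * A l z)" if "l \<in> {1..n}" for l using A(1) that by (intro indep_scale w) auto
    have 2: "cmod (-1 * A l z - (H (\<phi> l) z a - H (\<phi> l) z b)) \<le> \<delta>" if "l \<in> {1..n}" "z \<in> E_dom E w" for l z
    proof -
      have "-1 * A l z - (H (\<phi> l) z a - H (\<phi> l) z b) = - (A l z - (H (\<phi> l) z b - H (\<phi> l) z a))" by simp
      then show ?thesis using A(1) that by (simp only: norm_minus_cancel)
    qed
    have "Rad_norm M \<epsilon> n (\<lambda>l. blinfun_apply (Calc (\<lambda>z. -1 * A l z)) x) = Rad_norm M \<epsilon> n (\<lambda>l. - blinfun_apply (Calc (A l)) x)"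
      unfolding Rad_norm_def
    proof (intro arg_cong[where f = sqrt] Bochner_Integration.integral_cong refl arg_cong[where f = "\<lambda>y. (norm y)\<^sup>2"] sum.cong)
      fix l \<omega> assume "l \<in> {1..n}"
      then have "Calc (\<lambda>z. -1 * A l z) = -1 *\<^sub>C Calc (A l)" using A(1) by (intro Calc_scale indep_Hinf0_r) auto
      then show "\<epsilon> l \<omega> *\<^sub>R blinfun_apply (Calc (\<lambda>z. -1 * A l z)) x = \<epsilon> l \<omega> *\<^sub>R - blinfun_apply (Calc (A l)) x"
        by (simp add: scaleC_minus_left scaleC_one blinfun.minus_left)
    qed
    then have "Rad_norm M \<epsilon> n (\<lambda>l. blinfun_apply (Calc (\<lambda>z. -1 * A l z)) x) \<le> C * Bd * norm x"
      using A(2) by (simp only: Rad_norm_minus)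
    then show "\<exists>A. (\<forall>l\<in>{1..n}. indep w (A l) \<and> (\<forall>z\<in>E_dom E w. cmod (A l z - (H (\<phi> l) z a - H (\<phi> l) z b)) \<le> \<delta>)) \<and>
      Rad_norm M \<epsilon> n (\<lambda>l. blinfun_apply (Calc (A l)) x) \<le> C * Bd * norm x"
      using 1 2 by (intro exI[of _ "\<lambda>l z. -1 * A l z"]) blast
  qed
qed

lemma Rad_norm_cong: "(\<And>l. l \<in> {1..n} \<Longrightarrow> x l = y l) \<Longrightarrow> Rad_norm M \<epsilon> n x = Rad_norm M \<epsilon> n (y :: nat \<Rightarrow> 'a)"
proof -
  assume "\<And>l. l \<in> {1..n} \<Longrightarrow> x l = y l"
  then have "(\<Sum>k=1..n. \<epsilon> k \<omega> *\<^sub>R x k) = (\<Sum>k=1..n. \<epsilon> k \<omega> *\<^sub>R y k)" for \<omega>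
    by (intro sum.cong) auto
  then show ?thesis by (simp only: Rad_norm_def)
qed

lemma Good_trans:
  assumes "Good a b" "Good b c"
  shows "Good a c"
proof -
  obtain C where C: "C \<ge> 0" and ex: "\<And>n \<phi> Bd x \<delta>. \<lbrakk>\<And>l. l \<in> {1..n} \<Longrightarrow> small s (\<phi> l); 0 \<le> Bd;
      \<And>z. z \<in> E_dom E s \<Longrightarrow> (\<Sum>l=1..n. (cmod (\<phi> l z))\<^sup>2) \<le> Bd\<^sup>2; 0 < \<delta>\<rbrakk> \<Longrightarrow>
    \<exists>A. (\<forall>l\<in>{1..n}. indep w (A l) \<and> (\<forall>z\<in>E_dom E w. cmod (A l z - (H (\<phi> l) z b - H (\<phi> l) z a)) \<le> \<delta>)) \<and>
      Rad_norm M \<epsilon> n (\<lambda>l. blinfun_apply (Calc (A l)) x) \<le> C * Bd * norm x"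
    using assms(1) by (rule GoodE) blast
  obtain C' where C': "C' \<ge> 0" and ex': "\<And>n \<phi> Bd x \<delta>. \<lbrakk>\<And>l. l \<in> {1..n} \<Longrightarrow> small s (\<phi> l); 0 \<le> Bd;
      \<And>z. z \<in> E_dom E s \<Longrightarrow> (\<Sum>l=1..n. (cmod (\<phi> l z))\<^sup>2) \<le> Bd\<^sup>2; 0 < \<delta>\<rbrakk> \<Longrightarrow>
    \<exists>A. (\<forall>l\<in>{1..n}. indep w (A l) \<and> (\<forall>z\<in>E_dom E w. cmod (A l z - (H (\<phi> l) z c - H (\<phi> l) z b)) \<le> \<delta>)) \<and>
      Rad_norm M \<epsilon> n (\<lambda>l. blinfun_apply (Calc (A l)) x) \<le> C' * Bd * norm x"
    using assms(2) by (rule GoodE) blast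
  show ?thesis
  proof (rule GoodI)
    show "C + C' \<ge> 0" using C C' by simp
    fix n :: nat and \<phi> Bd x and \<delta> :: real
    assume a: "\<And>l. l \<in> {1..n} \<Longrightarrow> small s (\<phi> l)" "0 \<le> Bd"
      "\<And>z. z \<in> E_dom E s \<Longrightarrow> (\<Sum>l=1..n. (cmod (\<phi> l z))\<^sup>2) \<le> Bd\<^sup>2" and \<delta>: "0 < \<delta>"
    then have \<delta>2: "0 < \<delta> / 2" by simp
    obtain A where A: "\<forall>l\<in>{1..n}. indep w (A l) \<and> (\<forall>z\<in>E_dom E w. cmod (A l z - (H (\<phi> l) z b - H (\<phi> l) z a)) \<le> \<delta> / 2)"
      "Rad_norm M \<epsilon> n (\<lambda>l. blinfun_apply (Calc (A l)) x) \<le> C * Bd * norm x"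
      using ex[of n \<phi> Bd "\<delta> / 2" x, OF a \<delta>2] by blast
    obtain A' where A': "\<forall>l\<in>{1..n}. indep w (A' l) \<and> (\<forall>z\<in>E_dom E w. cmod (A' l z - (H (\<phi> l) z c - H (\<phi> l) z b)) \<le> \<delta> / 2)"
      "Rad_norm M \<epsilon> n (\<lambda>l. blinfun_apply (Calc (A' l)) x) \<le> C' * Bd * norm x"
      using ex'[of n \<phi> Bd "\<delta> / 2" x, OF a \<delta>2] by blast
    have 1: "indep w (\<lambda>z. A l z + A' l z)" if "l \<in> {1..n}" for l using A(1) A'(1) that by (intro indep_add w) auto
    have 2: "cmod ((A l z + A' l z) - (H (\<phi> l) z c - H (\<phi> l) z a)) \<le> \<delta>" if "l \<in> {1..n}" "z \<in> E_dom E w" for l z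
    proof -
      have "(A l z + A' l z) - (H (\<phi> l) z c - H (\<phi> l) z a) =
        (A l z - (H (\<phi> l) z b - H (\<phi> l) z a)) + (A' l z - (H (\<phi> l) z c - H (\<phi> l) z b))" by simp
      also have "cmod \<dots> \<le> \<delta> / 2 + \<delta> / 2"
        using A(1) A'(1) that by (intro norm_triangle_le add_mono) auto
      finally show ?thesis by simp
    qed
    have "Rad_norm M \<epsilon> n (\<lambda>l. blinfun_apply (Calc (\<lambda>z. A l z + A' l z)) x) =
      Rad_norm M \<epsilon> n (\<lambda>l. blinfun_apply (Calc (A l)) x + blinfun_apply (Calc (A' l)) x)"
    proof (rule Rad_norm_cong)
      fix l assume "l \<in> {1..n}"
      then have "Calc (\<lambda>z. A l z + A' l z) = Calc (A l) + Calc (A' l)"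
        using A(1) A'(1) by (intro Calc_add indep_Hinf0_r) auto
      then show "blinfun_apply (Calc (\<lambda>z. A l z + A' l z)) x = blinfun_apply (Calc (A l)) x + blinfun_apply (Calc (A' l)) x"
        by (simp add: blinfun.add_left)
    qed
    also have "\<dots> \<le> C * Bd * norm x + C' * Bd * norm x"
      by (rule order_trans[OF Rad_norm_triangle[OF rad] add_mono[OF A(2) A'(2)]])
    finally have 3: "Rad_norm M \<epsilon> n (\<lambda>l. blinfun_apply (Calc (\<lambda>z. A l z + A' l z)) x) \<le> (C + C') * Bd * norm x"
      by (simp add: algebra_simps)
    show "\<exists>A. (\<forall>l\<in>{1..n}. indep w (A l) \<and> (\<forall>z\<in>E_dom E w. cmod (A l z - (H (\<phi> l) z c - H (\<phi> l) z a)) \<le> \<delta>)) \<and>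
      Rad_norm M \<epsilon> n (\<lambda>l. blinfun_apply (Calc (A l)) x) \<le> (C + C') * Bd * norm x"
      using 1 2 3 by (intro exI[of _ "\<lambda>l z. A l z + A' l z"]) blast
  qed
qed

text \<open>Adding \<open>m\<close> Rademacher norms costs a factor \<open>m\<close>, which the
  bound B / m on each grid pays. So \<open>m\<close> and \<open>N\<close> may depend on \<delta> and
  on the functions, while \<open>B\<close> may not.\<close>

lemma Good_grid:
  assumes B: "B \<ge> 0" and grid: "\<And>(n::nat) \<phi> \<delta>. \<lbrakk>\<And>l. l \<in> {1..n} \<Longrightarrow> small s (\<phi> l); 0 < \<delta>\<rbrakk> \<Longrightarrow>
    \<exists>(m::nat) (N::nat) (t::nat \<Rightarrow> nat \<Rightarrow> real) (t'::nat \<Rightarrow> nat \<Rightarrow> real). m > 0 \<and> (\<forall>i<m. \<forall>k<N. bd v (t i k) \<notin> E) \<and>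
      (\<forall>i<m. \<forall>z\<in>E_dom E r. (\<Sum>k<N. cmod (bd v (t i k) - bd v (t' i k)) * cmod (kern (bd v (t i k)) z)) \<le> B / real m) \<and>
      (\<forall>l\<in>{1..n}. \<forall>z\<in>E_dom E w. cmod ((\<Sum>i<m. \<Sum>k<N. 1 / (2 * of_real pi * \<i>) * F (\<phi> l) z (t i k) * (bd v (t i k) - bd v (t' i k)))
        - (H (\<phi> l) z b - H (\<phi> l) z a)) \<le> \<delta>)"
  shows "Good a b"
proof -
  from core_bound obtain C where C: "C > 0 \<and> (\<forall>(N::nat) (t :: nat \<Rightarrow> real) \<Delta> \<alpha> (n::nat) Bd B x. (\<forall>k<N. bd v (t k) \<notin> E) \<longrightarrow>
    (\<forall>z\<in>E_dom E r. (\<Sum>k<N. cmod (\<Delta> k) * cmod (kern (bd v (t k)) z)) \<le> B) \<longrightarrow> 0 \<le> Bd \<longrightarrow>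
    (\<forall>k<N. (\<Sum>l=1..n. (cmod (\<alpha> l k))\<^sup>2) \<le> Bd\<^sup>2) \<longrightarrow>
    Rad_norm M \<epsilon> n (\<lambda>l. blinfun_apply (Calc (\<lambda>z. \<Sum>k<N. \<alpha> l k * (\<Delta> k * kern (bd v (t k)) z))) x)
      \<le> C * Bd * B * norm x)" ..
  show ?thesis
  proof (rule GoodI)
    show "C * B \<ge> 0" using C B by simp
    fix n :: nat and \<phi> Bd x and \<delta> :: real
    assume \<phi>: "\<And>l. l \<in> {1..n} \<Longrightarrow> small s (\<phi> l)" and Bd: "0 \<le> Bd"
      and sq: "\<And>z. z \<in> E_dom E s \<Longrightarrow> (\<Sum>l=1..n. (cmod (\<phi> l z))\<^sup>2) \<le> Bd\<^sup>2" and \<delta>: "0 < \<delta>"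
    have "\<exists>(m::nat) (N::nat) (t::nat \<Rightarrow> nat \<Rightarrow> real) (t'::nat \<Rightarrow> nat \<Rightarrow> real). m > 0 \<and> (\<forall>i<m. \<forall>k<N. bd v (t i k) \<notin> E) \<and>
      (\<forall>i<m. \<forall>z\<in>E_dom E r. (\<Sum>k<N. cmod (bd v (t i k) - bd v (t' i k)) * cmod (kern (bd v (t i k)) z)) \<le> B / real m) \<and>
      (\<forall>l\<in>{1..n}. \<forall>z\<in>E_dom E w. cmod ((\<Sum>i<m. \<Sum>k<N. 1 / (2 * of_real pi * \<i>) * F (\<phi> l) z (t i k) * (bd v (t i k) - bd v (t' i k)))
        - (H (\<phi> l) z b - H (\<phi> l) z a)) \<le> \<delta>)"
      by (rule grid[of n \<phi> \<delta>]) (use \<phi> \<delta> in simp_all)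
    then obtain m N :: nat and t t' :: "nat \<Rightarrow> nat \<Rightarrow> real" where m: "m > 0"
      and t': "\<forall>i<m. \<forall>k<N. bd v (t i k) \<notin> E"
      and sum': "\<forall>i<m. \<forall>z\<in>E_dom E r. (\<Sum>k<N. cmod (bd v (t i k) - bd v (t' i k)) * cmod (kern (bd v (t i k)) z)) \<le> B / real m"
      and approx': "\<forall>l\<in>{1..n}. \<forall>z\<in>E_dom E w. cmod ((\<Sum>i<m. \<Sum>k<N. 1 / (2 * of_real pi * \<i>) * F (\<phi> l) z (t i k) * (bd v (t i k) - bd v (t' i k)))
        - (H (\<phi> l) z b - H (\<phi> l) z a)) \<le> \<delta>"
      by (elim exE conjE) (rule that)
    note t = t'[rule_format] and sum = sum'[rule_format] and approx = approx'[rule_format]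
    define \<Delta> where "\<Delta> i k = 1 / (2 * of_real pi * \<i>) * (bd v (t i k) - bd v (t' i k))" for i k
    define A where "A i l z = (\<Sum>k<N. \<phi> l (bd v (t i k)) * (\<Delta> i k * kern (bd v (t i k)) z))" for i l z
    have \<Delta>: "cmod (\<Delta> i k) \<le> cmod (bd v (t i k) - bd v (t' i k))" for i k
    proof -
      have "cmod (\<Delta> i k) = cmod (bd v (t i k) - bd v (t' i k)) / (2 * pi)" by (simp add: \<Delta>_def norm_mult norm_divide)
      also have "\<dots> \<le> cmod (bd v (t i k) - bd v (t' i k)) / 1" using pi_ge_two by (intro divide_left_mono) auto
      finally show ?thesis by simp
    qed
    have indA: "indep w (A i l)" if "i < m" for i l
      unfolding A_def using t that by (intro indep_sum' indep_scale kern_indep w) auto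
    have indS: "indep w (\<lambda>z. \<Sum>i<m. A i l z)" for l using indA by (intro indep_sum' w) auto
    have ap: "cmod ((\<Sum>i<m. A i l z) - (H (\<phi> l) z b - H (\<phi> l) z a)) \<le> \<delta>" if "l \<in> {1..n}" "z \<in> E_dom E w" for l z
      using approx[OF that] unfolding A_def F_def \<Delta>_def by (simp add: mult_ac)
    have RA: "Rad_norm M \<epsilon> n (\<lambda>l. blinfun_apply (Calc (A i l)) x) \<le> C * Bd * (B / real m) * norm x" if i: "i < m" for i
      unfolding A_def
    proof (rule C[THEN conjunct2, THEN spec, THEN spec, THEN spec, THEN spec, THEN spec, THEN spec, THEN spec, THEN spec, THEN mp, THEN mp, THEN mp, THEN mp])
      show "\<forall>k<N. bd v (t i k) \<notin> E" using t i by blast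
      show "\<forall>z\<in>E_dom E r. (\<Sum>k<N. cmod (\<Delta> i k) * cmod (kern (bd v (t i k)) z)) \<le> B / real m"
      proof
        fix z assume z: "z \<in> E_dom E r"
        have "(\<Sum>k<N. cmod (\<Delta> i k) * cmod (kern (bd v (t i k)) z)) \<le> (\<Sum>k<N. cmod (bd v (t i k) - bd v (t' i k)) * cmod (kern (bd v (t i k)) z))"
          by (intro sum_mono mult_right_mono \<Delta>) auto
        then show "(\<Sum>k<N. cmod (\<Delta> i k) * cmod (kern (bd v (t i k)) z)) \<le> B / real m" using sum[OF i z] by simp
      qed
      show "\<forall>k<N. (\<Sum>l=1..n. (cmod (\<phi> l (bd v (t i k))))\<^sup>2) \<le> Bd\<^sup>2" using t i sq bd_s by blast
    qed (rule Bd)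
    have "Rad_norm M \<epsilon> n (\<lambda>l. blinfun_apply (Calc (\<lambda>z. \<Sum>i<m. A i l z)) x) =
      Rad_norm M \<epsilon> n (\<lambda>l. \<Sum>i<m. blinfun_apply (Calc (A i l)) x)"
    proof (rule Rad_norm_cong)
      fix l
      have "Calc (\<lambda>z. \<Sum>i<m. 1 * A i l z) = (\<Sum>i<m. 1 *\<^sub>C Calc (A i l))"
        using indA by (intro Calc_sum[THEN conjunct2] indep_Hinf0_r) auto
      then show "blinfun_apply (Calc (\<lambda>z. \<Sum>i<m. A i l z)) x = (\<Sum>i<m. blinfun_apply (Calc (A i l)) x)"
        by (simp add: scaleC_one blinfun.sum_left)
    qed
    also have "\<dots> \<le> (\<Sum>i<m. Rad_norm M \<epsilon> n (\<lambda>l. blinfun_apply (Calc (A i l)) x))"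
      by (rule Rad_norm_sum[OF rad]) simp
    also have "\<dots> \<le> (\<Sum>i<m. C * Bd * (B / real m) * norm x)" by (intro sum_mono RA) simp
    also have "\<dots> = C * B * Bd * norm x" using m by simp
    finally have R: "Rad_norm M \<epsilon> n (\<lambda>l. blinfun_apply (Calc (\<lambda>z. \<Sum>i<m. A i l z)) x) \<le> C * B * Bd * norm x" .
    show "\<exists>A. (\<forall>l\<in>{1..n}. indep w (A l) \<and> (\<forall>z\<in>E_dom E w. cmod (A l z - (H (\<phi> l) z b - H (\<phi> l) z a)) \<le> \<delta>)) \<and>
      Rad_norm M \<epsilon> n (\<lambda>l. blinfun_apply (Calc (A l)) x) \<le> C * B * Bd * norm x"
      using indS ap R by (intro exI[of _ "\<lambda>l z. \<Sum>i<m. A i l z"]) blast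
  qed
qed

end

context ritt_quadratic
begin

text \<open>Uniform continuity of the integrands on the compact set A \<times> closure (E_dom E w),
  where \<open>A\<close> avoids the parameters of \<open>E\<close>; the width is the least one over
  finitely many \<open>l\<close>.\<close>

lemma mesh:
  fixes n :: nat
  assumes \<phi>: "\<And>l. l \<in> {1..n} \<Longrightarrow> small s (\<phi> l)" and A: "compact A" "A \<subseteq> {0..1}" "\<And>\<tau>. \<tau> \<in> A \<Longrightarrow> bd v \<tau> \<notin> E"
    and \<omega>: "\<omega> > 0"
  shows "\<exists>\<eta>>0. \<forall>l\<in>{1..n}. \<forall>a b. closed_segment a b \<subseteq> A \<longrightarrow> \<bar>b - a\<bar> < \<eta> \<longrightarrow> (\<forall>z\<in>E_dom E w.
    cmod (H (\<phi> l) z b - H (\<phi> l) z a - 1 / (2 * of_real pi * \<i>) * F (\<phi> l) z a * (bd v b - bd v a)) \<le> \<omega> * L * \<bar>b - a\<bar>)"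
proof -
  let ?Z = "closure (E_dom E w)"
  have Z: "compact ?Z"
    using closure_E_dom_cball[OF w(3)] bounded_subset[OF bounded_cball] by (auto simp: compact_eq_bounded_closed)
  have "\<forall>l\<in>{1..n}. \<exists>\<eta>>0. \<forall>p\<in>A \<times> ?Z. \<forall>q\<in>A \<times> ?Z. dist q p < \<eta> \<longrightarrow>
    dist ((\<lambda>(t, z). \<phi> l (bd v t) * kern (bd v t) z) q) ((\<lambda>(t, z). \<phi> l (bd v t) * kern (bd v t) z) p) < \<omega>"
  proof
    fix l assume l: "l \<in> {1..n}"
    have "continuous_on (A \<times> ?Z) (\<lambda>(t, z). \<phi> l (bd v t) * kern (bd v t) z)"
      by (rule kern_cont_pair[OF \<phi>[OF l] order_refl A(3)])
    then have "uniformly_continuous_on (A \<times> ?Z) (\<lambda>(t, z). \<phi> l (bd v t) * kern (bd v t) z)"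
      by (rule compact_uniformly_continuous) (rule compact_Times[OF A(1) Z])
    then show "\<exists>\<eta>>0. \<forall>p\<in>A \<times> ?Z. \<forall>q\<in>A \<times> ?Z. dist q p < \<eta> \<longrightarrow>
      dist ((\<lambda>(t, z). \<phi> l (bd v t) * kern (bd v t) z) q) ((\<lambda>(t, z). \<phi> l (bd v t) * kern (bd v t) z) p) < \<omega>"
      unfolding uniformly_continuous_on_def using \<omega> by blast
  qed
  from bchoice[OF this] obtain \<eta> where \<eta>: "\<forall>l\<in>{1..n}. \<eta> l > 0 \<and> (\<forall>p\<in>A \<times> ?Z. \<forall>q\<in>A \<times> ?Z. dist q p < \<eta> l \<longrightarrow>
    dist ((\<lambda>(t, z). \<phi> l (bd v t) * kern (bd v t) z) q) ((\<lambda>(t, z). \<phi> l (bd v t) * kern (bd v t) z) p) < \<omega>)" ..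
  define e where "e = Min (insert 1 (\<eta> ` {1..n}))"
  have e0: "e > 0" unfolding e_def using \<eta> by (subst Min_gr_iff) auto
  have el: "e \<le> \<eta> l" if "l \<in> {1..n}" for l unfolding e_def using that by (intro Min_le) auto
  have "cmod (H (\<phi> l) z b - H (\<phi> l) z a - 1 / (2 * of_real pi * \<i>) * F (\<phi> l) z a * (bd v b - bd v a)) \<le> \<omega> * L * \<bar>b - a\<bar>"
    if l: "l \<in> {1..n}" and ab: "closed_segment a b \<subseteq> A" "\<bar>b - a\<bar> < e" and z: "z \<in> E_dom E w" for l a b z
  proof (rule H_riemann[OF \<phi>[OF l]])
    have zc: "z \<in> ?Z" using z closure_subset by blast
    then show "z \<in> ?Z" .
    show "a \<in> {0..1}" "b \<in> {0..1}" using ab(1) A(2) by auto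
    fix \<tau> assume \<tau>: "\<tau> \<in> closed_segment a b - {}"
    then have "\<bar>\<tau> - a\<bar> \<le> \<bar>b - a\<bar>" by (auto simp: closed_segment_eq_real_ivl split: if_splits)
    then have "dist (\<tau>, z) (a, z) < \<eta> l" using ab(2) el[OF l] by (simp add: dist_Pair_Pair dist_real_def)
    moreover have "(\<tau>, z) \<in> A \<times> ?Z" "(a, z) \<in> A \<times> ?Z" using \<tau> ab(1) zc by auto
    ultimately have "dist ((\<lambda>(t, z). \<phi> l (bd v t) * kern (bd v t) z) (\<tau>, z)) ((\<lambda>(t, z). \<phi> l (bd v t) * kern (bd v t) z) (a, z)) < \<omega>"
      using \<eta> l by blast
    then show "cmod (F (\<phi> l) z \<tau> - F (\<phi> l) z a) \<le> \<omega>" by (simp add: F_def dist_norm)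
  qed (use \<omega> in auto)
  then show ?thesis using e0 by (intro exI[of _ e] conjI ballI allI impI)
qed

section \<open>Grids near regular and singular parameters\<close>

lemma kern_le:
  assumes "bd v t \<notin> E" "z \<in> E_dom E w"
  shows "cmod (kern (bd v t) z) \<le> (2 * Cst) ^ card E / cmod (bd v t - z)"
proof -
  have "z \<in> closure (E_dom E v)" using assms(2) cl_wv closure_subset by blast
  then show ?thesis
    unfolding kern_def norm_divide using assms by (intro divide_right_mono G_bound bd_cl) auto
qed

lemma sep_pos: "1 + 2 / csep > 0"
  using csep by (simp add: add_pos_pos)

text \<open>Away from \<open>E\<close> the kernel is bounded uniformly in \<open>z\<close>, so an
  equal subdivision suffices: \<open>m\<close> grids with one node each.\<close>

lemma Good_regular:
  assumes x: "x \<in> {0..1}" "bd v x \<notin> E"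
  shows "\<exists>h>0. \<forall>y\<in>{0..1}. \<bar>y - x\<bar> \<le> h \<longrightarrow> Good x y"
proof -
  obtain d where d: "d > 0" "\<And>\<xi>. \<xi> \<in> E \<Longrightarrow> 2 * d \<le> cmod (bd v x - \<xi>)"
  proof -
    obtain d where d: "d > 0" "\<forall>\<xi>\<in>E. \<xi> \<noteq> bd v x \<longrightarrow> d \<le> dist (bd v x) \<xi>"
      using finite_set_avoid[OF fin] by blast
    show thesis
    proof (rule that[of "d / 2"])
      show "2 * (d / 2) \<le> cmod (bd v x - \<xi>)" if "\<xi> \<in> E" for \<xi>
        using d(2) that x(2) by (auto simp: dist_norm)
    qed (use d in simp)
  qed
  define h where "h = d / L"
  have h: "h > 0" using d L_pos by (simp add: h_def)
  have far: "d \<le> cmod (bd v t - \<xi>)" if "t \<in> {0..1}" "\<bar>t - x\<bar> \<le> h" "\<xi> \<in> E" for t \<xi>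
  proof -
    have "cmod (bd v t - bd v x) \<le> L * \<bar>t - x\<bar>" by (rule lipschitz) (use that x in auto)
    also have "\<dots> \<le> L * h" using that L_pos by (intro mult_left_mono) auto
    also have "\<dots> = d" using L_pos by (simp add: h_def)
    finally show ?thesis
      using d(2)[OF that(3)] norm_triangle_ineq4[of "bd v x - bd v t" "\<xi> - bd v t"]
      by (simp add: norm_minus_commute)
  qed
  define B where "B = L * ((2 * Cst) ^ card E * ((1 + 2 / csep) / d))"
  have B: "B \<ge> 0" using L_pos Cst(1) sep_pos d by (simp add: B_def)
  have kb: "cmod (kern (bd v t) z) \<le> (2 * Cst) ^ card E * ((1 + 2 / csep) / d)"
    if t: "t \<in> {0..1}" "\<bar>t - x\<bar> \<le> h" "bd v t \<notin> E" and z: "z \<in> E_dom E w" for t z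
  proof -
    have "z \<in> closure (E_dom E w)" using z closure_subset by blast
    then obtain \<xi> where \<xi>: "\<xi> \<in> E" "cmod (bd v t - \<xi>) + cmod (z - \<xi>) \<le> (1 + 2 / csep) * cmod (bd v t - z)"
      using separation bd_eq(4)[OF v, of t] by blast
    then have "d \<le> (1 + 2 / csep) * cmod (bd v t - z)"
      using far[OF t(1,2) \<xi>(1)] norm_ge_zero[of "z - \<xi>"] by linarith
    moreover from this have pos: "cmod (bd v t - z) > 0" using d(1) by (cases "bd v t = z") auto
    ultimately have "1 / cmod (bd v t - z) \<le> (1 + 2 / csep) / d" using d(1) by (simp add: divide_simps mult.commute)
    then have "(2 * Cst) ^ card E * (1 / cmod (bd v t - z)) \<le> (2 * Cst) ^ card E * ((1 + 2 / csep) / d)"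
      using Cst(1) by (intro mult_left_mono) auto
    then show ?thesis using kern_le[OF t(3) z] by simp
  qed
  have "Good x y" if y: "y \<in> {0..1}" "\<bar>y - x\<bar> \<le> h" for y
  proof (rule Good_grid[OF B])
    fix n :: nat and \<phi> and \<delta> :: real
    assume \<phi>: "\<And>l. l \<in> {1..n} \<Longrightarrow> small s (\<phi> l)" and \<delta>: "0 < \<delta>"
    define A where "A = closed_segment x y"
    have A01: "A \<subseteq> {0..1}" unfolding A_def using x y by (intro closed_segment_subset) auto
    have Ah: "\<bar>\<tau> - x\<bar> \<le> h" if "\<tau> \<in> A" for \<tau>
      using that y by (auto simp: A_def closed_segment_eq_real_ivl split: if_splits)
    have AE: "bd v \<tau> \<notin> E" if "\<tau> \<in> A" for \<tau>
      using far[of \<tau> "bd v \<tau>"] Ah[OF that] A01 that d(1) by auto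
    define \<omega> where "\<omega> = \<delta> / L"
    have \<omega>: "\<omega> > 0" using \<delta> L_pos by (simp add: \<omega>_def)
    have cA: "compact A" by (simp add: A_def)
    have ex_mesh: "\<exists>\<eta>>0. \<forall>l\<in>{1..n}. \<forall>a b. closed_segment a b \<subseteq> A \<longrightarrow> \<bar>b - a\<bar> < \<eta> \<longrightarrow> (\<forall>z\<in>E_dom E w.
      cmod (H (\<phi> l) z b - H (\<phi> l) z a - 1 / (2 * of_real pi * \<i>) * F (\<phi> l) z a * (bd v b - bd v a)) \<le> \<omega> * L * \<bar>b - a\<bar>)"
      by (rule mesh[OF _ cA A01 _ \<omega>]) (use \<phi> AE in simp_all)
    obtain \<eta> where \<eta>: "\<eta> > 0" "\<And>l a b z. l \<in> {1..n} \<Longrightarrow> closed_segment a b \<subseteq> A \<Longrightarrow> \<bar>b - a\<bar> < \<eta> \<Longrightarrow> z \<in> E_dom E w \<Longrightarrow>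
      cmod (H (\<phi> l) z b - H (\<phi> l) z a - 1 / (2 * of_real pi * \<i>) * F (\<phi> l) z a * (bd v b - bd v a)) \<le> \<omega> * L * \<bar>b - a\<bar>"
      using ex_mesh by blast
    obtain m :: nat where m: "m > 0" "1 / real m < \<eta>"
      using \<eta>(1) by (metis nat_approx_posE zero_less_Suc)
    \<comment> \<open>The nodes run from \<open>y\<close> back to \<open>x\<close>, so that the
      steps from p (Suc i) to p i add up to the integral from \<open>x\<close> to
      \<open>y\<close>.\<close>
    define p where "p i = x + (y - x) * (1 - real i / real m)" for i
    have pA: "p i \<in> A" if "i \<le> m" for i
      using that m unfolding A_def p_def in_segment
      by (intro exI[of _ "1 - real i / real m"]) (auto simp: algebra_simps diff_divide_distrib)
    have seg: "closed_segment (p i) (p (Suc i)) \<subseteq> A" if "i < m" for i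
      using pA[of i] pA[of "Suc i"] that by (simp add: A_def subset_closed_segment)
    have diff: "\<bar>p (Suc i) - p i\<bar> = \<bar>y - x\<bar> / real m" for i
    proof -
      have "p (Suc i) - p i = - ((y - x) / real m)" using m by (simp add: p_def field_simps)
      then show ?thesis using m by simp
    qed
    have yx1: "\<bar>y - x\<bar> \<le> 1" using x y by auto
    have small': "\<bar>p (Suc i) - p i\<bar> < \<eta>" for i
    proof -
      have "\<bar>y - x\<bar> / real m \<le> 1 / real m" using yx1 by (intro divide_right_mono) auto
      then show ?thesis using m diff by simp
    qed
    show "\<exists>(m::nat) (N::nat) (t::nat \<Rightarrow> nat \<Rightarrow> real) (t'::nat \<Rightarrow> nat \<Rightarrow> real). m > 0 \<and> (\<forall>i<m. \<forall>k<N. bd v (t i k) \<notin> E) \<and>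
      (\<forall>i<m. \<forall>z\<in>E_dom E r. (\<Sum>k<N. cmod (bd v (t i k) - bd v (t' i k)) * cmod (kern (bd v (t i k)) z)) \<le> B / real m) \<and>
      (\<forall>l\<in>{1..n}. \<forall>z\<in>E_dom E w. cmod ((\<Sum>i<m. \<Sum>k<N. 1 / (2 * of_real pi * \<i>) * F (\<phi> l) z (t i k) * (bd v (t i k) - bd v (t' i k)))
        - (H (\<phi> l) z y - H (\<phi> l) z x)) \<le> \<delta>)"
    proof (rule exI[of _ m], rule exI[of _ "1::nat"], rule exI[of _ "\<lambda>i (k::nat). p i"], rule exI[of _ "\<lambda>i (k::nat). p (Suc i)"], intro conjI allI impI ballI m(1))
      show "bd v (p i) \<notin> E" if "i < m" for i using pA[of i] that AE by auto
      show "(\<Sum>k<1::nat. cmod (bd v (p i) - bd v (p (Suc i))) * cmod (kern (bd v (p i)) z)) \<le> B / real m"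
        if i: "i < m" and z: "z \<in> E_dom E r" for i z
      proof -
        have p01: "p i \<in> {0..1}" "p (Suc i) \<in> {0..1}" using pA[of i] pA[of "Suc i"] i A01 by auto
        have "cmod (bd v (p i) - bd v (p (Suc i))) \<le> L * \<bar>p i - p (Suc i)\<bar>" by (rule lipschitz[OF p01(2,1)])
        also have "\<bar>p i - p (Suc i)\<bar> = \<bar>y - x\<bar> / real m" using diff[of i] by (simp add: abs_minus_commute)
        also have "L * (\<bar>y - x\<bar> / real m) \<le> L * (1 / real m)"
          using yx1 L_pos by (intro mult_left_mono divide_right_mono) auto
        finally have 1: "cmod (bd v (p i) - bd v (p (Suc i))) \<le> L * (1 / real m)" .
        have "cmod (kern (bd v (p i)) z) \<le> (2 * Cst) ^ card E * ((1 + 2 / csep) / d)"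
          using pA[of i] i Ah AE w_r z by (intro kb p01) auto
        from mult_mono[OF 1 this] have "cmod (bd v (p i) - bd v (p (Suc i))) * cmod (kern (bd v (p i)) z) \<le> B / real m"
          using L_pos m by (simp add: B_def mult_ac)
        then show ?thesis by simp
      qed
      show "cmod ((\<Sum>i<m. \<Sum>k<1::nat. 1 / (2 * of_real pi * \<i>) * F (\<phi> l) z (p i) * (bd v (p i) - bd v (p (Suc i))))
        - (H (\<phi> l) z y - H (\<phi> l) z x)) \<le> \<delta>" if l: "l \<in> {1..n}" and z: "z \<in> E_dom E w" for l z
      proof -
        define c where "c i = 1 / (2 * of_real pi * \<i>) * F (\<phi> l) z (p i) * (bd v (p (Suc i)) - bd v (p i))" for i
        have "p 0 = y" "p m = x" using m by (auto simp: p_def)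
        then have tel: "H (\<phi> l) z y - H (\<phi> l) z x = (\<Sum>i<m. H (\<phi> l) z (p i) - H (\<phi> l) z (p (Suc i)))"
          using sum_lessThan_telescope'[of "\<lambda>i. H (\<phi> l) z (p i)" m] by simp
        have "(\<Sum>i<m. \<Sum>k<1::nat. 1 / (2 * of_real pi * \<i>) * F (\<phi> l) z (p i) * (bd v (p i) - bd v (p (Suc i)))) = (\<Sum>i<m. - c i)"
          by (intro sum.cong) (auto simp: c_def algebra_simps diff_divide_distrib)
        then have "(\<Sum>i<m. \<Sum>k<1::nat. 1 / (2 * of_real pi * \<i>) * F (\<phi> l) z (p i) * (bd v (p i) - bd v (p (Suc i))))
          - (H (\<phi> l) z y - H (\<phi> l) z x) = (\<Sum>i<m. H (\<phi> l) z (p (Suc i)) - H (\<phi> l) z (p i) - c i)"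
          unfolding tel by (simp add: sum_subtractf sum_negf)
        also have "cmod \<dots> \<le> (\<Sum>i<m. \<omega> * L * \<bar>p (Suc i) - p i\<bar>)"
          unfolding c_def by (intro order_trans[OF norm_sum] sum_mono \<eta>(2)[OF l seg small' z]) auto
        also have "\<dots> = \<omega> * L * \<bar>y - x\<bar>" using m by (simp add: diff)
        also have "\<dots> \<le> \<omega> * L * 1" using \<omega> L_pos yx1 by (intro mult_left_mono) auto
        also have "\<dots> = \<delta>" using L_pos by (simp add: \<omega>_def)
        finally show ?thesis .
      qed
    qed
  qed
  then show ?thesis using h by blast
qed

text \<open>The interval is cut into \<open>N\<close> dyadic blocks shrinking to \<open>x\<close>,
  each into \<open>m\<close> equal steps. For a fixed offset \<open>i\<close> the nodes lie at
  distances y0 / 2^k from \<open>x\<close>, and each step is at most that distance divided by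
  \<open>m\<close>. The kernel bounds then sum to the series of \<open>dyadic_sum_le\<close>, which
  is bounded uniformly in \<open>N\<close> and \<open>z\<close>.\<close>

lemma Good_singular:
  assumes x: "x \<in> {0..1}" "bd v x \<in> E"
  shows "\<exists>h>0. \<forall>y\<in>{0..1}. \<bar>y - x\<bar> \<le> h \<longrightarrow> Good x y"
proof -
  define \<xi> where "\<xi> = bd v x"
  have \<xi>: "\<xi> \<in> E" using x by (simp add: \<xi>_def)
  have cx: "cis (2 * pi * x) \<in> E" "\<xi> = cis (2 * pi * x)"
    using x(2) bd_in_E_iff[OF v] bd_at_E[OF v(2,3)] by (auto simp: \<xi>_def)
  obtain d where d: "d > 0" "\<And>\<eta>. \<eta> \<in> E \<Longrightarrow> \<eta> \<noteq> \<xi> \<Longrightarrow> d \<le> cmod (\<xi> - \<eta>)"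
    using finite_set_avoid[OF fin, of \<xi>] by (auto simp: dist_norm)
  \<comment> \<open>The bound 1 / 2 rules out the wrap-around in \<open>bd_dist_ge\<close>; d / (2
    L) keeps the path away from the other points of \<open>E\<close>.\<close>
  define h where "h = min (1 / 2) (d / (2 * L))"
  have h: "h > 0" "h \<le> 1 / 2" "L * h \<le> d / 2"
  proof -
    have "L * h \<le> L * (d / (2 * L))" using L_pos by (intro mult_left_mono) (auto simp: h_def)
    then show "L * h \<le> d / 2" using L_pos by simp
  qed (use d L_pos in \<open>auto simp: h_def\<close>)
  have near: "cmod (bd v t - \<xi>) \<le> d / 2" if "t \<in> {0..1}" "\<bar>t - x\<bar> \<le> h" for t
  proof -
    have "cmod (bd v t - bd v x) \<le> L * \<bar>t - x\<bar>" by (rule lipschitz) (use that x in auto)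
    also have "\<dots> \<le> L * h" using that L_pos by (intro mult_left_mono) auto
    finally show ?thesis using h by (simp add: \<xi>_def)
  qed
  have low: "\<bar>t - x\<bar> \<le> cmod (bd v t - \<xi>)" if "t \<in> {0..1}" "\<bar>t - x\<bar> \<le> h" for t
    using bd_dist_ge[OF v that(1) x(1) cx(1)] that h cx(2) by simp
  have notE: "bd v t \<notin> E" if t: "t \<in> {0..1}" "\<bar>t - x\<bar> \<le> h" "t \<noteq> x" for t
  proof
    assume "bd v t \<in> E"
    show False
    proof (cases "bd v t = \<xi>")
      case True
      then show False using low[OF t(1,2)] t(3) by simp
    next
      case False
      then show False using d(2)[OF \<open>bd v t \<in> E\<close>] near[OF t(1,2)] d(1) by (simp add: norm_minus_commute)
    qed
  qed
  define C0 where "C0 = 1 + 2 / csep"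
  \<comment> \<open>If \<open>separation\<close> yields another point \<eta> of \<open>E\<close>,
    the left side of \<open>sep\<close> is at most 4 while C0 |bd v t - z| is at least d / 2; the
    factor 8 / d balances the two.\<close>
  define C2 where "C2 = C0 * (1 + 8 / d)"
  have C0: "C0 > 0" unfolding C0_def by (rule sep_pos)
  have C2: "C2 > 0" unfolding C2_def using C0 d by (intro mult_pos_pos add_pos_pos) auto
  have sep: "cmod (bd v t - \<xi>) + cmod (z - \<xi>) \<le> C2 * cmod (bd v t - z)"
    if t: "t \<in> {0..1}" "\<bar>t - x\<bar> \<le> h" and z: "z \<in> E_dom E w" for t z
  proof -
    have "z \<in> closure (E_dom E w)" using z closure_subset by blast
    then obtain \<eta> where \<eta>: "\<eta> \<in> E" "cmod (bd v t - \<eta>) + cmod (z - \<eta>) \<le> C0 * cmod (bd v t - z)"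
      using separation bd_eq(4)[OF v, of t] unfolding C0_def by blast
    have CC: "C2 * cmod (bd v t - z) = C0 * cmod (bd v t - z) + (8 / d) * (C0 * cmod (bd v t - z))"
      by (simp add: C2_def algebra_simps)
    show ?thesis
    proof (cases "\<eta> = \<xi>")
      case True
      have "(8 / d) * (C0 * cmod (bd v t - z)) \<ge> 0" using C0 d by simp
      then show ?thesis using \<eta>(2) True CC by simp
    next
      case False
      have "d \<le> cmod (\<xi> - \<eta>)" by (rule d(2)[OF \<eta>(1) False])
      also have "\<dots> \<le> cmod (bd v t - \<eta>) + cmod (bd v t - \<xi>)"
        using norm_triangle_ineq4[of "bd v t - \<eta>" "bd v t - \<xi>"] by simp
      finally have "d / 2 \<le> cmod (bd v t - \<eta>)" using near[OF t] by simp
      then have "d / 2 \<le> C0 * cmod (bd v t - z)" using \<eta>(2) norm_ge_zero[of "z - \<eta>"] by linarith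
      then have "(8 / d) * (d / 2) \<le> (8 / d) * (C0 * cmod (bd v t - z))" using d(1) by (intro mult_left_mono) auto
      then have 4: "4 \<le> (8 / d) * (C0 * cmod (bd v t - z))" using d(1) by simp
      have b1: "cmod (bd v t) \<le> 1" using bd_cl[of t] closure_E_dom_cball[OF v(3)] by auto
      have b2: "cmod z \<le> 1" using E_dom_ball[OF w(3)] z by fastforce
      have "cmod (bd v t - \<xi>) + cmod (z - \<xi>) \<le> 4"
        using norm_triangle_ineq4[of "bd v t" \<xi>] norm_triangle_ineq4[of z \<xi>] b1 b2 norm_E[OF \<xi>] by simp
      moreover have "C0 * cmod (bd v t - z) \<ge> 0" using C0 by simp
      ultimately show ?thesis using 4 CC by simp
    qed
  qed
  define C3 where "C3 = (2 * Cst) ^ card E * C2"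
  have C3: "C3 \<ge> 0" using Cst(1) C2 by (simp add: C3_def)
  have kb: "cmod (kern (bd v t) z) \<le> C3 * (cmod (z - \<xi>) / (\<bar>t - x\<bar> + cmod (z - \<xi>))\<^sup>2)"
    if t: "t \<in> {0..1}" "\<bar>t - x\<bar> \<le> h" "t \<noteq> x" and z: "z \<in> E_dom E w" for t z
  proof -
    let ?a = "cmod (\<xi> - bd v t)" and ?w = "cmod (\<xi> - z)" and ?y = "\<bar>t - x\<bar>"
    have zv: "z \<in> closure (E_dom E v)" using z cl_wv closure_subset by blast
    have y: "?y > 0" using t by simp
    have ya: "?y \<le> ?a" using low[OF t(1,2)] by (simp add: norm_minus_commute)
    have "cmod (G (bd v t) z) \<le> (2 * Cst) ^ card E * (?w / (?a + ?w))"
      by (rule G_bound_factor[OF zv bd_cl notE[OF t] \<xi>])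
    also have "\<dots> \<le> (2 * Cst) ^ card E * (?w / (?y + ?w))"
    proof (intro mult_left_mono divide_left_mono mult_pos_pos)
      show "?a + ?w > 0" using y ya norm_ge_zero[of "\<xi> - z"] by linarith
      show "?y + ?w > 0" using y norm_ge_zero[of "\<xi> - z"] by linarith
    qed (use Cst(1) ya in auto)
    finally have g: "cmod (G (bd v t) z) \<le> (2 * Cst) ^ card E * (?w / (?y + ?w))" .
    have s: "?y + ?w \<le> C2 * cmod (bd v t - z)"
      using sep[OF t(1,2) z] ya by (simp add: norm_minus_commute)
    have yw: "?y + ?w > 0" using y by (intro add_pos_nonneg) auto
    have pos: "cmod (bd v t - z) > 0" using s yw C2 by (cases "bd v t = z") auto
    have inv: "1 / cmod (bd v t - z) \<le> C2 / (?y + ?w)" using s yw pos by (simp add: divide_simps mult.commute)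
    have "cmod (kern (bd v t) z) = cmod (G (bd v t) z) * (1 / cmod (bd v t - z))" by (simp add: kern_def norm_divide)
    also have "\<dots> \<le> ((2 * Cst) ^ card E * (?w / (?y + ?w))) * (C2 / (?y + ?w))"
      using Cst(1) yw by (intro mult_mono g inv) auto
    also have "\<dots> = C3 * (?w / (?y + ?w)\<^sup>2)" by (simp add: C3_def power2_eq_square)
    finally show ?thesis by (simp add: norm_minus_commute)
  qed
  define B where "B = 2 * L * C3"
  have B: "B \<ge> 0" using L_pos C3 by (simp add: B_def)
  have "Good x y" if y: "y \<in> {0..1}" "\<bar>y - x\<bar> \<le> h" "y \<noteq> x" for y
  proof (rule Good_grid[OF B])
    fix n :: nat and \<phi> and \<delta> :: real
    assume \<phi>: "\<And>l. l \<in> {1..n} \<Longrightarrow> small s (\<phi> l)" and \<delta>: "0 < \<delta>"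
    have yx1: "\<bar>y - x\<bar> \<le> 1" "\<bar>y - x\<bar> > 0" using x y by auto
    have "\<forall>l\<in>{1..n}. \<exists>Bl>0. \<forall>t z. bd v t \<notin> E \<longrightarrow> z \<in> closure (E_dom E w) \<longrightarrow> cmod (\<phi> l (bd v t) * kern (bd v t) z) \<le> Bl"
      using integrand_small_bound \<phi> by blast
    from bchoice[OF this] obtain Bl where Bl: "\<forall>l\<in>{1..n}. Bl l > 0 \<and>
      (\<forall>t z. bd v t \<notin> E \<longrightarrow> z \<in> closure (E_dom E w) \<longrightarrow> cmod (\<phi> l (bd v t) * kern (bd v t) z) \<le> Bl l)" ..
    define Bm where "Bm = (\<Sum>l\<in>{1..n}. Bl l) + 1"
    have Blm: "Bl l \<le> Bm" if "l \<in> {1..n}" for l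
    proof -
      have "Bl l \<le> (\<Sum>l\<in>{1..n}. Bl l)" using Bl that by (intro member_le_sum) (auto intro: less_imp_le)
      then show ?thesis by (simp add: Bm_def)
    qed
    have Bm: "Bm > 0" unfolding Bm_def using Bl by (intro add_nonneg_pos sum_nonneg) (auto intro: less_imp_le)
    \<comment> \<open>On the innermost piece the integrand is only known to be bounded;
      \<open>N\<close> makes the piece so short that it contributes at most \<delta> / 2. The
      constant \<open>B\<close> was fixed before \<open>N\<close>.\<close>
    obtain N :: nat where N: "Bm * L * (1 / 2 ^ N) \<le> \<delta> / 2" "N > 0"
    proof -
      have "(\<lambda>N. Bm * L * (1 / 2 ^ N)) \<longlonglongrightarrow> Bm * L * 0"
        by (intro tendsto_mult tendsto_const LIMSEQ_divide_realpow_zero) simp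
      then have "\<forall>\<^sub>F N in sequentially. Bm * L * (1 / 2 ^ N) < \<delta> / 2"
        by (rule order_tendstoD) (use \<delta> in simp)
      then have "\<forall>\<^sub>F N in sequentially. Bm * L * (1 / 2 ^ N) < \<delta> / 2 \<and> N > 0"
        using eventually_gt_at_top by (rule eventually_conj)
      then obtain N where "Bm * L * (1 / 2 ^ N) < \<delta> / 2 \<and> N > 0"
        using eventually_happens'[OF sequentially_bot] by blast
      then show thesis by (intro that[of N]) auto
    qed
    define x' where "x' = x + (y - x) * (1 / 2 ^ N)"
    define A where "A = closed_segment x' y"
    have x'seg: "x' \<in> closed_segment x y"
      unfolding x'_def in_segment by (intro exI[of _ "1 / 2 ^ N"]) (auto simp: algebra_simps diff_divide_distrib)
    have Axy: "A \<subseteq> closed_segment x y" unfolding A_def using x'seg by (simp add: subset_closed_segment)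
    have sub01: "closed_segment x y \<subseteq> {0..1}" using x y by (intro closed_segment_subset) auto
    have A01: "A \<subseteq> {0..1}" using Axy sub01 by blast
    have segh: "\<bar>\<tau> - x\<bar> \<le> \<bar>y - x\<bar>" if "\<tau> \<in> closed_segment x y" for \<tau>
      using that by (auto simp: closed_segment_eq_real_ivl split: if_splits)
    have Ax: "\<tau> \<noteq> x" if "\<tau> \<in> A" for \<tau>
    proof -
      have "x' \<noteq> x" using yx1 by (simp add: x'_def)
      moreover have "(x' - x) * (y - x) \<ge> 0" by (simp add: x'_def)
      ultimately show ?thesis
        using that yx1 by (auto simp: A_def closed_segment_eq_real_ivl zero_le_mult_iff split: if_splits)
    qed
    have AE: "bd v \<tau> \<notin> E" if "\<tau> \<in> A" for \<tau>
      using that A01 Axy segh[of \<tau>] Ax[OF that] y(2) by (intro notE) auto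
    \<comment> \<open>\<open>N\<close> blocks of \<open>m\<close> steps, each with error at most
      \<omega> L / m, add up to \<delta> / 2.\<close>
    define \<omega> where "\<omega> = \<delta> / (2 * L * real N)"
    have \<omega>: "\<omega> > 0" using \<delta> L_pos N by (simp add: \<omega>_def)
    have cA: "compact A" by (simp add: A_def)
    have ex_mesh: "\<exists>\<eta>>0. \<forall>l\<in>{1..n}. \<forall>a b. closed_segment a b \<subseteq> A \<longrightarrow> \<bar>b - a\<bar> < \<eta> \<longrightarrow> (\<forall>z\<in>E_dom E w.
      cmod (H (\<phi> l) z b - H (\<phi> l) z a - 1 / (2 * of_real pi * \<i>) * F (\<phi> l) z a * (bd v b - bd v a)) \<le> \<omega> * L * \<bar>b - a\<bar>)"
      by (rule mesh[OF _ cA A01 _ \<omega>]) (use \<phi> AE in simp_all)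
    obtain \<eta> where \<eta>: "\<eta> > 0" "\<And>l a b z. l \<in> {1..n} \<Longrightarrow> closed_segment a b \<subseteq> A \<Longrightarrow> \<bar>b - a\<bar> < \<eta> \<Longrightarrow> z \<in> E_dom E w \<Longrightarrow>
      cmod (H (\<phi> l) z b - H (\<phi> l) z a - 1 / (2 * of_real pi * \<i>) * F (\<phi> l) z a * (bd v b - bd v a)) \<le> \<omega> * L * \<bar>b - a\<bar>"
      using ex_mesh by blast
    obtain m :: nat where m: "m > 0" "1 / real m < \<eta>"
      using \<eta>(1) by (metis nat_approx_posE zero_less_Suc)
    \<comment> \<open>Falls from 1 to 1 / 2 as \<open>i\<close> runs from 0 to \<open>m\<close>, so
      that the last node of one block is the first of the next: p k m = p (Suc k) 0.\<close>
    define q where "q i = 1 - real i / (2 * real m)" for i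
    define p where "p k i = x + (y - x) * (1 / 2 ^ k * q i)" for k i
    have q: "1 / 2 \<le> q i" "q i \<le> 1" if "i \<le> m" for i
      using that m by (auto simp: q_def field_simps)
    have px: "\<bar>p k i - x\<bar> = \<bar>y - x\<bar> * q i / 2 ^ k" if "i \<le> m" for k i
      using q[OF that] by (simp add: p_def abs_mult)
    have pA: "p k i \<in> A" if "i \<le> m" "k < N" for k i
    proof -
      have "1 / 2 ^ N \<le> 1 / 2 ^ k * q i"
      proof -
        have "(1::real) / 2 ^ N \<le> 1 / 2 ^ Suc k" using that(2) by (intro divide_left_mono power_increasing) auto
        also have "\<dots> = 1 / 2 ^ k * (1 / 2)" by simp
        also have "\<dots> \<le> 1 / 2 ^ k * q i" using q[OF that(1)] by (intro mult_left_mono) auto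
        finally show ?thesis .
      qed
      moreover have "1 / 2 ^ k * q i \<le> 1"
      proof -
        have "1 / 2 ^ k * q i \<le> 1 * 1" using q[OF that(1)] by (intro mult_mono) auto
        then show ?thesis by simp
      qed
      moreover have mono: "x + (y - x) * c \<in> A" if "1 / 2 ^ N \<le> c" "c \<le> 1" for c
      proof (cases "x \<le> y")
        case True
        have "(y - x) * (1 / 2 ^ N) \<le> (y - x) * c" "(y - x) * c \<le> (y - x) * 1"
          using True that mult_left_mono[of "1 / 2 ^ N" c "y - x"] mult_left_mono[of c 1 "y - x"] by simp_all
        then show ?thesis unfolding A_def x'_def closed_segment_eq_real_ivl by auto
      next
        case False
        have "(y - x) * c \<le> (y - x) * (1 / 2 ^ N)" "(y - x) * 1 \<le> (y - x) * c"
          using False that mult_left_mono_neg[of "1 / 2 ^ N" c "y - x"] mult_left_mono_neg[of c 1 "y - x"] by simp_all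
        then show ?thesis unfolding A_def x'_def closed_segment_eq_real_ivl by auto
      qed
      ultimately show ?thesis unfolding p_def by blast
    qed
    have seg: "closed_segment (p k i) (p k (Suc i)) \<subseteq> A" if "i < m" "k < N" for k i
      using pA[of i k] pA[of "Suc i" k] that unfolding A_def by (simp add: subset_closed_segment)
    have diff: "\<bar>p k (Suc i) - p k i\<bar> = \<bar>y - x\<bar> / 2 ^ k * (1 / (2 * real m))" for k i
    proof -
      have "q (Suc i) - q i = - (1 / (2 * real m))" using m by (simp add: q_def field_simps)
      moreover have "x + a * (c * q') - (x + a * (c * q'')) = a * c * (q' - q'')" for a c q' q'' :: real
        by (simp add: algebra_simps)
      then have "p k (Suc i) - p k i = (y - x) * (1 / 2 ^ k) * (q (Suc i) - q i)" unfolding p_def .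
      ultimately show ?thesis by (simp add: abs_mult)
    qed
    have diff_m: "\<bar>p k (Suc i) - p k i\<bar> \<le> 1 / real m" for k i
    proof -
      have "\<bar>y - x\<bar> / 2 ^ k * (1 / (2 * real m)) \<le> 1 * (1 / real m)"
        using yx1 m by (intro mult_mono) (auto simp: divide_le_eq_1 field_simps intro: order_trans[OF yx1(1)])
      then show ?thesis using diff by simp
    qed
    have diff_rel: "\<bar>p k (Suc i) - p k i\<bar> \<le> \<bar>p k i - x\<bar> / real m" if "i \<le> m" for k i
    proof -
      have "\<bar>y - x\<bar> / 2 ^ k * (1 / 2) \<le> \<bar>y - x\<bar> / 2 ^ k * q i" using q[OF that] by (intro mult_left_mono) auto
      then have "\<bar>y - x\<bar> / 2 ^ k * (1 / 2) / real m \<le> \<bar>y - x\<bar> / 2 ^ k * q i / real m" by (rule divide_right_mono) simp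
      then show ?thesis unfolding diff px[OF that] by simp
    qed
    show "\<exists>(m::nat) (N::nat) (t::nat \<Rightarrow> nat \<Rightarrow> real) (t'::nat \<Rightarrow> nat \<Rightarrow> real). m > 0 \<and> (\<forall>i<m. \<forall>k<N. bd v (t i k) \<notin> E) \<and>
      (\<forall>i<m. \<forall>z\<in>E_dom E r. (\<Sum>k<N. cmod (bd v (t i k) - bd v (t' i k)) * cmod (kern (bd v (t i k)) z)) \<le> B / real m) \<and>
      (\<forall>l\<in>{1..n}. \<forall>z\<in>E_dom E w. cmod ((\<Sum>i<m. \<Sum>k<N. 1 / (2 * of_real pi * \<i>) * F (\<phi> l) z (t i k) * (bd v (t i k) - bd v (t' i k)))
        - (H (\<phi> l) z y - H (\<phi> l) z x)) \<le> \<delta>)"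
    proof (rule exI[of _ m], rule exI[of _ N], rule exI[of _ "\<lambda>i k. p k i"], rule exI[of _ "\<lambda>i k. p k (Suc i)"], intro conjI allI impI ballI m(1))
      show "bd v (p k i) \<notin> E" if "i < m" "k < N" for i k using pA[of i k] that AE by auto
      show "(\<Sum>k<N. cmod (bd v (p k i) - bd v (p k (Suc i))) * cmod (kern (bd v (p k i)) z)) \<le> B / real m"
        if i: "i < m" and z: "z \<in> E_dom E r" for i z
      proof -
        define y0 where "y0 = \<bar>y - x\<bar> * q i"
        have y0: "y0 > 0" using yx1 q[of i] i by (simp add: y0_def)
        have pk: "\<bar>p k i - x\<bar> = y0 / 2 ^ k" for k using px[of i k] i by (simp add: y0_def)
        have "cmod (bd v (p k i) - bd v (p k (Suc i))) * cmod (kern (bd v (p k i)) z) \<le>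
          (L * C3 / real m) * ((y0 / 2 ^ k) * (cmod (z - \<xi>) / (y0 / 2 ^ k + cmod (z - \<xi>))\<^sup>2))" if k: "k < N" for k
        proof -
          have p01: "p k i \<in> {0..1}" "p k (Suc i) \<in> {0..1}" using pA[of i k] pA[of "Suc i" k] i k A01 by auto
          have "cmod (bd v (p k i) - bd v (p k (Suc i))) \<le> L * \<bar>p k i - p k (Suc i)\<bar>" by (rule lipschitz[OF p01(2,1)])
          also have "\<bar>p k i - p k (Suc i)\<bar> \<le> y0 / 2 ^ k / real m"
            using diff_rel[of i k] i unfolding pk by (simp add: abs_minus_commute)
          then have "L * \<bar>p k i - p k (Suc i)\<bar> \<le> L * (y0 / 2 ^ k / real m)" using L_pos by (intro mult_left_mono) auto
          finally have 1: "cmod (bd v (p k i) - bd v (p k (Suc i))) \<le> L * (y0 / 2 ^ k / real m)" .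
          have inA: "p k i \<in> A" using pA[of i k] i k by simp
          have "\<bar>p k i - x\<bar> \<le> h" using segh[of "p k i"] Axy inA y(2) by auto
          then have "cmod (kern (bd v (p k i)) z) \<le> C3 * (cmod (z - \<xi>) / (\<bar>p k i - x\<bar> + cmod (z - \<xi>))\<^sup>2)"
            using Ax[OF inA] w_r z by (intro kb p01) auto
          then have 2: "cmod (kern (bd v (p k i)) z) \<le> C3 * (cmod (z - \<xi>) / (y0 / 2 ^ k + cmod (z - \<xi>))\<^sup>2)" unfolding pk .
          have "cmod (bd v (p k i) - bd v (p k (Suc i))) * cmod (kern (bd v (p k i)) z) \<le>
            (L * (y0 / 2 ^ k / real m)) * (C3 * (cmod (z - \<xi>) / (y0 / 2 ^ k + cmod (z - \<xi>))\<^sup>2))"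
            using L_pos y0 by (intro mult_mono 1 2) auto
          then show ?thesis by (simp add: mult_ac)
        qed
        then have "(\<Sum>k<N. cmod (bd v (p k i) - bd v (p k (Suc i))) * cmod (kern (bd v (p k i)) z)) \<le>
          (\<Sum>k<N. (L * C3 / real m) * ((y0 / 2 ^ k) * (cmod (z - \<xi>) / (y0 / 2 ^ k + cmod (z - \<xi>))\<^sup>2)))"
          by (intro sum_mono) auto
        also have "\<dots> = (L * C3 / real m) * (\<Sum>k<N. (y0 / 2 ^ k) * (cmod (z - \<xi>) / (y0 / 2 ^ k + cmod (z - \<xi>))\<^sup>2))"
          by (rule sum_distrib_left[symmetric])
        also have "\<dots> \<le> (L * C3 / real m) * 2"
          using L_pos C3 y0 by (intro mult_left_mono dyadic_sum_le) auto
        finally show ?thesis by (simp add: B_def mult_ac)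
      qed
      show "cmod ((\<Sum>i<m. \<Sum>k<N. 1 / (2 * of_real pi * \<i>) * F (\<phi> l) z (p k i) * (bd v (p k i) - bd v (p k (Suc i))))
        - (H (\<phi> l) z y - H (\<phi> l) z x)) \<le> \<delta>" if l: "l \<in> {1..n}" and z: "z \<in> E_dom E w" for l z
      proof -
        let ?H = "H (\<phi> l) z"
        have zc: "z \<in> closure (E_dom E w)" using z closure_subset by blast
        define c where "c k i = 1 / (2 * of_real pi * \<i>) * F (\<phi> l) z (p k i) * (bd v (p k (Suc i)) - bd v (p k i))" for k i
        have inner: "(\<Sum>i<m. ?H (p k i) - ?H (p k (Suc i))) = ?H (p k 0) - ?H (p (Suc k) 0)" for k
        proof -
          have "p k m = p (Suc k) 0" using m by (simp add: p_def q_def)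
          then show ?thesis using sum_lessThan_telescope'[of "\<lambda>i. ?H (p k i)" m] by simp
        qed
        have "(\<Sum>k<N. \<Sum>i<m. ?H (p k i) - ?H (p k (Suc i))) = ?H (p 0 0) - ?H (p N 0)"
          unfolding inner by (rule sum_lessThan_telescope'[of "\<lambda>k. ?H (p k 0)" N])
        moreover have "p 0 0 = y" "p N 0 = x'" by (auto simp: p_def q_def x'_def)
        ultimately have tel: "?H y - ?H x' = (\<Sum>k<N. \<Sum>i<m. ?H (p k i) - ?H (p k (Suc i)))" by simp
        have "(\<Sum>i<m. \<Sum>k<N. 1 / (2 * of_real pi * \<i>) * F (\<phi> l) z (p k i) * (bd v (p k i) - bd v (p k (Suc i)))) =
          (\<Sum>k<N. \<Sum>i<m. 1 / (2 * of_real pi * \<i>) * F (\<phi> l) z (p k i) * (bd v (p k i) - bd v (p k (Suc i))))"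
          by (rule sum.swap)
        also have "\<dots> = (\<Sum>k<N. \<Sum>i<m. - c k i)"
          by (intro sum.cong) (auto simp: c_def algebra_simps diff_divide_distrib)
        also have "\<dots> = - (\<Sum>k<N. \<Sum>i<m. c k i)" by (simp only: sum_negf)
        finally have S1: "(\<Sum>i<m. \<Sum>k<N. 1 / (2 * of_real pi * \<i>) * F (\<phi> l) z (p k i) * (bd v (p k i) - bd v (p k (Suc i)))) = - (\<Sum>k<N. \<Sum>i<m. c k i)" .
        have S2: "(\<Sum>k<N. \<Sum>i<m. ?H (p k (Suc i)) - ?H (p k i) - c k i) =
          - (\<Sum>k<N. \<Sum>i<m. ?H (p k i) - ?H (p k (Suc i))) - (\<Sum>k<N. \<Sum>i<m. c k i)"
          by (simp add: sum_subtractf)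
        have "(\<Sum>i<m. \<Sum>k<N. 1 / (2 * of_real pi * \<i>) * F (\<phi> l) z (p k i) * (bd v (p k i) - bd v (p k (Suc i))))
          - (?H y - ?H x) = (\<Sum>k<N. \<Sum>i<m. ?H (p k (Suc i)) - ?H (p k i) - c k i) - (?H x' - ?H x)"
          unfolding S1 S2 tel[symmetric] by (simp only: minus_diff_eq diff_diff_eq2) simp
        also have "cmod \<dots> \<le> \<delta> / 2 + \<delta> / 2"
        proof (rule order_trans[OF norm_triangle_ineq4 add_mono])
          have "cmod (\<Sum>k<N. \<Sum>i<m. ?H (p k (Suc i)) - ?H (p k i) - c k i) \<le>
            (\<Sum>k<N. \<Sum>i<m. \<omega> * L * (1 / real m))"
          proof (rule order_trans[OF norm_sum], rule sum_mono)
            fix k assume k: "k \<in> {..<N}"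
            show "cmod (\<Sum>i<m. ?H (p k (Suc i)) - ?H (p k i) - c k i) \<le> (\<Sum>i<m. \<omega> * L * (1 / real m))"
            proof (rule order_trans[OF norm_sum], rule sum_mono)
              fix i assume i: "i \<in> {..<m}"
              have sm: "\<bar>p k (Suc i) - p k i\<bar> < \<eta>" using diff_m[of k i] m(2) by simp
              have "closed_segment (p k i) (p k (Suc i)) \<subseteq> A" using seg i k by simp
              from \<eta>(2)[OF l this sm z]
              have "cmod (?H (p k (Suc i)) - ?H (p k i) - c k i) \<le> \<omega> * L * \<bar>p k (Suc i) - p k i\<bar>" by (simp add: c_def)
              also have "\<dots> \<le> \<omega> * L * (1 / real m)" using \<omega> L_pos diff_m by (intro mult_left_mono) auto
              finally show "cmod (?H (p k (Suc i)) - ?H (p k i) - c k i) \<le> \<omega> * L * (1 / real m)" .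
            qed
          qed
          also have "\<dots> = \<omega> * L * real N" using m by simp
          also have "\<dots> = \<delta> / 2" using L_pos N by (simp add: \<omega>_def)
          finally show "cmod (\<Sum>k<N. \<Sum>i<m. ?H (p k (Suc i)) - ?H (p k i) - c k i) \<le> \<delta> / 2" .
          \<comment> \<open>There are no nodes in the innermost piece; the comparison value c = 0
            leaves just the bound on the integrand, and \<open>x\<close> itself is exceptional
            because it is mapped into \<open>E\<close>.\<close>
          have "cmod (?H x' - ?H x - 1 / (2 * of_real pi * \<i>) * 0 * (bd v x' - bd v x)) \<le> Bm * L * \<bar>x' - x\<bar>"
          proof (rule H_riemann[OF \<phi>[OF l] zc x(1)])
            show "x' \<in> {0..1}" using x'seg sub01 by blast
            show "finite {x}" by simp
            fix \<tau> assume \<tau>: "\<tau> \<in> closed_segment x x' - {x}"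
            then have "\<tau> \<in> closed_segment x y" using x'seg subset_closed_segment[of x x' x y] by auto
            then have "bd v \<tau> \<notin> E" using \<tau> sub01 segh[of \<tau>] y(2) by (intro notE) auto
            then have "cmod (\<phi> l (bd v \<tau>) * kern (bd v \<tau>) z) \<le> Bl l" using Bl l zc by blast
            then show "cmod (F (\<phi> l) z \<tau> - 0) \<le> Bm" using Blm[OF l] by (simp add: F_def)
          qed (use Bm in simp)
          also have "\<bar>x' - x\<bar> = \<bar>y - x\<bar> * (1 / 2 ^ N)" by (simp add: x'_def abs_mult)
          also have "Bm * L * (\<bar>y - x\<bar> * (1 / 2 ^ N)) \<le> Bm * L * (1 * (1 / 2 ^ N))"
            using Bm L_pos yx1 by (intro mult_left_mono mult_right_mono) auto
          finally have "cmod (?H x' - ?H x) \<le> Bm * L * (1 / 2 ^ N)" by (simp only: mult_zero_right mult_zero_left diff_zero mult_1_left)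
          then show "cmod (?H x' - ?H x) \<le> \<delta> / 2" using N(1) by (rule order_trans)
        qed
        finally show ?thesis by simp
      qed
    qed
  qed
  then have "\<forall>y\<in>{0..1}. \<bar>y - x\<bar> \<le> h \<longrightarrow> Good x y" using Good_refl by metis
  then show ?thesis using h(1) by blast
qed

text \<open>\<open>Good\<close> holds on short intervals about each parameter and is transitive, so
  a bisection argument spreads it over [0, 1].\<close>

lemma Good_01: "Good 0 1"
proof -
  have "{0..1::real} \<subseteq> {0..1} \<longrightarrow> Good 0 1"
  proof (rule Bolzano[of 0 1 "\<lambda>a b. {a..b} \<subseteq> {0..1} \<longrightarrow> Good a b"])
    fix a b c :: real
    assume "{a..b} \<subseteq> {0..1} \<longrightarrow> Good a b" "{b..c} \<subseteq> {0..1} \<longrightarrow> Good b c" "a \<le> b" "b \<le> c"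
    then show "{a..c} \<subseteq> {0..1} \<longrightarrow> Good a c"
      using Good_trans by (metis atLeastatMost_subset_iff order_trans)
  next
    fix x :: real assume x: "0 \<le> x" "x \<le> 1"
    then have "\<exists>h>0. \<forall>y\<in>{0..1}. \<bar>y - x\<bar> \<le> h \<longrightarrow> Good x y"
      using Good_regular[of x] Good_singular[of x] by (cases "bd v x \<in> E") auto
    then obtain h where h: "h > 0" "\<And>y. y \<in> {0..1} \<Longrightarrow> \<bar>y - x\<bar> \<le> h \<Longrightarrow> Good x y" by blast
    show "\<exists>d>0. \<forall>a b. a \<le> x \<and> x \<le> b \<and> b - a < d \<longrightarrow> {a..b} \<subseteq> {0..1} \<longrightarrow> Good a b"
    proof (intro exI[of _ h] conjI h(1) allI impI)
      fix a b assume ab: "a \<le> x \<and> x \<le> b \<and> b - a < h" "{a..b} \<subseteq> {0..1}"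
      then have "a \<in> {0..1}" "b \<in> {0..1}" by auto
      then have "Good x a" "Good x b" using ab by (auto intro!: h(2))
      then show "Good a b" using Good_trans Good_sym by blast
    qed
  qed simp
  then show ?thesis by simp
qed

end

context ritt_quadratic
begin

section \<open>From approximants to the calculus\<close>

lemma small_approx:
  shows "\<exists>C\<ge>0. \<forall>(n::nat) \<phi> Bd x \<delta>. (\<forall>l\<in>{1..n}. small s (\<phi> l)) \<longrightarrow> 0 \<le> Bd \<longrightarrow>
    (\<forall>z\<in>E_dom E s. (\<Sum>l=1..n. (cmod (\<phi> l z))\<^sup>2) \<le> Bd\<^sup>2) \<longrightarrow> 0 < \<delta> \<longrightarrow>
    (\<exists>A. (\<forall>l\<in>{1..n}. indep w (A l) \<and> (\<forall>z\<in>E_dom E w. cmod (A l z - \<phi> l z) \<le> \<delta>)) \<and>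
      Rad_norm M \<epsilon> n (\<lambda>l. blinfun_apply (Calc (A l)) x) \<le> C * Bd * norm x)"
proof -
  obtain C where C: "C \<ge> 0" and ex: "\<And>n \<phi> Bd x \<delta>. \<lbrakk>\<And>l. l \<in> {1..n} \<Longrightarrow> small s (\<phi> l); 0 \<le> Bd;
      \<And>z. z \<in> E_dom E s \<Longrightarrow> (\<Sum>l=1..n. (cmod (\<phi> l z))\<^sup>2) \<le> Bd\<^sup>2; 0 < \<delta>\<rbrakk> \<Longrightarrow>
    \<exists>A. (\<forall>l\<in>{1..n}. indep w (A l) \<and> (\<forall>z\<in>E_dom E w. cmod (A l z - (H (\<phi> l) z 1 - H (\<phi> l) z 0)) \<le> \<delta>)) \<and>
      Rad_norm M \<epsilon> n (\<lambda>l. blinfun_apply (Calc (A l)) x) \<le> C * Bd * norm x"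
    using Good_01 by (rule GoodE) blast
  show ?thesis
  proof (rule exI[of _ C], intro conjI C allI impI)
    fix n :: nat and \<phi> Bd x and \<delta> :: real
    assume \<phi>: "\<forall>l\<in>{1..n}. small s (\<phi> l)" and a: "0 \<le> Bd"
      "\<forall>z\<in>E_dom E s. (\<Sum>l=1..n. (cmod (\<phi> l z))\<^sup>2) \<le> Bd\<^sup>2" "0 < \<delta>"
    have "\<exists>A. (\<forall>l\<in>{1..n}. indep w (A l) \<and> (\<forall>z\<in>E_dom E w. cmod (A l z - (H (\<phi> l) z 1 - H (\<phi> l) z 0)) \<le> \<delta>)) \<and>
      Rad_norm M \<epsilon> n (\<lambda>l. blinfun_apply (Calc (A l)) x) \<le> C * Bd * norm x"
      by (rule ex) (use \<phi> a in simp_all)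
    then obtain A where A: "\<forall>l\<in>{1..n}. indep w (A l) \<and> (\<forall>z\<in>E_dom E w. cmod (A l z - (H (\<phi> l) z 1 - H (\<phi> l) z 0)) \<le> \<delta>)"
      "Rad_norm M \<epsilon> n (\<lambda>l. blinfun_apply (Calc (A l)) x) \<le> C * Bd * norm x" by (elim exE conjE) (rule that)
    have "cmod (A l z - \<phi> l z) \<le> \<delta>" if l: "l \<in> {1..n}" and z: "z \<in> E_dom E w" for l z
    proof -
      have "small s (\<phi> l)" using \<phi> l by blast
      from H_representation[OF this z] A(1) l z show ?thesis by metis
    qed
    then show "\<exists>A. (\<forall>l\<in>{1..n}. indep w (A l) \<and> (\<forall>z\<in>E_dom E w. cmod (A l z - \<phi> l z) \<le> \<delta>)) \<and>
      Rad_norm M \<epsilon> n (\<lambda>l. blinfun_apply (Calc (A l)) x) \<le> C * Bd * norm x"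
      using A by (intro exI[of _ A]) blast
  qed
qed

lemma small_w: "small s \<phi> \<Longrightarrow> \<phi> \<in> Hinf0 E w"
  using ord by (intro Hinf0_mono[OF small_Hinf0]) auto

text \<open>The approximants converge uniformly on \<open>E_dom E w\<close>, which contains
  \<open>E_dom E r\<close>. So the bounded calculus makes their operators converge in norm, and the
  estimate passes to the limit.\<close>

lemma small_Calc_bound:
  shows "\<exists>C\<ge>0. \<forall>(n::nat) \<phi> Bd x. (\<forall>l\<in>{1..n}. small s (\<phi> l)) \<longrightarrow> 0 \<le> Bd \<longrightarrow>
    (\<forall>z\<in>E_dom E s. (\<Sum>l=1..n. (cmod (\<phi> l z))\<^sup>2) \<le> Bd\<^sup>2) \<longrightarrow>
    Rad_norm M \<epsilon> n (\<lambda>l. blinfun_apply (Calc (\<phi> l)) x) \<le> C * Bd * norm x"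
proof -
  from small_approx obtain C where C: "C \<ge> 0 \<and> (\<forall>(n::nat) \<phi> Bd x \<delta>. (\<forall>l\<in>{1..n}. small s (\<phi> l)) \<longrightarrow> 0 \<le> Bd \<longrightarrow>
    (\<forall>z\<in>E_dom E s. (\<Sum>l=1..n. (cmod (\<phi> l z))\<^sup>2) \<le> Bd\<^sup>2) \<longrightarrow> 0 < \<delta> \<longrightarrow>
    (\<exists>A. (\<forall>l\<in>{1..n}. indep w (A l) \<and> (\<forall>z\<in>E_dom E w. cmod (A l z - \<phi> l z) \<le> \<delta>)) \<and>
      Rad_norm M \<epsilon> n (\<lambda>l. blinfun_apply (Calc (A l)) x) \<le> C * Bd * norm x))" ..
  show ?thesis
  proof (rule exI[of _ C], intro conjI C[THEN conjunct1] allI impI)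
    fix n :: nat and \<phi> Bd x
    assume \<phi>: "\<forall>l\<in>{1..n}. small s (\<phi> l)" and a: "0 \<le> Bd"
      "\<forall>z\<in>E_dom E s. (\<Sum>l=1..n. (cmod (\<phi> l z))\<^sup>2) \<le> Bd\<^sup>2"
    have "\<exists>A. (\<forall>l\<in>{1..n}. indep w (A l) \<and> (\<forall>z\<in>E_dom E w. cmod (A l z - \<phi> l z) \<le> 1 / real (Suc j))) \<and>
      Rad_norm M \<epsilon> n (\<lambda>l. blinfun_apply (Calc (A l)) x) \<le> C * Bd * norm x" for j
      by (rule C[THEN conjunct2, THEN spec, THEN spec, THEN spec, THEN spec, THEN spec, THEN mp, THEN mp, THEN mp, THEN mp, OF \<phi> a]) simp
    then have "\<forall>j. \<exists>A. (\<forall>l\<in>{1..n}. indep w (A l) \<and> (\<forall>z\<in>E_dom E w. cmod (A l z - \<phi> l z) \<le> 1 / real (Suc j))) \<and>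
      Rad_norm M \<epsilon> n (\<lambda>l. blinfun_apply (Calc (A l)) x) \<le> C * Bd * norm x" ..
    from choice[OF this] obtain A where A: "\<forall>j. (\<forall>l\<in>{1..n}. indep w (A j l) \<and> (\<forall>z\<in>E_dom E w. cmod (A j l z - \<phi> l z) \<le> 1 / real (Suc j))) \<and>
      Rad_norm M \<epsilon> n (\<lambda>l. blinfun_apply (Calc (A j l)) x) \<le> C * Bd * norm x" ..
    have lim: "(\<lambda>j. Calc (A j l)) \<longlonglongrightarrow> Calc (\<phi> l)" if l: "l \<in> {1..n}" for l
    proof -
      have fr: "\<phi> l \<in> Hinf0 E r" by (rule Hinf0_mono[OF small_w u(3)]) (use \<phi> l in blast)
      have nb: "norm (Calc (A j l) - Calc (\<phi> l)) \<le> K * (1 / real (Suc j))" for j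
      proof -
        have Ar: "A j l \<in> Hinf0 E r" using A l by (intro indep_Hinf0_r) blast
        have mr: "(\<lambda>z. -1 * \<phi> l z) \<in> Hinf0 E r" by (rule Hinf0_scale[OF fr r(2)])
        have "Calc (A j l) - Calc (\<phi> l) = Calc (\<lambda>z. A j l z + -1 * \<phi> l z)"
          unfolding Calc_add[OF Ar mr] Calc_scale[OF fr] by (simp add: scaleC_minus_left scaleC_one)
        also have "norm \<dots> \<le> K * (1 / real (Suc j))"
        proof (rule Calc_bound[OF Hinf0_add[OF Ar mr r(2)]])
          fix z assume "z \<in> E_dom E r"
          then have "z \<in> E_dom E w" using w_r by blast
          then have "cmod (A j l z - \<phi> l z) \<le> 1 / real (Suc j)" using A l by blast
          then show "cmod (A j l z + -1 * \<phi> l z) \<le> 1 / real (Suc j)" by simp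
        qed
        finally show ?thesis .
      qed
      have "(\<lambda>j. K * (1 / real (Suc j))) \<longlonglongrightarrow> 0"
        by (intro tendsto_mult_right_zero LIMSEQ_Suc[OF lim_1_over_n[where 'a = real]])
      then have "(\<lambda>j. Calc (A j l) - Calc (\<phi> l)) \<longlonglongrightarrow> 0"
        by (rule Lim_null_comparison[OF always_eventually, rotated]) (use nb in simp)
      then show ?thesis by (rule LIM_zero_cancel)
    qed
    have "(\<lambda>j. Rad_norm M \<epsilon> n (\<lambda>l. blinfun_apply (Calc (A j l)) x)) \<longlonglongrightarrow> Rad_norm M \<epsilon> n (\<lambda>l. blinfun_apply (Calc (\<phi> l)) x)"
      by (rule tendsto_Rad_norm[OF rad]) (intro blinfun.tendsto lim tendsto_const)
    then show "Rad_norm M \<epsilon> n (\<lambda>l. blinfun_apply (Calc (\<phi> l)) x) \<le> C * Bd * norm x"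
      by (rule LIMSEQ_le_const2) (use A in blast)
  qed
qed

text \<open>The approximants are independent of the contour, but their uniform limit is taken under
  the integrals only after damping, for a fixed factor; then dominated convergence removes the
  damping.\<close>

lemma small_I_independent:
  assumes \<phi>: "small s \<phi>" and uu: "r0 < u1" "u1 < w" "r0 < u2" "u2 < w"
  shows "I u1 \<phi> = I u2 \<phi>"
proof -
  from small_approx obtain C where C: "\<forall>(n::nat) \<phi> Bd x \<delta>. (\<forall>l\<in>{1..n}. small s (\<phi> l)) \<longrightarrow> 0 \<le> Bd \<longrightarrow>
    (\<forall>z\<in>E_dom E s. (\<Sum>l=1..n. (cmod (\<phi> l z))\<^sup>2) \<le> Bd\<^sup>2) \<longrightarrow> 0 < \<delta> \<longrightarrow>
    (\<exists>A. (\<forall>l\<in>{1..n}. indep w (A l) \<and> (\<forall>z\<in>E_dom E w. cmod (A l z - \<phi> l z) \<le> \<delta>)) \<and>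
      Rad_norm M \<epsilon> n (\<lambda>l. blinfun_apply (Calc (A l)) x) \<le> C * Bd * norm x)" by (elim exE conjE) (rule that)
  obtain B where B: "\<And>z. z \<in> E_dom E s \<Longrightarrow> cmod (\<phi> z) \<le> B"
    using small_Hinf0[OF \<phi> ord(4)] unfolding Hinf0_def bounded_iff by blast
  have sq: "\<forall>z\<in>E_dom E s. (\<Sum>l=1..1::nat. (cmod (\<phi> z))\<^sup>2) \<le> (max B 0)\<^sup>2"
  proof
    fix z assume "z \<in> E_dom E s"
    then have "cmod (\<phi> z) \<le> max B 0" using B by (simp add: le_max_iff_disj)
    then show "(\<Sum>l=1..1::nat. (cmod (\<phi> z))\<^sup>2) \<le> (max B 0)\<^sup>2" by (simp add: power_mono)
  qed
  have "\<exists>f. indep w f \<and> (\<forall>z\<in>E_dom E w. cmod (f z - \<phi> z) \<le> 1 / real (Suc j))" for j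
  proof -
    \<comment> \<open>Only the approximation is wanted here, hence a single function and the vector
      0.\<close>
    have "\<exists>A. (\<forall>l\<in>{1..1::nat}. indep w (A l) \<and> (\<forall>z\<in>E_dom E w. cmod (A l z - \<phi> z) \<le> 1 / real (Suc j))) \<and>
      Rad_norm M \<epsilon> 1 (\<lambda>l. blinfun_apply (Calc (A l)) 0) \<le> C * max B 0 * norm (0 :: 'a)"
      by (rule C[THEN spec, THEN spec, THEN spec, THEN spec, THEN spec, THEN mp, THEN mp, THEN mp, THEN mp, OF _ _ sq]) (use \<phi> in simp_all)
    then show ?thesis by auto
  qed
  then have "\<forall>j. \<exists>f. indep w f \<and> (\<forall>z\<in>E_dom E w. cmod (f z - \<phi> z) \<le> 1 / real (Suc j))" ..
  from choice[OF this] obtain A where A: "\<forall>j. indep w (A j) \<and> (\<forall>z\<in>E_dom E w. cmod (A j z - \<phi> z) \<le> 1 / real (Suc j))" ..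
  have Aw: "A j \<in> Hinf0 E w" for j by (rule indepD(1)) (use A in blast)
  have Alim: "cmod (A j z - \<phi> z) \<le> 1 / real (Suc j)" if "z \<in> E_dom E w" for j z using A that by blast
  have z0: "(\<lambda>j. 1 / real (Suc j)) \<longlonglongrightarrow> 0" by (rule LIMSEQ_Suc[OF lim_1_over_n[where 'a = real]])
  have damped: "I u1 (\<lambda>z. \<phi> z * damp \<delta> z) = I u2 (\<lambda>z. \<phi> z * damp \<delta> z)" if \<delta>: "\<delta> > 0" for \<delta>
  proof (rule LIMSEQ_unique)
    show "(\<lambda>j. I u1 (\<lambda>z. A j z * damp \<delta> z)) \<longlonglongrightarrow> I u1 (\<lambda>z. \<phi> z * damp \<delta> z)"
      by (rule I_uniform_limit_damp[OF uu(1,2) w(3) \<delta> small_w[OF \<phi>] Aw Alim z0])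
    have "indep w (\<lambda>z. A j z * damp \<delta> z)" for j by (rule indep_damp[OF _ w(3) \<delta>]) (use A in blast)
    from indepD(2)[OF this uu]
    have eq: "I u1 (\<lambda>z. A j z * damp \<delta> z) = I u2 (\<lambda>z. A j z * damp \<delta> z)" for j .
    show "(\<lambda>j. I u1 (\<lambda>z. A j z * damp \<delta> z)) \<longlonglongrightarrow> I u2 (\<lambda>z. \<phi> z * damp \<delta> z)"
      unfolding eq by (rule I_uniform_limit_damp[OF uu(3,4) w(3) \<delta> small_w[OF \<phi>] Aw Alim z0])
  qed
  show ?thesis
  proof (rule LIMSEQ_unique)
    show "(\<lambda>n. I u1 (\<lambda>z. \<phi> z * damp (1 / real (Suc n)) z)) \<longlonglongrightarrow> I u1 \<phi>"
      by (rule I_damp_tendsto[OF uu(1,2) w(3) small_w[OF \<phi>]])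
    have eq: "I u1 (\<lambda>z. \<phi> z * damp (1 / real (Suc n)) z) = I u2 (\<lambda>z. \<phi> z * damp (1 / real (Suc n)) z)" for n
      by (rule damped) simp
    show "(\<lambda>n. I u1 (\<lambda>z. \<phi> z * damp (1 / real (Suc n)) z)) \<longlonglongrightarrow> I u2 \<phi>"
      unfolding eq by (rule I_damp_tendsto[OF uu(3,4) w(3) small_w[OF \<phi>]])
  qed
qed

text \<open>\<open>u2\<close> stands for the radius chosen by the calculus on
  \<open>E_dom E s\<close>. Damping makes the functions small, so that the radii \<open>u2\<close>
  and \<open>u\<close> give the same operators, and it does not enlarge the square function because
  the factor is at most 1.\<close>

lemma quadratic_bound:
  assumes u2: "r0 < u2" "u2 < w"
  shows "\<exists>C>0. \<forall>n\<ge>1. \<forall>\<phi> :: nat \<Rightarrow> complex \<Rightarrow> complex. \<forall>x.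
    (\<forall>l\<in>{1..n}. \<phi> l \<in> Hinf0 E s) \<longrightarrow>
    Rad_norm M \<epsilon> n (\<lambda>l. blinfun_apply (Hinf_calc_at E u2 T (\<phi> l)) x) \<le>
      C * norm x * (SUP z\<in>E_dom E s. sqrt (\<Sum>l=1..n. (cmod (\<phi> l z))\<^sup>2))"
proof -
  from small_Calc_bound obtain C where C: "C \<ge> 0 \<and> (\<forall>(n::nat) \<phi> Bd x. (\<forall>l\<in>{1..n}. small s (\<phi> l)) \<longrightarrow> 0 \<le> Bd \<longrightarrow>
    (\<forall>z\<in>E_dom E s. (\<Sum>l=1..n. (cmod (\<phi> l z))\<^sup>2) \<le> Bd\<^sup>2) \<longrightarrow>
    Rad_norm M \<epsilon> n (\<lambda>l. blinfun_apply (Calc (\<phi> l)) x) \<le> C * Bd * norm x)" ..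
  show ?thesis
  \<comment> \<open>\<open>C\<close> may be 0, and the constant has to be positive.\<close>
  proof (rule exI[of _ "C + 1"], intro conjI allI impI)
    show "C + 1 > 0" using C by simp
    fix n :: nat and \<phi> :: "nat \<Rightarrow> complex \<Rightarrow> complex" and x
    assume \<phi>: "\<forall>l\<in>{1..n}. \<phi> l \<in> Hinf0 E s"
    define Bd where "Bd = (SUP z\<in>E_dom E s. sqrt (\<Sum>l=1..n. (cmod (\<phi> l z))\<^sup>2))"
    have "\<forall>l\<in>{1..n}. \<exists>b. \<forall>z\<in>E_dom E s. cmod (\<phi> l z) \<le> b"
      using \<phi> unfolding Hinf0_def bounded_iff by blast
    from bchoice[OF this] obtain b where b: "\<forall>l\<in>{1..n}. \<forall>z\<in>E_dom E s. cmod (\<phi> l z) \<le> b l" ..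
    have bdd: "bdd_above ((\<lambda>z. sqrt (\<Sum>l=1..n. (cmod (\<phi> l z))\<^sup>2)) ` E_dom E s)"
      using b by (intro bdd_aboveI2[where M = "sqrt (\<Sum>l=1..n. (b l)\<^sup>2)"] real_sqrt_le_mono sum_mono power_mono) auto
    have le: "sqrt (\<Sum>l=1..n. (cmod (\<phi> l z))\<^sup>2) \<le> Bd" if "z \<in> E_dom E s" for z
      unfolding Bd_def by (rule cSUP_upper[OF that bdd])
    have z0: "0 \<in> E_dom E s" by (rule zero_in_E_dom) (use ord r0 in simp)
    have Bd: "0 \<le> Bd" by (rule order_trans[OF _ le[OF z0]]) (simp add: sum_nonneg)
    define d where "d j = damp (1 / real (Suc j))" for j
    define f where "f j l z = \<phi> l z * d j z" for j l z
    have f_small: "small s (f j l)" if "l \<in> {1..n}" for j l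
      unfolding f_def d_def using \<phi> that ord(4) by (intro small_damp) auto
    have f_le: "cmod (f j l z) \<le> cmod (\<phi> l z)" if "z \<in> E_dom E s" for j l z
    proof -
      have "cmod z \<le> 1" using E_dom_ball[OF ord(4)] that by fastforce
      then have "cmod (d j z) \<le> 1" unfolding d_def by (intro damp_le_1) auto
      from mult_left_mono[OF this, of "cmod (\<phi> l z)"] show ?thesis by (simp add: f_def norm_mult)
    qed
    have sq: "\<forall>z\<in>E_dom E s. (\<Sum>l=1..n. (cmod (f j l z))\<^sup>2) \<le> Bd\<^sup>2" for j
    proof
      fix z assume z: "z \<in> E_dom E s"
      have "(\<Sum>l=1..n. (cmod (f j l z))\<^sup>2) \<le> (\<Sum>l=1..n. (cmod (\<phi> l z))\<^sup>2)"
        using f_le[OF z] by (intro sum_mono power_mono) auto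
      also have "\<dots> = (sqrt (\<Sum>l=1..n. (cmod (\<phi> l z))\<^sup>2))\<^sup>2" by (simp add: sum_nonneg)
      also have "\<dots> \<le> Bd\<^sup>2" using le[OF z] by (intro power_mono) (auto simp: sum_nonneg)
      finally show "(\<Sum>l=1..n. (cmod (f j l z))\<^sup>2) \<le> Bd\<^sup>2" .
    qed
    have same: "Hinf_calc_at E u2 T (f j l) = Calc (f j l)" if "l \<in> {1..n}" for j l
      unfolding Hinf_calc_at_eq small_I_independent[OF f_small[OF that] u2 u(1) order_less_le_trans[OF u(2,3)]] ..
    have bound: "Rad_norm M \<epsilon> n (\<lambda>l. blinfun_apply (Hinf_calc_at E u2 T (f j l)) x) \<le> C * Bd * norm x" for j
    proof -
      have "Rad_norm M \<epsilon> n (\<lambda>l. blinfun_apply (Hinf_calc_at E u2 T (f j l)) x) = Rad_norm M \<epsilon> n (\<lambda>l. blinfun_apply (Calc (f j l)) x)"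
        by (rule Rad_norm_cong) (simp only: same)
      also have "\<dots> \<le> C * Bd * norm x"
        by (rule C[THEN conjunct2, THEN spec, THEN spec, THEN spec, THEN spec, THEN mp, THEN mp, THEN mp, OF _ Bd sq])
          (use f_small in blast)
      finally show ?thesis .
    qed
    have lim: "(\<lambda>j. Hinf_calc_at E u2 T (f j l)) \<longlonglongrightarrow> Hinf_calc_at E u2 T (\<phi> l)" if "l \<in> {1..n}" for l
    proof -
      have "\<phi> l \<in> Hinf0 E s" using \<phi> that by blast
      moreover have "u2 < s" using u2 ord by simp
      ultimately show ?thesis
        unfolding Hinf_calc_at_eq f_def d_def
        by (intro tendsto_scaleC tendsto_const I_damp_tendsto[OF u2(1) _ ord(4)])
    qed
    have "(\<lambda>j. Rad_norm M \<epsilon> n (\<lambda>l. blinfun_apply (Hinf_calc_at E u2 T (f j l)) x)) \<longlonglongrightarrow>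
      Rad_norm M \<epsilon> n (\<lambda>l. blinfun_apply (Hinf_calc_at E u2 T (\<phi> l)) x)"
      by (rule tendsto_Rad_norm[OF rad]) (intro blinfun.tendsto lim tendsto_const)
    then have "Rad_norm M \<epsilon> n (\<lambda>l. blinfun_apply (Hinf_calc_at E u2 T (\<phi> l)) x) \<le> C * Bd * norm x"
      by (rule LIMSEQ_le_const2) (use bound in blast)
    also have "\<dots> \<le> (C + 1) * norm x * Bd" using Bd by (simp add: algebra_simps)
    finally show "Rad_norm M \<epsilon> n (\<lambda>l. blinfun_apply (Hinf_calc_at E u2 T (\<phi> l)) x) \<le>
      (C + 1) * norm x * (SUP z\<in>E_dom E s. sqrt (\<Sum>l=1..n. (cmod (\<phi> l z))\<^sup>2))" by (simp only: Bd_def)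
  qed
qed

end

theorem theorem5p4:
  fixes M :: "'w measure" and \<epsilon> :: "nat \<Rightarrow> 'w \<Rightarrow> real"
    and E :: "complex set" and r :: real and T :: "'a :: complex_banach \<Rightarrow>\<^sub>L 'a"
  assumes "rademacher_seq M \<epsilon>"
    and "finite E" and "E \<noteq> {}" and "E \<subseteq> sphere 0 1"
    and "finite_cotype M \<epsilon> TYPE('a)"
    and "0 < r" and "r < 1"
    and "bounded_Hinf_calculus E r T"
  shows "\<forall>s\<in>{r<..<1}. quadratic_Hinf_calculus M \<epsilon> E s T"
proof
  fix s assume s: "s \<in> {r<..<1}"
  \<comment> \<open>These are the two contour radii that \<open>Hinf_calc\<close> chooses for
    \<open>r\<close> and for \<open>s\<close>; the choices are unrelated.\<close>
  define u where "u = (SOME u. \<exists>r1. ritt_type E r1 T \<and> r1 < u \<and> u < r)"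
  define u' where "u' = (SOME u. \<exists>r1. ritt_type E r1 T \<and> r1 < u \<and> u < s)"
  obtain ra where ra: "ra < r" "ritt_type E ra T"
    using assms(8) unfolding bounded_Hinf_calculus_def ritt_type_less_def by blast
  have "\<exists>u. \<exists>r1. ritt_type E r1 T \<and> r1 < u \<and> u < r"
    using ra by (intro exI[of _ "(ra + r) / 2"] exI[of _ ra]) auto
  then have "\<exists>r1. ritt_type E r1 T \<and> r1 < u \<and> u < r" unfolding u_def by (rule someI_ex)
  then obtain r1 where r1: "ritt_type E r1 T" "r1 < u" "u < r" by blast
  have "\<exists>u. \<exists>r1. ritt_type E r1 T \<and> r1 < u \<and> u < s"
    using ra s by (intro exI[of _ "(ra + r) / 2"] exI[of _ ra]) auto
  then have "\<exists>r1. ritt_type E r1 T \<and> r1 < u' \<and> u' < s" unfolding u'_def by (rule someI_ex)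
  then obtain r2 where r2: "ritt_type E r2 T" "r2 < u'" "u' < s" by blast
  \<comment> \<open>Each choice comes with its own type of \<open>T\<close>; the smaller of the two
    is again a type and lies below both contour radii.\<close>
  define r0 where "r0 = min r1 r2"
  have r0: "ritt_type E r0 T" using r1 r2 by (simp add: r0_def min_def)
  obtain K where K: "K \<ge> 1" "\<And>\<phi>. \<phi> \<in> Hinf0 E r \<Longrightarrow> norm (Hinf_calc_at E u T \<phi>) \<le> K * (SUP z\<in>E_dom E r. cmod (\<phi> z))"
    using assms(8) unfolding bounded_Hinf_calculus_def Hinf_calc_def u_def by blast
  \<comment> \<open>At least \<open>r\<close> and above \<open>u'\<close>, so that both contour
    radii stay below the radius on which the approximation takes place.\<close>
  define w where "w = (max r u' + s) / 2"
  define v where "v = (w + s) / 2"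
  have w_ord: "r \<le> w" "u' < w" "w < s" using r2 s by (auto simp: w_def max_def)
  have v_ord: "w < v" "v < s" using w_ord by (auto simp: v_def)
  interpret ritt_operator E T r0
    by unfold_locales (use assms r0 in auto)
  have v': "E_large_enough E v" "0 < v" "v < 1"
    using large_u[of v] v_ord w_ord r1 s by (auto simp: r0_def)
  obtain \<gamma>' S L where \<gamma>: "contour (polar_boundary (E_dom E v)) \<gamma>' S L" using contour_bd[OF v'] by blast
  interpret contour "polar_boundary (E_dom E v)" \<gamma>' S L by (rule \<gamma>)
  interpret ritt_quadratic E T r0 v \<gamma>' S L w s M \<epsilon> u r K
    by unfold_locales (use assms r1 r2 w_ord v_ord s K in \<open>auto simp: r0_def\<close>)
  have type_s: "ritt_type_less E s T" unfolding ritt_type_less_def using ra s by (intro exI[of _ ra]) auto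
  have "\<exists>C>0. \<forall>n\<ge>1. \<forall>\<phi> :: nat \<Rightarrow> complex \<Rightarrow> complex. \<forall>x.
    (\<forall>l\<in>{1..n}. \<phi> l \<in> Hinf0 E s) \<longrightarrow>
    Rad_norm M \<epsilon> n (\<lambda>l. blinfun_apply (Hinf_calc_at E u' T (\<phi> l)) x) \<le>
      C * norm x * (SUP z\<in>E_dom E s. sqrt (\<Sum>l=1..n. (cmod (\<phi> l z))\<^sup>2))"
    by (rule quadratic_bound) (use r2 w_ord in \<open>auto simp: r0_def\<close>)
  then show "quadratic_Hinf_calculus M \<epsilon> E s T"
    unfolding quadratic_Hinf_calculus_def Hinf_calc_def u'_def using type_s by simp
qed

end
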